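(* Let $V:\mathbb{R}\to\mathbb{R}$ be a (locally absolutely continuous) function with $V'\in L^1_{loc}(\mathbb{R})$, and assume that the function $x\mapsto[\max(1,-V(x))]^{-1/2}$ is not integrable at $+\infty$ and not integrable at $-\infty$, i.e. $$\int_0^{+\infty}\frac{dx}{\sqrt{\max(1,-V(x))}}=+\infty,\qquad \int_{-\infty}^0\frac{dx}{\sqrt{\max(1,-V(x))}}=+\infty.$$ Let $b(x,y)=(y,-V'(x))$ for $(x,y)\in\mathbb{R}^2$. Then for every initial condition $u^o\in L^p(\mathbb{R}^2)$, $p\in[1,\infty]$, the transport equation $$\partial_t u+y\,\partial_x u-V'(x)\,\partial_y u=0\quad\text{on }[0,\infty)\times\mathbb{R}^2,\qquad u(0,\cdot)=u^o,$$ has a unique renormalized solution.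
   Context: Functions are identified when equal almost everywhere. Solution: for $u^o\in L^\infty(\mathbb{R}^2)$, a function $u\in L^\infty([0,\infty)\times\mathbb{R}^2)$ is a solution with initial condition $u^o$ if for all $\phi\in C_c^\infty([0,\infty)\times\mathbb{R}^2)$ (test functions need not vanish at $t=0$) $$\int_{[0,\infty)\times\mathbb{R}^2}u\,\big(\partial_t\phi+b\cdot\nabla_{x,y}\phi\big)\,dt\,dx\,dy=-\int_{\mathbb{R}^2}u^o\,\phi(0,\cdot)\,dx\,dy.$$ Renormalized solution: a function $u\in L^1_{loc}([0,\infty)\times\mathbb{R}^2)$ is a renormalized solution with initial condition $u^o$ if for every $\beta\in C^1_b(\mathbb{R})$ (bounded continuously differentiable functions $\mathbb{R}\to\mathbb{R}$ with bounded derivative), $\beta(u)$ is a solution with initial condition $\beta(u^o)$. *)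

theory Defs
  imports "HOL-Analysis.Analysis"
begin

text \<open>Functions are identified when they agree almost everywhere; they are represented by
  Lebesgue measurable functions, and uniqueness is stated up to null sets. Points of space-time
  are triples \<open>(t, x, y)\<close>, that is, pairs of a time \<open>t\<close> and a position \<open>(x, y)\<close>.\<close>

definition space_time :: "(real \<times> real \<times> real) set" where
  "space_time = {0..} \<times> UNIV"

definition Lp_fun :: "ennreal \<Rightarrow> 'a measure \<Rightarrow> ('a \<Rightarrow> real) \<Rightarrow> bool" where
  "Lp_fun p M f \<longleftrightarrow> f \<in> borel_measurable M \<and>
     (if p = \<infinity> then \<exists>C. AE x in M. \<bar>f x\<bar> \<le> C
      else integrable M (\<lambda>x. \<bar>f x\<bar> powr enn2real p))"

definition L1_loc :: "'a::euclidean_space set \<Rightarrow> ('a \<Rightarrow> real) \<Rightarrow> bool" where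
  "L1_loc S f \<longleftrightarrow> (\<forall>K. compact K \<and> K \<subseteq> S \<longrightarrow> f absolutely_integrable_on K)"

text \<open>Absolute continuity on every compact interval. The finite families of non-overlapping
  subintervals of \<open>[a, b]\<close> are exactly the divisions of subsets of \<open>[a, b]\<close>.\<close>

definition locally_abs_continuous :: "(real \<Rightarrow> real) \<Rightarrow> bool" where
  "locally_abs_continuous f \<longleftrightarrow>
     (\<forall>a b. \<forall>\<epsilon>>0. \<exists>\<delta>>0. \<forall>D T. D division_of T \<and> T \<subseteq> {a..b} \<and> (\<Sum>K\<in>D. Sup K - Inf K) < \<delta> \<longrightarrow>
        (\<Sum>K\<in>D. \<bar>f (Sup K) - f (Inf K)\<bar>) < \<epsilon>)"

primrec C_k :: "nat \<Rightarrow> ('a::euclidean_space \<Rightarrow> real) \<Rightarrow> bool" where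
  "C_k 0 f \<longleftrightarrow> continuous_on UNIV f"
| "C_k (Suc k) f \<longleftrightarrow>
     (\<forall>x. f differentiable (at x)) \<and> (\<forall>v. C_k k (\<lambda>x. frechet_derivative f (at x) v))"

text \<open>\<open>C\<^sub>c\<^sup>\<infinity>\<close> functions on the closed half-space \<open>[0, \<infinity>) \<times> \<real>\<^sup>2\<close> are the restrictions of
  \<open>C\<^sub>c\<^sup>\<infinity>\<close> functions on the whole space. A test function is given here by such an
  extension; the definition of a solution uses only its values on the half-space and its
  derivatives there, which for \<open>t > 0\<close> do not depend on the extension.\<close>

definition test_function :: "(real \<times> real \<times> real \<Rightarrow> real) \<Rightarrow> bool" where
  "test_function \<phi> \<longleftrightarrow> (\<forall>k. C_k k \<phi>) \<and> compact (closure {z. \<phi> z \<noteq> 0})"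

definition is_solution ::
  "(real \<times> real \<Rightarrow> real \<times> real) \<Rightarrow> (real \<times> real \<Rightarrow> real) \<Rightarrow> (real \<times> real \<times> real \<Rightarrow> real) \<Rightarrow> bool" where
  "is_solution b u0 u \<longleftrightarrow>
     Lp_fun \<infinity> lebesgue u0 \<and> Lp_fun \<infinity> (lebesgue_on space_time) u \<and>
     (\<forall>\<phi>. test_function \<phi> \<longrightarrow>
        integral\<^sup>L (lebesgue_on space_time)
          (\<lambda>(t, x, y). u (t, x, y) *
             (deriv (\<lambda>s. \<phi> (s, x, y)) t
              + (fst (b (x, y)) * deriv (\<lambda>s. \<phi> (t, s, y)) x
                 + snd (b (x, y)) * deriv (\<lambda>s. \<phi> (t, x, s)) y)))
        = - integral\<^sup>L lebesgue (\<lambda>(x, y). u0 (x, y) * \<phi> (0, x, y)))"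

definition C1_bounded :: "(real \<Rightarrow> real) \<Rightarrow> bool" where
  "C1_bounded \<beta> \<longleftrightarrow>
     \<beta> C1_differentiable_on UNIV \<and> bounded (range \<beta>) \<and> bounded (range (deriv \<beta>))"

definition renormalized_solution ::
  "(real \<times> real \<Rightarrow> real \<times> real) \<Rightarrow> (real \<times> real \<Rightarrow> real) \<Rightarrow> (real \<times> real \<times> real \<Rightarrow> real) \<Rightarrow> bool" where
  "renormalized_solution b u0 u \<longleftrightarrow>
     L1_loc space_time u \<and>
     (\<forall>\<beta>. C1_bounded \<beta> \<longrightarrow> is_solution b (\<lambda>q. \<beta> (u0 q)) (\<lambda>z. \<beta> (u z)))"

end

theory Submission
 imports Defs
begin

text \<open>Uniqueness: in the coordinates \<open>x\<close> and \<open>H = y\<^sup>2/2 + V(x)\<close> the stationary equation becomes one-dimensional on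
 each energy level, so bounded weak solutions renormalize although \<open>V'\<close> is only integrable; mollification in time handles
 the evolution. Test functions \<open>\<Theta>(t, x) g(H)\<close> that decrease along the light cone of the travel time
 \<open>T(x) = \<integral> max(1, -V)\<^bsup>-1/2\<^esup>\<close>, whose support is bounded because \<open>T\<close> is unbounded, then show that a nonnegative
 solution with zero initial datum vanishes. Existence: weak limits \<open>u\<close>, \<open>q\<close> of a splitting scheme and of its squares
 exist, the defect \<open>q - u\<^sup>2\<close> vanishes by the same confinement, and so the scheme converges strongly.\<close>

text \<open>On an energy level a function has two branches, at velocities +- sqrt(2 (E - V)). For y
  d_x f - k d_y f = h their difference \<open>Dm f\<close> has x-derivative \<open>Sm h\<close>
  divided by the speed, and away from turning points the sum \<open>Sm f\<close> has derivative
  \<open>Dm h\<close> divided by the speed. Since a^2 - b^2 = (a + b)(a - b), renormalizing f^2 is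
  the product rule for \<open>Sm f\<close> times \<open>Dm f\<close>. The obstacle is the turning
  points: cutting \<open>Sm\<close> off where E - V is of order dl costs a term of size |k| |Sm Dm|
  / dl on a band of that width. It disappears because the branches merge there: where k(x) is
  nonzero, the barrier V > E lies within distance O(dl), and the travel time to it bounds
  \<open>Dm\<close>, whose mean over the band is O(sqrt dl). Where k(x) = 0 the term is absent.
  Mollification in time needs a solution on both sides of t = 0, so the scheme also runs backwards.
  Unbounded data are handled by \<open>arctan\<close>, an injective admissible renormalization; the
  area-preserving scheme controls sizes well enough to undo it in the limit.\<close>

abbreviation (input) px where "px z \<equiv> fst (snd z)"
abbreviation (input) py where "py z \<equiv> snd (snd z)"
abbreviation (input) tx where "tx z \<equiv> (fst z, fst (snd z))"

lemmas lint_cong = Bochner_Integration.integral_cong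
 and lint_nonneg = Bochner_Integration.integral_nonneg
 and lint_bound = Bochner_Integration.integrable_bound
 and lint_add = Bochner_Integration.integrable_add
 and lint_diff = Bochner_Integration.integrable_diff

type_synonym R2 = "real \<times> real"
type_synonym R3 = "real \<times> real \<times> real"
abbreviation (input) limseq ("(_)/ ----> (_)" [60, 60] 60) where "X ----> L \<equiv> X \<longlonglongrightarrow> L"
abbreviation (input) lint (binder "LI " [60] 60) where "lint f \<equiv> integral\<^sup>L lborel f"
abbreviation (input) bm where "bm \<equiv> borel_measurable borel"
abbreviation (input) intgr where "intgr \<equiv> integrable lborel"
lemmas bm_cont = borel_measurable_continuous_onI
 and cont_comp = continuous_on_compose2
 and dct = integral_dominated_convergence
notation (input) abs ("%%_%%")

section \<open>Smooth functions, smooth steps and plateaus\<close>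

definition smooth :: "('a::euclidean_space => real) => bool" where
 "smooth f \<longleftrightarrow> (\<forall>k. C_k k f)"

lemma C_k_SucD: "C_k (Suc k) f ==> C_k k f"
proof (induction k arbitrary: f)
 case 0
 then show ?case
 by (auto intro!: continuous_at_imp_continuous_on differentiable_imp_continuous_within)
next
 case (Suc k)
 then show ?case using C_k.simps(2) by blast
qed

text \<open>\<open>C_k\<close> is phrased with \<open>frechet_derivative\<close>; uniqueness of
  derivatives lets any explicit formula take its place, which is how the closure properties below
  are obtained.\<close>

lemma C_k_SucI:
 assumes "!!x. (f has_derivative f' x) (at x)" and "!!v. C_k k (%x. f' x v)"
 shows "C_k (Suc k) f"
proof -
 have "frechet_derivative f (at x) = f' x" for x
 using frechet_derivative_at[OF assms(1)[of x]] by simp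
 then show ?thesis using assms by (auto simp: differentiable_def)
qed

lemma C_k_Suc_has_derivative:
 "C_k (Suc k) f ==> (f has_derivative frechet_derivative f (at x)) (at x)"
 by (simp flip: frechet_derivative_works)

lemma C_k_const: "C_k k (%x. c)"
 by (induction k arbitrary: c) (simp_all add: frechet_derivative_const)

lemma C_k_add: "C_k k f ==> C_k k g ==> C_k k (%x. f x + g x)"
proof (induction k arbitrary: f g)
 case (Suc k)
 show ?case
 by (rule C_k_SucI[OF has_derivative_add[OF C_k_Suc_has_derivative[OF Suc.prems(1)]
 C_k_Suc_has_derivative[OF Suc.prems(2)]]])
 (use Suc in auto)
qed (auto intro: continuous_intros)

lemma C_k_mult: "C_k k f ==> C_k k g ==> C_k k (%x. f x * g x)"
proof (induction k arbitrary: f g)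
 case (Suc k)
 show ?case
 by (rule C_k_SucI[OF has_derivative_mult[OF C_k_Suc_has_derivative[OF Suc.prems(1)]
 C_k_Suc_has_derivative[OF Suc.prems(2)]]])
 (use Suc.prems C_k_SucD[OF Suc.prems(1)] C_k_SucD[OF Suc.prems(2)] in
 \<open>auto intro!: C_k_add Suc.IH simp del: C_k.simps(1)\<close>)
qed (auto intro: continuous_intros)

lemma C_k_comp:
 fixes g :: "real => real"
 shows "C_k k g ==> C_k k f ==> C_k k (%x. g (f x))"
proof (induction k arbitrary: f g)
 case 0
 then show ?case by (auto intro: cont_comp)
next
 case (Suc k)
 \<comment> \<open>A linear map of the line is multiplication by its value at 1; the chain rule thus
   becomes a product, to which \<open>C_k_mult\<close> applies.\<close>
 have eq: "frechet_derivative g (at y) s = frechet_derivative g (at y) 1 * s" for y s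
 proof -
 have "linear (frechet_derivative g (at y))"
 using C_k_Suc_has_derivative[OF Suc.prems(1)] has_derivative_linear by blast
 from linear_scale[OF this, of s 1] show ?thesis by simp
 qed
 have d: "((%x. g (f x)) has_derivative
 (%v. frechet_derivative g (at (f x)) 1 * frechet_derivative f (at x) v)) (at x)" for x
 using has_derivative_compose[OF C_k_Suc_has_derivative[OF Suc.prems(2)]
 C_k_Suc_has_derivative[OF Suc.prems(1)], of x]
 by (subst (asm) eq) simp
 show ?case
 proof (rule C_k_SucI[OF d], rule C_k_mult)
 show "C_k k (%x. frechet_derivative g (at (f x)) 1)"
 by (rule Suc.IH) (use Suc.prems(1) C_k_SucD[OF Suc.prems(2)] in auto)
 qed (use Suc.prems(2) in auto)
qed

lemma smooth_const: "smooth (%x. c)"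
 and smooth_add: "smooth f ==> smooth g ==> smooth (%x. f x + g x)"
 and smooth_mult: "smooth f ==> smooth g ==> smooth (%x. f x * g x)"
 by (auto simp: smooth_def C_k_const intro: C_k_add C_k_mult)

lemma smooth_comp: "smooth (g::real => real) ==> smooth f ==> smooth (%x. g (f x))"
 by (auto simp: smooth_def intro: C_k_comp)

lemma smooth_linear:
 assumes "bounded_linear f" shows "smooth f"
proof -
 have "C_k k f" for k
 proof (cases k)
 case (Suc j)
 show ?thesis unfolding Suc
 by (rule C_k_SucI[OF bounded_linear_imp_has_derivative[OF assms] C_k_const])
 qed (simp add: linear_continuous_on assms)
 then show ?thesis by (simp add: smooth_def)
qed

lemma C_k_Suc_real:
 fixes f :: "real => real"
 assumes "!!x. (f has_real_derivative f' x) (at x)" "C_k k f'"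
 shows "C_k (Suc k) f"
 by (rule C_k_SucI[OF assms(1)[unfolded has_field_derivative_def]])
 (intro C_k_mult assms C_k_const)

lemma smooth_poly: "smooth (poly p :: real => real)"
 by (induction p)
 (simp_all add: smooth_const smooth_add smooth_mult smooth_linear bounded_linear_ident)

lemma poly_mult_exp_tendsto_0: "((%x. poly p x * exp (- x)) \<longlongrightarrow> 0) (at_top :: real filter)"
proof -
 have "((%x. \<Sum>i\<le>degree p. coeff p i * (x ^ i / exp x)) \<longlongrightarrow> (\<Sum>i\<le>degree p. coeff p i * 0)) (at_top :: real filter)"
 by (intro tendsto_intros tendsto_power_div_exp_0)
 then show ?thesis
 by (simp add: poly_altdef sum_distrib_right exp_minus divide_inverse mult.assoc)
qed

text \<open>The classical flat function exp(-1/x), with a polynomial in 1/x as a parameter: this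
  makes the family closed under differentiation, so that smoothness follows by induction for all
  \<open>p\<close> at once.\<close>

definition flat :: "real poly => real => real" where
 "flat p x = (if x > 0 then poly p (1 / x) * exp (- (1 / x)) else 0)"

lemma flat_has_real_derivative:
 "(flat p has_real_derivative flat (monom 1 2 * (p - pderiv p)) x) (at x)"
proof (cases x "0 :: real" rule: linorder_cases)
 case less
 have "((%x. 0) has_real_derivative 0) (at x)" by simp
 then have "(flat p has_real_derivative 0) (at x)"
 by (rule has_field_derivative_transform_within_open[where S="{..<0}"])
 (use less in \<open>auto simp: flat_def\<close>)
 then show ?thesis using less by (simp add: flat_def)
next
 case greater
 have "((%x. poly p (1 / x) * exp (- (1 / x))) has_real_derivative
 flat (monom 1 2 * (p - pderiv p)) x) (at x)"
 using greater unfolding flat_def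
 by (auto intro!: derivative_eq_intros DERIV_chain2[OF poly_DERIV]
 simp: poly_monom power2_eq_square field_simps)
 then show ?thesis
 by (rule has_field_derivative_transform_within_open[where S="{0<..}"])
 (use greater in \<open>auto simp: flat_def\<close>)
next
 case equal
 have "((%h. flat p h / h) \<longlongrightarrow> 0) (at_right 0)"
 proof -
 have "((%h. poly (monom 1 1 * p) (inverse h) * exp (- inverse h)) \<longlongrightarrow> 0) (at_right (0::real))"
 by (rule filterlim_compose[OF poly_mult_exp_tendsto_0 filterlim_inverse_at_top_right])
 then show ?thesis
 by (rule Lim_transform_eventually)
 (auto simp: eventually_at_filter flat_def poly_monom divide_inverse)
 qed
 moreover have "((%h. flat p h / h) \<longlongrightarrow> 0) (at_left 0)"
 by (rule Lim_transform_eventually[OF tendsto_const]) (auto simp: eventually_at_filter flat_def)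
 ultimately have "((%h. flat p h / h) \<longlongrightarrow> 0) (at 0)"
 by (simp add: filterlim_at_split)
 then show ?thesis
 using equal by (simp add: DERIV_def flat_def[of _ 0])
qed

lemma smooth_flat: "smooth (flat p)"
proof -
 have "C_k k (flat p)" for k
 proof (induction k arbitrary: p)
 case 0
 then show ?case
 using flat_has_real_derivative
 by (auto intro!: continuous_at_imp_continuous_on DERIV_isCont)
 next
 case (Suc k)
 then show ?case by (rule C_k_Suc_real[OF flat_has_real_derivative])
 qed
 then show ?thesis by (simp add: smooth_def)
qed

lemma smooth_step_exists:
 obtains s :: "real => real"
 where "smooth s" "!!x. x <= 0 ==> s x = 0" "!!x. x >= 1 ==> s x = 1" "!!x. 0 <= s x & s x <= 1"
 "mono s"
proof -
 \<comment> \<open>A bump vanishing outside (0, 1); the step is its normalized primitive.\<close>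
 define b where "b = (%x::real. flat 1 x * flat 1 (1 - x))"
 have smb: "smooth b"
 unfolding b_def
 using smooth_add[OF smooth_const smooth_linear[OF bounded_linear_minus[OF bounded_linear_ident]], of "1::real"]
 by (intro smooth_mult smooth_flat smooth_comp[OF smooth_flat]) simp
 have b0: "b x = 0" if "x <= 0 | x >= 1" for x using that by (auto simp: b_def flat_def)
 have bnn: "b x >= 0" for x by (auto simp: b_def flat_def)
 have bcont: "continuous_on A b" for A
 using smb[unfolded smooth_def, rule_format, of 0] by (auto intro: continuous_on_subset)
 have bint: "b integrable_on {u..v}" for u v
 using bcont by (rule integrable_continuous_interval)
 \<comment> \<open>Starting at -1, left of the support of \<open>b\<close>, keeps every x >= 0
   interior to the interval of integration, so the derivative is two-sided there.\<close>
 define S where "S = (%x. integral {-1..x} b)"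
 have S0: "S x = 0" if "x <= 0" for x
 proof -
 have "integral {-1..x} b = integral {-1..x} (%x. 0)"
 by (rule integral_cong) (use that b0 in auto)
 then show ?thesis by (simp add: S_def)
 qed
 have Sdiff: "S v - S u = integral {u..v} b" if "u <= v" "-1 <= u" for u v
 using Henstock_Kurzweil_Integration.integral_combine[OF that(2,1) bint] by (simp add: S_def)
 have S1: "S x = S 1" if "x >= 1" for x
 proof -
 have "integral {1..x} b = integral {1..x} (%x. 0)"
 by (rule integral_cong) (use that b0 in auto)
 then show ?thesis using Sdiff[of 1 x] that by simp
 qed
 have Sder: "(S has_real_derivative b x) (at x)" for x
 proof (cases "x < 0")
 case True
 have "((%x. 0) has_real_derivative 0) (at x)" by simp
 then have "(S has_real_derivative 0) (at x)"
 by (rule has_field_derivative_transform_within_open[where S="{..<0}"])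
 (use True S0 in auto)
 then show ?thesis using b0[of x] True by simp
 next
 case False
 have "(S has_real_derivative b x) (at x within {-1..x+1})"
 unfolding S_def by (rule integral_has_real_derivative[OF bcont]) (use False in auto)
 moreover have "at x within {-1..x+1} = at x"
 by (rule at_within_Icc_at) (use False in auto)
 ultimately show ?thesis by simp
 qed
 have Smono: "mono S"
 proof (rule monoI)
 show "S u <= S v" if "u <= v" for u v
 by (rule DERIV_nonneg_imp_nondecreasing[OF that]) (use Sder bnn in blast)
 qed
 have Spos: "S 1 > 0"
 proof -
 obtain z where z: "0 < z" "z < 1" "S 1 - S 0 = (1 - 0) * b z"
 using MVT2[of 0 1 S b] Sder by auto
 have "b z > 0" using z by (simp add: b_def flat_def)
 then show ?thesis using z S0[of 0] by simp
 qed
 have smS: "smooth S"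
 proof -
 have "C_k k S" for k
 by (rule C_k_SucD, rule C_k_Suc_real[OF Sder]) (use smb in \<open>simp add: smooth_def\<close>)
 then show ?thesis by (simp add: smooth_def)
 qed
 show thesis
 proof (rule that[of "%x. inverse (S 1) * S x"])
 show "smooth (%x. inverse (S 1) * S x)" by (intro smooth_mult smooth_const smS)
 show "mono (%x. inverse (S 1) * S x)" using Smono Spos by (auto simp: mono_def)
 show "x >= 1 ==> inverse (S 1) * S x = 1" for x using S1[of x] Spos by simp
 show "0 <= inverse (S 1) * S x & inverse (S 1) * S x <= 1" for x
 proof -
 have "0 <= S x"
 using monoD[OF Smono, of "min x 0" x] S0[of "min x 0"] by simp
 moreover have "S x <= S 1"
 using monoD[OF Smono, of x "max x 1"] S1[of "max x 1"] by simp
 ultimately show ?thesis using Spos by (simp add: field_simps)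
 qed
 qed (simp add: S0)
qed

lemma smooth_plateau_exists:
 assumes "R > (0::real)"
 obtains kp :: "real => real"
 where "smooth kp" "!!x. %%x%% <= R / 2 ==> kp x = 1" "!!x. %%x%% >= R ==> kp x = 0" "!!x. 0 <= kp x & kp x <= 1"
proof -
 obtain s :: "real => real" where s: "smooth s" "!!x. x <= 0 ==> s x = 0" "!!x. x >= 1 ==> s x = 1"
 "!!x. 0 <= s x & s x <= 1" by (rule smooth_step_exists) blast
 show thesis
 \<comment> \<open>The argument (2/R) x + 2 runs from 0 at x = -R to 1 at x = -R/2; the other factor
   is the mirror image.\<close>
 proof (rule that[of "%x. s ((2/R) * x + 2) * s ((-2/R) * x + 2)"])
 show "smooth (%x. s ((2/R) * x + 2) * s ((-2/R) * x + 2))"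
 by (intro smooth_mult smooth_comp[OF s(1)] smooth_add smooth_const smooth_linear
 bounded_linear_ident)
 next
 fix x :: real assume "%%x%% <= R / 2"
 then show "s ((2/R) * x + 2) * s ((-2/R) * x + 2) = 1"
 using assms by (subst (1 2) s(3)) (auto simp: field_simps abs_le_iff)
 next
 fix x :: real assume "%%x%% >= R"
 then consider "x >= R" | "x <= -R" by linarith
 then show "s ((2/R) * x + 2) * s ((-2/R) * x + 2) = 0"
 proof cases
 case 1
 then have "(-2/R) * x + 2 <= 0" using assms by (auto simp: field_simps)
 then show ?thesis using s(2) by simp
 next
 case 2
 then have "(2/R) * x + 2 <= 0" using assms by (auto simp: field_simps)
 then show ?thesis using s(2) by simp
 qed
 qed (use s(4) in \<open>auto intro: mult_le_one\<close>)
qed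

section \<open>Measurability and null sets in product spaces\<close>

lemma borel_measurable_fst_comp [measurable (raw)]:
 fixes f :: "'c => 'a::second_countable_topology \<times> 'b::second_countable_topology"
 assumes "f \<in> borel_measurable M"
 shows "(%x. fst (f x)) \<in> borel_measurable M"
 using measurable_compose[OF assms, of fst borel] by (simp add: bm_cont continuous_on_fst)

lemma borel_measurable_snd_comp [measurable (raw)]:
 fixes f :: "'c => 'a::second_countable_topology \<times> 'b::second_countable_topology"
 assumes "f \<in> borel_measurable M"
 shows "(%x. snd (f x)) \<in> borel_measurable M"
 using measurable_compose[OF assms, of snd borel] by (simp add: bm_cont continuous_on_snd)

lemma AE_lborel_snd:
 assumes "AE y in lborel. P y"
 shows "AE z in (lborel :: ('a::euclidean_space \<times> 'b::euclidean_space) measure). P (snd z)"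
proof -
 obtain N where N0: "!!y. y \<in> space lborel - N ==> P y" and N: "N \<in> null_sets (lborel :: 'b measure)"
 using AE_E3[OF assms] by blast
 then have [measurable]: "N \<in> sets borel" by (auto simp: null_sets_def)
 have "AE z in (lborel :: 'a measure) \<Otimes>\<^sub>M (lborel :: 'b measure). snd z \<notin> N"
 proof (rule lborel_pair.AE_pair_measure)
 have "{x \<in> space ((lborel :: 'a measure) \<Otimes>\<^sub>M (lborel :: 'b measure)). snd x \<notin> N} = UNIV \<times> - N"
 by (auto simp: space_pair_measure)
 also have "... \<in> sets (lborel \<Otimes>\<^sub>M lborel)" by (intro pair_measureI) auto
 finally show "{x \<in> space ((lborel :: 'a measure) \<Otimes>\<^sub>M (lborel :: 'b measure)). snd x \<notin> N} \<in> sets (lborel \<Otimes>\<^sub>M lborel)" .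
 qed (use AE_not_in[OF N] in simp)
 then show ?thesis unfolding lborel_prod by eventually_elim (simp add: N0)
qed

lemma AE_lborel_fst:
 assumes "AE x in lborel. P x"
 shows "AE z in (lborel :: ('a::euclidean_space \<times> 'b::euclidean_space) measure). P (fst z)"
proof -
 obtain N where N0: "!!y. y \<in> space lborel - N ==> P y" and N: "N \<in> null_sets (lborel :: 'a measure)"
 using AE_E3[OF assms] by blast
 then have [measurable]: "N \<in> sets borel" by (auto simp: null_sets_def)
 have "AE z in (lborel :: 'a measure) \<Otimes>\<^sub>M (lborel :: 'b measure). fst z \<notin> N"
 proof (rule lborel_pair.AE_pair_measure)
 have "{x \<in> space ((lborel :: 'a measure) \<Otimes>\<^sub>M (lborel :: 'b measure)). fst x \<notin> N} = (- N) \<times> UNIV"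
 by (auto simp: space_pair_measure)
 also have "... \<in> sets (lborel \<Otimes>\<^sub>M lborel)" by (intro pair_measureI) auto
 finally show "{x \<in> space ((lborel :: 'a measure) \<Otimes>\<^sub>M (lborel :: 'b measure)). fst x \<notin> N} \<in> sets (lborel \<Otimes>\<^sub>M lborel)" .
 show "AE x in (lborel :: 'a measure). AE y in (lborel :: 'b measure). fst (x, y) \<notin> N"
 using AE_not_in[OF N] by eventually_elim simp
 qed
 then show ?thesis unfolding lborel_prod by eventually_elim (simp add: N0)
qed

lemma integrable_lborel_prod_mult:
 fixes f :: "'a::euclidean_space => real" and g :: "'b::euclidean_space => real"
 assumes f: "intgr f" and g: "intgr g"
 shows "intgr (%z. f (fst z) * g (snd z))"
proof -
 have [measurable]: "f \<in> bm" "g \<in> bm"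
 using f g by auto
 have "integrable (lborel \<Otimes>\<^sub>M lborel) (%z. f (fst z) * g (snd z))"
 proof (rule lborel_pair.Fubini_integrable)
 show "intgr (%x. LI y. norm (f (fst (x, y)) * g (snd (x, y))))"
 using f by (simp add: abs_mult)
 qed (use g in auto)
 then show ?thesis by (simp add: lborel_prod)
qed

abbreviation ivl :: "real => real => real" where
 "ivl R x \<equiv> indicator {-R..R} x"

definition locint :: "(real => real) => bool" where
 "locint k \<longleftrightarrow> k \<in> bm & (\<forall>R. intgr (%x. ivl R x * k x))"

lemma integrable_kernel_box:
 assumes "intgr (%x. ivl R x * q x)"
 shows "intgr (%z::R3. ivl R (fst z) * (ivl R (px z) * q (px z) * ivl R (py z)))"
proof -
 have i: "intgr (ivl R)" by (simp add: integrable_indicator_iff emeasure_lborel_Icc_eq)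
 show ?thesis
 using integrable_lborel_prod_mult[OF i integrable_lborel_prod_mult[OF assms i]] by simp
qed

section \<open>Partial derivatives in space-time\<close>

text \<open>Total differentiability with the three partials as explicit data, so that sums, products
  and compositions compute them symbolically.\<close>

definition has_partials ::
 "(R3 => real) => (R3 => real) => (R3 => real) =>
 (R3 => real) => bool" where
 "has_partials P Pt Px Py \<longleftrightarrow>
 (\<forall>z. (P has_derivative (%v. fst v * Pt z + px v * Px z + py v * Py z)) (at z))"

lemma has_partialsD:
 "has_partials P Pt Px Py ==>
 (P has_derivative (%v. fst v * Pt z + px v * Px z + py v * Py z)) (at z)"
 unfolding has_partials_def by blast

lemma has_partialsI:
 assumes "!!z. (P has_derivative D z) (at z)"
 and "!!z v. D z v = fst v * Pt z + px v * Px z + py v * Py z"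
 shows "has_partials P Pt Px Py"
 using assms(1) unfolding assms(2)[abs_def] has_partials_def by blast

lemma has_partials_add:
 assumes "has_partials P Pt Px Py" "has_partials Q Qt Qx Qy"
 shows "has_partials (%z. P z + Q z) (%z. Pt z + Qt z) (%z. Px z + Qx z) (%z. Py z + Qy z)"
 by (rule has_partialsI, rule has_derivative_add[OF has_partialsD[OF assms(1)] has_partialsD[OF assms(2)]])
 (simp add: algebra_simps)

lemma has_partials_mult:
 assumes "has_partials P Pt Px Py" "has_partials Q Qt Qx Qy"
 shows "has_partials (%z. P z * Q z) (%z. Pt z * Q z + P z * Qt z) (%z. Px z * Q z + P z * Qx z)
 (%z. Py z * Q z + P z * Qy z)"
 by (rule has_partialsI, rule has_derivative_mult[OF has_partialsD[OF assms(1)] has_partialsD[OF assms(2)]])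
 (simp add: algebra_simps)

lemma has_partials_comp:
 assumes "!!s. (f has_real_derivative f' s) (at s)" "has_partials P Pt Px Py"
 shows "has_partials (%z. f (P z)) (%z. f' (P z) * Pt z) (%z. f' (P z) * Px z) (%z. f' (P z) * Py z)"
 by (rule has_partialsI,
 rule has_derivative_compose[OF has_partialsD[OF assms(2)] assms(1)[unfolded has_field_derivative_def]])
 (simp add: algebra_simps)

lemma has_partials_coord:
 "has_partials (%z. fst z) (%z. 1) (%z. 0) (%z. 0)"
 "has_partials (%z. px z) (%z. 0) (%z. 1) (%z. 0)"
 "has_partials (%z. py z) (%z. 0) (%z. 0) (%z. 1)"
 by (auto simp: has_partials_def intro!: derivative_eq_intros)

lemma has_partials_DERIV:
 assumes "has_partials P Pt Px Py"
 shows "((%s. P (s, x, y)) has_real_derivative Pt (t, x, y)) (at t)"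
 "((%s. P (t, s, y)) has_real_derivative Px (t, x, y)) (at x)"
 "((%s. P (t, x, s)) has_real_derivative Py (t, x, y)) (at y)"
proof -
 note * = has_partialsD[OF assms, of "(t, x, y)"]
 have "((%s. (s, x, y)) has_derivative (%h. (h, 0, 0))) (at t)"
 by (auto intro!: derivative_eq_intros simp: zero_prod_def)
 from has_derivative_compose[OF this *]
 show "((%s. P (s, x, y)) has_real_derivative Pt (t, x, y)) (at t)"
 by (simp add: has_field_derivative_def mult_commute_abs)
 have "((%s. (t, s, y)) has_derivative (%h. (0, h, 0))) (at x)"
 by (auto intro!: derivative_eq_intros)
 from has_derivative_compose[OF this *]
 show "((%s. P (t, s, y)) has_real_derivative Px (t, x, y)) (at x)"
 by (simp add: has_field_derivative_def mult_commute_abs)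
 have "((%s. (t, x, s)) has_derivative (%h. (0, 0, h))) (at y)"
 by (auto intro!: derivative_eq_intros)
 from has_derivative_compose[OF this *]
 show "((%s. P (t, x, s)) has_real_derivative Py (t, x, y)) (at y)"
 by (simp add: has_field_derivative_def mult_commute_abs)
qed

lemma has_partials_eq_0:
 assumes "has_partials P Pt Px Py" "(P has_derivative (%v. 0)) (at z)"
 shows "Pt z = 0 & Px z = 0 & Py z = 0"
proof -
 have "fst v * Pt z + px v * Px z + py v * Py z = 0" for v
 using has_derivative_unique[OF has_partialsD[OF assms(1)] assms(2)] by (rule fun_cong)
 from this[of "(1,0,0)"] this[of "(0,1,0)"] this[of "(0,0,1)"] show ?thesis by simp
qed

lemmas has_partials_deriv = has_partials_DERIV[THEN DERIV_imp_deriv]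

lemma smooth_has_partials:
 assumes "smooth P"
 obtains Pt Px Py where "has_partials P Pt Px Py" "smooth Pt" "smooth Px" "smooth Py"
proof -
 have d: "(P has_derivative frechet_derivative P (at z)) (at z)" for z
 using assms C_k_Suc_has_derivative unfolding smooth_def by blast
 have s: "smooth (%z. frechet_derivative P (at z) v)" for v
 using assms unfolding smooth_def by (metis C_k.simps(2))
 have e: "frechet_derivative P (at z) v = fst v * frechet_derivative P (at z) (1,0,0)
 + px v * frechet_derivative P (at z) (0,1,0) + py v * frechet_derivative P (at z) (0,0,1)" for z v
 proof -
 have l: "linear (frechet_derivative P (at z))"
 using d has_derivative_linear by blast
 have "v = fst v *\<^sub>R (1,0,0) + px v *\<^sub>R (0,1,0) + py v *\<^sub>R (0,0,1)"
 by (simp add: prod_eq_iff)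
 then have "frechet_derivative P (at z) v = frechet_derivative P (at z) (fst v *\<^sub>R (1,0,0) + px v *\<^sub>R (0,1,0) + py v *\<^sub>R (0,0,1))"
 by simp
 then show ?thesis by (simp only: linear_add[OF l] linear_scale[OF l] real_scaleR_def)
 qed
 have "has_partials P (%z. frechet_derivative P (at z) (1,0,0)) (%z. frechet_derivative P (at z) (0,1,0))
 (%z. frechet_derivative P (at z) (0,0,1))"
 by (rule has_partialsI[OF d e])
 then show thesis using that s by blast
qed

lemma has_partials_unique:
 assumes "has_partials P Pt Px Py" "has_partials P Qt Qx Qy"
 shows "Pt = Qt" "Px = Qx" "Py = Qy"
 using has_partials_deriv[OF assms(1)] has_partials_deriv[OF assms(2)] by (auto simp: fun_eq_iff)

lemma smooth_continuous: "smooth f ==> continuous_on S f"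
 unfolding smooth_def by (metis C_k.simps(1) continuous_on_subset top_greatest)

lemma smooth_borel: "smooth f ==> f \<in> bm"
 by (simp add: bm_cont smooth_continuous)

lemma smooth_coord:
 "smooth (%z::R3. fst z)" "smooth (%z::R3. px z)"
 "smooth (%z::R3. py z)"
 by (auto intro!: smooth_linear bounded_linear_fst bounded_linear_snd bounded_linear_compose[OF bounded_linear_fst]
 bounded_linear_compose[OF bounded_linear_snd])

text \<open>\<open>weak_sol k u0 w\<close>: \<open>\<partial>\<^sub>t w + y \<partial>\<^sub>x w - k \<partial>\<^sub>y w = u0 dl\<^bsub>t=0\<^esub>\<close> in the sense of
 distributions on the whole of space-time.\<close>

definition weak_sol ::
 "(real => real) => (R2 => real) => (R3 => real) => bool" where
 "weak_sol k u0 w \<longleftrightarrow> (\<forall>ph pht phx phy. test_function ph --> has_partials ph pht phx phy -->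
 (LI z. w z * (pht z + py z * phx z - k (px z) * phy z))
 = - (LI q. u0 q * ph (0, q)))"

section \<open>Test functions of low regularity\<close>

definition in_box :: "real => R3 => bool" where
 "in_box R z \<longleftrightarrow> %%fst z%% <= R & %%px z%% <= R & %%py z%% <= R"

text \<open>Functions of the energy have an x-derivative containing \<open>k\<close>, which is
  merely integrable. Hence the asymmetry: \<open>Py\<close> is multiplied by \<open>k\<close> in the
  equation and must be bounded, whereas \<open>Px\<close> is multiplied only by y and may be
  dominated by an integrable function of x. The exceptional null set is one of x alone, so that
  convergence survives the restriction to t = 0.\<close>

definition approximable ::
 "real => (R3 => real) => (R3 => real) =>
 (R3 => real) => (R3 => real) => bool" where
 "approximable R Q Qt Qx Qy \<longleftrightarrow>
 Q \<in> bm & Qt \<in> bm & Qx \<in> bm &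
 Qy \<in> bm &
 (\<exists>P Pt Px Py C q. (\<forall>n::nat. smooth (P n) & has_partials (P n) (Pt n) (Px n) (Py n)) &
 intgr (%x. ivl R x * q x) &
 (AE x in lborel. \<forall>z. px z = x --> in_box R z -->
 (\<forall>n. %%P n z%% <= C & %%Pt n z%% <= C & %%Py n z%% <= C & %%Px n z%% <= q x) &
 (%n. P n z) ----> Q z & (%n. Pt n z) ----> Qt z & (%n. Px n z) ----> Qx z &
 (%n. Py n z) ----> Qy z))"

lemma test_function_box:
 assumes "smooth ph" "!!z. ~ in_box R z ==> ph z = 0"
 shows "test_function ph"
proof -
 have "{z. ph z ~= 0} \<subseteq> {-R..R} \<times> {-R..R} \<times> {-R..R}"
 proof
 fix z assume "z \<in> {z. ph z ~= 0}"
 then have "in_box R z" using assms(2) by blast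
 then show "z \<in> {-R..R} \<times> {-R..R} \<times> {-R..R}" by (cases z) (auto simp: in_box_def)
 qed
 moreover have "bounded ({-R..R} \<times> {-R..R} \<times> {-R..R})"
 by (intro bounded_Times bounded_closed_interval) 
 ultimately have "bounded {z. ph z ~= 0}" using bounded_subset by blast
 then show ?thesis using assms(1) by (simp add: test_function_def smooth_def)
qed

text \<open>Each smooth approximant, multiplied by a plateau \<open>B\<close> to give it compact
  support, is inserted into the weak formulation; the domination built into
  \<open>approximable\<close> carries both sides to the limit.\<close>

lemma weak_sol_approximable:
 fixes w :: "R3 => real"
 assumes ws: "weak_sol k u0 w"
 and [measurable]: "w \<in> bm" "u0 \<in> bm"
 and bd: "!!z. %%w z%% <= M" "!!z. %%u0 z%% <= M"
 and k: "locint k" and R: "R > 0"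
 and ap: "approximable R Q Qt Qx Qy"
 and van: "!!z. ~ in_box (R/2) z ==> Q z = 0 & Qt z = 0 & Qx z = 0 & Qy z = 0"
 shows "(LI z. w z * (Qt z + py z * Qx z - k (px z) * Qy z))
 = - (LI q. u0 q * Q (0, q))"
proof -
 have [measurable]: "k \<in> bm" using k by (simp add: locint_def)
 have [measurable]: "Q \<in> bm" "Qt \<in> bm"
 "Qx \<in> bm" "Qy \<in> bm"
 using ap by (auto simp: approximable_def)
 obtain kp :: "real => real" where kp: "smooth kp" "!!x. %%x%% <= R / 2 ==> kp x = 1" "!!x. %%x%% >= R ==> kp x = 0"
 "!!x. 0 <= kp x & kp x <= 1"
 using smooth_plateau_exists[OF R] by metis
 define B where "B z = kp (fst z) * (kp (px z) * kp (py z))" for z :: "R3"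
 have smB: "smooth B" unfolding B_def
 by (intro smooth_mult smooth_comp[OF kp(1)] smooth_coord)
 obtain Bt Bx By where B: "has_partials B Bt Bx By" "smooth Bt" "smooth Bx" "smooth By"
 using smooth_has_partials[OF smB] by blast
 note [measurable] = smooth_borel[OF smB] smooth_borel[OF B(2)] smooth_borel[OF B(3)] smooth_borel[OF B(4)]
 have B0: "B z = 0" if "~ in_box R z" for z
 proof -
 have "%%fst z%% >= R | %%px z%% >= R | %%py z%% >= R"
 using that by (auto simp: in_box_def)
 then show ?thesis using kp(3) unfolding B_def by auto
 qed
 have B1: "B z = 1" if "in_box (R/2) z" for z
 using that kp(2) by (simp add: B_def in_box_def)
 have Bder0: "Bt z = 0 & Bx z = 0 & By z = 0" if "~ in_box R z" for z
 proof -
 have "open {z. ~ in_box R z}"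
 unfolding in_box_def de_Morgan_conj not_le
 by (intro open_Collect_disj open_Collect_less continuous_intros)
 have "(B has_derivative (%v. 0)) (at z)"
 proof (rule has_derivative_transform_within_open[OF has_derivative_const[of 0] \<open>open _\<close>])
 show "0 = B x" if "x \<in> {z. ~ in_box R z}" for x using B0[of x] that by simp
 qed (use that in simp)
 from has_partials_eq_0[OF B(1) this] show ?thesis .
 qed
 have cb: "compact {z. in_box R z}"
 proof -
 have "{z. in_box R z} = {-R..R} \<times> {-R..R} \<times> {-R..R}"
 by (auto simp: in_box_def abs_le_iff minus_le_iff mem_Times_iff)
 then show ?thesis by (simp add: compact_Times)
 qed
 obtain K where K: "K >= 0" "!!z. %%B z%% <= K & %%Bt z%% <= K & %%Bx z%% <= K & %%By z%% <= K"
 proof -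
 have "\<exists>K. \<forall>z. %%f z%% <= K" if "smooth f" "!!z. ~ in_box R z ==> f z = 0" for f
 proof -
 have "bounded (f ` {z. in_box R z})"
 using compact_continuous_image[OF smooth_continuous[OF that(1)] cb] compact_imp_bounded by blast
 then obtain K where K: "!!z. in_box R z ==> %%f z%% <= K" unfolding bounded_iff by fastforce
 have "%%f z%% <= %%K%%" for z
 proof (cases "in_box R z")
 case True
 then show ?thesis using K[of z] by linarith
 qed (use that(2)[of z] in simp)
 then show ?thesis by blast
 qed
 note * = this
 obtain a where a: "!!z. %%B z%% <= a" using *[OF smB B0] by blast
 obtain b where b: "!!z. %%Bt z%% <= b" using *[OF B(2)] Bder0 by blast
 obtain c where c: "!!z. %%Bx z%% <= c" using *[OF B(3)] Bder0 by blast
 obtain d where d: "!!z. %%By z%% <= d" using *[OF B(4)] Bder0 by blast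
 show ?thesis
 proof (rule that[of "a + b + c + d"])
 have "a >= 0" "b >= 0" "c >= 0" "d >= 0"
 using order_trans[OF abs_ge_zero a] order_trans[OF abs_ge_zero b] order_trans[OF abs_ge_zero c]
 order_trans[OF abs_ge_zero d] by auto
 then show "a + b + c + d >= 0" "%%B z%% <= a+b+c+d & %%Bt z%% <= a+b+c+d & %%Bx z%% <= a+b+c+d & %%By z%% <= a+b+c+d" for z
 using a[of z] b[of z] c[of z] d[of z] by auto
 qed
 qed
 have van': "Bt z * Q z = 0" "Bx z * Q z = 0" "By z * Q z = 0" for z
 proof -
 consider "~ in_box (R/2) z" | "in_box (R/2) z" by blast
 then have "Q z = 0 | Bt z = 0 & Bx z = 0 & By z = 0"
 proof cases
 case 2
 \<comment> \<open>\<open>B\<close> is maximal at \<open>z\<close>.\<close>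
 have "B y <= B z" for y
 unfolding B1[OF 2] unfolding B_def using kp(4) by (intro mult_le_one mult_nonneg_nonneg) auto
 then have "(%v. fst v * Bt z + px v * Bx z + py v * By z) = (%v. 0)"
 using has_partialsD[OF B(1), of z]
 by (intro differential_zero_maxmin[where f=B and x=z and S=UNIV]) auto
 then show ?thesis using has_partials_eq_0[OF B(1), of z] has_partialsD[OF B(1), of z] by simp
 qed (use van in auto)
 then show "Bt z * Q z = 0" "Bx z * Q z = 0" "By z * Q z = 0" by auto
 qed
 have van'': "B z * Q z = Q z" "B z * Qt z = Qt z" "B z * Qx z = Qx z" "B z * Qy z = Qy z" for z
 using van[of z] B1[of z] by (cases "in_box (R/2) z"; simp)+
 obtain P Pt Px Py C q where P: "!!n::nat. smooth (P n)" "!!n. has_partials (P n) (Pt n) (Px n) (Py n)"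
 and q: "intgr (%x. ivl R x * q x)"
 and ae: "AE x in lborel. \<forall>z. px z = x --> in_box R z -->
 (\<forall>n. %%P n z%% <= C & %%Pt n z%% <= C & %%Py n z%% <= C & %%Px n z%% <= q x) &
 (%n. P n z) ----> Q z & (%n. Pt n z) ----> Qt z & (%n. Px n z) ----> Qx z &
 (%n. Py n z) ----> Qy z"
 using ap unfolding approximable_def by blast
 have [measurable]: "P n \<in> bm" "Pt n \<in> bm"
 "Px n \<in> bm" "Py n \<in> bm" for n
 proof -
 obtain At Ax Ay where A: "has_partials (P n) At Ax Ay" "smooth At" "smooth Ax" "smooth Ay"
 using smooth_has_partials[OF P(1)] by metis
 note has_partials_unique[OF P(2) A(1)]
 then show "P n \<in> bm" "Pt n \<in> bm"
 "Px n \<in> bm" "Py n \<in> bm"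
 using A(2-) smooth_borel P(1) by auto
 qed
 have aez: "AE z in lborel. in_box R z -->
 (\<forall>n. %%P n z%% <= C & %%Pt n z%% <= C & %%Py n z%% <= C & %%Px n z%% <= q (px z)) &
 (%n. P n z) ----> Q z & (%n. Pt n z) ----> Qt z & (%n. Px n z) ----> Qx z &
 (%n. Py n z) ----> Qy z"
 using AE_lborel_snd[OF AE_lborel_fst[OF ae], where 'a=real] by eventually_elim auto
 have ae0: "AE p in lborel. in_box R (0, p) --> (\<forall>n. %%P n (0,p)%% <= C) & (%n. P n (0,p)) ----> Q (0,p)"
 using AE_lborel_fst[OF ae] by eventually_elim auto
 define F where "F n z = w z * ((Bt z * P n z + B z * Pt n z) + py z * (Bx z * P n z + B z * Px n z)
 - k (px z) * (By z * P n z + B z * Py n z))" for n z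
 have Feq: "(LI z. F n z) = - (LI p. u0 p * (B (0,p) * P n (0,p)))" for n
 unfolding F_def
 using ws[unfolded weak_sol_def, rule_format, of "%z. B z * P n z", OF test_function_box[where R=R] has_partials_mult[OF B(1) P(2)]]
 by (auto intro: smooth_mult smB P(1) simp: B0)
 have lim1: "(%n. LI z. F n z) ----> (LI z. w z * (Qt z + py z * Qx z - k (px z) * Qy z))"
 proof (rule dct)
 \<comment> \<open>Pointwise majorant of \<open>F n\<close>: \<open>M\<close> bounds the solution,
   \<open>K\<close> the plateau and its derivatives, \<open>C\<close> and \<open>q\<close> the
   approximants, and \<open>R\<close> bounds y.\<close>
 define h where "h x = M * ((2 * K * C) + R * (K * C + K * q x) + %%k x%% * (2 * K * C))" for x
 have "intgr (%x. ivl R x * h x)"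
 proof -
 have "intgr (%x. ivl R x * k x)" using k by (simp add: locint_def)
 from integrable_abs[OF this] have 1: "intgr (%x. ivl R x * %%k x%%)"
 by (simp add: abs_mult)
 have i: "intgr (ivl R)" by (simp add: integrable_indicator_iff emeasure_lborel_Icc_eq)
 have "intgr (%x. (M * (2 * K * C) + M * R * K * C) * ivl R x + (M * R * K) * (ivl R x * q x)
 + (M * 2 * K * C) * (ivl R x * %%k x%%))"
 using 1 i q by (intro lint_add integrable_mult_right)
 then show ?thesis by (simp add: h_def algebra_simps)
 qed
 from integrable_kernel_box[OF this]
 show "intgr (%z::R3. ivl R (fst z) * (ivl R (px z) * h (px z) * ivl R (py z)))" .
 show "(%z. w z * (Qt z + py z * Qx z - k (px z) * Qy z)) \<in> borel_measurable lborel"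
 by measurable
 show "F n \<in> borel_measurable lborel" for n unfolding F_def by measurable
 show "AE z in lborel. (%n. F n z) ----> w z * (Qt z + py z * Qx z - k (px z) * Qy z)"
 using aez
 proof eventually_elim
 case (elim z)
 show ?case
 proof (cases "in_box R z")
 case True
 with elim have "(%n. F n z) ----> w z * ((Bt z * Q z + B z * Qt z) + py z * (Bx z * Q z + B z * Qx z)
 - k (px z) * (By z * Q z + B z * Qy z))"
 unfolding F_def by (intro tendsto_intros) auto
 then show ?thesis unfolding van' van'' add_0 .
 next
 case False
 then have nb: "~ in_box (R/2) z" using R by (auto simp: in_box_def)
 show ?thesis using van[OF nb] B0[OF False] Bder0[OF False] by (simp add: F_def)
 qed
 qed
 show "AE z in lborel. norm (F n z) <= ivl R (fst z) * (ivl R (px z) * h (px z) * ivl R (py z))" for n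
 using aez
 proof eventually_elim
 case (elim z)
 show ?case
 proof (cases "in_box R z")
 case True
 then have i: "ivl R (fst z) = 1" "ivl R (px z) = 1" "ivl R (py z) = 1"
 by (auto simp: in_box_def indicator_def)
 have b: "%%P n z%% <= C" "%%Pt n z%% <= C" "%%Py n z%% <= C" "%%Px n z%% <= q (px z)"
 using elim True by blast+
 have C0: "C >= 0" using b(1) by linarith
 have Kz: "%%B z%% <= K" "%%Bt z%% <= K" "%%Bx z%% <= K" "%%By z%% <= K" using K(2)[of z] by blast+
 have M0: "M >= 0" using bd(1)[of z] by linarith
 have "%%Bt z * P n z + B z * Pt n z%% <= K * C + K * C"
 using K(1) Kz b C0 by (intro order_trans[OF abs_triangle_ineq] add_mono) (auto simp: abs_mult intro!: mult_mono)
 moreover have "%%By z * P n z + B z * Py n z%% <= K * C + K * C"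
 using K(1) Kz b C0 by (intro order_trans[OF abs_triangle_ineq] add_mono) (auto simp: abs_mult intro!: mult_mono)
 moreover have "%%Bx z * P n z + B z * Px n z%% <= K * C + K * q (px z)"
 using K(1) Kz b C0 by (intro order_trans[OF abs_triangle_ineq] add_mono) (auto simp: abs_mult intro!: mult_mono)
 moreover have "%%py z%% <= R" using True by (simp add: in_box_def)
 ultimately have "%%(Bt z * P n z + B z * Pt n z) + py z * (Bx z * P n z + B z * Px n z)
 - k (px z) * (By z * P n z + B z * Py n z)%% <= (2 * K * C) + R * (K * C + K * q (px z)) + %%k (px z)%% * (2 * K * C)"
 proof -
 have tri: "%%a + s * b - l * c%% <= A + R * B' + %%l%% * A"
 if "%%a%% <= A" "%%c%% <= A" "%%b%% <= B'" "%%s%% <= R" for a b c s l A B' :: real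
 proof -
 have "%%s * b%% <= R * B'" "%%l * c%% <= %%l%% * A"
 using that by (auto simp: abs_mult intro!: mult_mono)
 then show ?thesis using that by linarith
 qed
 assume "%%Bt z * P n z + B z * Pt n z%% <= K * C + K * C"
 "%%By z * P n z + B z * Py n z%% <= K * C + K * C"
 "%%Bx z * P n z + B z * Px n z%% <= K * C + K * q (px z)" "%%py z%% <= R"
 then show ?thesis by (intro tri) (simp_all add: algebra_simps)
 qed
 then have "%%F n z%% <= h (px z)"
 unfolding F_def h_def abs_mult[of "w z"] using bd(1)[of z] M0 by (intro mult_mono) auto
 then show ?thesis by (simp add: i)
 next
 case False
 then have "F n z = 0" using B0[of z] Bder0[of z] by (simp add: F_def)
 moreover have "ivl R (fst z) = 0 | ivl R (px z) = 0 | ivl R (py z) = 0"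
 using False by (auto simp: in_box_def indicator_def)
 ultimately show ?thesis by auto
 qed
 qed
 qed
 have "(%n. LI p. u0 p * (B (0,p) * P n (0,p))) ----> (LI p. u0 p * Q (0, p))"
 proof (rule dct)
 have i: "intgr (ivl R)" by (simp add: integrable_indicator_iff emeasure_lborel_Icc_eq)
 from integrable_mult_right[OF integrable_lborel_prod_mult[OF i i], of "M * (K * C)"]
 show "intgr (%p::R2. M * (K * C) * (ivl R (fst p) * ivl R (snd p)))" by simp
 show "(%p. u0 p * Q (0, p)) \<in> borel_measurable lborel" by measurable
 show "(%p. u0 p * (B (0,p) * P n (0,p))) \<in> borel_measurable lborel" for n by measurable
 show "AE p in lborel. (%n. u0 p * (B (0,p) * P n (0,p))) ----> u0 p * Q (0, p)"
 using ae0
 proof eventually_elim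
 case (elim p)
 show ?case
 proof (cases "in_box R (0,p)")
 case True
 with elim have "(%n. u0 p * (B (0,p) * P n (0,p))) ----> u0 p * (B (0,p) * Q (0,p))"
 by (intro tendsto_intros) auto
 then show ?thesis by (simp add: van'')
 next
 case False
 then show ?thesis using van''(1)[of "(0,p)"] B0[of "(0,p)"] by simp
 qed
 qed
 show "AE p in lborel. norm (u0 p * (B (0,p) * P n (0,p))) <= M * (K * C) * (ivl R (fst p) * ivl R (snd p))" for n
 using ae0
 proof eventually_elim
 case (elim p)
 show ?case
 proof (cases "in_box R (0,p)")
 case True
 then have i: "ivl R (fst p) = 1" "ivl R (snd p) = 1"
 by (auto simp: in_box_def indicator_def)
 have "%%P n (0,p)%% <= C" using elim True by auto
 moreover have "%%B (0,p)%% <= K" using K by blast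
 ultimately show ?thesis using bd(2)[of p] K(1) by (auto simp: i abs_mult intro!: mult_mono)
 next
 case False
 then have "B (0,p) = 0" using B0 by blast
 moreover have "ivl R (fst p) = 0 | ivl R (snd p) = 0"
 using False R by (auto simp: in_box_def indicator_def)
 ultimately show ?thesis by auto
 qed
 qed
 qed
 from LIMSEQ_unique[OF lim1[unfolded Feq] tendsto_minus[OF this]] show ?thesis .
qed

section \<open>Approximation by continuous functions and polynomials\<close>

text \<open>A measurable function is an a.e. limit of continuous ones; clipping these to [-M, M]
  keeps the limit and supplies the majorant 2 M on the set \<open>S\<close> of finite
  measure.\<close>

lemma bounded_approx_continuous:
 fixes f :: "'a::euclidean_space => real"
 assumes [measurable]: "f \<in> bm" "S \<in> sets borel"
 and bd: "!!x. %%f x%% <= M" and S: "emeasure lborel S < \<infinity>" and "e > 0"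
 obtains g where "continuous_on UNIV g" "!!x. %%g x%% <= M"
 "(LI x. indicator S x * %%f x - g x%%) < e"
proof -
 have "f \<in> borel_measurable lebesgue"
 by (rule measurable_completion) simp
 then have "f measurable_on UNIV"
 by (simp add: measurable_on_iff_borel_measurable lebesgue_on_UNIV_eq)
 then obtain N g where N: "negligible N" and g: "!!n. continuous_on UNIV (g n)"
 and lim: "!!x. x \<notin> N ==> (%n. g n x) ----> f x"
 unfolding measurable_on_def by auto
 have "AE x in lebesgue. x \<notin> N"
 using N by (simp add: AE_not_in negligible_iff_null_sets)
 then have ae: "AE x in lborel. x \<notin> N" by (simp add: AE_completion_iff)
 define h where "h n x = max (-M) (min M (g n x))" for n x
 have M0: "M >= 0" using bd[of undefined] by linarith
 have hc: "continuous_on UNIV (h n)" for n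
 unfolding h_def by (intro continuous_intros g)
 have [measurable]: "h n \<in> bm" for n
 using hc by (simp add: bm_cont)
 have hb: "%%h n x%% <= M" for n x using M0 by (auto simp: h_def abs_le_iff)
 have "(%n. LI x. indicator S x * %%f x - h n x%%) ----> (LINT x|(lborel :: 'a measure). (0 :: real))"
 proof (rule dct)
 show "intgr (%x. indicator S x * (2 * M))"
 using S by (intro integrable_mult_left) (auto simp: integrable_indicator_iff)
 show "AE x in lborel. (%n. indicator S x * %%f x - h n x%%) ----> 0"
 using ae
 proof eventually_elim
 case (elim x)
 have "(%n. h n x) ----> max (-M) (min M (f x))"
 unfolding h_def by (intro tendsto_intros lim elim)
 moreover have "max (-M) (min M (f x)) = f x" using bd[of x] by auto
 ultimately have "(%n. indicator S x * %%f x - h n x%%) ----> indicator S x * %%f x - f x%%"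
 by (intro tendsto_intros) simp
 then show ?case by simp
 qed
 show "AE x in lborel. norm (indicator S x * %%f x - h n x%%) <= indicator S x * (2 * M)" for n
 proof (rule AE_I2)
 fix x
 have "%%f x - h n x%% <= 2 * M" using bd[of x] hb[of n x] by linarith
 then show "norm (indicator S x * %%f x - h n x%%) <= indicator S x * (2 * M)"
 by (auto simp: indicator_def)
 qed
 qed simp_all
 then have "(%n. LI x. indicator S x * %%f x - h n x%%) ----> 0" by simp
 from order_tendstoD(2)[OF this \<open>e > 0\<close>] obtain n where "(LI x. indicator S x * %%f x - h n x%%) < e"
 by (auto simp: eventually_sequentially)
 with that hc hb show thesis by blast
qed

definition poly_primitive :: "real poly => real poly" where
 "poly_primitive p = (\<Sum>i\<le>degree p. monom (coeff p i / real (Suc i)) (Suc i))"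

lemma pderiv_poly_primitive: "pderiv (poly_primitive p) = p"
proof -
 have "pderiv (poly_primitive p) = (\<Sum>i\<le>degree p. monom (coeff p i) i)"
 using higher_pderiv_sum[of 1 "%i. monom (coeff p i / real (Suc i)) (Suc i)" "{..degree p}"]
 unfolding poly_primitive_def by (simp add: pderiv_monom del: of_nat_Suc)
 then show ?thesis by (simp add: poly_as_sum_of_monoms)
qed

lemma poly_approx_continuous:
 fixes f :: "real => real"
 assumes "continuous_on {-R..R} f" "e > 0"
 obtains p where "!!x. %%x%% <= R ==> %%f x - poly p x%% < e"
proof -
 obtain g where g: "real_polynomial_function g" "!!x. x \<in> {-R..R} ==> %%f x - g x%% < e"
 using Stone_Weierstrass_real_polynomial_function[OF compact_Icc assms] by blast
 obtain a n where a: "g = (%x. \<Sum>i\<le>n. a i * x ^ i)"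
 using g(1) unfolding real_polynomial_function_iff_sum by blast
 have "poly (\<Sum>i\<le>n. monom (a i) i) x = g x" for x
 by (simp add: a poly_sum poly_monom)
 then show thesis using g(2) by (intro that[of "\<Sum>i\<le>n. monom (a i) i"]) (simp add: abs_le_iff)
qed

text \<open>Weierstrass approximation is applied to the derivative and the result is integrated: an
  error e/(C + 1) in the derivative accumulates to at most e over a distance C.\<close>

lemma poly_approx_C1:
 fixes ph ph' :: "real => real"
 assumes d: "!!s. (ph has_real_derivative ph' s) (at s)" and c: "continuous_on UNIV ph'" and C: "C >= 0" and e: "e > 0"
 obtains p where "!!x. %%x%% <= C ==> %%ph x - poly p x%% <= e" "!!x. %%x%% <= C ==> %%ph' x - poly (pderiv p) x%% <= e"
proof -
 have e': "e / (C + 1) > 0" using C e by simp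
 obtain r where r: "!!x. %%x%% <= C ==> %%ph' x - poly r x%% < e / (C + 1)"
 using poly_approx_continuous[OF continuous_on_subset[OF c] e'] by blast
 define p where "p = poly_primitive r + [:ph 0 - poly (poly_primitive r) 0:]"
 have pd: "pderiv p = r" by (simp add: p_def pderiv_add pderiv_poly_primitive pderiv_pCons)
 have "e / (C+1) <= e" using e C by (simp add: divide_le_eq)
 then have 1: "%%ph' x - poly (pderiv p) x%% <= e" if "%%x%% <= C" for x
 using r[OF that] by (simp add: pd)
 have 2: "%%ph x - poly p x%% <= e" if x: "%%x%% <= C" for x
 proof -
 have "norm ((ph x - poly p x) - (ph 0 - poly p 0)) <= (e / (C + 1)) * norm (x - 0)"
 proof (rule field_differentiable_bound[where S="{-C..C}" and f'="%x. ph' x - poly r x"])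
 show "((%x. ph x - poly p x) has_field_derivative ph' z - poly r z) (at z within {-C..C})" for z
 using DERIV_diff[OF d[of z] poly_DERIV[of p z]] by (simp add: pd has_field_derivative_at_within)
 show "norm (ph' z - poly r z) <= e / (C + 1)" if "z \<in> {-C..C}" for z
 using r[of z] that by (auto simp: abs_le_iff)
 qed (use x C in \<open>auto simp: abs_le_iff\<close>)
 also have "... <= (e / (C + 1)) * (C + 1)" using x e' by (intro mult_left_mono) auto
 also have "... = e" using C by simp
 finally show ?thesis by (simp add: p_def)
 qed
 show thesis using that[OF 2 1] .
qed

lemma integrable_ivl: "intgr (%x. ivl R x)"
 by (simp add: integrable_indicator_iff emeasure_lborel_Icc_eq)

lemma integrable_ivl_continuous:
 fixes f :: "real => real"
 assumes "continuous_on UNIV f"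
 shows "intgr (%x. ivl R x * f x)"
 using borel_integrable_atLeastAtMost'[OF continuous_on_subset[OF assms subset_UNIV], of "-R" R]
 by (simp add: set_integrable_def)

text \<open>Three errors below e/3: truncation of \<open>k\<close> at height m, replacement by a
  continuous function, then by a polynomial. A uniform error e/(6 R + 1) on an interval of length 2
  R stays below e/3.\<close>

lemma poly_approx_L1:
 assumes k: "locint k" and R: "R > 0" and e: "e > 0"
 obtains p where "(LI x. ivl R x * %%k x - poly p x%%) < e"
proof -
 have [measurable]: "k \<in> bm" and ki: "intgr (%x. ivl R x * k x)"
 using k by (auto simp: locint_def)
 define km where "km m x = max (- real m) (min (real m) (k x))" for m x
 have [measurable]: "km m \<in> bm" for m unfolding km_def by measurable
 have "(%m. LI x. ivl R x * %%k x - km m x%%) ----> (LINT x|(lborel :: real measure). (0 :: real))"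
 proof (rule dct)
 show "intgr (%x. norm (ivl R x * k x))" using ki by (rule integrable_norm)
 show "AE x in lborel. (%m. ivl R x * %%k x - km m x%%) ----> 0"
 proof (rule AE_I2)
 fix x
 obtain n where n: "%%k x%% <= real n" using real_arch_simple by blast
 have "eventually (%m. ivl R x * %%k x - km m x%% = 0) sequentially"
 using eventually_ge_at_top[of n]
 proof eventually_elim
 case (elim m)
 then have "%%k x%% <= real m" using n by linarith
 then have "km m x = k x" by (auto simp: km_def)
 then show ?case by simp
 qed
 then show "(%m. ivl R x * %%k x - km m x%%) ----> 0" by (rule tendsto_eventually)
 qed
 show "AE x in lborel. norm (ivl R x * %%k x - km m x%%) <= norm (ivl R x * k x)" for m
 proof (rule AE_I2)
 fix x
 have "%%k x - km m x%% <= %%k x%%" by (auto simp: km_def)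
 then show "norm (ivl R x * %%k x - km m x%%) <= norm (ivl R x * k x)"
 by (auto simp: indicator_def)
 qed
 qed simp_all
 then have "(%m. LI x. ivl R x * %%k x - km m x%%) ----> 0" by simp
 from order_tendstoD(2)[OF this, of "e/3"] e obtain m where m: "(LI x. ivl R x * %%k x - km m x%%) < e/3"
 by (auto simp: eventually_sequentially)
 have kmb: "%%km m x%% <= real m" for x by (auto simp: km_def)
 obtain g where g: "continuous_on UNIV g" "!!x. %%g x%% <= real m"
 "(LI x. ivl R x * %%km m x - g x%%) < e/3"
 by (rule bounded_approx_continuous[of "km m" "{-R..R}" "real m" "e/3"])
 (use e kmb in \<open>auto simp: emeasure_lborel_Icc_eq\<close>)
 have e': "e / (6 * R + 1) > 0" using e R by simp
 obtain p where p: "!!x. %%x%% <= R ==> %%g x - poly p x%% < e / (6 * R + 1)"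
 using poly_approx_continuous[OF continuous_on_subset[OF g(1)] e'] by blast
 have [measurable]: "g \<in> bm" using g(1) by (simp add: bm_cont)
 have pc: "continuous_on UNIV (poly p)" by (intro continuous_on_poly continuous_on_id)
 have [measurable]: "poly p \<in> bm" using pc by (simp add: bm_cont)
 have ai: "intgr (%x. ivl R x * %%u x - v x%%)" if "intgr (%x. ivl R x * u x)" "intgr (%x. ivl R x * v x)" for u v :: "real => real"
 using integrable_abs[OF lint_diff[OF that]] by (simp flip: right_diff_distrib add: abs_mult)
 have kmi: "intgr (%x. ivl R x * km m x)"
 by (rule lint_bound[OF integrable_mult_left[OF integrable_ivl[of R], of "real m"]])
 (use kmb in \<open>auto simp: abs_mult indicator_def\<close>)
 note gi = integrable_ivl_continuous[OF g(1), of R] and pi = integrable_ivl_continuous[OF pc, of R]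
 have "(LI x. ivl R x * %%k x - poly p x%%) <= (LI x. (ivl R x * %%k x - km m x%% + ivl R x * %%km m x - g x%%) + ivl R x * (e / (6 * R + 1)))"
 proof (rule integral_mono)
 show "ivl R x * %%k x - poly p x%% <= (ivl R x * %%k x - km m x%% + ivl R x * %%km m x - g x%%) + ivl R x * (e / (6 * R + 1))" for x
 using p[of x] by (auto simp: indicator_def abs_le_iff)
 qed (intro ai ki kmi gi pi lint_add integrable_mult_left integrable_ivl)+
 also have "... = (LI x. ivl R x * %%k x - km m x%%) + (LI x. ivl R x * %%km m x - g x%%) + (2 * R) * (e / (6 * R + 1))"
 using R by (subst Bochner_Integration.integral_add | intro ai ki kmi gi lint_add integrable_mult_left integrable_ivl)+ simp
 also have "... < e/3 + e/3 + e/3"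
 using m g(3) R e by (intro add_strict_mono) (auto simp: field_simps)
 finally show thesis using that by simp
qed

text \<open>Convergence in L^1 alone gives neither a.e. convergence nor a majorant. Errors below
  2^-n have an integrable sum; this sum is finite a.e., and |k| plus it is the majorant
  \<open>q\<close>.\<close>

lemma poly_approx_L1_dominated:
 assumes k: "locint k" and R: "R > 0"
 obtains p q where "intgr (%x. ivl R x * q x)"
 "AE x in lborel. %%x%% <= R --> (\<forall>n::nat. %%poly (p n) x%% <= q x) & (%n. poly (p n) x) ----> k x"
 "(%n. LI x. ivl R x * %%k x - poly (p n) x%%) ----> 0"
proof -
 have [measurable]: "k \<in> bm" and ki: "intgr (%x. ivl R x * k x)"
 using k by (auto simp: locint_def)
 have "\<exists>p. (LI x. ivl R x * %%k x - poly p x%%) < (1/2) ^ n" for n :: nat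
 using poly_approx_L1[OF k R, of "(1/2)^n"] by auto
 then obtain p where p: "!!n. (LI x. ivl R x * %%k x - poly (p n) x%%) < (1/2) ^ n" by metis
 have pc: "continuous_on UNIV (poly (p n))" for n by (intro continuous_on_poly continuous_on_id)
 have [measurable]: "poly (p n) \<in> bm" for n using pc by (simp add: bm_cont)
 define d where "d n x = ivl R x * %%k x - poly (p n) x%%" for n x
 have di: "intgr (d n)" for n
 using integrable_abs[OF lint_diff[OF ki integrable_ivl_continuous[OF pc, of R n]]]
 by (simp flip: right_diff_distrib add: abs_mult d_def[abs_def])
 have dnn: "d n x >= 0" for n x by (simp add: d_def)
 have sm: "summable (%n. LI x. d n x)"
 by (rule summable_comparison_test'[of "%n. (1/2)^n" 0])
 (use p dnn in \<open>auto simp: d_def[symmetric] less_imp_le intro!: summable_geometric\<close>)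
 have "(\<integral>\<^sup>+x. (\<Sum>n. ennreal (d n x)) \<partial>lborel) = (\<Sum>n. \<integral>\<^sup>+x. ennreal (d n x) \<partial>lborel)"
 by (rule nn_integral_suminf) (simp add: d_def)
 also have "... = (\<Sum>n. ennreal (LI x. d n x))"
 by (intro suminf_cong nn_integral_eq_integral di) (simp add: dnn)
 also have "... = ennreal (\<Sum>n. LI x. d n x)"
 by (rule suminf_ennreal2) (use sm dnn in auto)
 finally have "(\<integral>\<^sup>+x. (\<Sum>n. ennreal (d n x)) \<partial>lborel) ~= \<infinity>" by simp
 then have "AE x in lborel. (\<Sum>n. ennreal (d n x)) ~= \<infinity>"
 by (intro nn_integral_PInf_AE) (simp_all add: d_def)
 then have ae: "AE x in lborel. summable (%n. d n x)"
 by eventually_elim (use dnn in \<open>auto intro: summable_suminf_not_top\<close>)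
 define q where "q x = %%k x%% + (\<Sum>n. d n x)" for x
 show thesis
 proof (rule that[of q p])
 have "intgr (%x. \<Sum>n. d n x)"
 by (rule integrable_suminf) (use di ae sm dnn in auto)
 from lint_add[OF integrable_abs[OF ki] integrable_mult_indicator[OF _ this, of "{-R..R}"]]
 show "intgr (%x. ivl R x * q x)" by (simp add: q_def distrib_left abs_mult)
 show "AE x in lborel. %%x%% <= R --> (\<forall>n::nat. %%poly (p n) x%% <= q x) & (%n. poly (p n) x) ----> k x"
 using ae
 proof eventually_elim
 case (elim x)
 show ?case
 proof (intro impI conjI allI)
 assume x: "%%x%% <= R"
 then have d: "d n x = %%k x - poly (p n) x%%" for n by (auto simp: d_def indicator_def abs_le_iff)
 show "%%poly (p n) x%% <= q x" for n
 proof -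
 have "d n x <= (\<Sum>n. d n x)" using sum_le_suminf[OF elim, of "{n}"] dnn by simp
 then show ?thesis using d[of n] by (simp add: q_def)
 qed
 have "(%n. %%k x - poly (p n) x%%) ----> 0"
 using summable_LIMSEQ_zero[OF elim] by (simp add: d)
 then have "(%n. k x - poly (p n) x) ----> 0" by (simp add: tendsto_rabs_zero_iff)
 from tendsto_diff[OF tendsto_const[of "k x"] this] show "(%n. poly (p n) x) ----> k x" by simp
 qed
 qed
 show "(%n. LI x. ivl R x * %%k x - poly (p n) x%%) ----> 0"
 using summable_LIMSEQ_zero[OF sm] by (simp add: d_def)
 qed
qed

section \<open>Closure properties of approximable test functions\<close>

lemma approximableI:
 assumes "Q \<in> bm" "Qt \<in> bm" "Qx \<in> bm"
 "Qy \<in> bm"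
 "!!n::nat. smooth (P n)" "!!n. has_partials (P n) (Pt n) (Px n) (Py n)"
 "intgr (%x. ivl R x * q x)"
 "AE x in lborel. \<forall>z. px z = x --> in_box R z -->
 (\<forall>n. %%P n z%% <= C & %%Pt n z%% <= C & %%Py n z%% <= C & %%Px n z%% <= q x) &
 (%n. P n z) ----> Q z & (%n. Pt n z) ----> Qt z & (%n. Px n z) ----> Qx z &
 (%n. Py n z) ----> Qy z"
 shows "approximable R Q Qt Qx Qy"
 using assms unfolding approximable_def by blast

lemma approximable_smooth:
 assumes "smooth P" "has_partials P Pt Px Py"
 shows "approximable R P Pt Px Py"
proof -
 obtain At Ax Ay where A: "has_partials P At Ax Ay" "smooth At" "smooth Ax" "smooth Ay"
 using smooth_has_partials[OF assms(1)] by metis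
 note u = has_partials_unique[OF assms(2) A(1)]
 have sm: "smooth Pt" "smooth Px" "smooth Py" using A(2-) by (simp_all add: u)
 have cb: "compact {z. in_box R z}"
 proof -
 have "{z. in_box R z} = {-R..R} \<times> {-R..R} \<times> {-R..R}"
 by (auto simp: in_box_def abs_le_iff minus_le_iff mem_Times_iff)
 then show ?thesis by (simp add: compact_Times)
 qed
 have "\<exists>C. \<forall>z. in_box R z --> %%f z%% <= C" if "smooth f" for f
 using compact_imp_bounded[OF compact_continuous_image[OF smooth_continuous[OF that] cb]]
 by (auto simp: bounded_iff)
 from this[OF assms(1)] this[OF sm(1)] this[OF sm(2)] this[OF sm(3)]
 obtain a b c d where abcd: "\<forall>z. in_box R z --> %%P z%% <= a" "\<forall>z. in_box R z --> %%Pt z%% <= b"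
 "\<forall>z. in_box R z --> %%Px z%% <= c" "\<forall>z. in_box R z --> %%Py z%% <= d" by blast
 show ?thesis
 proof (rule approximableI[where P="%n. P" and Pt="%n. Pt" and Px="%n. Px" and Py="%n. Py" and C="max a (max b d)" and q="%x. c"])
 show "intgr (%x. ivl R x * c)" by (intro integrable_mult_left integrable_ivl)
 show "AE x in lborel. \<forall>z. px z = x --> in_box R z -->
 (\<forall>n::nat. %%P z%% <= max a (max b d) & %%Pt z%% <= max a (max b d) & %%Py z%% <= max a (max b d) & %%Px z%% <= c) &
 (%n. P z) ----> P z & (%n. Pt z) ----> Pt z & (%n. Px z) ----> Px z &
 (%n. Py z) ----> Py z"
 proof (intro AE_I2 allI impI)
 fix x and z :: "R3" assume "in_box R z"
 with abcd have "%%P z%% <= a" "%%Pt z%% <= b" "%%Px z%% <= c" "%%Py z%% <= d" by blast+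
 then show "(\<forall>n::nat. %%P z%% <= max a (max b d) & %%Pt z%% <= max a (max b d) & %%Py z%% <= max a (max b d) & %%Px z%% <= c) &
 (%n. P z) ----> P z & (%n. Pt z) ----> Pt z & (%n. Px z) ----> Px z &
 (%n. Py z) ----> Py z"
 by (simp add: le_max_iff_disj)
 qed
 qed (use assms sm in \<open>simp_all add: smooth_borel\<close>)
qed

lemma approximable_add:
 assumes "approximable R Q Qt Qx Qy" "approximable R S St Sx Sy"
 shows "approximable R (%z. Q z + S z) (%z. Qt z + St z) (%z. Qx z + Sx z) (%z. Qy z + Sy z)"
proof -
 from assms have [measurable]: "Q \<in> bm" "Qt \<in> bm" "Qx \<in> bm" "Qy \<in> bm"
 "S \<in> bm" "St \<in> bm" "Sx \<in> bm" "Sy \<in> bm"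
 by (auto simp: approximable_def)
 obtain P Pt Px Py C q where P: "!!n::nat. smooth (P n) & has_partials (P n) (Pt n) (Px n) (Py n)"
 and q: "intgr (%x. ivl R x * q x)"
 and aeP: "AE x in lborel. \<forall>z. px z = x --> in_box R z -->
 (\<forall>n. %%P n z%% <= C & %%Pt n z%% <= C & %%Py n z%% <= C & %%Px n z%% <= q x) &
 (%n. P n z) ----> Q z & (%n. Pt n z) ----> Qt z & (%n. Px n z) ----> Qx z &
 (%n. Py n z) ----> Qy z"
 using assms(1) unfolding approximable_def by blast
 obtain T Tt Tx Ty D r where T: "!!n::nat. smooth (T n) & has_partials (T n) (Tt n) (Tx n) (Ty n)"
 and r: "intgr (%x. ivl R x * r x)"
 and aeT: "AE x in lborel. \<forall>z. px z = x --> in_box R z -->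
 (\<forall>n. %%T n z%% <= D & %%Tt n z%% <= D & %%Ty n z%% <= D & %%Tx n z%% <= r x) &
 (%n. T n z) ----> S z & (%n. Tt n z) ----> St z & (%n. Tx n z) ----> Sx z &
 (%n. Ty n z) ----> Sy z"
 using assms(2) unfolding approximable_def by blast
 show ?thesis
 proof (rule approximableI[where P="%n z. P n z + T n z" and Pt="%n z. Pt n z + Tt n z" and Px="%n z. Px n z + Tx n z" and Py="%n z. Py n z + Ty n z" and C="C + D" and q="%x. q x + r x"])
 show "intgr (%x. ivl R x * (q x + r x))"
 using lint_add[OF q r] by (simp add: distrib_left)
 show "AE x in lborel. \<forall>z. px z = x --> in_box R z -->
 (\<forall>n. %%P n z + T n z%% <= C + D & %%Pt n z + Tt n z%% <= C + D & %%Py n z + Ty n z%% <= C + D & %%Px n z + Tx n z%% <= q x + r x) &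
 (%n. P n z + T n z) ----> Q z + S z & (%n. Pt n z + Tt n z) ----> Qt z + St z & (%n. Px n z + Tx n z) ----> Qx z + Sx z &
 (%n. Py n z + Ty n z) ----> Qy z + Sy z"
 using aeP aeT
 proof eventually_elim
 case (elim x)
 show ?case
 proof (intro allI impI)
 fix z :: "R3" assume z: "px z = x" "in_box R z"
 note a = elim(1)[rule_format, OF z] and b = elim(2)[rule_format, OF z]
 show "(\<forall>n. %%P n z + T n z%% <= C + D & %%Pt n z + Tt n z%% <= C + D & %%Py n z + Ty n z%% <= C + D & %%Px n z + Tx n z%% <= q x + r x) &
 (%n. P n z + T n z) ----> Q z + S z & (%n. Pt n z + Tt n z) ----> Qt z + St z & (%n. Px n z + Tx n z) ----> Qx z + Sx z &
 (%n. Py n z + Ty n z) ----> Qy z + Sy z"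
 by (intro conjI allI order_trans[OF abs_triangle_ineq] add_mono tendsto_add)
 (use a b in blast)+
 qed
 qed
 qed (use P T in \<open>auto intro: smooth_add has_partials_add\<close>)
qed

lemma approximable_mult:
 assumes "approximable R Q Qt Qx Qy" "approximable R S St Sx Sy"
 shows "approximable R (%z. Q z * S z) (%z. Qt z * S z + Q z * St z) (%z. Qx z * S z + Q z * Sx z)
 (%z. Qy z * S z + Q z * Sy z)"
proof -
 from assms have [measurable]: "Q \<in> bm" "Qt \<in> bm" "Qx \<in> bm" "Qy \<in> bm"
 "S \<in> bm" "St \<in> bm" "Sx \<in> bm" "Sy \<in> bm"
 by (auto simp: approximable_def)
 obtain P Pt Px Py C q where P: "!!n::nat. smooth (P n) & has_partials (P n) (Pt n) (Px n) (Py n)"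
 and q: "intgr (%x. ivl R x * q x)"
 and aeP: "AE x in lborel. \<forall>z. px z = x --> in_box R z -->
 (\<forall>n. %%P n z%% <= C & %%Pt n z%% <= C & %%Py n z%% <= C & %%Px n z%% <= q x) &
 (%n. P n z) ----> Q z & (%n. Pt n z) ----> Qt z & (%n. Px n z) ----> Qx z &
 (%n. Py n z) ----> Qy z"
 using assms(1) unfolding approximable_def by blast
 obtain T Tt Tx Ty D r where T: "!!n::nat. smooth (T n) & has_partials (T n) (Tt n) (Tx n) (Ty n)"
 and r: "intgr (%x. ivl R x * r x)"
 and aeT: "AE x in lborel. \<forall>z. px z = x --> in_box R z -->
 (\<forall>n. %%T n z%% <= D & %%Tt n z%% <= D & %%Ty n z%% <= D & %%Tx n z%% <= r x) &
 (%n. T n z) ----> S z & (%n. Tt n z) ----> St z & (%n. Tx n z) ----> Sx z &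
 (%n. Ty n z) ----> Sy z"
 using assms(2) unfolding approximable_def by blast
 have pr: "%%a * b%% <= A * B" if "%%a%% <= A" "%%b%% <= B" for a b A B :: real
 using that by (auto simp: abs_mult intro!: mult_mono)
 show ?thesis
 proof (rule approximableI[where P="%n z. P n z * T n z" and Pt="%n z. Pt n z * T n z + P n z * Tt n z" and Px="%n z. Px n z * T n z + P n z * Tx n z" and Py="%n z. Py n z * T n z + P n z * Ty n z" and C="%%C * D%% + %%C * D%%" and q="%x. q x * D + C * r x"])
 show "intgr (%x. ivl R x * (q x * D + C * r x))"
 using lint_add[OF integrable_mult_left[OF q, of D] integrable_mult_right[OF r, of C]]
 by (simp add: algebra_simps)
 show "AE x in lborel. \<forall>z. px z = x --> in_box R z -->
 (\<forall>n. %%P n z * T n z%% <= %%C * D%% + %%C * D%% & %%Pt n z * T n z + P n z * Tt n z%% <= %%C * D%% + %%C * D%% &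
 %%Py n z * T n z + P n z * Ty n z%% <= %%C * D%% + %%C * D%% & %%Px n z * T n z + P n z * Tx n z%% <= q x * D + C * r x) &
 (%n. P n z * T n z) ----> Q z * S z & (%n. Pt n z * T n z + P n z * Tt n z) ----> Qt z * S z + Q z * St z &
 (%n. Px n z * T n z + P n z * Tx n z) ----> Qx z * S z + Q z * Sx z &
 (%n. Py n z * T n z + P n z * Ty n z) ----> Qy z * S z + Q z * Sy z"
 using aeP aeT
 proof eventually_elim
 case (elim x)
 show ?case
 proof (intro allI impI)
 fix z :: "R3" assume z: "px z = x" "in_box R z"
 note a = elim(1)[rule_format, OF z] and b = elim(2)[rule_format, OF z]
 have "%%P n z%% <= C" "%%Pt n z%% <= C" "%%Py n z%% <= C" "%%Px n z%% <= q x"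
 "%%T n z%% <= D" "%%Tt n z%% <= D" "%%Ty n z%% <= D" "%%Tx n z%% <= r x" for n using a b by blast+
 note bds = this
 have "C * D <= %%C * D%%" by simp
 note pr' = order_trans[OF pr this]
 have "%%P n z * T n z%% <= %%C * D%% + %%C * D%% & %%Pt n z * T n z + P n z * Tt n z%% <= %%C * D%% + %%C * D%% &
 %%Py n z * T n z + P n z * Ty n z%% <= %%C * D%% + %%C * D%% & %%Px n z * T n z + P n z * Tx n z%% <= q x * D + C * r x" for n
 proof (intro conjI)
 show "%%P n z * T n z%% <= %%C * D%% + %%C * D%%" using pr'[OF bds(1)[of n] bds(5)[of n]] by linarith
 qed (intro order_trans[OF abs_triangle_ineq] add_mono pr' pr bds)+
 moreover have "(%n. P n z * T n z) ----> Q z * S z & (%n. Pt n z * T n z + P n z * Tt n z) ----> Qt z * S z + Q z * St z &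
 (%n. Px n z * T n z + P n z * Tx n z) ----> Qx z * S z + Q z * Sx z &
 (%n. Py n z * T n z + P n z * Ty n z) ----> Qy z * S z + Q z * Sy z"
 by (intro conjI tendsto_add tendsto_mult) (use a b in blast)+
 ultimately show "(\<forall>n. %%P n z * T n z%% <= %%C * D%% + %%C * D%% & %%Pt n z * T n z + P n z * Tt n z%% <= %%C * D%% + %%C * D%% &
 %%Py n z * T n z + P n z * Ty n z%% <= %%C * D%% + %%C * D%% & %%Px n z * T n z + P n z * Tx n z%% <= q x * D + C * r x) &
 (%n. P n z * T n z) ----> Q z * S z & (%n. Pt n z * T n z + P n z * Tt n z) ----> Qt z * S z + Q z * St z &
 (%n. Px n z * T n z + P n z * Tx n z) ----> Qx z * S z + Q z * Sx z &
 (%n. Py n z * T n z + P n z * Ty n z) ----> Qy z * S z + Q z * Sy z"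
 by blast
 qed
 qed
 qed (use P T in \<open>auto intro: smooth_mult has_partials_mult\<close>)
qed

text \<open>As \<open>ph\<close> is only C^1, the outer function has to be approximated too:
  polynomials within 1/(n + 1) of \<open>ph\<close> and \<open>ph'\<close> on [-|C|, |C|], the
  interval containing the approximants of \<open>Q\<close> on the box.\<close>

lemma approximable_comp:
 assumes d: "!!s. (ph has_real_derivative ph' s) (at s)" and c: "continuous_on UNIV ph'"
 and Q: "approximable R Q Qt Qx Qy"
 shows "approximable R (%z. ph (Q z)) (%z. ph' (Q z) * Qt z) (%z. ph' (Q z) * Qx z) (%z. ph' (Q z) * Qy z)"
proof -
 have cphi: "continuous_on UNIV ph" using d by (intro continuous_at_imp_continuous_on) (auto intro: DERIV_isCont)
 have [measurable]: "ph \<in> bm" "ph' \<in> bm"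
 using c cphi by (auto simp: bm_cont)
 from Q have [measurable]: "Q \<in> bm" "Qt \<in> bm" "Qx \<in> bm" "Qy \<in> bm"
 by (auto simp: approximable_def)
 obtain P Pt Px Py C q where P: "!!n::nat. smooth (P n) & has_partials (P n) (Pt n) (Px n) (Py n)"
 and q: "intgr (%x. ivl R x * q x)"
 and aeP: "AE x in lborel. \<forall>z. px z = x --> in_box R z -->
 (\<forall>n. %%P n z%% <= C & %%Pt n z%% <= C & %%Py n z%% <= C & %%Px n z%% <= q x) &
 (%n. P n z) ----> Q z & (%n. Pt n z) ----> Qt z & (%n. Px n z) ----> Qx z &
 (%n. Py n z) ----> Qy z"
 using Q unfolding approximable_def by blast
 have "\<exists>p. (\<forall>x. %%x%% <= %%C%% --> %%ph x - poly p x%% <= 1 / real (Suc n) & %%ph' x - poly (pderiv p) x%% <= 1 / real (Suc n))" for n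
 using poly_approx_C1[OF d c, of "%%C%%" "1 / real (Suc n)"] by (metis abs_ge_zero of_nat_0_less_iff zero_less_Suc zero_less_divide_1_iff)
 then obtain p where p: "!!n x. %%x%% <= %%C%% ==> %%ph x - poly (p n) x%% <= 1 / real (Suc n)"
 "!!n x. %%x%% <= %%C%% ==> %%ph' x - poly (pderiv (p n)) x%% <= 1 / real (Suc n)" by metis
 have bdd: "\<exists>K\<ge>0. \<forall>x. %%x%% <= %%C%% --> %%f x%% <= K" if "continuous_on UNIV f" for f :: "real => real"
 proof -
 have "bounded (f ` {-%%C%%..%%C%%})"
 by (intro compact_imp_bounded compact_continuous_image continuous_on_subset[OF that]) auto
 then obtain K where K: "!!x. x \<in> {-%%C%%..%%C%%} ==> %%f x%% <= K" unfolding bounded_iff by fastforce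
 have "%%f x%% <= %%K%%" if "%%x%% <= %%C%%" for x
 using K[of x] that by (simp add: abs_le_iff)
 then show ?thesis by (intro exI[of _ "%%K%%"]) simp
 qed
 obtain K1 where K1: "K1 >= 0" "!!x. %%x%% <= %%C%% ==> %%ph x%% <= K1" using bdd[OF cphi] by blast
 obtain K2 where K2: "K2 >= 0" "!!x. %%x%% <= %%C%% ==> %%ph' x%% <= K2" using bdd[OF c] by blast
 have n1: "1 / real (Suc n) <= 1" for n by simp
 have b1: "%%poly (p n) x%% <= K1 + 1" if "%%x%% <= %%C%%" for n x
 using p(1)[OF that, of n] K1(2)[OF that] n1[of n] by linarith
 have b2: "%%poly (pderiv (p n)) x%% <= K2 + 1" if "%%x%% <= %%C%%" for n x
 using p(2)[OF that, of n] K2(2)[OF that] n1[of n] by linarith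
 have lim: "(%n. f n (x n)) ----> g y" if "continuous_on UNIV g" "!!n. %%x n%% <= %%C%%" "x ----> y"
 "!!n x. %%x%% <= %%C%% ==> %%g x - f n x%% <= 1 / real (Suc n)" for f :: "nat => real => real" and g x y
 proof -
 have "(%n. g (x n)) ----> g y"
 by (rule continuous_on_tendsto_compose[OF that(1,3)]) auto
 moreover have "(%n. g (x n) - f n (x n)) ----> 0"
 by (rule Lim_null_comparison[OF _ LIMSEQ_Suc[OF lim_1_over_n]]) (use that(2,4) in auto)
 ultimately have "(%n. g (x n) - (g (x n) - f n (x n))) ----> g y - 0" by (rule tendsto_diff)
 then show ?thesis by simp
 qed
 have pr: "%%a * b%% <= A * B" if "%%a%% <= A" "%%b%% <= B" for a b A B :: real
 using that by (auto simp: abs_mult intro!: mult_mono)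
 show ?thesis
 proof (rule approximableI[where P="%n z. poly (p n) (P n z)" and Pt="%n z. poly (pderiv (p n)) (P n z) * Pt n z" and Px="%n z. poly (pderiv (p n)) (P n z) * Px n z" and Py="%n z. poly (pderiv (p n)) (P n z) * Py n z" and C="(K1 + 1) + (K2 + 1) * %%C%%" and q="%x. (K2 + 1) * q x"])
 show "intgr (%x. ivl R x * ((K2 + 1) * q x))"
 using integrable_mult_right[OF q, of "K2 + 1"] by (simp add: mult.left_commute)
 show "smooth (%z. poly (p n) (P n z))" for n using P by (auto intro: smooth_comp smooth_poly)
 show "has_partials (%z. poly (p n) (P n z)) (%z. poly (pderiv (p n)) (P n z) * Pt n z)
 (%z. poly (pderiv (p n)) (P n z) * Px n z) (%z. poly (pderiv (p n)) (P n z) * Py n z)" for n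
 using P by (intro has_partials_comp poly_DERIV) auto
 show "AE x in lborel. \<forall>z. px z = x --> in_box R z -->
 (\<forall>n. %%poly (p n) (P n z)%% <= (K1 + 1) + (K2 + 1) * %%C%% & %%poly (pderiv (p n)) (P n z) * Pt n z%% <= (K1 + 1) + (K2 + 1) * %%C%% &
 %%poly (pderiv (p n)) (P n z) * Py n z%% <= (K1 + 1) + (K2 + 1) * %%C%% & %%poly (pderiv (p n)) (P n z) * Px n z%% <= (K2 + 1) * q x) &
 (%n. poly (p n) (P n z)) ----> ph (Q z) & (%n. poly (pderiv (p n)) (P n z) * Pt n z) ----> ph' (Q z) * Qt z &
 (%n. poly (pderiv (p n)) (P n z) * Px n z) ----> ph' (Q z) * Qx z &
 (%n. poly (pderiv (p n)) (P n z) * Py n z) ----> ph' (Q z) * Qy z"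
 using aeP
 proof eventually_elim
 case (elim x)
 show ?case
 proof (intro allI impI)
 fix z :: "R3" assume z: "px z = x" "in_box R z"
 note a = elim[rule_format, OF z]
 have bds: "%%P n z%% <= C" "%%Pt n z%% <= C" "%%Py n z%% <= C" "%%Px n z%% <= q x" for n using a by blast+
 have PC: "%%P n z%% <= %%C%%" "%%Pt n z%% <= %%C%%" "%%Py n z%% <= %%C%%" for n using bds[of n] by linarith+
 have K0: "0 <= K1 + 1" "0 <= (K2 + 1) * %%C%%" using K1 K2 by auto
 have "%%poly (p n) (P n z)%% <= (K1 + 1) + (K2 + 1) * %%C%% & %%poly (pderiv (p n)) (P n z) * Pt n z%% <= (K1 + 1) + (K2 + 1) * %%C%% &
 %%poly (pderiv (p n)) (P n z) * Py n z%% <= (K1 + 1) + (K2 + 1) * %%C%% & %%poly (pderiv (p n)) (P n z) * Px n z%% <= (K2 + 1) * q x" for n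
 using b1[OF PC(1), of n n] pr[OF b2[OF PC(1), of n n] PC(2)[of n]] pr[OF b2[OF PC(1), of n n] PC(3)[of n]]
 pr[OF b2[OF PC(1), of n n] bds(4)[of n]] K0 by linarith
 moreover have "(%n. poly (p n) (P n z)) ----> ph (Q z)"
 by (rule lim[OF cphi PC(1) _ p(1)]) (use a in blast)
 moreover have l: "(%n. poly (pderiv (p n)) (P n z)) ----> ph' (Q z)"
 by (rule lim[OF c PC(1) _ p(2)]) (use a in blast)
 have "(%n. poly (pderiv (p n)) (P n z) * Pt n z) ----> ph' (Q z) * Qt z"
 "(%n. poly (pderiv (p n)) (P n z) * Px n z) ----> ph' (Q z) * Qx z"
 "(%n. poly (pderiv (p n)) (P n z) * Py n z) ----> ph' (Q z) * Qy z"
 by (intro tendsto_mult[OF l]; use a in blast)+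
 ultimately show "(\<forall>n. %%poly (p n) (P n z)%% <= (K1 + 1) + (K2 + 1) * %%C%% & %%poly (pderiv (p n)) (P n z) * Pt n z%% <= (K1 + 1) + (K2 + 1) * %%C%% &
 %%poly (pderiv (p n)) (P n z) * Py n z%% <= (K1 + 1) + (K2 + 1) * %%C%% & %%poly (pderiv (p n)) (P n z) * Px n z%% <= (K2 + 1) * q x) &
 (%n. poly (p n) (P n z)) ----> ph (Q z) & (%n. poly (pderiv (p n)) (P n z) * Pt n z) ----> ph' (Q z) * Qt z &
 (%n. poly (pderiv (p n)) (P n z) * Px n z) ----> ph' (Q z) * Qx z &
 (%n. poly (pderiv (p n)) (P n z) * Py n z) ----> ph' (Q z) * Qy z" by blast
 qed
 qed
 qed measurable
qed

text \<open>The polynomials approximating \<open>k\<close> in L^1, integrated from -R, converge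
  uniformly to V on [-R, R], the error being at most the L^1 error of the derivatives. Here the
  integral representation of V enters.\<close>

lemma approximable_potential:
 assumes k: "locint k" and R: "R > 0"
 and V: "!!a b. a <= b ==> V b - V a = (LI x. indicator {a..b} x * k x)"
 and Vc: "continuous_on UNIV V"
 shows "approximable R (%z. V (px z)) (%z. 0) (%z. k (px z)) (%z. 0)"
proof -
 have [measurable]: "k \<in> bm" "V \<in> bm"
 and ki: "intgr (%x. ivl R x * k x)"
 using k Vc by (auto simp: locint_def bm_cont)
 obtain p q where q: "intgr (%x. ivl R x * q x)"
 and ae: "AE x in lborel. %%x%% <= R --> (\<forall>n::nat. %%poly (p n) x%% <= q x) & (%n. poly (p n) x) ----> k x"
 and lim: "(%n. LI x. ivl R x * %%k x - poly (p n) x%%) ----> 0"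
 by (rule poly_approx_L1_dominated[OF k R])
 have pc: "continuous_on UNIV (poly (p n))" for n by (intro continuous_on_poly continuous_on_id)
 have [measurable]: "poly (p n) \<in> bm" for n using pc by (simp add: bm_cont)
 define F where "F n x = V (-R) + poly (poly_primitive (p n)) x - poly (poly_primitive (p n)) (-R)" for n x
 have FT: "F n x - V (-R) = (LI s. indicator {-R..x} s * poly (p n) s)" if "-R <= x" for n x
 proof -
 have "(LI s. indicator {-R..x} s *\<^sub>R poly (p n) s) = poly (poly_primitive (p n)) x - poly (poly_primitive (p n)) (-R)"
 proof (rule integral_FTC_atLeastAtMost[OF that])
 show "(poly (poly_primitive (p n)) has_vector_derivative poly (p n) s) (at s within {-R..x})" for s
 using poly_DERIV[of "poly_primitive (p n)" s] unfolding pderiv_poly_primitive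
 by (simp add: has_real_derivative_iff_has_vector_derivative[symmetric] has_field_derivative_at_within)
 qed (rule continuous_on_subset[OF pc], simp)
 then show ?thesis by (simp add: F_def)
 qed
 have diff: "%%V x - F n x%% <= (LI x. ivl R x * %%k x - poly (p n) x%%)" if x: "%%x%% <= R" for n x
 proof -
 have r: "indicator {-R..x} s = indicator {-R..x} s * ivl R s" for s
 using x by (auto simp: indicator_def)
 have i1: "intgr (%s. indicator {-R..x} s * k s)"
 using integrable_mult_indicator[OF _ ki, of "{-R..x}"] by (subst r) (simp add: mult.assoc)
 have i2: "intgr (%s. indicator {-R..x} s * poly (p n) s)"
 using integrable_mult_indicator[OF _ integrable_ivl_continuous[OF pc[of n], of R], of "{-R..x}"] by (subst r) (simp add: mult.assoc)
 have i3: "intgr (%x. ivl R x * %%k x - poly (p n) x%%)"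
 using integrable_abs[OF lint_diff[OF ki integrable_ivl_continuous[OF pc, of R n]]]
 by (simp flip: right_diff_distrib add: abs_mult)
 have "V x - F n x = (LI s. indicator {-R..x} s * k s) - (LI s. indicator {-R..x} s * poly (p n) s)"
 using V[of "-R" x] FT[of x n] x by (simp add: abs_le_iff)
 also have "... = (LI s. indicator {-R..x} s * (k s - poly (p n) s))"
 using i1 i2 by (simp add: right_diff_distrib)
 also have "%%...%% <= (LI s. %%indicator {-R..x} s * (k s - poly (p n) s)%%)"
 by (rule integral_abs_bound)
 also have "... <= (LI x. ivl R x * %%k x - poly (p n) x%%)"
 by (rule integral_mono') (use i3 x in \<open>auto simp: indicator_def\<close>)
 finally show ?thesis .
 qed
 have limF: "(%n. F n x) ----> V x" if x: "%%x%% <= R" for x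
 proof -
 have "(%n. V x - F n x) ----> 0"
 by (rule Lim_null_comparison[OF _ lim]) (use diff[OF x] in auto)
 from tendsto_diff[OF tendsto_const[of "V x"] this] show ?thesis by simp
 qed
 obtain D where D: "!!n. %%LI x. ivl R x * %%k x - poly (p n) x%%%% <= D"
 using convergent_imp_Bseq[OF convergentI[OF lim]] unfolding Bseq_def by auto
 have "bounded (V ` {-R..R})"
 by (intro compact_imp_bounded compact_continuous_image continuous_on_subset[OF Vc]) auto
 then obtain K where K: "!!x. %%x%% <= R ==> %%V x%% <= K" unfolding bounded_iff by (fastforce simp: abs_le_iff)
 show ?thesis
 proof (rule approximableI[where P="%n z. F n (px z)" and Pt="%n z. 0" and Px="%n z. poly (p n) (px z)" and Py="%n z. 0" and C="K + D" and q=q])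
 show "intgr (%x. ivl R x * q x)" by (rule q)
 show "smooth (%z::R3. F n (px z))" for n
 proof -
 have "smooth (%z::R3. (V (-R) - poly (poly_primitive (p n)) (-R)) + poly (poly_primitive (p n)) (px z))"
 by (intro smooth_add smooth_const smooth_comp[OF smooth_poly] smooth_coord)
 then show ?thesis by (simp add: F_def algebra_simps)
 qed
 show "has_partials (%z. F n (px z)) (%z. 0) (%z. poly (p n) (px z)) (%z. 0)" for n
 proof -
 have "(F n has_real_derivative poly (p n) s) (at s)" for s
 unfolding F_def[abs_def] by (auto intro!: derivative_eq_intros poly_DERIV simp: pderiv_poly_primitive)
 from has_partials_comp[OF this has_partials_coord(2)] show ?thesis by simp
 qed
 show "AE x in lborel. \<forall>z. px z = x --> in_box R z -->
 (\<forall>n. %%F n (px z)%% <= K + D & %%0::real%% <= K + D & %%0::real%% <= K + D & %%poly (p n) (px z)%% <= q x) &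
 (%n. F n (px z)) ----> V (px z) & (%n. 0::real) ----> 0 &
 (%n. poly (p n) (px z)) ----> k (px z) & (%n. 0::real) ----> 0"
 using ae
 proof eventually_elim
 case (elim x)
 show ?case
 proof (intro allI impI)
 fix z :: "R3" assume z: "px z = x" "in_box R z"
 then have x: "%%x%% <= R" by (auto simp: in_box_def)
 have bF: "%%F n x%% <= K + D" for n
 using diff[OF x, of n] K[OF x] D[of n] by linarith
 have "0 <= K + D" using order_trans[OF abs_ge_zero bF[of 0]] .
 with bF show "(\<forall>n. %%F n (px z)%% <= K + D & %%0::real%% <= K + D & %%0::real%% <= K + D & %%poly (p n) (px z)%% <= q x) &
 (%n. F n (px z)) ----> V (px z) & (%n. 0::real) ----> 0 &
 (%n. poly (p n) (px z)) ----> k (px z) & (%n. 0::real) ----> 0"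
 unfolding z(1) using elim x limF[OF x] by simp
 qed
 qed
 qed measurable
qed

section \<open>Absolute continuity and the fundamental theorem of calculus\<close>

lemma locally_abs_continuousD:
 assumes "locally_abs_continuous f" "e > 0"
 obtains d where "d > 0" "!!D T. D division_of T ==> T \<subseteq> {a..b} ==> (\<Sum>K\<in>D. Sup K - Inf K) < d ==>
 (\<Sum>K\<in>D. %%f (Sup K) - f (Inf K)%%) < e"
 using assms unfolding locally_abs_continuous_def by meson

lemma locally_abs_continuous_imp_continuous:
 assumes "locally_abs_continuous f"
 shows "continuous_on UNIV f"
proof (rule continuous_at_imp_continuous_on, intro ballI)
 fix x
 show "isCont f x"
 unfolding isCont_def LIM_def dist_real_def
 proof (intro allI impI)
 fix e :: real assume "e > 0"
 obtain d where d: "d > 0" "!!D T. D division_of T ==> T \<subseteq> {x-1..x+1} ==> (\<Sum>K\<in>D. Sup K - Inf K) < d ==>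
 (\<Sum>K\<in>D. %%f (Sup K) - f (Inf K)%%) < e"
 using locally_abs_continuousD[OF assms \<open>e > 0\<close>, of "x-1" "x+1"] by blast
 have *: "%%f v - f u%% < e" if "u <= v" "{u..v} \<subseteq> {x-1..x+1}" "v - u < d" for u v
 using d(2)[OF division_of_self[of u v, unfolded cbox_interval]] that by simp
 have "%%f y - f x%% < e" if "%%y - x%% < min d 1" for y
 proof (cases "x <= y")
 case True then show ?thesis using *[of x y] that by auto
 next
 case False then show ?thesis using *[of y x] that by (auto simp: abs_minus_commute)
 qed
 then show "\<exists>s>0. \<forall>y. y ~= x & %%y - x%% < s --> %%f y - f x%% < e"
 using d(1) by (intro exI[of _ "min d 1"]) auto
 qed
qed

text \<open>Argued with the gauge integral. At a point of differentiability the gauge makes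
  increments of \<open>f\<close> close to \<open>k x\<close> times the length. The exceptional null
  set is covered by an open \<open>U\<close> of measure below the threshold \<open>d\<close> of
  absolute continuity, so the increments over intervals tagged there sum to less than e/2.\<close>

theorem locally_abs_continuous_FTC:
 assumes ac: "locally_abs_continuous f"
 and der: "AE x in lborel. (f has_real_derivative k x) (at x)"
 and ab: "a <= b"
 shows "(k has_integral f b - f a) {a..b}"
proof -
 define N where "N = {x. ~ (f has_real_derivative k x) (at x)}"
 have N: "negligible N"
 proof -
 obtain N0 where N0: "!!x. x \<in> space lborel - N0 ==> (f has_real_derivative k x) (at x)" "N0 \<in> null_sets lborel"
 using AE_E3[OF der] by blast
 have "negligible N0" using null_sets_completionI[OF N0(2)] by (simp add: negligible_iff_null_sets)
 then show ?thesis by (rule negligible_subset) (use N0(1) in \<open>auto simp: N_def\<close>)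
 qed
 define g where "g x = (if x \<in> N then 0 else k x)" for x
 have "(g has_integral f b - f a) (cbox a b)"
 unfolding has_integral
 proof (intro allI impI)
 fix e :: real assume e: "e > 0"
 \<comment> \<open>The summand 1 keeps \<open>l\<close> positive when a = b.\<close>
 define l where "l = b - a + 1"
 have l: "l > 0" using ab by (simp add: l_def)
 define e' where "e' = e / 2 / l"
 have e': "e' > 0" using e l by (simp add: e'_def)
 have "e' * (b - a) <= e' * l" using e' by (intro mult_left_mono) (auto simp: l_def)
 also have "... = e / 2" using l by (simp add: e'_def)
 finally have e'b: "e' * (b - a) <= e / 2" .
 obtain d where d: "d > 0" "!!D T. D division_of T ==> T \<subseteq> {a..b} ==> (\<Sum>K\<in>D. Sup K - Inf K) < d ==>
 (\<Sum>K\<in>D. %%f (Sup K) - f (Inf K)%%) < e / 2"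
 using locally_abs_continuousD[OF ac half_gt_zero[OF e], of a b] by blast
 obtain U where U: "open U" "N \<subseteq> U" "U \<in> lmeasurable" "measure lebesgue U < d"
 proof -
 have Nn: "N \<in> null_sets lebesgue" using N by (simp add: negligible_iff_null_sets)
 have "N \<in> sets lebesgue" using Nn by auto
 then obtain T where T: "open T" "N \<subseteq> T" "T - N \<in> lmeasurable" "emeasure lebesgue (T - N) < ennreal d"
 using sets_lebesgue_outer_open[OF _ d(1)] by blast
 have "T - N \<union> N \<in> lmeasurable" by (intro fmeasurable.Un T(3) negligible_imp_measurable[OF N])
 moreover have "T - N \<union> N = T" using T(2) by auto
 ultimately have TL: "T \<in> lmeasurable" by simp
 have "measure lebesgue T = measure lebesgue (T - N)"
 using measure_Diff_null_set[OF _ Nn, of T] TL by auto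
 also have "... < d" using T(3,4) d(1) by (simp add: emeasure_eq_measure2 ennreal_less_iff)
 finally show thesis using that T(1,2) TL by blast
 qed
 have "\<exists>r>0. \<forall>u v. u <= x & x <= v & {u..v} \<subseteq> ball x r --> %%f v - f u - k x * (v - u)%% <= e' * (v - u)"
 if "x \<notin> N" for x
 proof -
 have "(f has_derivative (%h. h * k x)) (at x)"
 using that by (simp add: N_def has_field_derivative_def mult_commute_abs)
 then obtain r where r: "r > 0" "!!y. %%y - x%% < r ==> %%f y - f x - (y - x) * k x%% <= e' * %%y - x%%"
 unfolding has_derivative_at_alt using e' by (metis real_norm_def)
 show ?thesis
 proof (intro exI[of _ r] conjI allI impI r(1))
 fix u v assume uv: "u <= x & x <= v & {u..v} \<subseteq> ball x r"
 have "u \<in> {u..v}" "v \<in> {u..v}" using uv by auto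
 then have "u \<in> ball x r" "v \<in> ball x r" using uv by blast+
 then have "%%f v - f x - (v - x) * k x%% <= e' * (v - x)" "%%f u - f x - (u - x) * k x%% <= e' * (x - u)"
 using r(2)[of v] r(2)[of u] uv by (auto simp: dist_real_def abs_minus_commute)
 moreover have "f v - f u - k x * (v - u) = (f v - f x - (v - x) * k x) - (f u - f x - (u - x) * k x)"
 by (simp add: algebra_simps)
 moreover have "e' * (v - u) = e' * (v - x) + e' * (x - u)" by (simp add: algebra_simps)
 ultimately show "%%f v - f u - k x * (v - u)%% <= e' * (v - u)" by linarith
 qed
 qed
 then obtain r where r: "!!x. x \<notin> N ==> r x > 0"
 "!!x u v. x \<notin> N ==> u <= x ==> x <= v ==> {u..v} \<subseteq> ball x (r x) ==> %%f v - f u - k x * (v - u)%% <= e' * (v - u)"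
 by metis
 define \<gamma> where "\<gamma> x = (if x \<in> N then U else ball x (r x))" for x
 show "\<exists>\<gamma>. gauge \<gamma> & (\<forall>p. p tagged_division_of cbox a b & \<gamma> fine p -->
 norm ((\<Sum>(x, K)\<in>p. measure lborel K *\<^sub>R g x) - (f b - f a)) < e)"
 proof (intro exI[of _ \<gamma>] conjI allI impI)
 show "gauge \<gamma>" using U r(1) by (auto simp: gauge_def \<gamma>_def)
 fix p assume "p tagged_division_of cbox a b & \<gamma> fine p"
 then have p: "p tagged_division_of {a..b}" and fine: "\<gamma> fine p" by auto
 have fin: "finite p" using p by auto
 \<comment> \<open>The value 0 on the empty set matters:
   \<open>sum.over_tagged_division_lemma\<close> also asks about degenerate intervals, where Sup and
   Inf are unspecified.\<close>
 define \<Delta> where "\<Delta> K = (if K = {} then 0 else f (Sup K) - f (Inf K))" for K :: "real set"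
 have form: "\<exists>u v. K = {u..v} & u <= x & x <= v & {u..v} \<subseteq> \<gamma> x & {u..v} \<subseteq> {a..b}" if xK: "(x, K) \<in> p" for x K
 proof -
 obtain u v where K: "K = cbox u v" using tagged_division_ofD(4)[OF p xK] by blast
 have "x \<in> K" "K \<subseteq> {a..b}" using tagged_division_ofD(2,3)[OF p xK] .
 moreover have "K \<subseteq> \<gamma> x" using fine xK by (auto simp: fine_def)
 ultimately show ?thesis using K by (intro exI[of _ u] exI[of _ v]) auto
 qed
 have tele: "(\<Sum>(x,K)\<in>p. \<Delta> K) = f b - f a"
 proof -
 have "(\<Sum>(x,K)\<in>p. \<Delta> K) = (\<Sum>(x,K)\<in>p. f (Sup K) - f (Inf K))"
 proof (intro sum.cong refl)
 fix q assume "q \<in> p"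
 then have "snd q ~= {}" using form[of "fst q" "snd q"] by auto
 then show "(case q of (x, K) => \<Delta> K) = (case q of (x, K) => f (Sup K) - f (Inf K))"
 by (simp add: \<Delta>_def split_def)
 qed
 then show ?thesis using additive_tagged_division_1[OF ab p, of f] by simp
 qed
 define p1 where "p1 = {(x, K) \<in> p. x \<in> N}"
 have p1: "p1 \<subseteq> p" "finite p1" using fin by (auto simp: p1_def intro: finite_subset)
 have tp1: "p1 tagged_division_of \<Union>(snd ` p1)"
 proof (rule tagged_partial_division_of_Union_self[OF tagged_partial_division_subset[OF _ p1(1)]])
 show "p tagged_partial_division_of {a..b}" using p unfolding tagged_division_of_def by blast
 qed
 define D where "D = snd ` p1"
 have divD: "D division_of \<Union>D" unfolding D_def using division_of_tagged_division[OF tp1] .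
 have DI: "\<exists>u v. K = {u..v} & u <= v & {u..v} \<subseteq> U & {u..v} \<subseteq> {a..b}" if "K \<in> D" for K
 using that form by (fastforce simp: D_def p1_def \<gamma>_def)
 have "(\<Sum>K\<in>D. Sup K - Inf K) = (\<Sum>K\<in>D. measure lebesgue K)"
 proof (intro sum.cong refl)
 fix K assume "K \<in> D"
 then obtain u v where "K = {u..v}" "u <= v" using DI by blast
 then show "Sup K - Inf K = measure lebesgue K" by (simp add: measure_completion)
 qed
 also have "... = measure lebesgue (\<Union>D)" using content_division[OF divD] by simp
 also have "... <= measure lebesgue U"
 proof (rule measure_mono_fmeasurable)
 show "\<Union>D \<subseteq> U" using DI by blast
 show "\<Union>D \<in> sets lebesgue" using divD by (meson division_ofD(1) fmeasurableD lmeasurable_division)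
 qed (rule U)
 also note U(4)
 finally have "(\<Sum>K\<in>D. %%f (Sup K) - f (Inf K)%%) < e / 2"
 using d(2)[OF divD] DI by blast
 moreover have "(\<Sum>(x,K)\<in>p1. %%\<Delta> K%%) = (\<Sum>K\<in>D. %%\<Delta> K%%)"
 unfolding D_def
 proof (rule sum.over_tagged_division_lemma[OF tp1])
 fix u v :: real assume "box u v = {}"
 then have "v <= u" by (simp add: box_real)
 then show "%%\<Delta> (cbox u v)%% = 0" by (cases "u = v") (auto simp: \<Delta>_def)
 qed
 moreover have "(\<Sum>K\<in>D. %%\<Delta> K%%) = (\<Sum>K\<in>D. %%f (Sup K) - f (Inf K)%%)"
 by (intro sum.cong refl) (use DI in \<open>fastforce simp: \<Delta>_def\<close>)
 ultimately have b1: "(\<Sum>(x,K)\<in>p1. %%\<Delta> K%%) < e / 2" by simp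
 have "%%(\<Sum>(x, K)\<in>p. measure lborel K *\<^sub>R g x) - (f b - f a)%% = %%\<Sum>(x, K)\<in>p. measure lborel K * g x - \<Delta> K%%"
 unfolding tele[symmetric] by (simp add: sum_subtractf split_def)
 also have "... <= (\<Sum>(x, K)\<in>p. %%measure lborel K * g x - \<Delta> K%%)"
 unfolding split_def by (rule sum_abs)
 also have "... <= (\<Sum>(x, K)\<in>p. e' * measure lborel K + (if x \<in> N then %%\<Delta> K%% else 0))"
 proof (rule sum_mono, clarify)
 fix x K assume xK: "(x, K) \<in> p"
 then obtain u v where uv: "K = {u..v}" "u <= x" "x <= v" "{u..v} \<subseteq> \<gamma> x" using form by blast
 show "%%measure lborel K * g x - \<Delta> K%% <= e' * measure lborel K + (if x \<in> N then %%\<Delta> K%% else 0)"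
 proof (cases "x \<in> N")
 case True
 then show ?thesis using e' by (simp add: g_def)
 next
 case False
 have "{u..v} ~= {}" using uv by auto
 then show ?thesis using r(2)[OF False uv(2,3)] uv False
 by (auto simp: g_def \<Delta>_def \<gamma>_def abs_minus_commute mult.commute)
 qed
 qed
 also have "... = e' * (\<Sum>(x, K)\<in>p. measure lborel K) + (\<Sum>(x,K)\<in>p1. %%\<Delta> K%%)"
 proof -
 have "(\<Sum>(x,K)\<in>p. if x \<in> N then %%\<Delta> K%% else 0) = (\<Sum>(x,K)\<in>p1. %%\<Delta> K%%)"
 unfolding p1_def split_def by (rule sum.mono_neutral_cong_right) (use fin in auto)
 then show ?thesis by (simp add: split_def sum.distrib sum_distrib_left)
 qed
 also have "(\<Sum>(x, K)\<in>p. measure lborel K) = b - a"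
 using additive_content_tagged_division[of p a b] p ab by simp
 also have "e' * (b - a) + (\<Sum>(x,K)\<in>p1. %%\<Delta> K%%) < e" using b1 e'b by linarith
 finally show "norm ((\<Sum>(x, K)\<in>p. measure lborel K *\<^sub>R g x) - (f b - f a)) < e" by simp
 qed
 qed
 then have "(g has_integral f b - f a) {a..b}" by simp
 then show ?thesis
 by (rule has_integral_spike[OF N, rotated]) (auto simp: g_def)
qed

section \<open>Change of variables to position and energy\<close>

text \<open>Fubini: if every fibre map preserves length, integrating an indicator first along the
  fibre changes nothing. Used for the reflection of velocities and later for the kicks and drifts of
  the scheme.\<close>

lemma distr_fiberwise:
 fixes g :: "'a::euclidean_space => 'b::euclidean_space => 'b"
 assumes m[measurable]: "(%p. g (fst p) (snd p)) \<in> bm"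
 and g: "!!x. distr lborel borel (g x) = lborel"
 shows "distr lborel borel (%p. (fst p, g (fst p) (snd p))) = lborel"
proof (rule measure_eqI)
 fix A assume "A \<in> sets (distr lborel borel (%p. (fst p, g (fst p) (snd p))))"
 then have A[measurable]: "A \<in> sets borel" by simp
 have [measurable]: "g x \<in> bm" for x
 using measurable_compose[OF _ m, of "%y. (x, y)" borel] by simp
 have [measurable]: "(%p. indicator A p :: ennreal) \<in> borel_measurable (lborel \<Otimes>\<^sub>M lborel)"
 unfolding lborel_prod by simp
 have [measurable]: "(%p. indicator A (fst p, g (fst p) (snd p)) :: ennreal) \<in> borel_measurable (lborel \<Otimes>\<^sub>M lborel)"
 unfolding lborel_prod by measurable
 have [measurable]: "(%y. indicator A (x, y) :: ennreal) \<in> bm" for x by measurable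
 have "emeasure (distr lborel borel (%p. (fst p, g (fst p) (snd p)))) A = (\<integral>\<^sup>+p. indicator A p \<partial>distr lborel borel (%p. (fst p, g (fst p) (snd p))))"
 by simp
 also have "... = (\<integral>\<^sup>+p. indicator A (fst p, g (fst p) (snd p)) \<partial>lborel)"
 by (rule nn_integral_distr) measurable
 also have "... = (\<integral>\<^sup>+p. indicator A (fst p, g (fst p) (snd p)) \<partial>(lborel \<Otimes>\<^sub>M lborel))"
 by (simp add: lborel_prod)
 also have "... = (\<integral>\<^sup>+x. \<integral>\<^sup>+y. indicator A (x, g x y) \<partial>lborel \<partial>lborel)"
 by (subst lborel.nn_integral_fst[symmetric]) auto
 also have "... = (\<integral>\<^sup>+x. \<integral>\<^sup>+y. indicator A (x, y) \<partial>lborel \<partial>lborel)"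
 proof (rule nn_integral_cong)
 fix x
 have "(\<integral>\<^sup>+y. indicator A (x, g x y) \<partial>lborel) = (\<integral>\<^sup>+y. indicator A (x, y) \<partial>(distr lborel borel (g x)))"
 by (rule nn_integral_distr[symmetric]) measurable
 then show "(\<integral>\<^sup>+y. indicator A (x, g x y) \<partial>lborel) = (\<integral>\<^sup>+y. indicator A (x, y) \<partial>lborel)" by (simp add: g)
 qed
 also have "... = (\<integral>\<^sup>+p. indicator A p \<partial>(lborel \<Otimes>\<^sub>M lborel))"
 by (subst lborel.nn_integral_fst[symmetric]) auto
 also have "... = emeasure lborel A" by (simp add: lborel_prod)
 finally show "emeasure (distr lborel borel (%p. (fst p, g (fst p) (snd p)))) A = emeasure lborel A" .
qed simp

lemma distr_swap_lborel:
 "distr lborel borel (%p::'a::euclidean_space \<times> 'b::euclidean_space. (snd p, fst p)) = lborel"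
proof -
 have "lborel = distr (lborel \<Otimes>\<^sub>M lborel) (lborel \<Otimes>\<^sub>M lborel) (%(x, y). (y::'b, x::'a))"
 using lborel_pair.distr_pair_swap by (simp add: lborel_prod)
 also have "... = distr lborel borel (%p::'a \<times> 'b. (snd p, fst p))"
 unfolding lborel_prod by (intro distr_cong) (auto simp: split_def)
 finally show ?thesis by simp
qed

lemma distr_uminus_lborel: "distr lborel borel (%y::real. - y) = lborel"
 using lborel_distr_uminus by simp

text \<open>With E = y^2/2 + c one has y dy = dE on y > 0. The substitution is made on [0, n], and n
  tends to infinity by monotone convergence.\<close>

lemma energy_distr_1D:
 fixes c :: real
 shows "distr (density lborel (%y. ennreal (indicator {0<..} y * y))) borel (%y. y^2 / 2 + c)
 = density lborel (indicator {c<..})"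
proof (rule measure_eqI)
 fix A assume "A \<in> sets (distr (density lborel (%y. ennreal (indicator {0<..} y * y))) borel (%y. y^2 / 2 + c))"
 then have A[measurable]: "A \<in> sets borel" by simp
 have step: "(\<integral>\<^sup>+E. ennreal (indicator A E) * indicator {c..(real n)^2/2 + c} E \<partial>lborel) =
 (\<integral>\<^sup>+y. ennreal (indicator A (y^2/2 + c) * y) * indicator {0..real n} y \<partial>lborel)" for n
 proof -
 have "((%y. y^2/2 + c) has_real_derivative y) (at y)" for y
 by (auto intro!: derivative_eq_intros)
 moreover have "set_borel_measurable borel {0^2/2 + c..(real n)^2/2 + c} (indicat_real A)"
 unfolding set_borel_measurable_def by measurable
 ultimately show ?thesis
 using nn_integral_substitution[of "%y. y^2/2 + c" 0 "real n" "indicat_real A" "%y. y"]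
 by (simp add: ennreal_mult'' ennreal_indicator[symmetric] del: ennreal_indicator)
 qed
 have L: "(%n. \<integral>\<^sup>+E. ennreal (indicator A E) * indicator {c..(real n)^2/2 + c} E \<partial>lborel) ----> (\<integral>\<^sup>+E. ennreal (indicator A E) * indicator {c..} E \<partial>lborel)"
 proof (rule nn_integral_LIMSEQ)
 show "incseq (%n E. ennreal (indicator A E) * indicator {c..(real n)^2/2 + c} E)"
 by (auto simp: incseq_def le_fun_def indicator_def power_mono intro: order_trans)
 show "(%n. ennreal (indicator A E) * indicator {c..(real n)^2/2 + c} E) ----> ennreal (indicator A E) * indicator {c..} E" for E
 proof (rule tendsto_eventually)
 obtain m where m: "%%2 * (E - c)%% + 1 <= real m" using real_arch_simple by blast
 show "eventually (%n. ennreal (indicator A E) * indicator {c..(real n)^2/2 + c} E = ennreal (indicator A E) * indicator {c..} E) sequentially"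
 using eventually_ge_at_top[of m]
 proof eventually_elim
 case (elim n)
 then have n: "real n >= %%2 * (E - c)%% + 1" using m by linarith
 then have "real n * 1 <= real n * real n" by (intro mult_left_mono) auto
 then have "2 * (E - c) <= (real n)^2" using n by (simp add: power2_eq_square)
 then show ?case by (auto simp: indicator_def)
 qed
 qed
 qed measurable
 have R: "(%n. \<integral>\<^sup>+y. ennreal (indicator A (y^2/2 + c) * y) * indicator {0..real n} y \<partial>lborel) ----> (\<integral>\<^sup>+y. ennreal (indicator A (y^2/2 + c) * y) * indicator {0..} y \<partial>lborel)"
 proof (rule nn_integral_LIMSEQ)
 show "incseq (%n y. ennreal (indicator A (y^2/2 + c) * y) * indicator {0..real n} y)"
 by (auto simp: incseq_def le_fun_def indicator_def intro: order_trans)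
 show "(%n. ennreal (indicator A (y^2/2 + c) * y) * indicator {0..real n} y) ----> ennreal (indicator A (y^2/2 + c) * y) * indicator {0..} y" for y
 proof (rule tendsto_eventually)
 obtain m where m: "y <= real m" using real_arch_simple by blast
 show "eventually (%n. ennreal (indicator A (y^2/2 + c) * y) * indicator {0..real n} y = ennreal (indicator A (y^2/2 + c) * y) * indicator {0..} y) sequentially"
 using eventually_ge_at_top[of m] by eventually_elim (use m in \<open>auto simp: indicator_def\<close>)
 qed
 qed measurable
 have eq: "(\<integral>\<^sup>+E. ennreal (indicator A E) * indicator {c..} E \<partial>lborel) = (\<integral>\<^sup>+y. ennreal (indicator A (y^2/2 + c) * y) * indicator {0..} y \<partial>lborel)"
 using LIMSEQ_unique[OF L[unfolded step] R] .
 have "emeasure (distr (density lborel (%y. ennreal (indicator {0<..} y * y))) borel (%y. y^2 / 2 + c)) A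
 = (\<integral>\<^sup>+y. ennreal (indicator {0<..} y * y) * indicator ((%y. y^2 / 2 + c) -` A) y \<partial>lborel)"
 proof -
 have "(%y. y^2 / 2 + c) -` A \<in> sets borel" by (rule measurable_sets_borel[OF _ A]) measurable
 then show ?thesis by (simp add: emeasure_distr emeasure_density)
 qed
 also have "... = (\<integral>\<^sup>+y. ennreal (indicator A (y^2/2 + c) * y) * indicator {0..} y \<partial>lborel)"
 by (intro nn_integral_cong) (auto simp: indicator_def)
 also have "... = (\<integral>\<^sup>+E. ennreal (indicator A E) * indicator {c..} E \<partial>lborel)" using eq by simp
 also have "... = (\<integral>\<^sup>+E. indicator {c<..} E * indicator A E \<partial>lborel)"
 by (intro nn_integral_cong_AE eventually_mono[OF AE_lborel_singleton[of c]]) (auto simp: indicator_def)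
 also have "... = emeasure (density lborel (indicator {c<..})) A"
 by (subst emeasure_density) auto
 finally show "emeasure (distr (density lborel (%y. ennreal (indicator {0<..} y * y))) borel (%y. y^2 / 2 + c)) A
 = emeasure (density lborel (indicator {c<..})) A" .
qed simp

definition above :: "(real => real) => R2 => real" where
 "above V p = (if V (fst p) < snd p then 1 else 0)"

definition spd :: "(real => real) => R2 => real" where
 "spd V p = sqrt (2 * (snd p - V (fst p)))"

lemma energy_distr:
 fixes V :: "real => real"
 assumes [measurable]: "V \<in> bm"
 shows "distr (density lborel (%p. ennreal (indicator {0<..} (snd p) * snd p))) borel
 (%p. (fst p, (snd p)^2 / 2 + V (fst p))) = density lborel (%p. ennreal (above V p))"
 (is "?L = ?R")
proof (rule measure_eqI)
 fix A assume "A \<in> sets ?L"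
 then have A[measurable]: "A \<in> sets borel" by simp
 have [measurable]: "above V \<in> bm" unfolding above_def by measurable
 let ?h = "%p. ennreal (indicator {0<..} (snd p) * snd p) * indicator A (fst p, (snd p)^2 / 2 + V (fst p))"
 have m1: "?h \<in> borel_measurable (lborel \<Otimes>\<^sub>M lborel)" unfolding lborel_prod by measurable
 have m2: "(%p. ennreal (above V p) * indicator A p) \<in> borel_measurable (lborel \<Otimes>\<^sub>M lborel)" unfolding lborel_prod by measurable
 have "(%p. (fst p, (snd p)^2 / 2 + V (fst p))) -` A \<in> sets borel"
 by (rule measurable_sets_borel[OF _ A]) measurable
 then have "emeasure ?L A = (\<integral>\<^sup>+p. ennreal (indicator {0<..} (snd p) * snd p) * indicator ((%p. (fst p, (snd p)^2 / 2 + V (fst p))) -` A) p \<partial>lborel)"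
 by (simp add: emeasure_distr emeasure_density)
 also have "... = (\<integral>\<^sup>+p. ?h p \<partial>(lborel \<Otimes>\<^sub>M lborel))"
 unfolding lborel_prod by (intro nn_integral_cong) (auto simp: indicator_def)
 also have "... = (\<integral>\<^sup>+x. \<integral>\<^sup>+y. ?h (x, y) \<partial>lborel \<partial>lborel)"
 by (rule lborel.nn_integral_fst[symmetric, OF m1])
 also have "... = (\<integral>\<^sup>+x. \<integral>\<^sup>+E. ennreal (above V (x, E)) * indicator A (x, E) \<partial>lborel \<partial>lborel)"
 proof (rule nn_integral_cong)
 fix x
 have S[measurable]: "Pair x -` A \<in> sets borel"
 by (rule measurable_sets_borel[OF _ A]) measurable
 have "(%y. y^2 / 2 + V x) -` (Pair x -` A) \<in> sets borel"
 by (rule measurable_sets_borel[OF _ S]) measurable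
 then have "(\<integral>\<^sup>+y. ?h (x, y) \<partial>lborel) = emeasure (distr (density lborel (%y. ennreal (indicator {0<..} y * y))) borel (%y. y^2 / 2 + V x)) (Pair x -` A)"
 by (simp add: emeasure_distr emeasure_density) (intro nn_integral_cong, auto simp: indicator_def)
 also have "... = (\<integral>\<^sup>+E. ennreal (above V (x, E)) * indicator A (x, E) \<partial>lborel)"
 unfolding energy_distr_1D by (simp add: emeasure_density) (intro nn_integral_cong, auto simp: indicator_def above_def)
 finally show "(\<integral>\<^sup>+y. ?h (x, y) \<partial>lborel) = (\<integral>\<^sup>+E. ennreal (above V (x, E)) * indicator A (x, E) \<partial>lborel)" .
 qed
 also have "... = (\<integral>\<^sup>+p. ennreal (above V p) * indicator A p \<partial>(lborel \<Otimes>\<^sub>M lborel))"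
 by (rule lborel.nn_integral_fst[OF m2])
 also have "... = emeasure ?R A" unfolding lborel_prod by (simp add: emeasure_density)
 finally show "emeasure ?L A = emeasure ?R A" .
qed simp

lemma distr_reflect_lborel: "distr lborel borel (%p::R2. (fst p, - snd p)) = lborel"
 using distr_fiberwise[of "%(x::real) (y::real). - y"] by (simp add: distr_uminus_lborel)

text \<open>Here \<open>p\<close> is (x, E). Both velocities on the level are summed, and 1/spd is
  the Jacobian dy/dE.\<close>

definition foldE :: "(real => real) => (R2 => real) => R2 => real" where
 "foldE V F p = above V p * ((F (fst p, spd V p) + F (fst p, - spd V p)) / spd V p)"

lemma borel_measurable_foldE:
 assumes [measurable]: "V \<in> bm" "F \<in> bm"
 shows "foldE V F \<in> bm"
 unfolding foldE_def[abs_def] above_def spd_def by measurable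

text \<open>The half-plane y < 0 is reflected onto y > 0, where F dy is written as (F/y) times y dy,
  the measure handled by \<open>energy_distr\<close>; the line y = 0 is null.\<close>

lemma integral_foldE:
 assumes V[measurable]: "V \<in> bm" and F: "intgr F"
 shows "intgr (foldE V F)" "(LI p. foldE V F p) = (LI p. F p)"
proof -
 have [measurable]: "F \<in> bm" using F by auto
 have [measurable]: "above V \<in> bm" unfolding above_def by measurable
 note [measurable] = borel_measurable_foldE[OF V \<open>F \<in> bm\<close>]
 let ?r = "%p::R2. (fst p, - snd p)"
 have Fr: "intgr (%p. F (?r p))"
 by (rule integrable_distr[of ?r lborel borel]) (use F in \<open>simp_all add: distr_reflect_lborel\<close>)
 let ?F' = "%p. indicator {0<..} (snd p) * (F p + F (?r p))"
 have i1: "intgr (%p. indicator {0<..} (snd p) * F p)"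
 by (rule lint_bound[OF F]) (auto simp: indicator_def)
 have i2: "intgr (%p. indicator {0<..} (snd p) * F (?r p))"
 by (rule lint_bound[OF Fr]) (auto simp: indicator_def)
 have i3: "intgr (%p. indicator {..<0} (snd p) * F p)"
 by (rule lint_bound[OF F]) (auto simp: indicator_def)
 have F': "intgr ?F'" using lint_add[OF i1 i2] by (simp add: distrib_left)
 have "(LI p. ?F' p) = (LI p. indicator {0<..} (snd p) * F p) + (LI p. indicator {0<..} (snd p) * F (?r p))"
 using Bochner_Integration.integral_add[OF i1 i2] by (simp add: distrib_left)
 also have "(LI p. indicator {0<..} (snd p) * F (?r p)) = (LINT p|distr lborel borel ?r. indicator {..<0} (snd p) * F p)"
 by (subst integral_distr) (auto intro!: lint_cong simp: indicator_def)
 also have "... = (LI p. indicator {..<0} (snd p) * F p)" by (simp add: distr_reflect_lborel)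
 also have "(LI p. indicator {0<..} (snd p) * F p) + (LI p. indicator {..<0} (snd p) * F p)
 = (LI p. indicator {0<..} (snd p) * F p + indicator {..<0} (snd p) * F p)"
 by (rule Bochner_Integration.integral_add[OF i1 i3, symmetric])
 also have "... = (LI p. F p)"
 by (intro integral_cong_AE eventually_mono[OF AE_lborel_snd[OF AE_lborel_singleton[of 0]]]) (auto simp: indicator_def)
 finally have F'i: "(LI p. ?F' p) = (LI p. F p)" .
 let ?\<Phi> = "%p. (fst p, (snd p)^2 / 2 + V (fst p))"
 have eq: "(indicator {0<..} (snd p) * snd p) *\<^sub>R foldE V F (?\<Phi> p) = ?F' p" for p
 by (auto simp: indicator_def foldE_def above_def spd_def real_sqrt_mult)
 have m: "(%p::R2. indicat_real {0<..} (snd p) * snd p) \<in> borel_measurable lborel" by measurable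
 have nn: "AE p in lborel. 0 <= indicat_real {0<..} (snd p) * snd (p::R2)" by (auto simp: indicator_def)
 have mF: "(%p. foldE V F (?\<Phi> p)) \<in> borel_measurable lborel" by measurable
 have m': "?\<Phi> \<in> measurable (density lborel (%p. ennreal (indicator {0<..} (snd p) * snd p))) borel" by simp
 have nn': "AE p in lborel. 0 <= above V p" by (auto simp: above_def)
 have ab: "above V p *\<^sub>R foldE V F p = foldE V F p" for p by (auto simp: foldE_def above_def)
 have "integrable (density lborel (%p. ennreal (indicator {0<..} (snd p) * snd p))) (%p. foldE V F (?\<Phi> p))"
 unfolding integrable_density[OF mF m nn] eq by (rule F')
 then have "integrable (distr (density lborel (%p. ennreal (indicator {0<..} (snd p) * snd p))) borel ?\<Phi>) (foldE V F)"
 by (subst integrable_distr_eq[OF m']) auto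
 then show "intgr (foldE V F)"
 unfolding energy_distr[OF V] by (subst (asm) integrable_density[OF _ _ nn']) (simp_all add: ab del: real_scaleR_def)
 have "(LI p. F p) = (LINT p|density lborel (%p. ennreal (indicator {0<..} (snd p) * snd p)). foldE V F (?\<Phi> p))"
 unfolding integral_density[OF mF m nn] eq F'i ..
 also have "... = (LINT p|distr (density lborel (%p. ennreal (indicator {0<..} (snd p) * snd p))) borel ?\<Phi>. foldE V F p)"
 by (rule integral_distr[symmetric, OF m']) auto
 also have "... = (LI p. foldE V F p)"
 unfolding energy_distr[OF V] by (subst integral_density[OF _ _ nn']) (simp_all add: ab del: real_scaleR_def)
 finally show "(LI p. foldE V F p) = (LI p. F p)" ..
qed

section \<open>Compactly supported C^1 functions and primitives on the line\<close>

text \<open>Function and derivative travel as a pair because both occur in every weak identity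
  below.\<close>

definition C1c :: "(real => real) => (real => real) => bool" where
 "C1c f f' \<longleftrightarrow> (\<forall>x. (f has_real_derivative f' x) (at x)) & continuous_on UNIV f' &
 (\<exists>R. \<forall>x. %%x%% >= R --> f x = 0 & f' x = 0)"

lemma C1cD:
 assumes "C1c f f'"
 shows "(f has_real_derivative f' x) (at x)" "continuous_on UNIV f'" "continuous_on UNIV f"
 "f \<in> bm" "f' \<in> bm"
proof -
 show 1: "(f has_real_derivative f' x) (at x)" "continuous_on UNIV f'" for x using assms by (auto simp: C1c_def)
 show 2: "continuous_on UNIV f"
 using 1(1) by (intro continuous_at_imp_continuous_on) (auto intro: DERIV_isCont)
 show "f \<in> bm" "f' \<in> bm"
 using 1 2 by (auto intro: bm_cont)
qed

lemma C1c_support: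
 assumes "C1c f f'"
 obtains R where "R > 0" "!!x. %%x%% >= R ==> f x = 0 & f' x = 0"
proof -
 obtain R where "!!x. %%x%% >= R ==> f x = 0 & f' x = 0" using assms by (auto simp: C1c_def)
 then show thesis by (intro that[of "max R 1"]) auto
qed

lemma continuous_compact_support_bounded:
 fixes f :: "real => real"
 assumes "continuous_on UNIV f" "!!x. %%x%% >= R ==> f x = 0"
 obtains K where "K >= 0" "!!x. %%f x%% <= K"
proof -
 have "bounded (f ` {-R..R})"
 by (intro compact_imp_bounded compact_continuous_image continuous_on_subset[OF assms(1)]) auto
 then obtain K where K: "!!x. x \<in> {-R..R} ==> %%f x%% <= K" unfolding bounded_iff by fastforce
 have "%%f x%% <= %%K%%" for x
 proof (cases "%%x%% >= R")
 case False
 then show ?thesis using K[of x] by (simp add: abs_le_iff) linarith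
 qed (use assms(2)[of x] in simp)
 then show thesis by (intro that[of "%%K%%"]) auto
qed

lemma C1c_bounded:
 assumes "C1c f f'"
 obtains K where "K >= 0" "!!x. %%f x%% <= K" "!!x. %%f' x%% <= K"
proof -
 obtain R where R: "!!x. %%x%% >= R ==> f x = 0 & f' x = 0" using C1c_support[OF assms] by blast
 obtain K where "K >= 0" "!!x. %%f x%% <= K"
 by (rule continuous_compact_support_bounded[OF C1cD(3)[OF assms], of R]) (use R in auto)
 moreover obtain L where "L >= 0" "!!x. %%f' x%% <= L"
 by (rule continuous_compact_support_bounded[OF C1cD(2)[OF assms], of R]) (use R in auto)
 ultimately show thesis by (intro that[of "max K L"]) (auto simp: le_max_iff_disj)
qed

lemma C1c_mult:
 assumes "C1c f f'" "C1c g g'"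
 shows "C1c (%x. f x * g x) (%x. f' x * g x + f x * g' x)"
proof -
 obtain R where R: "!!x. %%x%% >= R ==> f x = 0 & f' x = 0" using C1c_support[OF assms(1)] by blast
 show ?thesis
 unfolding C1c_def
 proof (intro conjI allI exI[of _ R] impI)
 show "((%x. f x * g x) has_real_derivative f' x * g x + f x * g' x) (at x)" for x
 using DERIV_mult[OF C1cD(1)[OF assms(1)] C1cD(1)[OF assms(2)], of x] by (simp add: algebra_simps)
 show "continuous_on UNIV (%x. f' x * g x + f x * g' x)"
 using C1cD(2,3)[OF assms(1)] C1cD(2,3)[OF assms(2)] by (intro continuous_intros)
 qed (use R in auto)
qed

lemma C1c_plateau_exists:
 assumes "R > 0"
 obtains kp kp' where "C1c kp kp'" "!!x. %%x%% <= R ==> kp x = 1" "!!x. %%x%% <= R ==> kp' x = 0"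
 "!!x. 0 <= kp x & kp x <= 1" "!!x. %%x%% >= 2 * R ==> kp x = 0 & kp' x = 0"
proof -
 obtain kp :: "real => real" where kp: "smooth kp" "!!x. %%x%% <= 2 * R / 2 ==> kp x = 1" "!!x. %%x%% >= 2 * R ==> kp x = 0"
 "!!x. 0 <= kp x & kp x <= 1"
 using smooth_plateau_exists[of "2 * R"] assms by (metis mult_pos_pos zero_less_numeral)
 define kp' where "kp' x = frechet_derivative kp (at x) 1" for x
 have d: "(kp has_real_derivative kp' x) (at x)" for x
 proof -
 have d: "(kp has_derivative frechet_derivative kp (at x)) (at x)"
 using kp(1) C_k_Suc_has_derivative unfolding smooth_def by blast
 have "frechet_derivative kp (at x) h = kp' x * h" for h
 using linear_scale[OF has_derivative_linear[OF d], of h 1] by (simp add: kp'_def)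
 then have "frechet_derivative kp (at x) = (*) (kp' x)" by (rule ext)
 then show ?thesis using d by (simp add: has_field_derivative_def)
 qed
 have "smooth kp'"
 using kp(1) unfolding smooth_def kp'_def[abs_def] by (metis C_k.simps(2))
 note c = smooth_continuous[OF this]
 \<comment> \<open>At plateau points, edges included, \<open>kp\<close> attains its maximal value 1,
   so the derivative vanishes; likewise for the value 0 in \<open>z2\<close>.\<close>
 have z1: "kp' x = 0" if "%%x%% <= R" for x
 proof (rule DERIV_local_max[OF d[of x], of 1])
 show "\<forall>y. %%x - y%% < 1 --> kp y <= kp x" using kp(2)[of x] kp(4) that by simp
 qed simp
 have z2: "kp' x = 0" if "%%x%% >= 2 * R" for x
 proof (rule DERIV_local_min[OF d[of x], of 1])
 show "\<forall>y. %%x - y%% < 1 --> kp x <= kp y" using kp(3)[of x] kp(4) that by simp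
 qed simp
 show thesis
 proof (rule that[of kp kp'])
 show "C1c kp kp'" unfolding C1c_def using d c z2 kp(3) by (intro conjI allI exI[of _ "2*R"]) auto
 qed (use kp z1 z2 in auto)
qed

lemma continuous_antiderivative:
 fixes f :: "real => real"
 assumes "continuous_on UNIV f"
 obtains F where "!!x. (F has_real_derivative f x) (at x)"
proof -
 have "isCont f x" for x using assms by (simp add: continuous_on_eq_continuous_at)
 then have "\<exists>F. \<forall>x :: real. (-\<infinity> :: ereal) < x --> x < (\<infinity>::ereal) --> (F has_vector_derivative f x) (at x)"
 by (intro einterval_antiderivative) auto
 then show thesis using that by (auto simp: has_real_derivative_iff_has_vector_derivative)
qed

lemma FTC_LINT:
 fixes F f :: "real => real"
 assumes "a <= b" "!!x. (F has_real_derivative f x) (at x)" "continuous_on UNIV f"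
 shows "(LI x. indicator {a..b} x * f x) = F b - F a"
proof -
 have "(LI s. indicator {a..b} s *\<^sub>R f s) = F b - F a"
 by (rule integral_FTC_atLeastAtMost[OF assms(1)])
 (use assms(2,3) in \<open>auto simp: has_real_derivative_iff_has_vector_derivative[symmetric]
 intro: has_field_derivative_at_within continuous_on_subset\<close>)
 then show ?thesis by simp
qed

lemma C1c_tail_integral:
 assumes "C1c xs xs'"
 shows "(LI x. indicator {z<..} x * xs' x) = - xs z"
proof -
 obtain R where R: "R > 0" "!!x. %%x%% >= R ==> xs x = 0 & xs' x = 0" using C1c_support[OF assms] by blast
 have "(LI x. indicator {z<..} x * xs' x) = (LI x. indicator {z..max z R} x * xs' x)"
 by (intro integral_cong_AE eventually_mono[OF AE_lborel_singleton[of z]])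
 (use C1cD(5)[OF assms] R in \<open>auto simp: indicator_def not_le\<close>)
 also have "... = xs (max z R) - xs z" by (rule FTC_LINT) (use C1cD[OF assms] in auto)
 finally show ?thesis using R(2)[of "max z R"] R(1) by simp
qed

lemma integrable_bdd_mult:
 fixes f h :: "'a => real"
 assumes "integrable M f" "h \<in> borel_measurable M" "!!x. %%h x%% <= K"
 shows "integrable M (%x. h x * f x)"
proof (rule lint_bound[OF integrable_mult_right[OF integrable_abs[OF assms(1)], of K]])
 show "AE x in M. norm (h x * f x) <= norm (K * %%f x%%)"
 proof (rule AE_I2)
 fix x
 have "%%h x%% * %%f x%% <= %%K%% * %%f x%%" using assms(3)[of x] by (intro mult_right_mono) auto
 then show "norm (h x * f x) <= norm (K * %%f x%%)" by (simp add: abs_mult)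
 qed
qed (use assms in measurable)

text \<open>Fubini on {z < x}: the integral of \<open>xs'\<close> beyond z is - xs z.\<close>

lemma primitive_IBP:
 assumes c: "intgr c" and xs: "C1c xs xs'"
 shows "(LI x. xs' x * (LI z. indicator {..<x} z * c z)) = - (LI x. xs x * c x)"
proof -
 have [measurable]: "c \<in> bm" "xs' \<in> bm" using c C1cD[OF xs] by auto
 obtain R where R: "R > 0" "!!x. %%x%% >= R ==> xs x = 0 & xs' x = 0" using C1c_support[OF xs] by blast
 have "intgr (%x. ivl R x * xs' x)" by (rule integrable_ivl_continuous[OF C1cD(2)[OF xs]])
 moreover have "ivl R x * xs' x = xs' x" for x using R(2)[of x] by (cases "%%x%% >= R") (auto simp: indicator_def)
 ultimately have xsi: "intgr xs'" by simp
 have I: "integrable (lborel \<Otimes>\<^sub>M lborel) (%(x, z). indicator {..<x} z * (xs' x * c z))"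
 unfolding lborel_prod split_def
 by (rule integrable_bdd_mult[where K=1])
 (use integrable_lborel_prod_mult[OF xsi c] in \<open>auto simp: indicator_def\<close>)
 have "(LI x. xs' x * (LI z. indicator {..<x} z * c z)) = (LI x. LI z. indicator {..<x} z * (xs' x * c z))"
 by (simp flip: integral_mult_right_zero add: mult.left_commute)
 also have "... = (LI z. LI x. indicator {..<x} z * (xs' x * c z))"
 by (rule lborel_pair.Fubini_integral[OF I, symmetric])
 also have "... = (LI z. c z * (LI x. indicator {z<..} x * xs' x))"
 by (simp flip: integral_mult_right_zero) (intro lint_cong refl, auto simp: indicator_def)
 also have "... = - (LI x. xs x * c x)"
 unfolding C1c_tail_integral[OF xs] by (simp add: mult.commute)
 finally show ?thesis .
qed

text \<open>The product is a double integral over z, w < x. Splitting it along w < z and z <= w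
  yields the two terms of the Leibniz rule without differentiating a primitive pointwise.\<close>

lemma primitive_mult:
 fixes a b :: "real => real"
 assumes a: "intgr a" and b: "intgr b"
 defines "\<alpha> \<equiv> %x. LI z. indicator {..<x} z * a z" and "\<beta> \<equiv> %x. LI z. indicator {..<x} z * b z"
 shows "\<alpha> x * \<beta> x = (LI z. indicator {..<x} z * (a z * \<beta> z + \<alpha> z * b z))"
 and "intgr (%z. a z * \<beta> z + \<alpha> z * b z)"
proof -
 have [measurable]: "a \<in> bm" "b \<in> bm" using a b by auto
 have prim: "(%x. LI z. indicator {..<x} z * c z) \<in> bm &
 (\<forall>x. %%LI z. indicator {..<x} z * c z%% <= (LI z. %%c z%%))" if c: "intgr c" for c :: "real => real"
 proof (intro conjI allI)
 have [measurable]: "c \<in> bm" using c by auto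
 have "(%(x, z). indicator {..<x} z * c z) \<in> borel_measurable (lborel \<Otimes>\<^sub>M lborel)"
 unfolding lborel_prod split_def indicator_def by (simp only: lessThan_iff) measurable
 from lborel.borel_measurable_lebesgue_integral[OF this]
 show "(%x. LI z. indicator {..<x} z * c z) \<in> bm" by simp
 fix x
 have "%%LI z. indicator {..<x} z * c z%% <= (LI z. %%indicator {..<x} z * c z%%)" by (rule integral_abs_bound)
 also have "... <= (LI z. %%c z%%)"
 by (rule integral_mono') (use c in \<open>auto simp: indicator_def\<close>)
 finally show "%%LI z. indicator {..<x} z * c z%% <= (LI z. %%c z%%)" .
 qed
 have [measurable]: "\<alpha> \<in> bm" "\<beta> \<in> bm"
 using prim[OF a] prim[OF b] by (auto simp: \<alpha>_def \<beta>_def)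
 have i1: "intgr (%z. \<beta> z * a z)"
 by (rule integrable_bdd_mult[OF a]) (use prim[OF b] in \<open>auto simp: \<beta>_def\<close>)
 have i2: "intgr (%z. \<alpha> z * b z)"
 by (rule integrable_bdd_mult[OF b]) (use prim[OF a] in \<open>auto simp: \<alpha>_def\<close>)
 show "intgr (%z. a z * \<beta> z + \<alpha> z * b z)"
 using lint_add[OF i1 i2] by (simp add: mult.commute)
 have P: "integrable (lborel \<Otimes>\<^sub>M lborel) (%p. a (fst p) * b (snd p))"
 unfolding lborel_prod by (rule integrable_lborel_prod_mult[OF a b])
 have I: "integrable (lborel \<Otimes>\<^sub>M lborel) (%p. h p * (a (fst p) * b (snd p)))"
 if [measurable]: "h \<in> bm" and "!!p. %%h p%% <= 1" for h
 by (rule integrable_bdd_mult[OF P, where K=1]) (use that in \<open>auto simp: lborel_prod\<close>)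
 let ?lt = "%p::R2. if snd p < fst p & fst p < x then 1 else 0 :: real"
 let ?ge = "%p::R2. if fst p <= snd p & snd p < x then 1 else 0 :: real"
 have I1: "integrable (lborel \<Otimes>\<^sub>M lborel) (%p. ?lt p * (a (fst p) * b (snd p)))"
 by (rule I) auto
 have I2: "integrable (lborel \<Otimes>\<^sub>M lborel) (%p. ?ge p * (a (fst p) * b (snd p)))"
 by (rule I) auto
 have I3: "integrable (lborel \<Otimes>\<^sub>M lborel) (%p. ?lt p * (a (fst p) * b (snd p)) + ?ge p * (a (fst p) * b (snd p)))"
 by (rule lint_add[OF I1 I2])
 have ae: "AE z in lborel. z ~= w" for w :: real by (rule AE_lborel_singleton)
 have "\<alpha> x * \<beta> x = (LI z. (indicator {..<x} z * a z) * \<beta> x)" by (simp add: \<alpha>_def)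
 also have "... = (LI z. LI w. ?lt (z, w) * (a z * b w) + ?ge (z, w) * (a z * b w))"
 unfolding \<beta>_def by (simp flip: integral_mult_right_zero)
 (intro lint_cong refl, auto simp: indicator_def)
 also have "... = (LINT p|(lborel \<Otimes>\<^sub>M lborel). ?lt p * (a (fst p) * b (snd p)) + ?ge p * (a (fst p) * b (snd p)))"
 using lborel_pair.integral_fst'[OF I3] by simp
 also have "... = (LINT p|(lborel \<Otimes>\<^sub>M lborel). ?lt p * (a (fst p) * b (snd p))) +
 (LINT p|(lborel \<Otimes>\<^sub>M lborel). ?ge p * (a (fst p) * b (snd p)))"
 by (rule Bochner_Integration.integral_add[OF I1 I2])
 also have "(LINT p|(lborel \<Otimes>\<^sub>M lborel). ?lt p * (a (fst p) * b (snd p))) = (LI z. LI w. ?lt (z, w) * (a z * b w))"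
 using lborel_pair.integral_fst'[OF I1] by simp
 also have "... = (LI z. indicator {..<x} z * (\<beta> z * a z))"
 unfolding \<beta>_def by (simp flip: integral_mult_right_zero integral_mult_left_zero)
 (intro lint_cong refl, auto simp: indicator_def)
 also have "(LINT p|(lborel \<Otimes>\<^sub>M lborel). ?ge p * (a (fst p) * b (snd p))) = (LI w. LI z. ?ge (z, w) * (a z * b w))"
 using lborel_pair.integral_snd[of "%z w. ?ge (z, w) * (a z * b w)"] I2 by (simp add: split_def)
 also have "... = (LI w. indicator {..<x} w * (\<alpha> w * b w))"
 proof (intro lint_cong refl)
 fix w
 have "(LI z. ?ge (z, w) * (a z * b w)) = (LI z. indicator {..<x} w * ((indicator {..<w} z * a z) * b w))"
 by (intro integral_cong_AE eventually_mono[OF ae[of w]]) (auto simp: indicator_def)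
 also have "... = indicator {..<x} w * (\<alpha> w * b w)" by (simp add: \<alpha>_def)
 finally show "(LI z. ?ge (z, w) * (a z * b w)) = indicator {..<x} w * (\<alpha> w * b w)" .
 qed
 also have "(LI z. indicator {..<x} z * (\<beta> z * a z)) + (LI w. indicator {..<x} w * (\<alpha> w * b w)) =
 (LI z. indicator {..<x} z * (\<beta> z * a z) + indicator {..<x} z * (\<alpha> z * b z))"
 by (rule Bochner_Integration.integral_add[symmetric])
 (auto intro!: integrable_bdd_mult[OF i1, of _ 1] integrable_bdd_mult[OF i2, of _ 1] simp: indicator_def)
 also have "... = (LI z. indicator {..<x} z * (a z * \<beta> z + \<alpha> z * b z))"
 by (simp add: algebra_simps)
 finally show "\<alpha> x * \<beta> x = (LI z. indicator {..<x} z * (a z * \<beta> z + \<alpha> z * b z))" .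
qed

lemma smooth_real_derivative:
 fixes f :: "real => real"
 assumes "smooth f"
 obtains f' where "!!x. (f has_real_derivative f' x) (at x)" "smooth f'"
proof -
 define f' where "f' x = frechet_derivative f (at x) 1" for x
 have d: "(f has_real_derivative f' x) (at x)" for x
 proof -
 have d: "(f has_derivative frechet_derivative f (at x)) (at x)"
 using assms C_k_Suc_has_derivative unfolding smooth_def by blast
 have "frechet_derivative f (at x) h = f' x * h" for h
 using linear_scale[OF has_derivative_linear[OF d], of h 1] by (simp add: f'_def)
 then have "frechet_derivative f (at x) = (*) (f' x)" by (rule ext)
 then show ?thesis using d by (simp add: has_field_derivative_def)
 qed
 have "smooth f'"
 using assms unfolding smooth_def f'_def[abs_def] by (metis C_k.simps(2))
 with d that show thesis by blast
qed

lemma C1c_approx_interval: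
 fixes a b :: real
 obtains zt zt' where "!!n::nat. C1c (zt n) (zt' n)" "!!n x. 0 <= zt n x & zt n x <= 1"
 "!!x. (%n. zt n x) ----> indicator {a<..<b} x" "!!n x. x \<notin> {a<..<b} ==> zt n x = 0"
proof -
 obtain s :: "real => real" where s: "smooth s" "!!x. x <= 0 ==> s x = 0" "!!x. x >= 1 ==> s x = 1"
 "!!x. 0 <= s x & s x <= 1" by (rule smooth_step_exists) blast
 define zt where "zt n x = s (real n * (x - a)) * s (real n * (b - x))" for n x
 have z: "zt n x = 0" if "x \<notin> {a<..<b}" for n x
 proof -
 have "real n * (x - a) <= 0 | real n * (b - x) <= 0"
 using that by (auto simp: mult_le_0_iff not_less)
 then show ?thesis using s(2) by (auto simp: zt_def)
 qed
 have sm: "smooth (zt n)" for n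
 proof -
 have "smooth (%x. s (real n * x + (- real n * a)) * s ((- real n) * x + real n * b))"
 by (intro smooth_mult smooth_comp[OF s(1)] smooth_add smooth_const smooth_linear bounded_linear_ident)
 then show ?thesis unfolding zt_def[abs_def] by (simp add: algebra_simps)
 qed
 have "\<exists>zt'. C1c (zt n) zt'" for n
 proof -
 obtain f' where f': "!!x. (zt n has_real_derivative f' x) (at x)" "smooth f'"
 using smooth_real_derivative[OF sm] by blast
 have z': "f' x = 0" if "x \<notin> {a<..<b}" for x
 proof (rule DERIV_local_min[OF f'(1)[of x], of 1])
 show "\<forall>y. %%x - y%% < 1 --> zt n x <= zt n y"
 unfolding z[OF that] using s(4) by (simp add: zt_def)
 qed simp
 have out: "x \<notin> {a<..<b}" if "%%x%% >= %%a%% + %%b%%" for x using that by auto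
 show ?thesis
 unfolding C1c_def
 by (intro exI[of _ f'] conjI allI f' smooth_continuous exI[of _ "%%a%% + %%b%%"] impI z z' out)
 qed
 then obtain zt' where "!!n. C1c (zt n) (zt' n)" by metis
 moreover have "(%n. zt n x) ----> indicator {a<..<b} x" for x
 proof (cases "x \<in> {a<..<b}")
 case True
 obtain m where m: "1 / (x - a) + 1 / (b - x) <= real m" using real_arch_simple by blast
 have "eventually (%n. zt n x = indicator {a<..<b} x) sequentially"
 using eventually_ge_at_top[of m]
 proof eventually_elim
 case (elim n)
 then have n: "1 / (x - a) + 1 / (b - x) <= real n" using m by linarith
 have p: "1 / (x - a) > 0" "1 / (b - x) > 0" using True by auto
 have "1 / (x - a) <= real n" "1 / (b - x) <= real n" using n p by linarith+
 then have "1 <= real n * (x - a)" "1 <= real n * (b - x)"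
 using True by (simp_all add: divide_le_eq)
 then show ?case using True s(3) by (simp add: zt_def)
 qed
 then show ?thesis by (rule tendsto_eventually)
 next
 case False
 then show ?thesis using z by simp
 qed
 moreover have "0 <= zt n x & zt n x <= 1" for n x
 using s(4) by (auto simp: zt_def intro: mult_le_one)
 ultimately show thesis using that z by blast
qed

lemma box_prod_real: "box l u = {fst l<..<fst u} \<times> {snd l<..<snd (u :: R2)}"
 by (cases l; cases u) (auto simp: box_def Basis_prod_def)

text \<open>The positive and the negative part of \<open>W\<close> have the same integral over every box.\<close>

lemma AE_zero_box:
 fixes W :: "R2 => real"
 assumes W: "intgr W" and box: "!!l u. (LI p. indicator (box l u) p * W p) = 0"
 shows "AE p in lborel. W p = 0"
proof -
 have [measurable]: "W \<in> bm" using W by auto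
 define P N where "P p = max 0 (W p)" and "N p = max 0 (- W p)" for p
 have Pm[measurable]: "P \<in> bm" and Nm[measurable]: "N \<in> bm"
 unfolding P_def N_def by measurable
 have Pi: "intgr P" "intgr N"
 by (rule lint_bound[OF W]; auto simp: P_def N_def)+
 have em: "emeasure (density lborel (%p. ennreal (F p))) B = ennreal (LI p. indicator B p * F p)"
 if "intgr F" "!!p. F p >= 0" and [measurable]: "B \<in> sets borel" for F :: "R2 => real" and B
 proof -
 have [measurable]: "F \<in> bm" using that by auto
 have "emeasure (density lborel (%p. ennreal (F p))) B = (\<integral>\<^sup>+p. ennreal (indicator B p * F p) \<partial>lborel)"
 by (subst emeasure_density) (auto intro!: nn_integral_cong simp: indicator_def)
 also have "... = ennreal (LI p. indicator B p * F p)"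
 by (rule nn_integral_eq_integral)
 (use that in \<open>auto intro!: integrable_bdd_mult[OF that(1), of _ 1] simp: indicator_def\<close>)
 finally show ?thesis .
 qed
 have "density lborel (%p. ennreal (P p)) = density lborel (%p. ennreal (N p))"
 proof (rule measure_eqI_generator_eq)
 let ?E = "range (%(l, u). box l u :: (R2) set)"
 show "Int_stable ?E" by (auto simp: Int_stable_def box_Int_box)
 show "?E \<subseteq> Pow UNIV" by simp
 show "sets (density lborel (%p. ennreal (P p))) = sigma_sets UNIV ?E"
 "sets (density lborel (%p. ennreal (N p))) = sigma_sets UNIV ?E"
 by (simp_all add: borel_eq_box)
 let ?A = "%n::nat. box (- (real n *\<^sub>R One)) (real n *\<^sub>R One) :: (R2) set"
 show "range ?A \<subseteq> ?E" by auto
 show "\<Union> (range ?A) = UNIV" by (rule UN_box_eq_UNIV)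
 show "emeasure (density lborel (%p. ennreal (P p))) (?A n) ~= \<infinity>" for n
 by (subst em[OF Pi(1)]) (auto simp: P_def)
 show "emeasure (density lborel (%p. ennreal (P p))) X = emeasure (density lborel (%p. ennreal (N p))) X" if XE: "X \<in> ?E" for X
 proof -
 obtain l u where X: "X = box l u" using XE by auto
 have i: "intgr (%p. indicator X p * F p)" if "intgr F" for F :: "R2 => real"
 by (rule integrable_bdd_mult[OF that, of _ 1]) (auto simp: X indicator_def)
 have "(LI p. indicator X p * P p) - (LI p. indicator X p * N p) = (LI p. indicator X p * P p - indicator X p * N p)"
 by (rule Bochner_Integration.integral_diff[OF i[OF Pi(1)] i[OF Pi(2)], symmetric])
 also have "... = (LI p. indicator X p * W p)"
 by (intro lint_cong refl) (auto simp: P_def N_def indicator_def max_def)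
 finally have "(LI p. indicator X p * P p) = (LI p. indicator X p * N p)" using box X by simp
 then show ?thesis
 by (subst (1 2) em) (use Pi in \<open>auto simp: X P_def N_def\<close>)
 qed
 qed
 then have "AE p in lborel. ennreal (P p) = ennreal (N p)"
 by (intro sigma_finite_measure.density_unique[OF sigma_finite_lborel]) auto
 then show ?thesis by eventually_elim (auto simp: P_def N_def max_def split: if_splits)
qed

text \<open>Products of C^1 bumps converge boundedly to indicators of open boxes, which reduces the
  claim to \<open>AE_zero_box\<close> on each of countably many boxes.\<close>

lemma AE_zero_product_tests:
 fixes W :: "R2 => real"
 assumes [measurable]: "W \<in> bm"
 and int: "!!N. intgr (%p. ivl N (fst p) * ivl N (snd p) * W p)"
 and test: "!!zt zt' g g'. C1c zt zt' ==> C1c g g' ==> (LI p. zt (fst p) * g (snd p) * W p) = 0"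
 shows "AE p in lborel. W p = 0"
proof -
 have box: "(LI p. indicator {a<..<b} (fst p) * indicator {c<..<d} (snd p) * W p) = 0" for a b c d
 proof -
 obtain zt zt' where z: "!!n::nat. C1c (zt n) (zt' n)" "!!n x. 0 <= zt n x & zt n x <= 1"
 "!!x. (%n. zt n x) ----> indicator {a<..<b} x" "!!n x. x \<notin> {a<..<b} ==> zt n x = 0"
 by (rule C1c_approx_interval[of a b]) blast
 obtain g g' where g: "!!n::nat. C1c (g n) (g' n)" "!!n x. 0 <= g n x & g n x <= 1"
 "!!x. (%n. g n x) ----> indicator {c<..<d} x" "!!n x. x \<notin> {c<..<d} ==> g n x = 0"
 by (rule C1c_approx_interval[of c d]) blast
 note [measurable] = C1cD(4)[OF z(1)] C1cD(4)[OF g(1)]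
 define N where "N = %%a%% + %%b%% + %%c%% + %%d%%"
 have "(%n. LI p. zt n (fst p) * g n (snd p) * W p) ----> (LI p. indicator {a<..<b} (fst p) * indicator {c<..<d} (snd p) * W p)"
 proof (rule dct)
 show "intgr (%p. %%ivl N (fst p) * ivl N (snd p) * W p%%)" using int by (rule integrable_abs)
 show "AE p in lborel. (%n. zt n (fst p) * g n (snd p) * W p) ----> indicator {a<..<b} (fst p) * indicator {c<..<d} (snd p) * W p"
 by (intro AE_I2 tendsto_intros z g)
 show "AE p in lborel. norm (zt n (fst p) * g n (snd p) * W p) <= %%ivl N (fst p) * ivl N (snd p) * W p%%" for n
 proof (rule AE_I2)
 fix p :: "R2"
 show "norm (zt n (fst p) * g n (snd p) * W p) <= %%ivl N (fst p) * ivl N (snd p) * W p%%"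
 proof (cases "fst p \<in> {a<..<b} & snd p \<in> {c<..<d}")
 case True
 then have "fst p \<in> {-N..N}" "snd p \<in> {-N..N}" by (auto simp: N_def)
 moreover have "%%zt n (fst p) * g n (snd p)%% <= 1" using z(2)[of n "fst p"] g(2)[of n "snd p"]
 by (simp add: abs_mult mult_le_one)
 ultimately show ?thesis by (simp add: abs_mult[of _ "W p"] mult_left_le_one_le)
 next
 case False
 then show ?thesis using z(4) g(4) by auto
 qed
 qed
 qed measurable
 moreover have "(LI p. zt n (fst p) * g n (snd p) * W p) = 0" for n by (rule test[OF z(1) g(1)])
 ultimately show ?thesis by (simp add: LIMSEQ_const_iff)
 qed
 have "AE p in lborel. \<forall>n::nat. indicator {-real n<..<real n} (fst p) * indicator {-real n<..<real n} (snd p) * W p = 0"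
 unfolding AE_all_countable
 proof
 fix n :: nat
 show "AE p in lborel. indicator {-real n<..<real n} (fst p) * indicator {-real n<..<real n} (snd p) * W p = 0"
 proof (rule AE_zero_box)
 show "intgr (%p. indicator {-real n<..<real n} (fst p) * indicator {-real n<..<real n} (snd p) * W p)"
 by (rule lint_bound[OF int[of "real n"]]) (auto simp: indicator_def)
 show "(LI p. indicator (box l u) p * (indicator {-real n<..<real n} (fst p) * indicator {-real n<..<real n} (snd p) * W p)) = 0" for l u
 proof -
 have "(LI p. indicator (box l u) p * (indicator {-real n<..<real n} (fst p) * indicator {-real n<..<real n} (snd p) * W p))
 = (LI p. indicator {max (fst l) (-real n)<..<min (fst u) (real n)} (fst p) * indicator {max (snd l) (-real n)<..<min (snd u) (real n)} (snd p) * W p)"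
 by (intro lint_cong refl) (auto simp: indicator_def box_prod_real mem_Times_iff)
 then show ?thesis using box by simp
 qed
 qed
 qed
 then show ?thesis
 proof eventually_elim
 case (elim p)
 obtain n where "%%fst p%% + %%snd p%% < real n" using reals_Archimedean2 by blast
 then have "fst p \<in> {-real n<..<real n}" "snd p \<in> {-real n<..<real n}" by auto
 then show ?case using elim[rule_format, of n] by simp
 qed
qed

section \<open>Energy slices and distributional x-derivatives\<close>

lemma lborel_integral_snd:
 fixes f :: "R2 => real"
 assumes "intgr f"
 shows "(LI p. f p) = (LI E. LI x. f (x, E))" "AE E in lborel. intgr (%x. f (x, E))"
 "intgr (%E. LI x. f (x, E))"
proof -
 have f: "integrable (lborel \<Otimes>\<^sub>M lborel) (%(x, E). f (x, E))" using assms by (simp add: lborel_prod)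
 show "(LI p. f p) = (LI E. LI x. f (x, E))"
 using lborel_pair.integral_snd[OF f] by (simp add: lborel_prod)
 show "AE E in lborel. intgr (%x. f (x, E))" by (rule lborel_pair.AE_integrable_snd[OF f])
 show "intgr (%E. LI x. f (x, E))" by (rule lborel_pair.integrable_snd[OF f])
qed

lemma lborel_integral_fst:
 fixes f :: "R2 => real"
 assumes "intgr f"
 shows "(LI p. f p) = (LI x. LI E. f (x, E))"
 using lborel_pair.integral_fst'[of f] assms by (simp add: lborel_prod)

lemma AE_lborel_pair_swap:
 fixes P :: "R2 => bool"
 assumes [measurable]: "Measurable.pred borel P" and "AE p in lborel. P p"
 shows "AE x in lborel. AE E in lborel. P (x, E)" "AE E in lborel. AE x in lborel. P (x, E)"
proof -
 show 1: "AE x in lborel. AE E in lborel. P (x, E)"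
 using lborel_pair.AE_pair[of P] assms(2) unfolding lborel_prod by blast
 have "{p \<in> space (lborel \<Otimes>\<^sub>M lborel). P (fst p, snd p)} \<in> sets (lborel \<Otimes>\<^sub>M lborel)"
 unfolding lborel_prod by simp
 from lborel_pair.AE_commute[OF this] 1 show "AE E in lborel. AE x in lborel. P (x, E)" by simp
qed

definition primE :: "(R2 => real) => R2 => real" where
 "primE A p = (LI z. indicator {..<fst p} z * A (z, snd p))"

lemma borel_measurable_primE [measurable]:
 assumes [measurable]: "A \<in> bm"
 shows "primE A \<in> bm"
proof -
 have "(%(p, z). indicator {..<fst p} z * A (z, snd p)) \<in> borel_measurable ((lborel :: (R2) measure) \<Otimes>\<^sub>M lborel)"
 unfolding lborel_prod split_def indicator_def by (simp only: lessThan_iff) measurable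
 from lborel.borel_measurable_lebesgue_integral[OF this] show ?thesis by (simp add: primE_def[abs_def])
qed

text \<open>\<open>dxE R A A'\<close>: \<open>\<partial>\<^sub>x A = A'\<close> in the sense of distributions in the variables \<open>(x, E)\<close>, for functions
 supported in \<open>\<bar>x\<bar> \<le> R\<close>.\<close>

definition dxE :: "real => (R2 => real) => (R2 => real) => bool" where
 "dxE R A A' \<longleftrightarrow> A \<in> bm & A' \<in> bm &
 (\<forall>p. %%fst p%% > R --> A p = 0 & A' p = 0) &
 (\<forall>N. intgr (%p. ivl N (snd p) * A p)) & (\<forall>N. intgr (%p. ivl N (snd p) * A' p)) &
 (\<forall>xs xs' g g'. C1c xs xs' --> C1c g g' --> (LI p. g (snd p) * (xs' (fst p) * A p + xs (fst p) * A' p)) = 0)"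

lemma dxE_slice_integrable:
 assumes "dxE R A A'"
 shows "AE E in lborel. intgr (%x. A' (x, E))"
proof -
 have "AE E in lborel. \<forall>n::nat. intgr (%x. ivl (real n) E * A' (x, E))"
 unfolding AE_all_countable
 using lborel_integral_snd(2)[of "%p. ivl _ (snd p) * A' p"] assms by (simp add: dxE_def)
 then show ?thesis
 proof eventually_elim
 case (elim E)
 obtain n where "%%E%% <= real n" using real_arch_simple by blast
 then have "ivl (real n) E = 1" by (auto simp: indicator_def)
 then show ?case using elim[rule_format, of n] by simp
 qed
qed

text \<open>Distributional derivatives determine a function up to a constant on each level E, and
  that constant is 0 because \<open>A\<close> vanishes for x < -R.\<close>

lemma dxE_AE_eq:
 assumes d: "dxE R A A'" and R: "R > 0"
 shows "AE p in lborel. A p = primE A' p"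
proof -
 have [measurable]: "A \<in> bm" "A' \<in> bm"
 and van: "!!p. %%fst p%% > R ==> A p = 0 & A' p = 0"
 and Ai: "!!N. intgr (%p. ivl N (snd p) * A p)" and A'i: "!!N. intgr (%p. ivl N (snd p) * A' p)"
 and tst: "!!xs xs' g g'. C1c xs xs' ==> C1c g g' ==> (LI p. g (snd p) * (xs' (fst p) * A p + xs (fst p) * A' p)) = 0"
 using d unfolding dxE_def by blast+
 define W where "W p = A p - primE A' p" for p
 have [measurable]: "W \<in> bm" unfolding W_def by measurable
 have pb: "%%ivl N (snd p) * primE A' p%% <= (LI x. %%ivl N (snd p) * A' (x, snd p)%%)" 
 if "intgr (%x. ivl N (snd p) * A' (x, snd p))" for N p
 proof -
 have "ivl N (snd p) * primE A' p = (LI z. indicator {..<fst p} z * (ivl N (snd p) * A' (z, snd p)))"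
 by (simp add: primE_def mult.left_commute flip: integral_mult_right_zero)
 also have "%%...%% <= (LI z. %%indicator {..<fst p} z * (ivl N (snd p) * A' (z, snd p))%%)" by (rule integral_abs_bound)
 also have "... <= (LI x. %%ivl N (snd p) * A' (x, snd p)%%)"
 by (rule integral_mono') (use that in \<open>auto simp: indicator_def\<close>)
 finally show ?thesis .
 qed
 have Pi: "intgr (%p. ivl L (fst p) * (ivl N (snd p) * primE A' p))" for L N
 proof (rule lint_bound)
 show "intgr (%p. ivl L (fst p) * (LI x. %%ivl N (snd p) * A' (x, snd p)%%))"
 using lborel_integral_snd(3)[OF integrable_abs[OF A'i[of N]]]
 by (intro integrable_lborel_prod_mult[OF integrable_ivl]) simp
 have "AE E in lborel. intgr (%x. ivl N E * A' (x, E))"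
 using lborel_integral_snd(2)[OF A'i[of N]] by simp
 from AE_lborel_snd[OF this, where 'a=real]
 show "AE p in lborel. norm (ivl L (fst p) * (ivl N (snd p) * primE A' p)) <= norm (ivl L (fst p) * (LI x. %%ivl N (snd p) * A' (x, snd p)%%))"
 proof eventually_elim
 case (elim p)
 have "0 <= (LI x. %%ivl N (snd p) * A' (x, snd p)%%)" by (rule lint_nonneg) simp
 then show ?case unfolding norm_mult[of "ivl L (fst p)"] using pb[OF elim] by (intro mult_left_mono) auto
 qed
 qed measurable
 have "AE p in lborel. W p = 0"
 proof (rule AE_zero_product_tests)
 show "intgr (%p. ivl N (fst p) * ivl N (snd p) * W p)" for N
 proof -
 have "intgr (%p. ivl N (fst p) * (ivl N (snd p) * A p))"
 by (rule integrable_bdd_mult[OF Ai, of _ 1]) (auto simp: indicator_def)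
 from lint_diff[OF this Pi[of N N]] show ?thesis by (simp add: W_def algebra_simps)
 qed
 fix zt zt' g g' assume z: "C1c zt zt'" and g: "C1c g g'"
 obtain L where L: "L > 0" "!!x. %%x%% >= L ==> zt x = 0 & zt' x = 0" using C1c_support[OF z] by blast
 obtain Z where Z: "!!x. (Z has_real_derivative zt x) (at x)" using continuous_antiderivative[OF C1cD(3)[OF z]] by blast
 have Zc: "Z x = Z L" if "x >= L" for x
 proof -
 have "Z x - Z L = (LI s. indicator {L..x} s * zt s)" using FTC_LINT[OF that Z C1cD(3)[OF z]] by simp
 also have "... = (LINT s|(lborel :: real measure). 0)"
 by (intro lint_cong refl) (use L in \<open>auto simp: indicator_def\<close>)
 finally show ?thesis by simp
 qed
 define R' where "R' = max R L"
 have R': "R' > 0" "R <= R'" "L <= R'" using L(1) by (auto simp: R'_def)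
 obtain kp kp' where kp: "C1c kp kp'" "!!x. %%x%% <= R' ==> kp x = 1" "!!x. %%x%% <= R' ==> kp' x = 0"
 "!!x. 0 <= kp x & kp x <= 1" "!!x. %%x%% >= 2 * R' ==> kp x = 0 & kp' x = 0"
 using C1c_plateau_exists[OF R'(1)] by blast
 \<comment> \<open>\<open>Z - Z L\<close> is a primitive of \<open>zt\<close> that vanishes for x >=
   L but is constant, in general nonzero, far to the left; \<open>kp\<close> cuts it off there. Then
   \<open>xs\<close> is an admissible test function, and \<open>xs'\<close> equals \<open>zt\<close>
   for all x >= -R', hence also to the right of R, where \<open>primE A'\<close> need not be seen to
   vanish beforehand.\<close>
 define xs xs' where "xs x = (Z x - Z L) * kp x" and "xs' x = zt x * kp x + (Z x - Z L) * kp' x" for x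
 have Zcont: "continuous_on UNIV Z" using Z by (intro continuous_at_imp_continuous_on) (auto intro: DERIV_isCont)
 have xs: "C1c xs xs'"
 unfolding C1c_def
 proof (intro conjI allI exI[of _ "2 * R'"] impI)
 show "(xs has_real_derivative xs' x) (at x)" for x
 unfolding xs_def xs'_def using DERIV_mult[OF DERIV_diff[OF Z[of x] DERIV_const[of "Z L"]] C1cD(1)[OF kp(1), of x]]
 by (simp add: algebra_simps)
 show "continuous_on UNIV xs'" unfolding xs'_def
 using C1cD(2,3)[OF kp(1)] C1cD(3)[OF z] Zcont by (intro continuous_intros)
 qed (use kp(5) in \<open>auto simp: xs_def xs'_def\<close>)
 note [measurable] = C1cD(4,5)[OF xs] C1cD(4,5)[OF z] C1cD(4)[OF g]
 have e1: "xs' x = zt x" if "x >= - R'" for x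
 proof (cases "x <= R'")
 case True
 then show ?thesis using kp(2,3)[of x] that by (simp add: xs'_def abs_le_iff)
 next
 case False
 then have x: "x >= L" "zt x = 0" using L R' by auto
 show ?thesis using Zc[OF x(1)] x(2) by (simp add: xs'_def)
 qed
 have e2: "xs' (fst p) * A p = zt (fst p) * A p" for p
 using e1[of "fst p"] van[of p] R' by (cases "%%fst p%% > R") auto
 have prim0: "primE A' p = 0" if "fst p <= - R" for p
 proof -
 have "primE A' p = (LINT z|(lborel :: real measure). 0)"
 unfolding primE_def by (intro lint_cong refl) (use that van in \<open>simp add: indicator_def\<close>)
 then show ?thesis by simp
 qed
 have e3: "xs' (fst p) * primE A' p = zt (fst p) * primE A' p" for p
 using e1[of "fst p"] prim0[of p] R' by (cases "fst p >= - R'") auto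
 obtain N where N: "N > 0" "!!x. %%x%% >= N ==> g x = 0 & g' x = 0" using C1c_support[OF g] by blast
 obtain G where G: "!!x. %%g x%% <= G" using C1c_bounded[OF g] by metis
 obtain K where K: "!!x. %%xs x%% <= K" "!!x. %%xs' x%% <= K" using C1c_bounded[OF xs] by metis
 have gN: "g E * ivl N E = g E" for E using N(2)[of E] by (cases "%%E%% >= N") (auto simp: indicator_def)
 have xsN: "xs' x * ivl (2*R') x = xs' x" for x
 using kp(5)[of x] by (cases "%%x%% >= 2*R'") (auto simp: indicator_def xs'_def)
 have bdd: "%%u * v%% <= U * V" if "%%u%% <= U" "%%v%% <= V" for u v U V :: real
 using that by (auto simp: abs_mult intro!: mult_mono)
 have i1: "intgr (%p. g (snd p) * xs' (fst p) * A p)"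
 proof -
 have "intgr (%p. (g (snd p) * xs' (fst p)) * (ivl N (snd p) * A p))"
 by (rule integrable_bdd_mult[OF Ai, of _ "G * K"]) (auto intro!: bdd G K)
 moreover have "(g (snd p) * xs' (fst p)) * (ivl N (snd p) * A p) = (g (snd p) * ivl N (snd p)) * xs' (fst p) * A p" for p
 by (simp add: mult_ac)
 ultimately show ?thesis by (simp add: gN)
 qed
 have i2: "intgr (%p. g (snd p) * xs (fst p) * A' p)"
 proof -
 have "intgr (%p. (g (snd p) * xs (fst p)) * (ivl N (snd p) * A' p))"
 by (rule integrable_bdd_mult[OF A'i, of _ "G * K"]) (auto intro!: bdd G K)
 moreover have "(g (snd p) * xs (fst p)) * (ivl N (snd p) * A' p) = (g (snd p) * ivl N (snd p)) * xs (fst p) * A' p" for p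
 by (simp add: mult_ac)
 ultimately show ?thesis by (simp add: gN)
 qed
 have i3: "intgr (%p. g (snd p) * xs' (fst p) * primE A' p)"
 proof -
 have "intgr (%p. (g (snd p) * xs' (fst p)) * (ivl (2*R') (fst p) * (ivl N (snd p) * primE A' p)))"
 by (rule integrable_bdd_mult[OF Pi, of _ "G * K"]) (auto intro!: bdd G K)
 moreover have "(g (snd p) * xs' (fst p)) * (ivl (2*R') (fst p) * (ivl N (snd p) * primE A' p)) = (g (snd p) * ivl N (snd p)) * (xs' (fst p) * ivl (2*R') (fst p)) * primE A' p" for p
 by (simp add: mult_ac)
 ultimately show ?thesis by (simp add: gN xsN)
 qed
 have "(LI p. zt (fst p) * g (snd p) * W p) = (LI p. g (snd p) * xs' (fst p) * A p - g (snd p) * xs' (fst p) * primE A' p)"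
 proof (intro lint_cong refl)
 fix p
 have "zt (fst p) * g (snd p) * W p = g (snd p) * (zt (fst p) * A p) - g (snd p) * (zt (fst p) * primE A' p)"
 by (simp add: W_def algebra_simps)
 also have "... = g (snd p) * xs' (fst p) * A p - g (snd p) * xs' (fst p) * primE A' p"
 unfolding e2[symmetric] e3[symmetric] by (simp add: mult.assoc)
 finally show "zt (fst p) * g (snd p) * W p = g (snd p) * xs' (fst p) * A p - g (snd p) * xs' (fst p) * primE A' p" .
 qed
 also have "... = (LI p. g (snd p) * xs' (fst p) * A p) - (LI p. g (snd p) * xs' (fst p) * primE A' p)"
 by (rule Bochner_Integration.integral_diff[OF i1 i3])
 also have "(LI p. g (snd p) * xs' (fst p) * primE A' p) = (LI E. g E * (LI x. xs' x * primE A' (x, E)))"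
 using lborel_integral_snd(1)[OF i3] by (simp add: mult.assoc)
 also have "... = (LI E. g E * (- (LI x. xs x * A' (x, E))))"
 proof (rule integral_cong_AE)
 show "AE E in lborel. g E * (LI x. xs' x * primE A' (x, E)) = g E * (- (LI x. xs x * A' (x, E)))"
 using dxE_slice_integrable[OF d]
 by eventually_elim (use primitive_IBP[OF _ xs] in \<open>simp add: primE_def\<close>)
 show "(%E. g E * (LI x. xs' x * primE A' (x, E))) \<in> borel_measurable lborel"
 "(%E. g E * (- (LI x. xs x * A' (x, E)))) \<in> borel_measurable lborel"
 using borel_measurable_integrable[OF lborel_integral_snd(3)[OF i3]] borel_measurable_integrable[OF lborel_integral_snd(3)[OF i2]]
 by (simp_all add: mult.assoc)
 qed
 also have "... = - (LI p. g (snd p) * xs (fst p) * A' p)"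
 using lborel_integral_snd(1)[OF i2] by (simp add: mult.assoc)
 also have "(LI p. g (snd p) * xs' (fst p) * A p) - - (LI p. g (snd p) * xs (fst p) * A' p)
 = (LI p. g (snd p) * xs' (fst p) * A p + g (snd p) * xs (fst p) * A' p)"
 using Bochner_Integration.integral_add[OF i1 i2] by simp
 also have "... = 0" using tst[OF xs g] by (simp add: distrib_left mult.assoc)
 finally show "(LI p. zt (fst p) * g (snd p) * W p) = 0" .
 qed measurable
 then show ?thesis by eventually_elim (simp add: W_def)
qed

text \<open>Leibniz rule: on almost every level both factors are primitives of integrable functions,
  so \<open>primitive_mult\<close> and \<open>primitive_IBP\<close> apply to the slice; integration
  over E concludes.\<close>

lemma dxE_mult:
 assumes dA: "dxE R A A'" and dB: "dxE R B B'" and R: "R > 0"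
 and bA: "!!p. %%A p%% <= M" and bB: "!!p. %%B p%% <= M" and xs: "C1c xs xs'" and g: "C1c g g'"
 shows "(LI p. g (snd p) * (xs' (fst p) * (A p * B p) + xs (fst p) * (A' p * B p + A p * B' p))) = 0"
proof -
 have [measurable]: "A \<in> bm" "A' \<in> bm" "B \<in> bm" "B' \<in> bm"
 using dA dB by (auto simp: dxE_def)
 note [measurable] = C1cD(4,5)[OF xs] C1cD(4,5)[OF g]
 obtain N where N: "N > 0" "!!x. %%x%% >= N ==> g x = 0 & g' x = 0" using C1c_support[OF g] by blast
 obtain G where G: "!!x. %%g x%% <= G" using C1c_bounded[OF g] by metis
 obtain K where K: "!!x. %%xs x%% <= K" "!!x. %%xs' x%% <= K" using C1c_bounded[OF xs] by metis
 have gN: "g E * ivl N E = g E" for E using N(2)[of E] by (cases "%%E%% >= N") (auto simp: indicator_def)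
 have bdd: "%%u * v%% <= U * V" if "%%u%% <= U" "%%v%% <= V" for u v U V :: real
 using that by (auto simp: abs_mult intro!: mult_mono)
 have int: "intgr (%p. g (snd p) * (h (fst p) * (D p * F p)))"
 if F: "!!N. intgr (%p. ivl N (snd p) * F p)" and [measurable]: "D \<in> bm" "h \<in> bm"
 and D: "!!p. %%D p%% <= M" and h: "!!x. %%h x%% <= K" for h :: "real => real" and D F :: "R2 => real"
 proof -
 have "intgr (%p. (g (snd p) * (h (fst p) * D p)) * (ivl N (snd p) * F p))"
 by (rule integrable_bdd_mult[OF F, of _ "G * (K * M)"]) (auto intro!: bdd G D h)
 moreover have "(g (snd p) * (h (fst p) * D p)) * (ivl N (snd p) * F p) = (g (snd p) * ivl N (snd p)) * (h (fst p) * (D p * F p))" for p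
 by (simp add: mult_ac)
 ultimately show ?thesis by (simp add: gN)
 qed
 have i1: "intgr (%p. g (snd p) * (xs' (fst p) * (A p * B p)))"
 using int[of B A xs'] dB bA K by (auto simp: dxE_def)
 have i2: "intgr (%p. g (snd p) * (xs (fst p) * (A' p * B p)))"
 using int[of A' B xs] dA bB K by (auto simp: dxE_def mult.commute)
 have i3: "intgr (%p. g (snd p) * (xs (fst p) * (A p * B' p)))"
 using int[of B' A xs] dB bA K by (auto simp: dxE_def)
 have I: "intgr (%p. g (snd p) * (xs' (fst p) * (A p * B p) + xs (fst p) * (A' p * B p + A p * B' p)))"
 using lint_add[OF i1 lint_add[OF i2 i3]] by (simp add: algebra_simps)
 have aA: "AE E in lborel. AE x in lborel. A (x, E) = primE A' (x, E)"
 by (rule AE_lborel_pair_swap(2)[OF _ dxE_AE_eq[OF dA R]]) measurable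
 have aB: "AE E in lborel. AE x in lborel. B (x, E) = primE B' (x, E)"
 by (rule AE_lborel_pair_swap(2)[OF _ dxE_AE_eq[OF dB R]]) measurable
 have "AE E in lborel. (LI x. g E * (xs' x * (A (x, E) * B (x, E)) + xs x * (A' (x, E) * B (x, E) + A (x, E) * B' (x, E)))) = 0"
 using aA aB dxE_slice_integrable[OF dA] dxE_slice_integrable[OF dB]
 proof eventually_elim
 case (elim E)
 let ?a = "%x. A' (x, E)" and ?b = "%x. B' (x, E)" and ?\<alpha> = "%x. primE A' (x, E)" and ?\<beta> = "%x. primE B' (x, E)"
 note pm = primitive_mult[OF elim(3,4)]
 let ?c = "%z. ?a z * ?\<beta> z + ?\<alpha> z * ?b z"
 have ci: "intgr ?c" using pm(2) by (simp add: primE_def)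
 have pr: "?\<alpha> x * ?\<beta> x = (LI z. indicator {..<x} z * ?c z)" for x using pm(1)[of x] by (simp add: primE_def)
 have ibp: "(LI x. xs' x * (?\<alpha> x * ?\<beta> x)) = - (LI x. xs x * ?c x)"
 unfolding pr by (rule primitive_IBP[OF ci xs])
 have bnd: "%%primE F' (x, E)%% <= (LI z. %%F' (z, E)%%)" if "intgr (%z. F' (z, E))" for F' x
 proof -
 have "%%primE F' (x, E)%% <= (LI z. %%indicator {..<x} z * F' (z, E)%%)"
 unfolding primE_def fst_conv snd_conv by (rule integral_abs_bound)
 also have "... <= (LI z. %%F' (z, E)%%)"
 by (rule integral_mono') (use that in \<open>auto simp: indicator_def\<close>)
 finally show ?thesis .
 qed
 have j2: "intgr (%x. xs x * ?c x)"
 by (rule integrable_bdd_mult[OF ci, of _ K]) (use K in auto)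
 have j1: "intgr (%x. xs' x * (?\<alpha> x * ?\<beta> x))"
 proof -
 obtain R1 where R1: "R1 > 0" "!!x. %%x%% >= R1 ==> xs x = 0 & xs' x = 0" using C1c_support[OF xs] by blast
 have "intgr (%x. (?\<alpha> x * ?\<beta> x) * (ivl R1 x * xs' x))"
 by (rule integrable_bdd_mult[OF integrable_ivl_continuous[OF C1cD(2)[OF xs]]])
 (auto intro!: bdd bnd elim)
 moreover have "(?\<alpha> x * ?\<beta> x) * (ivl R1 x * xs' x) = xs' x * (?\<alpha> x * ?\<beta> x)" for x
 using R1(2)[of x] by (cases "%%x%% >= R1") (auto simp: indicator_def)
 ultimately show ?thesis by simp
 qed
 have "(LI x. g E * (xs' x * (A (x, E) * B (x, E)) + xs x * (A' (x, E) * B (x, E) + A (x, E) * B' (x, E))))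
 = (LI x. g E * (xs' x * (?\<alpha> x * ?\<beta> x) + xs x * ?c x))"
 proof (rule integral_cong_AE)
 show "AE x in lborel. g E * (xs' x * (A (x, E) * B (x, E)) + xs x * (A' (x, E) * B (x, E) + A (x, E) * B' (x, E))) = g E * (xs' x * (?\<alpha> x * ?\<beta> x) + xs x * ?c x)"
 using elim(1,2) by eventually_elim simp
 qed measurable
 also have "... = g E * ((LI x. xs' x * (?\<alpha> x * ?\<beta> x)) + (LI x. xs x * ?c x))"
 using Bochner_Integration.integral_add[OF j1 j2] by simp
 also have "... = 0" by (simp add: ibp)
 finally show ?case .
 qed
 then have "(LI E. LI x. g E * (xs' x * (A (x, E) * B (x, E)) + xs x * (A' (x, E) * B (x, E) + A (x, E) * B' (x, E)))) = 0"
 by (rule integral_eq_zero_AE)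
 then show ?thesis using lborel_integral_snd(1)[OF I] by simp
qed

section \<open>Folding the stationary equation onto energy levels\<close>

definition Sm :: "(real => real) => (R2 => real) => R2 => real" where
 "Sm V f p = above V p * (f (fst p, spd V p) + f (fst p, - spd V p))"

definition Dm :: "(real => real) => (R2 => real) => R2 => real" where
 "Dm V f p = above V p * (f (fst p, spd V p) - f (fst p, - spd V p))"

text \<open>The inverse speed 1/|y| on the energy level, that is, travel time per unit length; it is
  0 in the forbidden region.\<close>

definition ia :: "(real => real) => R2 => real" where
 "ia V p = above V p / spd V p"

definition En :: "(real => real) => R2 => real" where
 "En V p = (snd p)^2 / 2 + V (fst p)"

lemma ia_nonneg: "0 <= ia V p"
 by (auto simp: ia_def above_def spd_def)

lemma En_spd: "V (fst p) < snd p ==> En V (fst p, spd V p) = snd p"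
 "V (fst p) < snd p ==> En V (fst p, - spd V p) = snd p"
 by (simp_all add: En_def spd_def diff_divide_distrib)

lemma spd_pos: "V (fst p) < snd p ==> spd V p > 0"
 by (auto simp: spd_def)

lemma Sm_bound: "(!!p. %%f p%% <= M) ==> %%Sm V f p%% <= 2 * M"
 and Dm_bound: "(!!p. %%f p%% <= M) ==> %%Dm V f p%% <= 2 * M"
proof -
 assume f: "!!p. %%f p%% <= M"
 have "%%f (fst p, spd V p)%% <= M" "%%f (fst p, - spd V p)%% <= M" by (rule f)+
 then show "%%Sm V f p%% <= 2 * M" "%%Dm V f p%% <= 2 * M"
 unfolding Sm_def Dm_def above_def by auto
qed

text \<open>Against a test function even in y, the factor y of the transport term changes sign
  between the branches and selects the difference of \<open>f\<close>, while the source
  \<open>h\<close> enters by its sum: weakly, the x-derivative of \<open>Dm V f\<close> is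
  \<open>ia V\<close> times \<open>Sm V h\<close>.\<close>

lemma foldE_even:
 "foldE V (%p. f p * (snd p * xs' (fst p) * g (En V p)) + h p * (xs (fst p) * g (En V p))) p
 = g (snd p) * (xs' (fst p) * Dm V f p + xs (fst p) * (ia V p * Sm V h p))"
proof (cases "V (fst p) < snd p")
 case True
 show ?thesis
 using En_spd[of V p, OF True] spd_pos[of V p, OF True]
 by (simp add: foldE_def Dm_def Sm_def ia_def above_def True field_simps)
qed (simp add: foldE_def Dm_def Sm_def ia_def above_def)

text \<open>An odd test function exchanges the roles of sum and difference. The cutoff
  \<open>vt\<close> keeps sgn y away from y = 0; since y^2/2 = E - V(x), it becomes a function of E
  - V(x), whose x-derivative is the term with \<open>k\<close> and \<open>vt'\<close>.\<close>

lemma foldE_odd: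
 assumes "dl > 0"
 shows "foldE V (%p. f p * (snd p * xs' (fst p) * (sgn (snd p) * vt ((snd p)^2 / (2 * dl))) * g (En V p)
 - k (fst p) * xs (fst p) * (vt' ((snd p)^2 / (2 * dl)) * %%snd p%% / dl) * g (En V p))
 + h p * (xs (fst p) * (sgn (snd p) * vt ((snd p)^2 / (2 * dl))) * g (En V p))) p
 = g (snd p) * (xs' (fst p) * (Sm V f p * vt ((snd p - V (fst p)) / dl))
 + xs (fst p) * (- k (fst p) * Sm V f p * vt' ((snd p - V (fst p)) / dl) / dl
 + ia V p * Dm V h p * vt ((snd p - V (fst p)) / dl)))"
proof (cases "V (fst p) < snd p")
 case True
 have "(spd V p)^2 = 2 * (snd p - V (fst p))" using True by (simp add: spd_def)
 then have e: "(spd V p)^2 / (2 * dl) = (snd p - V (fst p)) / dl" using assms by (simp only: mult_divide_mult_cancel_left_if) simp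
 let ?T = "vt ((snd p - V (fst p)) / dl)" and ?T' = "vt' ((snd p - V (fst p)) / dl)"
 have gen: "(a * (s * x' * T * G - K * x * (T' * s / dl) * G) + c * (x * T * G) +
 (b * (s * x' * T * G - K * x * (T' * s / dl) * G) + d * (x * (- T) * G))) / s
 = G * (x' * ((a + b) * T) + x * (- K * (a + b) * T' / dl + 1 / s * (c - d) * T))"
 if "s > 0" for a b c d s x x' T T' G K :: real
 using that assms by (simp add: field_simps)
 from gen[OF spd_pos[of V p, OF True]] show ?thesis
 using En_spd[of V p, OF True] spd_pos[of V p, OF True]
 by (simp add: foldE_def Dm_def Sm_def ia_def above_def True e)
qed (simp add: foldE_def Dm_def Sm_def ia_def above_def)

text \<open>With branch values a, b of \<open>f\<close> and c, d of \<open>h\<close>: a^2 - b^2 = (a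
  + b)(a - b) and 2 (a c + b d) = (a + b)(c + d) + (a - b)(c - d). Testing f^2 is therefore the
  Leibniz rule for \<open>Sm\<close> times \<open>Dm\<close>.\<close>

lemma foldE_square:
 "foldE V (%p. (f p)^2 * (snd p * xs' (fst p) * g (En V p)) + (2 * f p * h p) * (xs (fst p) * g (En V p))) p
 = g (snd p) * (xs' (fst p) * (Sm V f p * Dm V f p) + xs (fst p) * (ia V p * (Dm V h p * Dm V f p + Sm V f p * Sm V h p)))"
proof (cases "V (fst p) < snd p")
 case True
 show ?thesis
 using En_spd[of V p, OF True] spd_pos[of V p, OF True]
 by (simp add: foldE_def Dm_def Sm_def ia_def above_def True field_simps power2_eq_square)
qed (simp add: foldE_def Dm_def Sm_def ia_def above_def)

text \<open>In the velocity variable the integral is at most the length of an interval from sqrt m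
  to sqrt (m + 2 d) with m >= 0, and the square root is subadditive. The bound does not depend on
  the position \<open>z\<close>.\<close>

lemma nn_integral_ia_band:
 assumes "d > 0"
 shows "(\<integral>\<^sup>+E. indicator {e<..<e+d} E * ennreal (ia V (z, E)) \<partial>lborel) <= ennreal (sqrt (2 * d))"
proof -
 let ?c = "V z"
 let ?q = "%E. indicator {e<..<e+d} E * ennreal (1 / sqrt (2 * (E - ?c)))"
 have [measurable]: "?q \<in> bm" by measurable
 have "(\<integral>\<^sup>+E. indicator {e<..<e+d} E * ennreal (ia V (z, E)) \<partial>lborel) = (\<integral>\<^sup>+E. ?q E \<partial>density lborel (indicator {?c<..}))"
 by (subst nn_integral_density) (auto intro!: nn_integral_cong simp: ia_def above_def spd_def indicator_def)
 also have "... = (\<integral>\<^sup>+E. ?q E \<partial>distr (density lborel (%y. ennreal (indicator {0<..} y * y))) borel (%y. y^2 / 2 + ?c))"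
 by (simp only: energy_distr_1D)
 also have "... = (\<integral>\<^sup>+y. ?q (y^2 / 2 + ?c) \<partial>density lborel (%y. ennreal (indicator {0<..} y * y)))"
 by (rule nn_integral_distr) auto
 also have "... = (\<integral>\<^sup>+y. ennreal (indicator {0<..} y * y) * ?q (y^2 / 2 + ?c) \<partial>lborel)"
 by (rule nn_integral_density) auto
 also have "... <= (\<integral>\<^sup>+y. indicator {sqrt (max 0 (2 * (e - ?c)))..sqrt (max 0 (2 * (e - ?c)) + 2 * d)} y \<partial>lborel)"
 proof (rule nn_integral_mono)
 fix y :: real
 show "ennreal (indicator {0<..} y * y) * ?q (y^2 / 2 + ?c) <= indicator {sqrt (max 0 (2 * (e - ?c)))..sqrt (max 0 (2 * (e - ?c)) + 2 * d)} y"
 proof (cases "y > 0 & y^2 / 2 + ?c \<in> {e<..<e+d}")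
 case True
 then have y: "y > 0" "2 * (e - ?c) < y^2" "y^2 < 2 * (e - ?c) + 2 * d" by (auto simp: field_simps)
 have "sqrt (max 0 (2 * (e - ?c))) <= y" using y by (intro real_le_lsqrt) auto
 moreover have "y <= sqrt (max 0 (2 * (e - ?c)) + 2 * d)" using y by (intro real_le_rsqrt) auto
 moreover have "ennreal y * ennreal (1 / y) = 1" using y(1) by (simp flip: ennreal_mult)
 ultimately show ?thesis using True y(1) by (simp add: real_sqrt_mult)
 next
 case False
 then consider "~ y > 0" | "y^2 / 2 + ?c \<notin> {e<..<e+d}" by blast
 then show ?thesis by cases simp_all
 qed
 qed
 also have "... = ennreal (sqrt (max 0 (2 * (e - ?c)) + 2 * d) - sqrt (max 0 (2 * (e - ?c))))"
 using assms by simp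
 also have "... <= ennreal (sqrt (2 * d))"
 using sqrt_add_le_add_sqrt[of "max 0 (2 * (e - ?c))" "2 * d"] assms by (intro ennreal_leI) auto
 finally show ?thesis .
qed

lemma step_C1_exists:
 obtains vt vt' K where "!!x. (vt has_real_derivative vt' x) (at x)" "continuous_on UNIV vt'"
 "!!x. x <= 1 ==> vt x = 0" "!!x. x >= 2 ==> vt x = 1" "!!x::real. 0 <= vt x & vt x <= (1::real)"
 "!!x. x \<notin> {1..2} ==> vt' x = 0" "!!x. %%vt' x%% <= K" "K >= 0" "!!x. 0 <= vt' x"
proof -
 obtain s :: "real => real" where s: "smooth s" "!!x. x <= 0 ==> s x = 0" "!!x. x >= 1 ==> s x = 1"
 "!!x. 0 <= s x & s x <= 1" "mono s" by (rule smooth_step_exists) blast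
 obtain s' where s': "!!x. (s has_real_derivative s' x) (at x)" "smooth s'" using smooth_real_derivative[OF s(1)] by blast
 have z: "s' x = 0" if x: "x \<notin> {0..1}" for x
 proof (cases "x < 0")
 case True
 show ?thesis
 proof (rule DERIV_local_min[OF s'(1)[of x], of 1])
 show "\<forall>y. %%x - y%% < 1 --> s x <= s y" using s(2)[of x] s(4) True by simp
 qed simp
 next
 case False
 then have "x >= 1" using x by simp
 show ?thesis
 proof (rule DERIV_local_max[OF s'(1)[of x], of 1])
 show "\<forall>y. %%x - y%% < 1 --> s y <= s x" using s(3)[OF \<open>x >= 1\<close>] s(4) by simp
 qed simp
 qed
 have nn: "s' x >= 0" for x
 by (rule mono_on_imp_deriv_nonneg[OF _ s'(1), of UNIV]) (use s(5) in auto)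
 have z2: "s' x = 0" if "%%x%% >= 2" for x by (intro z) (use that in auto)
 obtain K where K: "K >= 0" "!!x. %%s' x%% <= K"
 using continuous_compact_support_bounded[OF smooth_continuous[OF s'(2)] z2] by blast
 show thesis
 proof (rule that[of "%x. s (x - 1)" "%x. s' (x - 1)" K])
 show "((%x. s (x - 1)) has_real_derivative s' (x - 1)) (at x)" for x
 proof -
 have "((%x. x - 1) has_real_derivative 1) (at x)" by (auto intro!: derivative_eq_intros)
 from DERIV_chain2[where f=s and g="%x. x - 1", OF s'(1) this] show ?thesis by simp
 qed
 show "continuous_on UNIV (%x. s' (x - 1))"
 by (rule cont_comp[OF smooth_continuous[OF s'(2)], of UNIV]) (auto intro: continuous_intros)
 qed (use s z K nn in auto)
qed

text \<open>The jump of sgn at 0 is harmless because \<open>vt\<close> vanishes for y^2 <= 2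
  dl.\<close>

lemma C1c_odd_step:
 assumes dl: "dl > 0"
 and vt: "!!x. (vt has_real_derivative vt' x) (at x)" "continuous_on UNIV vt'" "!!x. x <= 1 ==> vt x = 0"
 "!!x. x \<notin> {1..2} ==> vt' x = 0"
 and kp: "C1c kp kp'"
 shows "C1c (%y. sgn y * vt (y^2 / (2 * dl)) * kp y)
 (%y. (vt' (y^2 / (2 * dl)) * %%y%% / dl) * kp y + sgn y * vt (y^2 / (2 * dl)) * kp' y)"
proof -
 let ?h = "%y. sgn y * vt (y^2 / (2 * dl))"
 let ?h' = "%y. vt' (y^2 / (2 * dl)) * %%y%% / dl"
 have b: "((%y. vt (y^2 / (2 * dl))) has_real_derivative vt' (y^2 / (2 * dl)) * y / dl) (at y)" for y
 proof -
 have "((%y. y^2 / (2 * dl)) has_real_derivative y / dl) (at y)"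
 using dl by (auto intro!: derivative_eq_intros)
 from DERIV_chain2[where f=vt and g="%y. y^2 / (2 * dl)", OF vt(1) this] show ?thesis by simp
 qed
 have zero: "?h y = 0" if "%%y%% < sqrt dl" for y
 proof -
 have "%%y%%^2 < (sqrt dl)^2" using that by (intro power_strict_mono) auto
 then have "y^2 < dl" using dl by simp
 then have "y^2 / (2 * dl) <= 1" by (subst pos_divide_le_eq) (use dl in linarith)+
 from vt(3)[OF this] show ?thesis by simp
 qed
 have hd: "(?h has_real_derivative ?h' y) (at y)" for y
 proof (cases y "0 :: real" rule: linorder_cases)
 case greater
 have "((%y. vt (y^2 / (2 * dl))) has_real_derivative ?h' y) (at y)"
 using b[of y] greater by simp
 then show ?thesis
 by (rule has_field_derivative_transform_within_open[where S="{0<..}"]) (use greater in auto)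
 next
 case less
 have "((%y. - vt (y^2 / (2 * dl))) has_real_derivative ?h' y) (at y)"
 using DERIV_minus[OF b[of y]] less by simp
 then show ?thesis
 by (rule has_field_derivative_transform_within_open[where S="{..<0}"]) (use less in auto)
 next
 case equal
 have "((%y. 0) has_real_derivative 0) (at y)" by simp
 then have "(?h has_real_derivative 0) (at y)"
 proof (rule has_field_derivative_transform_within_open[where S="{- sqrt dl<..<sqrt dl}"])
 show "0 = ?h z" if "z \<in> {- sqrt dl<..<sqrt dl}" for z using zero[of z] that by (simp add: abs_less_iff)
 qed (use equal dl in auto)
 then show ?thesis using equal by simp
 qed
 have hc: "continuous_on UNIV ?h" using hd by (intro continuous_at_imp_continuous_on) (auto intro: DERIV_isCont)
 have h'c: "continuous_on UNIV ?h'"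
 by (intro continuous_intros cont_comp[OF vt(2)]) (use dl in auto)
 obtain R where R: "!!x. %%x%% >= R ==> kp x = 0 & kp' x = 0" using C1c_support[OF kp] by blast
 show ?thesis
 unfolding C1c_def
 proof (intro conjI allI exI[of _ R] impI)
 show "((%y. ?h y * kp y) has_real_derivative ?h' y * kp y + ?h y * kp' y) (at y)" for y
 using DERIV_mult[OF hd[of y] C1cD(1)[OF kp, of y]] by (simp add: algebra_simps)
 show "continuous_on UNIV (%y. ?h' y * kp y + ?h y * kp' y)"
 by (rule continuous_on_add[OF continuous_on_mult[OF h'c C1cD(3)[OF kp]] continuous_on_mult[OF hc C1cD(2)[OF kp]]])
 qed (use R in auto)
qed

section \<open>Speed bounds and the branch difference near turning points\<close>

locale potential =
 fixes V k :: "real => real"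
 assumes k: "locint k" and Vc: "continuous_on UNIV V"
 and FTC: "!!a b. a <= b ==> V b - V a = (LI x. indicator {a..b} x * k x)"
 and der: "AE x in lborel. (V has_real_derivative k x) (at x)"
begin

lemma Vm [measurable]: "V \<in> bm"
 using Vc by (simp add: bm_cont)

lemma km [measurable]: "k \<in> bm"
 using k by (simp add: locint_def)

lemma fold_measurable [measurable]:
 "above V \<in> bm" "spd V \<in> bm" "ia V \<in> bm"
 "En V \<in> bm"
 unfolding above_def[abs_def] spd_def[abs_def] ia_def[abs_def] En_def[abs_def] by measurable

lemma Sm_measurable [measurable]:
 assumes [measurable]: "f \<in> bm"
 shows "Sm V f \<in> bm" "Dm V f \<in> bm"
 unfolding Sm_def[abs_def] Dm_def[abs_def] by measurable

lemma V_bounded: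
 obtains K where "K >= 0" "!!x. %%x%% <= R ==> %%V x%% <= K"
proof -
 have "bounded (V ` {-R..R})"
 by (intro compact_imp_bounded compact_continuous_image continuous_on_subset[OF Vc]) auto
 then obtain K where K: "!!x. x \<in> {-R..R} ==> %%V x%% <= K" unfolding bounded_iff by fastforce
 have "%%V x%% <= %%K%%" if "%%x%% <= R" for x
 using order_trans[OF K[of x] abs_ge_self] that by (simp add: abs_le_iff)
 then show thesis by (intro that[of "%%K%%"]) auto
qed

text \<open>The energy bounds y only together with x, as V may be unbounded below. This is what
  gives products of a cutoff in x with a cutoff in energy compact support.\<close>

lemma speed_bound:
 obtains Y where "Y > 0" "!!p. %%fst p%% <= R ==> %%En V p%% <= N ==> %%snd p%% <= Y"
proof -
 obtain K where K: "K >= 0" "!!x. %%x%% <= R ==> %%V x%% <= K" using V_bounded by blast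
 show thesis
 proof (rule that[of "2 * (%%N%% + K) + 1"])
 show "2 * (%%N%% + K) + 1 > 0" using K(1) by simp
 fix p assume p: "%%fst p%% <= R" "%%En V p%% <= N"
 have y: "(snd p)^2 <= 2 * (%%N%% + K)" using K(2)[OF p(1)] p(2) by (auto simp: En_def)
 show "%%snd p%% <= 2 * (%%N%% + K) + 1"
 proof (rule ccontr)
 assume "~ %%snd p%% <= 2 * (%%N%% + K) + 1"
 then have a: "%%snd p%% > 2 * (%%N%% + K) + 1" by simp
 then have "%%snd p%% * 1 <= %%snd p%% * %%snd p%%" using K(1) by (intro mult_left_mono) auto
 then have "%%snd p%% <= (snd p)^2" by (simp add: power2_eq_square)
 then show False using y a by linarith
 qed
 qed
qed

lemma integrable_kbox:
 fixes F :: "R2 => real"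
 assumes [measurable]: "F \<in> bm"
 and bd: "!!p. %%F p%% <= C * (ivl R (fst p) * (1 + %%k (fst p)%%) * ivl Y (snd p))"
 shows "intgr F"
proof (rule lint_bound)
 have "intgr (%x. ivl R x * k x)" using k by (simp add: locint_def)
 from lint_add[OF integrable_ivl[of R] integrable_abs[OF this]]
 have "intgr (%x. ivl R x * (1 + %%k x%%))" by (simp add: distrib_left abs_mult)
 from integrable_mult_right[OF integrable_lborel_prod_mult[OF this integrable_ivl[of Y]], of C]
 show "intgr (%p. C * (ivl R (fst p) * (1 + %%k (fst p)%%) * ivl Y (snd p)))" .
 show "AE p in lborel. norm (F p) <= norm (C * (ivl R (fst p) * (1 + %%k (fst p)%%) * ivl Y (snd p)))"
 using bd by (intro AE_I2) (auto intro: order_trans[OF bd abs_ge_self])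
qed simp

lemma integrable_box:
 fixes F :: "R2 => real"
 assumes [measurable]: "F \<in> bm" and bd: "!!p. %%F p%% <= C"
 and sp: "!!p. F p ~= 0 ==> %%fst p%% <= R & %%snd p%% <= Y"
 shows "intgr F"
proof (rule integrable_kbox[where C=C and R=R and Y=Y])
 fix p
 have "C >= 0" using order_trans[OF abs_ge_zero bd] .
 show "%%F p%% <= C * (ivl R (fst p) * (1 + %%k (fst p)%%) * ivl Y (snd p))"
 proof (cases "F p = 0")
 case True
 then show ?thesis using \<open>C >= 0\<close> by simp
 next
 case False
 then have "%%fst p%% <= R" "%%snd p%% <= Y" using sp[of p] by auto
 then have "ivl R (fst p) = 1" "ivl Y (snd p) = 1" by (auto simp: indicator_def abs_le_iff)
 moreover have "C * 1 <= C * (1 + %%k (fst p)%%)" using \<open>C >= 0\<close> by (intro mult_left_mono) auto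
 ultimately show ?thesis using bd[of p] by simp
 qed
qed simp

text \<open>The singularity at turning points is integrable: on a bounded region \<open>ia V\<close>
  is the fold of one half of the indicator of a bounded set in phase space.\<close>

lemma integrable_ia: "intgr (%p. ivl R (fst p) * (ivl N (snd p) * ia V p))"
proof -
 let ?F = "%p. ivl R (fst p) * ivl N (En V p) / 2"
 obtain Y where Y: "Y > 0" "!!p. %%fst p%% <= R ==> %%En V p%% <= N ==> %%snd p%% <= Y" using speed_bound by blast
 have "intgr ?F"
 proof (rule integrable_box[where C=1 and R=R and Y=Y])
 fix p assume "?F p ~= 0"
 then have "%%fst p%% <= R" "%%En V p%% <= N" by (auto simp: indicator_def split: if_splits)
 then show "%%fst p%% <= R & %%snd p%% <= Y" using Y by blast
 qed (auto simp: indicator_def)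
 from integral_foldE(1)[OF Vm this] have "intgr (foldE V ?F)" .
 moreover have "foldE V ?F p = ivl R (fst p) * (ivl N (snd p) * ia V p)" for p
 proof (cases "V (fst p) < snd p")
 case True
 then show ?thesis using En_spd[of V p, OF True] by (simp add: foldE_def ia_def above_def)
 qed (simp add: foldE_def ia_def above_def)
 ultimately show ?thesis by (simp cong: Bochner_Integration.integrable_cong)
qed

text \<open>Where V > E the level has no points and \<open>Dm\<close> vanishes. Integrating its
  x-derivative \<open>ia V\<close> times \<open>Sm V h\<close> from such a point to x bounds it by 2
  M times the travel time.\<close>

lemma Dm_le_travel_time:
 assumes [measurable]: "f \<in> bm" "h \<in> bm"
 and bd: "!!p. %%f p%% <= M" "!!p. %%h p%% <= M"
 and xs: "!!x. %%x%% <= L ==> xs x = 1" "!!x. %%x%% <= L ==> xs' x = 0"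
 and B'_def: "B' = (%p. xs' (fst p) * Dm V f p + xs (fst p) * (ia V p * Sm V h p))"
 and int: "intgr (%z. B' (z, E))"
 and ae: "AE z in lborel. xs z * Dm V f (z, E) = primE B' (z, E)"
 and x: "xs x * Dm V f (x, E) = primE B' (x, E)"
 and I: "{i1..i2} \<subseteq> {-L..L}" "x \<in> {i1..i2}" "{j1<..<j2} \<subseteq> {i1..i2}" "j1 < j2"
 and J: "!!z. z \<in> {j1<..<j2} ==> V z > E"
 shows "ennreal %%Dm V f (x, E)%% <= (\<integral>\<^sup>+z. indicator {i1..i2} z * ennreal (2 * M * ia V (z, E)) \<partial>lborel)"
proof -
 \<comment> \<open>The representation as a primitive holds only almost everywhere; hence an interval
   of forbidden points is assumed instead of a single one.\<close>
 have "\<exists>z\<in>{j1<..<j2}. xs z * Dm V f (z, E) = primE B' (z, E)"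
 proof (rule ccontr)
 assume n: "~ ?thesis"
 have "AE z in lborel. z \<notin> {j1<..<j2}" using ae by eventually_elim (use n in blast)
 then have "{j1<..<j2} \<in> null_sets lborel" by (subst AE_iff_null_sets) auto
 then show False using I(4) by (simp add: null_sets_def)
 qed
 then obtain z0 where z0: "z0 \<in> {j1<..<j2}" "xs z0 * Dm V f (z0, E) = primE B' (z0, E)" by blast
 have "Dm V f (z0, E) = 0" using J[OF z0(1)] by (simp add: Dm_def above_def)
 then have p0: "primE B' (z0, E) = 0" using z0(2) by simp
 have "x \<in> {-L..L}" using I by blast
 then have "xs x = 1" using xs(1)[of x] by (simp add: abs_le_iff)
 then have "Dm V f (x, E) = primE B' (x, E) - primE B' (z0, E)" using x p0 by simp
 also have "... = (LI z. indicator {..<x} z * B' (z, E) - indicator {..<z0} z * B' (z, E))"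
 unfolding primE_def fst_conv snd_conv
 by (rule Bochner_Integration.integral_diff[symmetric];
 rule integrable_bdd_mult[OF int, of _ 1]; auto simp: indicator_def)
 finally have eq: "Dm V f (x, E) = (LI z. indicator {..<x} z * B' (z, E) - indicator {..<z0} z * B' (z, E))" .
 have "ennreal %%Dm V f (x, E)%% <= (\<integral>\<^sup>+z. norm (indicator {..<x} z * B' (z, E) - indicator {..<z0} z * B' (z, E)) \<partial>lborel)"
 unfolding eq real_norm_def[symmetric]
 by (intro integral_norm_bound_ennreal lint_diff;
 rule integrable_bdd_mult[OF int, of _ 1]; auto simp: indicator_def)
 also have "... <= (\<integral>\<^sup>+z. indicator {i1..i2} z * ennreal (2 * M * ia V (z, E)) \<partial>lborel)"
 proof (rule nn_integral_mono)
 fix z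
 show "ennreal (norm (indicator {..<x} z * B' (z, E) - indicator {..<z0} z * B' (z, E))) <= indicator {i1..i2} z * ennreal (2 * M * ia V (z, E))"
 proof (cases "z \<in> {i1..i2}")
 case True
 then have "%%z%% <= L" using I(1) by fastforce
 then have "B' (z, E) = ia V (z, E) * Sm V h (z, E)" using xs by (simp add: B'_def)
 moreover have "ia V (z, E) * %%Sm V h (z, E)%% <= ia V (z, E) * (2 * M)"
 using Sm_bound[OF bd(2)] ia_nonneg by (intro mult_left_mono) auto
 ultimately have "%%B' (z, E)%% <= 2 * M * ia V (z, E)" using ia_nonneg[of V "(z, E)"] by (simp add: abs_mult mult_ac)
 then have "norm (indicator {..<x} z * B' (z, E) - indicator {..<z0} z * B' (z, E)) <= 2 * M * ia V (z, E)"
 by (auto simp: indicator_def)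
 then show ?thesis using True by (simp add: ennreal_leI)
 next
 case False
 have "z0 \<in> {i1..i2}" using z0(1) I(3) by blast
 then have "indicator {..<x} z = (indicator {..<z0} z :: real)" using False I(2) by (auto simp: indicator_def)
 then show ?thesis by simp
 qed
 qed
 finally show ?thesis .
qed

end

section \<open>Renormalization of the stationary equation\<close>

context potential begin

text \<open>A nonzero slope of V at x places a barrier at distance O(dl) on the uphill side for
  every E in a band of width 3 dl above V x. Inserting the travel-time bound and integrating over E
  first, by \<open>nn_integral_ia_band\<close>, gives 4 s times 2 M times sqrt(6 dl) with s
  proportional to dl, hence order dl^(3/2).\<close>

lemma Dm_trace:
 assumes [measurable]: "f \<in> bm" "h \<in> bm"
 and bd: "!!p. %%f p%% <= M" "!!p. %%h p%% <= M"
 and xs: "!!x. %%x%% <= L ==> xs x = 1" "!!x. %%x%% <= L ==> xs' x = 0"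
 and B'_def: "B' = (%p. xs' (fst p) * Dm V f p + xs (fst p) * (ia V p * Sm V h p))"
 and dx: "dxE R (%p. xs (fst p) * Dm V f p) B'" and R: "R > 0"
 shows "AE x in lborel. %%x%% <= L - 1 & k x ~= 0 --> (\<exists>C\<ge>0. \<forall>\<^sub>F n in sequentially.
 (\<integral>\<^sup>+E. indicator {V x<..<V x + 3 * (1 / real (Suc n))} E * ennreal %%Dm V f (x, E)%% \<partial>lborel)
 <= ennreal (C * (1 / real (Suc n)) * sqrt (1 / real (Suc n))))"
proof -
 have M0: "M >= 0" using order_trans[OF abs_ge_zero bd(1)] .
 have B'm[measurable]: "B' \<in> bm" and Bm[measurable]: "(%p. xs (fst p) * Dm V f p) \<in> bm"
 using dx by (auto simp: dxE_def)
 have pr: "Measurable.pred borel (%p. xs (fst p) * Dm V f p = primE B' p)" by measurable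
 note ae = AE_lborel_pair_swap[OF pr dxE_AE_eq[OF dx R]]
 have good: "AE E in lborel. intgr (%z. B' (z, E)) & (AE z in lborel. xs z * Dm V f (z, E) = primE B' (z, E))"
 using dxE_slice_integrable[OF dx] ae(2) by eventually_elim simp
 show ?thesis
 using ae(1) der
 proof eventually_elim
 case (elim x)
 show ?case
 proof
 assume x: "%%x%% <= L - 1 & k x ~= 0"
 define c where "c = k x"
 have c: "%%c%% > 0" using x by (simp add: c_def)
 have "(V has_derivative (%h. h * c)) (at x)"
 using elim(2) by (simp add: c_def has_field_derivative_def mult_commute_abs)
 then obtain r where r: "r > 0" "!!y. %%y - x%% < r ==> %%V y - V x - (y - x) * c%% <= %%c%% / 2 * %%y - x%%"
 unfolding has_derivative_at_alt using c by (metis half_gt_zero real_norm_def)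
 define C where "C = 24 / %%c%% * (2 * M) * sqrt 6"
 have C0: "C >= 0" using c M0 by (simp add: C_def)
 have lim: "(%n. 12 / %%c%% * (1 / real (Suc n))) ----> 12 / %%c%% * 0"
 by (intro tendsto_mult tendsto_const LIMSEQ_Suc[OF lim_1_over_n])
 \<comment> \<open>This says 2 s < min r 1 for the \<open>s\<close> below: r is the radius where the
   linearization of V is valid, and 1 keeps the interval inside [-L, L] since |x| <= L - 1.\<close>
 have ev: "\<forall>\<^sub>F n in sequentially. 12 / %%c%% * (1 / real (Suc n)) < min r 1"
 by (rule order_tendstoD(2)[OF lim]) (use r(1) in simp)
 show "\<exists>C\<ge>0. \<forall>\<^sub>F n in sequentially.
 (\<integral>\<^sup>+E. indicator {V x<..<V x + 3 * (1 / real (Suc n))} E * ennreal %%Dm V f (x, E)%% \<partial>lborel)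
 <= ennreal (C * (1 / real (Suc n)) * sqrt (1 / real (Suc n)))"
 proof (intro exI[of _ C] conjI C0, use ev in eventually_elim)
 case (elim n)
 define dl where "dl = 1 / real (Suc n)"
 have dl: "dl > 0" by (simp add: dl_def)
 \<comment> \<open>Chosen so that s |c| / 2 = 3 dl: beyond distance s uphill, with half of the slope
   guaranteed, V exceeds every energy of the band.\<close>
 define s where "s = 6 / %%c%% * dl"
 have s: "s > 0" using dl c by (simp add: s_def)
 have s2: "2 * s < r" "2 * s < 1" using elim by (auto simp: s_def dl_def)
 have cs: "%%c%% * s = 6 * dl" using c by (simp add: s_def)
 \<comment> \<open>The barrier interval lies on the uphill side of x, to the right if c > 0 and to
   the left otherwise.\<close>
 define j1 j2 where "j1 = (if c > 0 then x + s else x - 2 * s)" and "j2 = (if c > 0 then x + 2 * s else x - s)"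
 have VJ: "V z > V x + 3 * dl" if z: "z \<in> {j1<..<j2}" for z
 proof -
 have zr: "%%z - x%% < r" "(z - x) * c = %%c%% * %%z - x%%" "%%z - x%% > s"
 using z s s2 c by (auto simp: j1_def j2_def abs_mult[symmetric] mult.commute split: if_splits intro!: abs_of_pos[symmetric] mult_neg_neg)
 have "%%c%% * s < %%c%% * %%z - x%%" using zr(3) c by (intro mult_strict_left_mono)
 then have "3 * dl < %%c%% / 2 * %%z - x%%" using cs by simp
 moreover have "V z - V x >= (z - x) * c - %%c%% / 2 * %%z - x%%" using r(2)[OF zr(1)] by linarith
 ultimately show ?thesis unfolding zr(2) by simp
 qed
 have sub: "{x - 2 * s .. x + 2 * s} \<subseteq> {-L..L}" "x \<in> {x - 2 * s .. x + 2 * s}" "{j1<..<j2} \<subseteq> {x - 2 * s .. x + 2 * s}" "j1 < j2"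
 using x s s2 by (auto simp: j1_def j2_def)
 let ?ind = "indicator {V x<..<V x + 3 * dl} :: real => ennreal"
 let ?I = "indicator {x - 2 * s .. x + 2 * s} :: real => ennreal"
 have "(\<integral>\<^sup>+E. ?ind E * ennreal %%Dm V f (x, E)%% \<partial>lborel) <= (\<integral>\<^sup>+E. ?ind E * (\<integral>\<^sup>+z. ?I z * ennreal (2 * M * ia V (z, E)) \<partial>lborel) \<partial>lborel)"
 proof (rule nn_integral_mono_AE)
 show "AE E in lborel. ?ind E * ennreal %%Dm V f (x, E)%% <= ?ind E * (\<integral>\<^sup>+z. ?I z * ennreal (2 * M * ia V (z, E)) \<partial>lborel)"
 using good \<open>AE E in lborel. xs (fst (x, E)) * Dm V f (x, E) = primE B' (x, E)\<close>
 proof eventually_elim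
 case (elim E)
 show ?case
 proof (cases "E \<in> {V x<..<V x + 3 * dl}")
 case True
 have "ennreal %%Dm V f (x, E)%% <= (\<integral>\<^sup>+z. ?I z * ennreal (2 * M * ia V (z, E)) \<partial>lborel)"
 proof (rule Dm_le_travel_time[OF _ _ bd xs B'_def])
 show "V z > E" if "z \<in> {j1<..<j2}" for z using VJ[OF that] True by simp
 qed (use elim sub in auto)
 then show ?thesis by (intro mult_left_mono) auto
 qed simp
 qed
 qed
 also have "... = (\<integral>\<^sup>+E. \<integral>\<^sup>+z. ?ind E * (?I z * ennreal (2 * M * ia V (z, E))) \<partial>lborel \<partial>lborel)"
 by (intro nn_integral_cong nn_integral_cmult[symmetric]) measurable
 also have "... = (\<integral>\<^sup>+z. \<integral>\<^sup>+E. ?ind E * (?I z * ennreal (2 * M * ia V (z, E))) \<partial>lborel \<partial>lborel)"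
 proof -
 have "(%(z, E). ?ind E * (?I z * ennreal (2 * M * ia V (z, E)))) \<in> borel_measurable (lborel \<Otimes>\<^sub>M lborel)"
 unfolding lborel_prod split_def by measurable
 from lborel_pair.Fubini'[OF this] show ?thesis .
 qed
 also have "... = (\<integral>\<^sup>+z. (?I z * ennreal (2 * M)) * (\<integral>\<^sup>+E. ?ind E * ennreal (ia V (z, E)) \<partial>lborel) \<partial>lborel)"
 by (intro nn_integral_cong) (subst nn_integral_cmult[symmetric], measurable,
 intro nn_integral_cong, simp add: ennreal_mult M0 ia_nonneg mult_ac)
 also have "... <= (\<integral>\<^sup>+z. (?I z * ennreal (2 * M)) * ennreal (sqrt (2 * (3 * dl))) \<partial>lborel)"
 by (intro nn_integral_mono mult_left_mono nn_integral_ia_band) (use dl in auto)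
 also have "... = ennreal (4 * s) * ennreal (2 * M) * ennreal (sqrt (2 * (3 * dl)))"
 using s by (simp add: nn_integral_multc)
 also have "ennreal (4 * s) * ennreal (2 * M) = ennreal (4 * s * (2 * M))"
 by (rule ennreal_mult[symmetric]) (use s M0 in auto)
 also have "ennreal (4 * s * (2 * M)) * ennreal (sqrt (2 * (3 * dl))) = ennreal (4 * s * (2 * M) * sqrt (2 * (3 * dl)))"
 by (rule ennreal_mult[symmetric]) (use s M0 dl in auto)
 also have "4 * s * (2 * M) * sqrt (2 * (3 * dl)) = C * dl * sqrt dl"
 by (simp add: s_def C_def real_sqrt_mult[of 6 dl])
 finally show ?case by (simp add: dl_def)
 qed
 qed
 qed
qed

text \<open>\<open>wk\<close> is the weak form of y d_x f - k d_y f = h. The Leibniz rule for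
  \<open>Sm V f\<close>, cut off near turning points, times \<open>Dm V f\<close> produces the
  desired integrand plus a term from the derivative of the cutoff, which vanishes with dl by
  \<open>Dm_trace\<close>.\<close>

theorem stationary_renormalization:
 assumes [measurable]: "f \<in> bm" "h \<in> bm"
 and bd: "!!p. %%f p%% <= M" "!!p. %%h p%% <= M"
 and wk: "!!xs xs' \<omega> \<omega>' g g'. C1c xs xs' ==> C1c \<omega> \<omega>' ==> C1c g g' ==>
 (LI p. f p * (snd p * xs' (fst p) * \<omega> (snd p) * g (En V p) - k (fst p) * xs (fst p) * \<omega>' (snd p) * g (En V p))
 + h p * (xs (fst p) * \<omega> (snd p) * g (En V p))) = 0"
 and xs: "C1c xs xs'" and g: "C1c g g'"
 shows "(LI p. (f p)^2 * (snd p * xs' (fst p) * g (En V p)) + (2 * f p * h p) * (xs (fst p) * g (En V p))) = 0"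
proof -
 have M0: "M >= 0" using order_trans[OF abs_ge_zero bd(1)] .
 have bdd: "%%u * v%% <= U * W" if "%%u%% <= U" "%%v%% <= W" for u v U W :: real
 using that by (auto simp: abs_mult intro!: mult_mono)
 have bda: "%%u + v%% <= U + W" if "%%u%% <= U" "%%v%% <= W" for u v U W :: real using that by linarith
 note Sb = Sm_bound[of f M V, OF bd(1)] Dm_bound[of f M V, OF bd(1)] Sm_bound[of h M V, OF bd(2)] Dm_bound[of h M V, OF bd(2)]
 have ivl1: "ivl N E * v = v" if "%%E%% >= N ==> v = 0" for N E v :: real
 using that by (cases "%%E%% >= N") (auto simp: indicator_def)
 obtain vt vt' :: "real => real" and Kvt where vt: "!!x. (vt has_real_derivative vt' x) (at x)" "continuous_on UNIV vt'"
 "!!x. x <= 1 ==> vt x = 0" "!!x. x >= 2 ==> vt x = 1" "!!x. 0 <= vt x & vt x <= 1"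
 "!!x. x \<notin> {1..2} ==> vt' x = 0" "!!x. %%vt' x%% <= Kvt" "Kvt >= 0"
 using step_C1_exists by metis
 have vt1: "%%vt x%% <= 1" for x using vt(5)[of x] by simp
 have "continuous_on UNIV vt" using vt(1) by (intro continuous_at_imp_continuous_on) (auto intro: DERIV_isCont)
 then have [measurable]: "vt \<in> bm" "vt' \<in> bm"
 using vt(2) by (auto simp: bm_cont)
 have evenE: "intgr (%p. g (snd p) * (ph' (fst p) * Dm V f p + ph (fst p) * (ia V p * Sm V h p)))"
 "(LI p. g (snd p) * (ph' (fst p) * Dm V f p + ph (fst p) * (ia V p * Sm V h p))) = 0"
 if ph: "C1c ph ph'" and g: "C1c g g'" for ph ph' g g'
 proof -
 note [measurable] = C1cD(4,5)[OF ph] C1cD(4)[OF g]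
 obtain R where R: "R > 0" "!!x. %%x%% >= R ==> ph x = 0 & ph' x = 0" using C1c_support[OF ph] by blast
 obtain N where N: "N > 0" "!!x. %%x%% >= N ==> g x = 0 & g' x = 0" using C1c_support[OF g] by blast
 obtain K where K: "K >= 0" "!!x. %%ph x%% <= K" "!!x. %%ph' x%% <= K" using C1c_bounded[OF ph] by metis
 obtain G where G: "G >= 0" "!!x. %%g x%% <= G" using C1c_bounded[OF g] by metis
 obtain Y where Y: "Y > 0" "!!p. %%fst p%% <= R ==> %%En V p%% <= N ==> %%snd p%% <= Y" using speed_bound by blast
 \<comment> \<open>\<open>wk\<close> asks for a compactly supported factor in y; a plateau equal to
   1 on all velocities allowed by \<open>ph\<close> and \<open>g\<close> supplies it without
   changing the integrand.\<close>
 obtain kp kp' where kp: "C1c kp kp'" "!!x. %%x%% <= Y ==> kp x = 1" "!!x. %%x%% <= Y ==> kp' x = 0"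
 using C1c_plateau_exists[OF Y(1)] by metis
 have sp: "ph (fst p) = 0 & ph' (fst p) = 0 | g (En V p) = 0 | %%fst p%% <= R & %%snd p%% <= Y" for p
 proof (cases "%%fst p%% >= R | %%En V p%% >= N")
 case True
 then show ?thesis using R(2) N(2) by blast
 next
 case False
 then show ?thesis using Y(2)[of p] by auto
 qed
 let ?F = "%p. f p * (snd p * ph' (fst p) * g (En V p)) + h p * (ph (fst p) * g (En V p))"
 have iF: "intgr ?F"
 proof (rule integrable_box)
 show "?F p ~= 0 ==> %%fst p%% <= R & %%snd p%% <= Y" for p using sp[of p] by auto
 show "%%?F p%% <= M * (Y * K * G) + M * (K * G)" for p
 proof (cases "ph (fst p) = 0 & ph' (fst p) = 0 | g (En V p) = 0")
 case True
 then have "?F p = 0" by auto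
 then show ?thesis using M0 Y K G by simp
 next
 case False
 then have "%%snd p%% <= Y" using sp[of p] by blast
 then show ?thesis by (intro bda bdd bd K G) 
 qed
 qed measurable
 have "(LI p. ?F p) = (LI p. f p * (snd p * ph' (fst p) * kp (snd p) * g (En V p) - k (fst p) * ph (fst p) * kp' (snd p) * g (En V p))
 + h p * (ph (fst p) * kp (snd p) * g (En V p)))"
 proof (intro lint_cong refl)
 fix p
 show "?F p = f p * (snd p * ph' (fst p) * kp (snd p) * g (En V p) - k (fst p) * ph (fst p) * kp' (snd p) * g (En V p))
 + h p * (ph (fst p) * kp (snd p) * g (En V p))"
 using sp[of p] kp(2,3)[of "snd p"] by auto
 qed
 then have F0: "(LI p. ?F p) = 0" using wk[OF ph kp(1) g] by simp
 note * = integral_foldE[OF Vm iF]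
 show "intgr (%p. g (snd p) * (ph' (fst p) * Dm V f p + ph (fst p) * (ia V p * Sm V h p)))"
 proof -
 have "foldE V ?F = (%p. g (snd p) * (ph' (fst p) * Dm V f p + ph (fst p) * (ia V p * Sm V h p)))"
 by (rule ext) (rule foldE_even)
 then show ?thesis using *(1) by simp
 qed
 show "(LI p. g (snd p) * (ph' (fst p) * Dm V f p + ph (fst p) * (ia V p * Sm V h p))) = 0"
 using *(2) F0 foldE_even[of V f ph' g h ph] by simp
 qed
 have oddE: "(LI p. g (snd p) * (ph' (fst p) * (Sm V f p * vt ((snd p - V (fst p)) / dl))
 + ph (fst p) * (- k (fst p) * Sm V f p * vt' ((snd p - V (fst p)) / dl) / dl
 + ia V p * Dm V h p * vt ((snd p - V (fst p)) / dl)))) = 0"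
 if dl: "dl > 0" and ph: "C1c ph ph'" and g: "C1c g g'" for dl ph ph' g g'
 proof -
 note [measurable] = C1cD(4,5)[OF ph] C1cD(4)[OF g]
 obtain R where R: "R > 0" "!!x. %%x%% >= R ==> ph x = 0 & ph' x = 0" using C1c_support[OF ph] by blast
 obtain N where N: "N > 0" "!!x. %%x%% >= N ==> g x = 0 & g' x = 0" using C1c_support[OF g] by blast
 obtain K where K: "K >= 0" "!!x. %%ph x%% <= K" "!!x. %%ph' x%% <= K" using C1c_bounded[OF ph] by metis
 obtain G where G: "G >= 0" "!!x. %%g x%% <= G" using C1c_bounded[OF g] by metis
 obtain Y where Y: "Y > 0" "!!p. %%fst p%% <= R ==> %%En V p%% <= N ==> %%snd p%% <= Y" using speed_bound by blast
 obtain kp kp' where kp: "C1c kp kp'" "!!x. %%x%% <= Y ==> kp x = 1" "!!x. %%x%% <= Y ==> kp' x = 0"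
 using C1c_plateau_exists[OF Y(1)] by metis
 have sp: "ph (fst p) = 0 & ph' (fst p) = 0 | g (En V p) = 0 | %%fst p%% <= R & %%snd p%% <= Y" for p
 proof (cases "%%fst p%% >= R | %%En V p%% >= N")
 case True
 then show ?thesis using R(2) N(2) by blast
 next
 case False
 then show ?thesis using Y(2)[of p] by auto
 qed
 let ?H = "%y. sgn y * vt (y^2 / (2 * dl))" and ?H' = "%y. vt' (y^2 / (2 * dl)) * %%y%% / dl"
 have Hb: "%%?H y%% <= 1 * 1" for y by (intro bdd vt1) (simp add: abs_sgn_eq)
 have H'b: "%%?H' y%% <= Kvt * Y / dl" if "%%y%% <= Y" for y
 proof -
 have "%%vt' (y^2 / (2 * dl)) * %%y%%%% <= Kvt * Y" by (intro bdd vt(7)) (use that in auto)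
 then show ?thesis using dl by (simp add: divide_right_mono)
 qed
 let ?F = "%p. f p * (snd p * ph' (fst p) * ?H (snd p) * g (En V p) - k (fst p) * ph (fst p) * ?H' (snd p) * g (En V p))
 + h p * (ph (fst p) * ?H (snd p) * g (En V p))"
 define C where "C = M * (Y * K * (1 * 1) * G) + M * (K * (Kvt * Y / dl) * G) + M * (K * (1 * 1) * G)"
 have C0: "0 <= M * (Y * K * (1 * 1) * G)" "0 <= M * (K * (Kvt * Y / dl) * G)" "0 <= M * (K * (1 * 1) * G)"
 using M0 Y K G vt(8) dl by auto
 have iF: "intgr ?F"
 proof (rule integrable_kbox[where C=C and R=R and Y=Y])
 fix p
 show "%%?F p%% <= C * (ivl R (fst p) * (1 + %%k (fst p)%%) * ivl Y (snd p))"
 proof (cases "ph (fst p) = 0 & ph' (fst p) = 0 | g (En V p) = 0")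
 case True
 then have "?F p = 0" by auto
 then show ?thesis using C0 by (simp add: C_def)
 next
 case False
 then have y: "%%snd p%% <= Y" "%%fst p%% <= R" using sp[of p] by blast+
 have i: "ivl R (fst p) = 1" "ivl Y (snd p) = 1" using y by (auto simp: indicator_def abs_le_iff)
 have 1: "%%f p * (snd p * ph' (fst p) * ?H (snd p) * g (En V p))%% <= M * (Y * K * (1 * 1) * G)"
 by (intro bdd bd K G Hb y)
 have 2: "%%f p * (ph (fst p) * ?H' (snd p) * g (En V p))%% <= M * (K * (Kvt * Y / dl) * G)"
 by (intro bdd bd K G H'b y)
 have 3: "%%h p * (ph (fst p) * ?H (snd p) * g (En V p))%% <= M * (K * (1 * 1) * G)"
 by (intro bdd bd K G Hb)
 have 4: "%%k (fst p) * (f p * (ph (fst p) * ?H' (snd p) * g (En V p)))%% <= %%k (fst p)%% * (M * (K * (Kvt * Y / dl) * G))"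
 by (rule bdd[OF order_refl 2])
 have 5: "?F p = f p * (snd p * ph' (fst p) * ?H (snd p) * g (En V p)) - k (fst p) * (f p * (ph (fst p) * ?H' (snd p) * g (En V p)))
 + h p * (ph (fst p) * ?H (snd p) * g (En V p))" by (simp add: right_diff_distrib mult_ac)
 have tri: "%%a - b + c%% <= A + B + D" if "%%a%% <= A" "%%b%% <= B" "%%c%% <= D" for a b c A B D :: real
 using that by linarith
 have "%%?F p%% <= M * (Y * K * (1 * 1) * G) + %%k (fst p)%% * (M * (K * (Kvt * Y / dl) * G)) + M * (K * (1 * 1) * G)"
 unfolding 5 by (rule tri[OF 1 4 3])
 also have "... <= C * (1 + %%k (fst p)%%)"
 proof -
 have ar: "a + b * l + c <= (a + b + c) * (1 + l)" if "0 <= a" "0 <= b" "0 <= c" "0 <= l" for a b c l :: real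
 using that mult_nonneg_nonneg[of a l] mult_nonneg_nonneg[of c l] by (simp add: algebra_simps)
 show ?thesis unfolding C_def mult.commute[of "%%k (fst p)%%"] by (rule ar[OF C0]) simp
 qed
 finally show ?thesis by (simp add: i)
 qed
 qed measurable
 let ?\<omega> = "%y. ?H y * kp y" and ?\<omega>' = "%y. ?H' y * kp y + ?H y * kp' y"
 have \<omega>: "C1c ?\<omega> ?\<omega>'" by (rule C1c_odd_step[OF dl vt(1,2,3,6) kp(1)])
 have "(LI p. ?F p) = (LI p. f p * (snd p * ph' (fst p) * ?\<omega> (snd p) * g (En V p) - k (fst p) * ph (fst p) * ?\<omega>' (snd p) * g (En V p))
 + h p * (ph (fst p) * ?\<omega> (snd p) * g (En V p)))"
 proof (intro lint_cong refl)
 fix p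
 show "?F p = f p * (snd p * ph' (fst p) * ?\<omega> (snd p) * g (En V p) - k (fst p) * ph (fst p) * ?\<omega>' (snd p) * g (En V p))
 + h p * (ph (fst p) * ?\<omega> (snd p) * g (En V p))"
 using sp[of p] kp(2,3)[of "snd p"] by auto
 qed
 then have F0: "(LI p. ?F p) = 0" using wk[OF ph \<omega> g] by simp
 note * = integral_foldE[OF Vm iF]
 show ?thesis
 using *(2) F0 foldE_odd[OF dl, of V f ph' vt g k ph vt' h] by simp
 qed
 note [measurable] = C1cD(4,5)[OF xs] C1cD(4)[OF g]
 obtain R0 where R0: "R0 > 0" "!!x. %%x%% >= R0 ==> xs x = 0 & xs' x = 0" using C1c_support[OF xs] by blast
 obtain N where N: "N > 0" "!!x. %%x%% >= N ==> g x = 0 & g' x = 0" using C1c_support[OF g] by blast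
 obtain K where K: "K >= 0" "!!x. %%xs x%% <= K" "!!x. %%xs' x%% <= K" using C1c_bounded[OF xs] by metis
 obtain G where G: "G >= 0" "!!x. %%g x%% <= G" using C1c_bounded[OF g] by metis
 \<comment> \<open>One unit of room beyond the support of \<open>xs\<close>, as
   \<open>Dm_trace\<close> controls only |x| <= L - 1.\<close>
 define L where "L = R0 + 1"
 have L: "L > 0" using R0 by (simp add: L_def)
 \<comment> \<open>Localizes both branch functions so that \<open>dxE\<close> applies; being 1 on
   the support of \<open>xs\<close>, it disappears from the final integrals.\<close>
 obtain xs1 xs1' where xs1: "C1c xs1 xs1'" "!!x. %%x%% <= L ==> xs1 x = 1" "!!x. %%x%% <= L ==> xs1' x = 0"
 "!!x. 0 <= xs1 x & xs1 x <= 1" "!!x. %%x%% >= 2 * L ==> xs1 x = 0 & xs1' x = 0"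
 using C1c_plateau_exists[OF L] by blast
 note [measurable] = C1cD(4,5)[OF xs1(1)]
 obtain K1 where K1: "K1 >= 0" "!!x. %%xs1 x%% <= K1" "!!x. %%xs1' x%% <= K1" using C1c_bounded[OF xs1(1)] by metis
 have xs1L: "xs1 x = ivl (2*L) x * xs1 x" "xs1' x = ivl (2*L) x * xs1' x" for x
 using ivl1[of "2*L" x] xs1(5)[of x] by simp_all
 define B' where "B' = (%p. xs1' (fst p) * Dm V f p + xs1 (fst p) * (ia V p * Sm V h p))"
 have iai: "intgr (%p. ivl N (snd p) * (xs1 (fst p) * (ia V p * D p)))"
 if [measurable]: "D \<in> bm" and D: "!!p. %%D p%% <= 2 * M" for D N
 proof -
 have "intgr (%p. (xs1 (fst p) * D p) * (ivl (2*L) (fst p) * (ivl N (snd p) * ia V p)))"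
 by (rule integrable_bdd_mult[OF integrable_ia, of _ "K1 * (2 * M)"]) (auto intro!: bdd D K1)
 moreover have "(xs1 (fst p) * D p) * (ivl (2*L) (fst p) * (ivl N (snd p) * ia V p)) = ivl N (snd p) * ((ivl (2*L) (fst p) * xs1 (fst p)) * (ia V p * D p))" for p
 by (simp add: mult_ac)
 ultimately show ?thesis by (simp flip: xs1L)
 qed
 have bdi: "intgr (%p. ivl N (snd p) * D p)"
 if [measurable]: "D \<in> bm" and D: "!!p. %%D p%% <= C" "!!p. %%fst p%% > 2 * L ==> D p = 0" for D N C
 proof (rule integrable_box[where C=C and R="2*L" and Y=N])
 show "%%ivl N (snd p) * D p%% <= C" for p using D(1)[of p] order_trans[OF abs_ge_zero D(1)[of p]] by (auto simp: indicator_def)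
 show "ivl N (snd p) * D p ~= 0 ==> %%fst p%% <= 2 * L & %%snd p%% <= N" for p
 using D(2)[of p] by (auto simp: indicator_def not_le split: if_splits) (meson not_le)
 qed measurable
 have xs1z: "xs1 x = 0" "xs1' x = 0" if "%%x%% > 2 * L" for x using xs1(5)[of x] that by auto
 have dB: "dxE (2*L) (%p. xs1 (fst p) * Dm V f p) B'"
 unfolding dxE_def
 proof (intro conjI allI impI)
 show "(%p. xs1 (fst p) * Dm V f p) \<in> bm" "B' \<in> bm"
 unfolding B'_def by measurable
 show "xs1 (fst p) * Dm V f p = 0" "B' p = 0" if "2 * L < %%fst p%%" for p using xs1z[OF that] by (auto simp: B'_def)
 show "intgr (%p. ivl N (snd p) * (xs1 (fst p) * Dm V f p))" for N
 by (rule bdi[of _ "K1 * (2 * M)"]) (auto intro!: bdd K1 Sb simp: xs1z)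
 show "intgr (%p. ivl N (snd p) * B' p)" for N
 proof -
 have "intgr (%p. ivl N (snd p) * (xs1' (fst p) * Dm V f p))"
 by (rule bdi[of _ "K1 * (2 * M)"]) (auto intro!: bdd K1 Sb simp: xs1z)
 from lint_add[OF this iai[of "Sm V h" N]] Sb show ?thesis
 unfolding B'_def by (simp add: distrib_left)
 qed
 fix zt zt' g g' assume z: "C1c zt zt'" and g: "C1c g g'"
 have "(LI p. g (snd p) * (zt' (fst p) * (xs1 (fst p) * Dm V f p) + zt (fst p) * B' p))
 = (LI p. g (snd p) * ((zt' (fst p) * xs1 (fst p) + zt (fst p) * xs1' (fst p)) * Dm V f p + (zt (fst p) * xs1 (fst p)) * (ia V p * Sm V h p)))"
 by (simp add: B'_def algebra_simps)
 then show "(LI p. g (snd p) * (zt' (fst p) * (xs1 (fst p) * Dm V f p) + zt (fst p) * B' p)) = 0"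
 using evenE(2)[OF C1c_mult[OF z xs1(1)] g] by simp
 qed
 have L2: "2 * L > 0" using L by simp
 define dl where "dl n = 1 / real (Suc n)" for n
 have dl: "dl n > 0" for n by (simp add: dl_def)
 \<comment> \<open>The cutoff is 0 for E - V <= dl and 1 for E - V >= 2 dl. Only \<open>Sm\<close>
   carries it, since even test functions give the equation of \<open>Dm\<close> across turning
   points.\<close>
 define et where "et n p = vt ((snd p - V (fst p)) / dl n)" for n p
 define et' where "et' n p = vt' ((snd p - V (fst p)) / dl n) / dl n" for n p
 have [measurable]: "et n \<in> bm" "et' n \<in> bm" for n
 unfolding et_def et'_def by measurable
 have etb: "%%et n p%% <= 1" for n p unfolding et_def by (rule vt1)
 have et'b: "%%et' n p%% <= Kvt / dl n" for n p unfolding et'_def using vt(7) dl[of n] by (simp add: divide_right_mono)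
 have Set: "%%Sm V f p * et n p%% <= 2 * M" for n p using bdd[OF Sb(1) etb, of p n p] by simp
 define A where "A n p = xs1 (fst p) * (Sm V f p * et n p)" for n p
 define A' where "A' n p = xs1' (fst p) * (Sm V f p * et n p) + xs1 (fst p) * (- k (fst p) * Sm V f p * et' n p + ia V p * Dm V h p * et n p)" for n p
 have dA: "dxE (2*L) (A n) (A' n)" for n
 unfolding dxE_def
 proof (intro conjI allI impI)
 show "A n \<in> bm" "A' n \<in> bm" unfolding A_def[abs_def] A'_def[abs_def] by measurable
 show "A n p = 0" "A' n p = 0" if "2 * L < %%fst p%%" for p using xs1z[OF that] by (auto simp: A_def A'_def)
 show "intgr (%p. ivl N (snd p) * A n p)" for N
 unfolding A_def by (rule bdi[of _ "K1 * (2 * M)"]) (auto intro!: bdd K1 Set simp: xs1z)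
 show "intgr (%p. ivl N (snd p) * A' n p)" for N
 proof -
 have 1: "intgr (%p. ivl N (snd p) * (xs1' (fst p) * (Sm V f p * et n p)))"
 by (rule bdi[of _ "K1 * (2 * M)"]) (auto intro!: bdd K1 Set simp: xs1z)
 have 2: "intgr (%p. ivl N (snd p) * (xs1 (fst p) * (- k (fst p) * Sm V f p * et' n p)))"
 proof (rule integrable_kbox[where C="K1 * (2 * M * (Kvt / dl n))" and R="2*L" and Y=N])
 fix p
 have 1: "%%xs1 (fst p) * (Sm V f p * et' n p)%% <= K1 * (2 * M * (Kvt / dl n))"
 by (intro bdd K1 Sb et'b)
 have "%%k (fst p) * (xs1 (fst p) * (Sm V f p * et' n p))%% <= %%k (fst p)%% * (K1 * (2 * M * (Kvt / dl n)))"
 by (rule bdd[OF order_refl 1])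
 also have "... <= (1 + %%k (fst p)%%) * (K1 * (2 * M * (Kvt / dl n)))"
 using order_trans[OF abs_ge_zero 1] by (intro mult_right_mono) auto
 finally have 2: "%%k (fst p) * (xs1 (fst p) * (Sm V f p * et' n p))%% <= (1 + %%k (fst p)%%) * (K1 * (2 * M * (Kvt / dl n)))" .
 have "ivl N (snd p) * (xs1 (fst p) * (- k (fst p) * Sm V f p * et' n p)) = (ivl N (snd p) * ivl (2*L) (fst p)) * - (k (fst p) * (xs1 (fst p) * (Sm V f p * et' n p)))"
 by (subst xs1L(1)) (simp add: mult_ac)
 also have "%%...%% <= (ivl N (snd p) * ivl (2*L) (fst p)) * ((1 + %%k (fst p)%%) * (K1 * (2 * M * (Kvt / dl n))))"
 unfolding abs_mult[of "ivl N (snd p) * ivl (2*L) (fst p)"] abs_minus_cancel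
 by (intro mult_mono 2) auto
 finally show "%%ivl N (snd p) * (xs1 (fst p) * (- k (fst p) * Sm V f p * et' n p))%% <= K1 * (2 * M * (Kvt / dl n)) * (ivl (2*L) (fst p) * (1 + %%k (fst p)%%) * ivl N (snd p))"
 by (simp only: mult_ac)
 qed measurable
 have 3: "intgr (%p. ivl N (snd p) * (xs1 (fst p) * (ia V p * (Dm V h p * et n p))))"
 proof (rule iai)
 show "%%Dm V h p * et n p%% <= 2 * M" for p using bdd[OF Sb(4) etb, of p n p] by simp
 qed measurable
 from lint_add[OF 1 lint_add[OF 2 3]] show ?thesis
 by (simp add: A'_def algebra_simps)
 qed
 fix zt zt' g g' assume z: "C1c zt zt'" and g: "C1c g g'"
 have "(LI p. g (snd p) * (zt' (fst p) * A n p + zt (fst p) * A' n p))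
 = (LI p. g (snd p) * ((zt' (fst p) * xs1 (fst p) + zt (fst p) * xs1' (fst p)) * (Sm V f p * vt ((snd p - V (fst p)) / dl n))
 + (zt (fst p) * xs1 (fst p)) * (- k (fst p) * Sm V f p * vt' ((snd p - V (fst p)) / dl n) / dl n
 + ia V p * Dm V h p * vt ((snd p - V (fst p)) / dl n))))"
 by (simp add: A_def A'_def et_def et'_def algebra_simps)
 then show "(LI p. g (snd p) * (zt' (fst p) * A n p + zt (fst p) * A' n p)) = 0"
 using oddE[OF dl[of n] C1c_mult[OF z xs1(1)] g] by simp
 qed
 define P where "P p = ia V p * (Dm V h p * Dm V f p + Sm V f p * Sm V h p)" for p
 have [measurable]: "P \<in> bm" unfolding P_def[abs_def] by measurable
 \<comment> \<open>\<open>main\<close> is the wanted integrand times the cutoff, \<open>bdry\<close>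
   the contribution of the derivative of the cutoff.\<close>
 define main where "main n p = g (snd p) * (xs' (fst p) * (Sm V f p * Dm V f p) + xs (fst p) * P p) * et n p" for n p
 define bdry where "bdry n p = g (snd p) * xs (fst p) * (- k (fst p)) * (Sm V f p * Dm V f p) * et' n p" for n p
 have [measurable]: "main n \<in> bm" "bdry n \<in> bm" for n
 unfolding main_def bdry_def by measurable
 define dom where "dom p = g (snd p) * xs' (fst p) * (Sm V f p * Dm V f p)" for p
 define dom2 where "dom2 p = g (snd p) * xs (fst p) * P p" for p
 have [measurable]: "dom \<in> bm" "dom2 \<in> bm" unfolding dom_def[abs_def] dom2_def[abs_def] by measurable
 have idom: "intgr dom"
 proof (rule integrable_box[where C="G * K * (2 * M * (2 * M))" and R=R0 and Y=N])
 show "%%dom p%% <= G * K * (2 * M * (2 * M))" for p unfolding dom_def by (intro bdd G K Sb)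
 show "dom p ~= 0 ==> %%fst p%% <= R0 & %%snd p%% <= N" for p
 using R0(2)[of "fst p"] N(2)[of "snd p"] by (auto simp: dom_def intro: ccontr)
 qed measurable
 have idom2: "intgr dom2"
 proof -
 have "intgr (%p. (g (snd p) * xs (fst p) * (Dm V h p * Dm V f p + Sm V f p * Sm V h p)) * (ivl R0 (fst p) * (ivl N (snd p) * ia V p)))"
 proof (rule integrable_bdd_mult[OF integrable_ia, where K="G * K * (2 * M * (2 * M) + 2 * M * (2 * M))"])
 show "%%g (snd p) * xs (fst p) * (Dm V h p * Dm V f p + Sm V f p * Sm V h p)%% <= G * K * (2 * M * (2 * M) + 2 * M * (2 * M))" for p
 by (intro bdd bda G K Sb)
 qed simp
 moreover have "(g (snd p) * xs (fst p) * (Dm V h p * Dm V f p + Sm V f p * Sm V h p)) * (ivl R0 (fst p) * (ivl N (snd p) * ia V p))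
 = (ivl N (snd p) * g (snd p)) * (ivl R0 (fst p) * xs (fst p)) * P p" for p
 by (simp add: P_def mult_ac)
 moreover have "ivl N (snd p) * g (snd p) = g (snd p)" "ivl R0 (fst p) * xs (fst p) = xs (fst p)" for p :: "R2"
 by (rule ivl1, use R0(2) N(2) in blast)+
 ultimately show ?thesis by (simp add: dom2_def[abs_def])
 qed
 have main_eq: "main n p = (dom p + dom2 p) * et n p" for n p
 by (simp add: main_def dom_def dom2_def algebra_simps)
 have idd: "intgr (%p. dom p + dom2 p)" by (rule lint_add[OF idom idom2])
 have imain: "intgr (main n)" for n
 using integrable_bdd_mult[OF idd, of "et n" 1] etb by (simp add: main_eq[abs_def] mult.commute)
 have ibdry: "intgr (bdry n)" for n
 proof (rule integrable_kbox[where C="G * K * (2 * M * (2 * M)) * (Kvt / dl n)" and R=R0 and Y=N])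
 fix p
 have 1: "%%g (snd p) * xs (fst p) * (Sm V f p * Dm V f p) * et' n p%% <= G * K * (2 * M * (2 * M)) * (Kvt / dl n)"
 by (intro bdd G K Sb et'b)
 have e: "bdry n p = - (k (fst p) * (g (snd p) * xs (fst p) * (Sm V f p * Dm V f p) * et' n p))"
 by (simp add: bdry_def mult_ac)
 have "%%bdry n p%% <= %%k (fst p)%% * (G * K * (2 * M * (2 * M)) * (Kvt / dl n))"
 unfolding e abs_minus_cancel by (rule bdd[OF order_refl 1])
 also have "... <= (1 + %%k (fst p)%%) * (G * K * (2 * M * (2 * M)) * (Kvt / dl n))"
 using order_trans[OF abs_ge_zero 1] by (intro mult_right_mono) auto
 finally have b: "%%bdry n p%% <= (1 + %%k (fst p)%%) * (G * K * (2 * M * (2 * M)) * (Kvt / dl n))" .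
 show "%%bdry n p%% <= G * K * (2 * M * (2 * M)) * (Kvt / dl n) * (ivl R0 (fst p) * (1 + %%k (fst p)%%) * ivl N (snd p))"
 proof (cases "%%fst p%% >= R0 | %%snd p%% >= N")
 case True
 then have "bdry n p = 0" using R0(2)[of "fst p"] N(2)[of "snd p"] by (auto simp: bdry_def)
 moreover have "0 <= G * K * (2 * M * (2 * M)) * (Kvt / dl n) * (ivl R0 (fst p) * (1 + %%k (fst p)%%) * ivl N (snd p))"
 using order_trans[OF abs_ge_zero 1] by (rule mult_nonneg_nonneg) simp
 ultimately show ?thesis by simp
 next
 case False
 then have "ivl R0 (fst p) = 1" "ivl N (snd p) = 1" by (auto simp: indicator_def)
 then show ?thesis using b by (simp add: mult_ac)
 qed
 qed measurable
 have sum0: "(LI p. main n p) + (LI p. bdry n p) = 0" for n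
 proof -
 have "(LI p. g (snd p) * (xs' (fst p) * (A n p * (xs1 (fst p) * Dm V f p)) + xs (fst p) * (A' n p * (xs1 (fst p) * Dm V f p) + A n p * B' p))) = 0"
 proof (rule dxE_mult[OF dA dB L2 _ _ xs g])
 show "%%A n p%% <= K1 * (2 * M * 1)" for p unfolding A_def by (intro bdd K1 Sb etb)
 have "%%xs1 (fst p) * Dm V f p%% <= K1 * (2 * M)" for p by (intro bdd K1 Sb)
 then show "%%xs1 (fst p) * Dm V f p%% <= K1 * (2 * M * 1)" for p by simp
 qed
 moreover have "g (snd p) * (xs' (fst p) * (A n p * (xs1 (fst p) * Dm V f p)) + xs (fst p) * (A' n p * (xs1 (fst p) * Dm V f p) + A n p * B' p))
 = main n p + bdry n p" for p
 proof (cases "%%fst p%% >= R0")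
 case True
 then show ?thesis using R0(2)[of "fst p"] by (simp add: main_def bdry_def)
 next
 case False
 then have "%%fst p%% <= L" by (simp add: L_def)
 note e = xs1(2,3)[OF this]
 show ?thesis by (simp add: main_def bdry_def A_def A'_def B'_def P_def e algebra_simps)
 qed
 ultimately show ?thesis using Bochner_Integration.integral_add[OF imain[of n] ibdry[of n]] by simp
 qed
 have lim_main: "(%n. LI p. main n p) ----> (LI p. dom p + dom2 p)"
 proof (rule dct)
 show "intgr (%p. %%dom p + dom2 p%%)" using idd by (rule integrable_abs)
 show "AE p in lborel. norm (main n p) <= %%dom p + dom2 p%%" for n
 proof (rule AE_I2)
 fix p show "norm (main n p) <= %%dom p + dom2 p%%"
 using bdd[OF order_refl etb, of "dom p + dom2 p" n p] by (simp add: main_eq)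
 qed
 show "AE p in lborel. (%n. main n p) ----> dom p + dom2 p"
 proof (rule AE_I2)
 fix p
 show "(%n. main n p) ----> dom p + dom2 p"
 proof (cases "V (fst p) < snd p")
 case True
 obtain m where m: "2 / (snd p - V (fst p)) <= real m" using real_arch_simple by blast
 have "eventually (%n. main n p = dom p + dom2 p) sequentially"
 using eventually_ge_at_top[of m]
 proof eventually_elim
 case (elim n)
 then have "2 / (snd p - V (fst p)) <= real (Suc n)" using m by simp
 then have "2 <= (snd p - V (fst p)) / dl n" using True by (simp add: dl_def divide_le_eq mult.commute)
 then show ?case using vt(4) by (simp add: main_eq et_def)
 qed
 then show ?thesis by (rule tendsto_eventually)
 next
 case False
 then have "dom p + dom2 p = 0" by (simp add: dom_def dom2_def P_def Sm_def ia_def above_def)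
 then show ?thesis by (simp add: main_eq)
 qed
 qed
 qed measurable
 have trace: "AE x in lborel. %%x%% <= R0 & k x ~= 0 --> (\<exists>C\<ge>0. \<forall>\<^sub>F n in sequentially.
 (\<integral>\<^sup>+E. indicator {V x<..<V x + 3 * dl n} E * ennreal %%Dm V f (x, E)%% \<partial>lborel)
 <= ennreal (C * dl n * sqrt (dl n)))"
 proof -
 have *: "R0 = L - 1" by (simp add: L_def)
 show ?thesis
 unfolding dl_def * by (rule Dm_trace[OF assms(1,2) bd _ _ B'_def dB L2]) (use xs1 in auto)
 qed
 have bslice: "AE x in lborel. \<forall>n. intgr (%E. bdry n (x, E))"
 unfolding AE_all_countable
 proof
 fix n
 show "AE x in lborel. intgr (%E. bdry n (x, E))"
 using lborel_pair.AE_integrable_fst'[of "bdry n"] ibdry[of n] by (simp add: lborel_prod)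
 qed
 \<comment> \<open>\<open>et'\<close> has size 1/dl and lives on dl <= E - V <= 2 dl, inside the
   band of width 3 dl treated by \<open>Dm_trace\<close>.\<close>
 have bE: "%%bdry n (x, E)%% <= ivl R0 x * (G * K * %%k x%% * (2 * M) * (Kvt / dl n)) * (indicator {V x<..<V x + 3 * dl n} E * %%Dm V f (x, E)%%)" for n x E
 proof (cases "%%x%% >= R0")
 case True
 then show ?thesis using R0(2)[OF True] G K M0 vt(8) dl[of n] by (simp add: bdry_def)
 next
 case x: False
 then have i: "ivl R0 x = 1" by (auto simp: indicator_def)
 show ?thesis
 proof (cases "E \<in> {V x<..<V x + 3 * dl n}")
 case True
 have "%%g E * xs x * %%k x%% * (Sm V f (x, E) * et' n (x, E))%% <= G * K * %%k x%% * (2 * M * (Kvt / dl n))"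
 by (intro bdd G K Sb et'b) auto
 from mult_right_mono[OF this abs_ge_zero[of "Dm V f (x, E)"]] True show ?thesis
 by (simp add: i bdry_def abs_mult mult_ac)
 next
 case False
 have "(E - V x) / dl n \<notin> {1..2}"
 using False dl[of n] by (auto simp: le_divide_eq divide_le_eq)
 then have "bdry n (x, E) = 0" using vt(6) by (simp add: bdry_def et'_def)
 then show ?thesis using G K M0 vt(8) dl[of n] by (simp add: i)
 qed
 qed
 \<comment> \<open>For k x nonzero the trace estimate leaves a slice integral of order dl^(3/2)/dl,
   and for k x = 0 the integrand is zero. The crude bound |Dm| <= 2 M on the band supplies a
   majorant that is a multiple of |k| on [-R0, R0].\<close>
 have lim_bdry: "(%n. LI p. bdry n p) ----> 0"
 proof -
 define J where "J n x = (\<integral>\<^sup>+E. indicator {V x<..<V x + 3 * dl n} E * ennreal %%Dm V f (x, E)%% \<partial>lborel)" for n x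
 define b where "b x = ivl R0 x * (G * K * %%k x%% * (2 * M) * Kvt)" for x
 have b0: "b x >= 0" for x using G K M0 vt(8) by (simp add: b_def)
 have GJ: "ennreal %%LI E. bdry n (x, E)%% <= ennreal (b x / dl n) * J n x"
 if "intgr (%E. bdry n (x, E))" for n x
 proof -
 have "ennreal %%LI E. bdry n (x, E)%% <= (\<integral>\<^sup>+E. norm (bdry n (x, E)) \<partial>lborel)"
 using integral_norm_bound_ennreal[OF that] by simp
 also have "... <= (\<integral>\<^sup>+E. ennreal (b x / dl n) * (indicator {V x<..<V x + 3 * dl n} E * ennreal %%Dm V f (x, E)%%) \<partial>lborel)"
 proof (rule nn_integral_mono)
 fix E
 have "ennreal (norm (bdry n (x, E))) <= ennreal (b x / dl n * (indicator {V x<..<V x + 3 * dl n} E * %%Dm V f (x, E)%%))"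
 using bE[of n x E] by (intro ennreal_leI) (simp add: b_def)
 also have "... = ennreal (b x / dl n) * (indicator {V x<..<V x + 3 * dl n} E * ennreal %%Dm V f (x, E)%%)"
 proof -
 have "0 <= b x / dl n" using b0[of x] dl[of n] by simp
 then show ?thesis by (cases "E \<in> {V x<..<V x + 3 * dl n}") (simp_all add: ennreal_mult del: times_divide_eq_left)
 qed
 finally show "ennreal (norm (bdry n (x, E))) <= ennreal (b x / dl n) * (indicator {V x<..<V x + 3 * dl n} E * ennreal %%Dm V f (x, E)%%)" .
 qed
 also have "... = ennreal (b x / dl n) * J n x"
 unfolding J_def by (rule nn_integral_cmult) measurable
 finally show ?thesis .
 qed
 have Jb: "J n x <= ennreal (6 * M * dl n)" for n x
 proof -
 have "J n x <= (\<integral>\<^sup>+E. ennreal (2 * M) * indicator {V x<..<V x + 3 * dl n} E \<partial>lborel)"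
 unfolding J_def using Sb(2) by (intro nn_integral_mono) (auto simp: indicator_def intro: ennreal_leI)
 also have "... = ennreal (6 * M * dl n)"
 using M0 dl[of n] by (simp add: nn_integral_cmult ennreal_mult[symmetric])
 finally show ?thesis .
 qed
 have real_le: "%%LI E. bdry n (x, E)%% <= b x / dl n * c"
 if "intgr (%E. bdry n (x, E))" "J n x <= ennreal c" "c >= 0" for n x c
 proof -
 have "ennreal %%LI E. bdry n (x, E)%% <= ennreal (b x / dl n) * ennreal c"
 using GJ[OF that(1)] mult_left_mono[OF that(2), of "ennreal (b x / dl n)"] by (meson order_trans zero_le)
 also have "... = ennreal (b x / dl n * c)"
 by (rule ennreal_mult[symmetric]) (use b0[of x] dl[of n] that(3) in auto)
 finally have le: "ennreal %%LI E. bdry n (x, E)%% <= ennreal (b x / dl n * c)" .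
 have "0 <= b x / dl n * c" using b0[of x] dl[of n] that(3) by simp
 from ennreal_le_iff[OF this] le show ?thesis by blast
 qed
 have "(%n. LI x. LI E. bdry n (x, E)) ----> (LINT x|(lborel :: real measure). 0)"
 proof (rule dct)
 have "intgr (%x. ivl R0 x * k x)" using k by (simp add: locint_def)
 from integrable_mult_right[OF integrable_abs[OF this], of "G * K * (2 * M) * Kvt * (6 * M)"]
 show "intgr (%x. b x * (6 * M))" by (simp add: b_def abs_mult mult_ac)
 show "(%x. LI E. bdry n (x, E)) \<in> borel_measurable lborel" for n
 using borel_measurable_integrable[OF lborel_pair.integrable_fst'[of "bdry n"]] ibdry[of n] by (simp add: lborel_prod)
 show "AE x in lborel. norm (LI E. bdry n (x, E)) <= b x * (6 * M)" for n
 using bslice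
 proof eventually_elim
 case (elim x)
 have "0 <= 6 * M * dl n" using M0 dl[of n] by simp
 from real_le[OF elim[rule_format] Jb this] show ?case using dl[of n] by simp
 qed
 show "AE x in lborel. (%n. LI E. bdry n (x, E)) ----> 0"
 using bslice trace
 proof eventually_elim
 case (elim x)
 note sl = elim(1)[rule_format]
 show ?case
 proof (cases "%%x%% <= R0 & k x ~= 0")
 case True
 then obtain C where C: "C >= 0" "\<forall>\<^sub>F n in sequentially. J n x <= ennreal (C * dl n * sqrt (dl n))"
 using elim(2) unfolding J_def by blast
 have "dl ----> 0" unfolding dl_def by (rule LIMSEQ_Suc[OF lim_1_over_n])
 then have "(%n. b x * C * sqrt (dl n)) ----> b x * C * sqrt 0" by (intro tendsto_intros)
 then have l: "(%n. b x * C * sqrt (dl n)) ----> 0" by simp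
 show ?thesis
 proof (rule Lim_null_comparison[OF _ l], use C(2) in eventually_elim)
 case (elim n)
 have "0 <= C * dl n * sqrt (dl n)" using C(1) dl[of n] by simp
 from real_le[OF sl elim this] show ?case using dl[of n] by simp
 qed
 next
 case False
 then have "bdry n (x, E) = 0" for n E using R0(2)[of x] by (auto simp: bdry_def)
 then show ?thesis by simp
 qed
 qed
 qed simp
 then show ?thesis using lborel_integral_fst[OF ibdry] by simp
 qed
 have "(%n. (LI p. main n p) + (LI p. bdry n p)) ----> (LI p. dom p + dom2 p) + 0"
 by (rule tendsto_add[OF lim_main lim_bdry])
 then have z: "(LI p. dom p + dom2 p) = 0"
 unfolding sum0 by (simp add: LIMSEQ_const_iff)
 obtain Y where Y: "Y > 0" "!!p. %%fst p%% <= R0 ==> %%En V p%% <= N ==> %%snd p%% <= Y" using speed_bound by blast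
 have sp: "xs (fst p) = 0 & xs' (fst p) = 0 | g (En V p) = 0 | %%fst p%% <= R0 & %%snd p%% <= Y" for p
 proof (cases "%%fst p%% >= R0 | %%En V p%% >= N")
 case True
 then show ?thesis using R0(2) N(2) by blast
 next
 case False
 then show ?thesis using Y(2)[of p] by auto
 qed
 let ?F = "%p. (f p)^2 * (snd p * xs' (fst p) * g (En V p)) + (2 * f p * h p) * (xs (fst p) * g (En V p))"
 have iF: "intgr ?F"
 proof (rule integrable_box)
 show "?F p ~= 0 ==> %%fst p%% <= R0 & %%snd p%% <= Y" for p using sp[of p] by auto
 show "%%?F p%% <= M * M * (Y * K * G) + (2 * M * M) * (K * G)" for p
 proof (cases "xs (fst p) = 0 & xs' (fst p) = 0 | g (En V p) = 0")
 case True
 then have "?F p = 0" by auto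
 then show ?thesis using M0 Y K G by simp
 next
 case False
 then have y: "%%snd p%% <= Y" using sp[of p] by blast
 have "%%2 :: real%% <= 2" by simp
 then show ?thesis unfolding power2_eq_square using y by (intro bda bdd bd K G) auto
 qed
 qed measurable
 have "(LI p. ?F p) = (LI p. foldE V ?F p)" using integral_foldE(2)[OF Vm iF] by simp
 also have "... = (LI p. dom p + dom2 p)"
 unfolding foldE_square by (simp add: dom_def dom2_def P_def algebra_simps)
 finally show ?thesis using z by simp
qed

end

section \<open>Mollification in time\<close>

lemma integrable_box3:
 fixes F :: "R3 => real"
 assumes [measurable]: "F \<in> bm" and bd: "!!z. %%F z%% <= C"
 and sp: "!!z. F z ~= 0 ==> in_box R z"
 shows "intgr F"
proof (rule lint_bound)
 have "intgr (%x. ivl R x * C)" by (intro integrable_mult_left integrable_ivl)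
 from integrable_kernel_box[OF this]
 show "intgr (%z::R3. ivl R (fst z) * (ivl R (px z) * C * ivl R (py z)))" .
 show "AE z in lborel. norm (F z) <= norm (ivl R (fst z) * (ivl R (px z) * C * ivl R (py z)))"
 proof (rule AE_I2)
 fix z
 show "norm (F z) <= norm (ivl R (fst z) * (ivl R (px z) * C * ivl R (py z)))"
 proof (cases "F z = 0")
 case False
 then have "ivl R (fst z) = 1" "ivl R (px z) = 1" "ivl R (py z) = 1"
 using sp[of z] by (auto simp: in_box_def indicator_def abs_le_iff)
 then show ?thesis using order_trans[OF bd[of z] abs_ge_self] by simp
 qed simp
 qed
qed simp

lemma lborel_integral_snd3:
 fixes F :: "R3 => real"
 assumes "intgr F"
 shows "(LI z. F z) = (LI p. LI s. F (s, p))"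
 "(LI z. F z) = (LI s. LI p. F (s, p))"
 "AE p in lborel. intgr (%s. F (s, p))"
proof -
 have f: "integrable (lborel \<Otimes>\<^sub>M lborel) (%(x, E). F (x, E))" using assms by (simp add: lborel_prod)
 show "(LI z. F z) = (LI p. LI s. F (s, p))"
 using lborel_pair.integral_snd[OF f] by (simp add: lborel_prod)
 show "(LI z. F z) = (LI s. LI p. F (s, p))"
 using lborel_pair.integral_fst'[of F] assms by (simp add: lborel_prod)
 show "AE p in lborel. intgr (%s. F (s, p))"
 by (rule lborel_pair.AE_integrable_snd[OF f])
qed

lemma C1c_integrable:
 assumes "C1c f f'"
 shows "intgr f" "intgr f'"
proof -
 obtain R where R: "R > 0" "!!x. %%x%% >= R ==> f x = 0 & f' x = 0" using C1c_support[OF assms] by blast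
 have "ivl R x * f x = f x" "ivl R x * f' x = f' x" for x
 using R(2)[of x] by (cases "%%x%% >= R"; auto simp: indicator_def)+
 then have "(%x. ivl R x * f x) = f" "(%x. ivl R x * f' x) = f'" by (auto intro: ext)
 then show "intgr f" "intgr f'"
 using integrable_ivl_continuous[OF C1cD(3)[OF assms], of R] integrable_ivl_continuous[OF C1cD(2)[OF assms], of R] by simp_all
qed

lemma C1c_reflect_shift:
 assumes "C1c f f'"
 shows "C1c (%s. f (t - s)) (%s. - f' (t - s))"
proof -
 obtain R where R: "R > 0" "!!x. %%x%% >= R ==> f x = 0 & f' x = 0" using C1c_support[OF assms] by blast
 show ?thesis
 unfolding C1c_def
 proof (intro conjI allI exI[of _ "R + %%t%%"] impI)
 fix s
 have "((%s. t - s) has_real_derivative - 1) (at s)" by (auto intro!: derivative_eq_intros)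
 from DERIV_chain2[where f=f and g="%s. t - s", OF C1cD(1)[OF assms] this]
 show "((%s. f (t - s)) has_real_derivative - f' (t - s)) (at s)" by simp
 next
 show "continuous_on UNIV (%s. - f' (t - s))"
 by (intro continuous_on_minus cont_comp[OF C1cD(2)[OF assms]] continuous_intros) auto
 next
 fix s assume "%%s%% >= R + %%t%%"
 then have "%%t - s%% >= R" by linarith
 from R(2)[OF this] show "f (t - s) = 0" "- f' (t - s) = 0" by auto
 qed
qed

definition conv :: "(real => real) => (R3 => real) => R3 => real" where
 "conv kp u z = (LI s. kp (fst z - s) * u (s, snd z))"

lemma borel_measurable_conv [measurable]:
 assumes [measurable]: "kp \<in> bm" "u \<in> bm"
 shows "conv kp u \<in> bm"
proof -
 have "(%(z, s). kp (fst z - s) * u (s, snd z)) \<in> borel_measurable ((lborel :: (R3) measure) \<Otimes>\<^sub>M lborel)"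
 unfolding lborel_prod split_def by measurable
 from lborel.borel_measurable_lebesgue_integral[OF this] show ?thesis by (simp add: conv_def[abs_def])
qed

lemma conv_integrable:
 fixes kp :: "real => real" and u :: "R3 => real"
 assumes kp: "continuous_on UNIV kp" "!!x. %%x%% >= R ==> kp x = 0" and [measurable]: "u \<in> bm"
 and u: "!!z. %%u z%% <= M"
 shows "intgr (%s. kp (t - s) * u (s, p))"
proof -
 obtain K where K: "K >= 0" "!!x. %%kp x%% <= K" using continuous_compact_support_bounded[OF kp] by blast
 have [measurable]: "kp \<in> bm" using kp(1) by (simp add: bm_cont)
 have M0: "M >= 0" using order_trans[OF abs_ge_zero u] .
 show ?thesis
 proof (rule lint_bound[OF integrable_mult_right[OF integrable_ivl[of "R + %%t%%"], of "K * M"]])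
 show "AE s in lborel. norm (kp (t - s) * u (s, p)) <= norm (K * M * ivl (R + %%t%%) s)"
 proof (rule AE_I2)
 fix s
 show "norm (kp (t - s) * u (s, p)) <= norm (K * M * ivl (R + %%t%%) s)"
 proof (cases "%%t - s%% >= R")
 case True
 then show ?thesis using kp(2) by simp
 next
 case False
 then have "ivl (R + %%t%%) s = 1" by (auto simp: indicator_def)
 moreover have "%%kp (t - s)%% * %%u (s, p)%% <= K * M" using K u by (intro mult_mono) auto
 ultimately show ?thesis using K(1) M0 by (simp add: abs_mult)
 qed
 qed
 qed measurable
qed

lemma conv_bounded:
 assumes kp: "intgr kp" and [measurable]: "u \<in> bm"
 and u: "!!z. %%u z%% <= M"
 shows "%%conv kp u z%% <= (LI s. %%kp s%%) * M"
proof -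
 have [measurable]: "kp \<in> bm" using kp by auto
 have i: "intgr (%s. %%kp (fst z - s)%%)"
 using lborel_integrable_real_affine[OF integrable_abs[OF kp], of "-1" "fst z"] by simp
 have "%%conv kp u z%% <= (LI s. %%kp (fst z - s) * u (s, snd z)%%)" unfolding conv_def by (rule integral_abs_bound)
 also have "... <= (LI s. %%kp (fst z - s)%% * M)"
 proof (rule integral_mono')
 show "%%kp (fst z - s) * u (s, snd z)%% <= %%kp (fst z - s)%% * M" for s
 unfolding abs_mult by (intro mult_left_mono u) simp
 show "0 <= %%kp (fst z - s)%% * M" for s using order_trans[OF abs_ge_zero u] by simp
 qed (use i in simp)
 also have "... = (LI s. %%kp (fst z - s)%%) * M" by simp
 also have "(LI s. %%kp (fst z - s)%%) = (LI s. %%kp s%%)"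
 using lborel_integral_real_affine[of "-1" "%s. %%kp s%%" "fst z"] by simp
 finally show ?thesis .
qed

text \<open>Functions of time and position; the velocity enters through the conserved factor g(H).
  Slices are C^1 for the one-variable arguments, and approximability admits the function in the weak
  formulation.\<close>

definition tx_test :: "(R2 => real) => (R2 => real) => (R2 => real) => bool" where
 "tx_test Th Tht Thx \<longleftrightarrow>
 (\<forall>t x. ((%s. Th (s, x)) has_real_derivative Tht (t, x)) (at t)) &
 (\<forall>t x. ((%s. Th (t, s)) has_real_derivative Thx (t, x)) (at x)) &
 continuous_on UNIV Th & continuous_on UNIV Tht & continuous_on UNIV Thx &
 (\<exists>L. \<forall>p. %%fst p%% >= L | %%snd p%% >= L --> Th p = 0 & Tht p = 0 & Thx p = 0) &
 (\<forall>R>0. approximable R (%z. Th (tx z)) (%z. Tht (tx z)) (%z. Thx (tx z)) (%z. 0))"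

lemma tx_test_support:
 assumes "tx_test Th Tht Thx"
 obtains L where "L > 0" "!!p. %%fst p%% >= L | %%snd p%% >= L ==> Th p = 0 & Tht p = 0 & Thx p = 0"
proof -
 obtain L where L: "!!p. %%fst p%% >= L | %%snd p%% >= L ==> Th p = 0 & Tht p = 0 & Thx p = 0"
 using assms unfolding tx_test_def by blast
 show thesis by (rule that[of "max L 1"]) (use L in auto)
qed

lemma tx_test_bounded:
 assumes "tx_test Th Tht Thx"
 obtains K where "K >= 0" "!!p. %%Th p%% <= K" "!!p. %%Tht p%% <= K" "!!p. %%Thx p%% <= K"
proof -
 obtain L where L: "L > 0" "!!p. %%fst p%% >= L | %%snd p%% >= L ==> Th p = 0 & Tht p = 0 & Thx p = 0"
 using tx_test_support[OF assms] by blast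
 have b: "\<exists>K\<ge>0. \<forall>p. %%f p%% <= K" if c: "continuous_on UNIV f" and z: "!!p. %%fst p%% >= L | %%snd p%% >= L ==> f p = 0"
 for f :: "R2 => real"
 proof -
 have "bounded (f ` ({-L..L} \<times> {-L..L}))"
 by (intro compact_imp_bounded compact_continuous_image continuous_on_subset[OF c] compact_Times) auto
 then obtain K where K: "!!p. p \<in> {-L..L} \<times> {-L..L} ==> %%f p%% <= K" unfolding bounded_iff by fastforce
 have "%%f p%% <= %%K%%" for p
 proof (cases "p \<in> {-L..L} \<times> {-L..L}")
 case True
 then show ?thesis using K[OF True] by linarith
 next
 case False
 then have "%%fst p%% >= L | %%snd p%% >= L" by (auto simp: mem_Times_iff)
 then show ?thesis using z by simp
 qed
 then show ?thesis by (intro exI[of _ "%%K%%"]) auto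
 qed
 have "continuous_on UNIV Th" "continuous_on UNIV Tht" "continuous_on UNIV Thx" using assms by (auto simp: tx_test_def)
 then obtain K1 K2 K3 where "K1 >= 0" "\<forall>p. %%Th p%% <= K1" "K2 >= 0" "\<forall>p. %%Tht p%% <= K2" "K3 >= 0" "\<forall>p. %%Thx p%% <= K3"
 using b[of Th] b[of Tht] b[of Thx] L(2) by metis
 then show thesis by (intro that[of "max K1 (max K2 K3)"]) (auto simp: le_max_iff_disj)
qed

lemma tx_test_measurable:
 assumes "tx_test Th Tht Thx"
 shows "Th \<in> bm" "Tht \<in> bm" "Thx \<in> bm"
 using assms by (auto simp: tx_test_def intro: bm_cont)

lemma tx_test_slices:
 assumes "tx_test Th Tht Thx"
 shows "C1c (%x. Th (t, x)) (%x. Thx (t, x))" "C1c (%t. Th (t, x)) (%t. Tht (t, x))"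
proof -
 obtain L where L: "L > 0" "!!p. %%fst p%% >= L | %%snd p%% >= L ==> Th p = 0 & Tht p = 0 & Thx p = 0"
 using tx_test_support[OF assms] by blast
 have c: "continuous_on UNIV Tht" "continuous_on UNIV Thx" using assms by (auto simp: tx_test_def)
 show "C1c (%x. Th (t, x)) (%x. Thx (t, x))"
 unfolding C1c_def
 proof (intro conjI allI exI[of _ L] impI)
 show "continuous_on UNIV (%x. Thx (t, x))"
 by (rule cont_comp[OF c(2)]) (auto intro!: continuous_intros)
 qed (use assms L in \<open>auto simp: tx_test_def\<close>)
 show "C1c (%t. Th (t, x)) (%t. Tht (t, x))"
 unfolding C1c_def
 proof (intro conjI allI exI[of _ L] impI)
 show "continuous_on UNIV (%t. Tht (t, x))"
 by (rule cont_comp[OF c(1)]) (auto intro!: continuous_intros)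
 qed (use assms L in \<open>auto simp: tx_test_def\<close>)
qed

context potential begin

lemma approximable_En:
 assumes R: "R > 0" and g: "C1c g g'"
 shows "approximable R (%z. g (En V (snd z))) (%z. 0) (%z. g' (En V (snd z)) * k (px z)) (%z. g' (En V (snd z)) * py z)"
proof -
 have y: "approximable R (%z. py z) (%z. 0) (%z. 0) (%z. 1)"
 by (rule approximable_smooth[OF smooth_coord(3) has_partials_coord(3)])
 have "((%s::real. s^2 / 2) has_real_derivative s) (at s)" for s by (auto intro!: derivative_eq_intros)
 from approximable_comp[OF this _ y]
 have y2: "approximable R (%z. (py z)^2 / 2) (%z. 0) (%z. 0) (%z. py z)" by (simp add: continuous_on_id)
 have "approximable R (%z. En V (snd z)) (%z. 0) (%z. k (px z)) (%z. py z)"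
 using approximable_add[OF y2 approximable_potential[OF k R FTC Vc]] by (simp add: En_def)
 from approximable_comp[OF C1cD(1)[OF g] C1cD(2)[OF g] this] show ?thesis by simp
qed

lemma approximable_coord_comp:
 assumes d: "!!s. (f has_real_derivative f' s) (at s)" and c: "continuous_on UNIV f'"
 shows "approximable R (%z. f (fst z)) (%z. f' (fst z)) (%z. 0) (%z. 0)"
 "approximable R (%z. f (px z)) (%z. 0) (%z. f' (px z)) (%z. 0)"
 "approximable R (%z. f (py z)) (%z. 0) (%z. 0) (%z. f' (py z))"
 using approximable_comp[OF d c approximable_smooth[OF smooth_coord(1) has_partials_coord(1)]]
 approximable_comp[OF d c approximable_smooth[OF smooth_coord(2) has_partials_coord(2)]]
 approximable_comp[OF d c approximable_smooth[OF smooth_coord(3) has_partials_coord(3)]] by simp_all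

lemma weak_sol_test:
 assumes ws: "weak_sol k u0 w"
 and m: "w \<in> bm" "u0 \<in> bm"
 and bd: "!!z. %%w z%% <= M" "!!z. %%u0 z%% <= M"
 and ap: "!!R. R > 0 ==> approximable R Q Qt Qx Qy"
 and van: "!!z. ~ in_box L z ==> Q z = 0 & Qt z = 0 & Qx z = 0 & Qy z = 0" and L: "L > 0"
 shows "(LI z. w z * (Qt z + py z * Qx z - k (px z) * Qy z))
 = - (LI q. u0 q * Q (0, q))"
 by (rule weak_sol_approximable[OF ws m bd k _ ap[of "2 * L"]]) (use van L in auto)

text \<open>g(H) is annihilated by y d_x - k d_y, so the two terms containing \<open>g'\<close>
  cancel and no derivative of \<open>g\<close> remains.\<close>

lemma weak_sol_product:
 assumes ws: "weak_sol k u0 w"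
 and m: "w \<in> bm" "u0 \<in> bm"
 and bd: "!!z. %%w z%% <= M" "!!z. %%u0 z%% <= M"
 and a: "C1c a a'" and xs: "C1c xs xs'" and \<omega>: "C1c \<omega> \<omega>'" and g: "C1c g g'"
 shows "(LI z. w z * (a' (fst z) * (xs (px z) * \<omega> (py z) * g (En V (snd z)))
 + a (fst z) * (py z * xs' (px z) * \<omega> (py z) * g (En V (snd z)) - k (px z) * xs (px z) * \<omega>' (py z) * g (En V (snd z)))))
 = - (LI q. u0 q * (a 0 * (xs (fst q) * \<omega> (snd q) * g (En V q))))"
proof -
 obtain L1 where L1: "L1 > 0" "!!x. %%x%% >= L1 ==> a x = 0 & a' x = 0" using C1c_support[OF a] by blast
 obtain L2 where L2: "L2 > 0" "!!x. %%x%% >= L2 ==> xs x = 0 & xs' x = 0" using C1c_support[OF xs] by blast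
 obtain L3 where L3: "L3 > 0" "!!x. %%x%% >= L3 ==> \<omega> x = 0 & \<omega>' x = 0" using C1c_support[OF \<omega>] by blast
 define L where "L = L1 + L2 + L3"
 note ap = approximable_mult[OF approximable_mult[OF approximable_coord_comp(1)[OF C1cD(1,2)[OF a]] approximable_coord_comp(2)[OF C1cD(1,2)[OF xs]]]
 approximable_mult[OF approximable_coord_comp(3)[OF C1cD(1,2)[OF \<omega>]] approximable_En[OF _ g]]]
 have van: "(a (fst z) = 0 & a' (fst z) = 0) | (xs (px z) = 0 & xs' (px z) = 0) | (\<omega> (py z) = 0 & \<omega>' (py z) = 0)"
 if z: "~ in_box L z" for z
 proof -
 have "%%fst z%% > L | %%px z%% > L | %%py z%% > L" using z by (auto simp: in_box_def)
 then have "%%fst z%% >= L1 | %%px z%% >= L2 | %%py z%% >= L3" using L1(1) L2(1) L3(1) by (auto simp: L_def)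
 then show ?thesis using L1(2) L2(2) L3(2) by blast
 qed
 have L: "L > 0" using L1 L2 L3 by (simp add: L_def)
 have "(LI z. w z * (a' (fst z) * (xs (px z) * \<omega> (py z) * g (En V (snd z)))
 + a (fst z) * (py z * xs' (px z) * \<omega> (py z) * g (En V (snd z)) - k (px z) * xs (px z) * \<omega>' (py z) * g (En V (snd z)))))
 = - (LI q. u0 q * ((a (fst (0::real, q)) * xs (fst (snd (0::real, q)))) * (\<omega> (snd (snd (0::real, q))) * g (En V (snd (0::real, q))))))"
 apply (rule trans[OF _ weak_sol_test[OF ws m bd ap _ L]])
 apply (rule lint_cong[OF refl])
 apply (simp add: algebra_simps)
 apply assumption
 apply (drule van)
 apply (elim disjE conjE)
 apply simp_all
 done
 then show ?thesis by (simp add: mult.assoc)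
qed

text \<open>Testing with s -> kp (t - s) freezes the time t: the time derivative falls on the kernel
  with a minus sign, so \<open>conv kp u\<close> at time t solves the stationary equation with the
  bounded source - conv kp' u.\<close>

lemma conv_stationary:
 assumes ws: "weak_sol k (%_. 0) u" and m[measurable]: "u \<in> bm" and bd: "!!z. %%u z%% <= M"
 and kp: "C1c kp kp'" and xs: "C1c xs xs'" and \<omega>: "C1c \<omega> \<omega>'" and g: "C1c g g'"
 shows "(LI p. conv kp u (t, p) * (snd p * xs' (fst p) * \<omega> (snd p) * g (En V p) - k (fst p) * xs (fst p) * \<omega>' (snd p) * g (En V p))
 + (- conv kp' u (t, p)) * (xs (fst p) * \<omega> (snd p) * g (En V p))) = 0"
proof -
 note [measurable] = C1cD(4,5)[OF kp] C1cD(4,5)[OF xs] C1cD(4,5)[OF \<omega>] C1cD(4)[OF g]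
 have M0: "M >= 0" using order_trans[OF abs_ge_zero bd] .
 define ps where "ps p = xs (fst p) * \<omega> (snd p) * g (En V p)" for p
 define D where "D p = snd p * xs' (fst p) * \<omega> (snd p) * g (En V p) - k (fst p) * xs (fst p) * \<omega>' (snd p) * g (En V p)" for p
 have [measurable]: "ps \<in> bm" "D \<in> bm" unfolding ps_def[abs_def] D_def[abs_def] by measurable
 obtain K1 where K1: "K1 >= 0" "!!x. %%xs x%% <= K1" "!!x. %%xs' x%% <= K1" using C1c_bounded[OF xs] by metis
 obtain K2 where K2: "K2 >= 0" "!!x. %%\<omega> x%% <= K2" "!!x. %%\<omega>' x%% <= K2" using C1c_bounded[OF \<omega>] by metis
 obtain G where G: "G >= 0" "!!x. %%g x%% <= G" using C1c_bounded[OF g] by metis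
 obtain R where R: "R > 0" "!!x. %%x%% >= R ==> xs x = 0 & xs' x = 0" using C1c_support[OF xs] by blast
 obtain Y where Y: "Y > 0" "!!x. %%x%% >= Y ==> \<omega> x = 0 & \<omega>' x = 0" using C1c_support[OF \<omega>] by blast
 have bdd: "%%u * v%% <= U * W" if "%%u%% <= U" "%%v%% <= W" for u v U W :: real
 using that by (auto simp: abs_mult intro!: mult_mono)
 have ips: "intgr ps"
 proof (rule integrable_box[where C="K1 * K2 * G" and R=R and Y=Y])
 show "%%ps p%% <= K1 * K2 * G" for p unfolding ps_def by (intro bdd K1 K2 G)
 show "ps p ~= 0 ==> %%fst p%% <= R & %%snd p%% <= Y" for p
 using R(2)[of "fst p"] Y(2)[of "snd p"] unfolding ps_def by (metis linear mult_zero_left mult_zero_right)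
 qed measurable
 have iD: "intgr D"
 proof (rule integrable_kbox[where C="(Y * K1 * K2 * G) + (K1 * K2 * G)" and R=R and Y=Y])
 fix p
 have C0: "0 <= Y * K1 * K2 * G" "0 <= K1 * K2 * G" using Y K1 K2 G by auto
 show "%%D p%% <= ((Y * K1 * K2 * G) + (K1 * K2 * G)) * (ivl R (fst p) * (1 + %%k (fst p)%%) * ivl Y (snd p))"
 proof (cases "%%fst p%% >= R | %%snd p%% >= Y")
 case True
 then have "D p = 0" using R(2)[of "fst p"] Y(2)[of "snd p"] by (auto simp: D_def)
 then show ?thesis using C0 by simp
 next
 case False
 then have i: "ivl R (fst p) = 1" "ivl Y (snd p) = 1" by (auto simp: indicator_def)
 have 1: "%%snd p * xs' (fst p) * \<omega> (snd p) * g (En V p)%% <= Y * K1 * K2 * G"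
 using False by (intro bdd K1 K2 G) auto
 have 2: "%%k (fst p) * xs (fst p) * \<omega>' (snd p) * g (En V p)%% <= %%k (fst p)%% * K1 * K2 * G"
 by (intro bdd K1 K2 G) auto
 have "%%D p%% <= Y * K1 * K2 * G + %%k (fst p)%% * K1 * K2 * G"
 unfolding D_def using 1 2 abs_triangle_ineq4 by (meson add_mono order_trans)
 also have "... <= ((Y * K1 * K2 * G) + (K1 * K2 * G)) * (1 + %%k (fst p)%%)"
 using C0 mult_nonneg_nonneg[of "Y * K1 * K2 * G" "%%k (fst p)%%"] by (simp add: algebra_simps)
 finally show ?thesis by (simp add: i)
 qed
 qed measurable
 note sh = C1c_reflect_shift[OF kp, of t]
 have i1: "intgr (%z. u z * (- kp' (t - fst z) * ps (snd z)))"
 by (rule integrable_bdd_mult[OF integrable_lborel_prod_mult[OF C1c_integrable(2)[OF sh] ips] _ bd]) simp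
 have i2: "intgr (%z. u z * (kp (t - fst z) * D (snd z)))"
 by (rule integrable_bdd_mult[OF integrable_lborel_prod_mult[OF C1c_integrable(1)[OF sh] iD] _ bd]) simp
 have i: "intgr (%z. u z * (- kp' (t - fst z) * ps (snd z)) + u z * (kp (t - fst z) * D (snd z)))"
 by (rule lint_add[OF i1 i2])
 have "(LI z. u z * (- kp' (t - fst z) * ps (snd z)) + u z * (kp (t - fst z) * D (snd z))) = 0"
 proof -
 have "(LI z. u z * (- kp' (t - fst z) * ps (snd z)) + u z * (kp (t - fst z) * D (snd z)))
 = (LI z. u z * (- kp' (t - fst z) * (xs (px z) * \<omega> (py z) * g (En V (snd z)))
 + kp (t - fst z) * (py z * xs' (px z) * \<omega> (py z) * g (En V (snd z)) - k (px z) * xs (px z) * \<omega>' (py z) * g (En V (snd z)))))"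
 unfolding ps_def D_def distrib_left ..
 also have "... = - (LI q. 0 * (kp (t - 0) * (xs (fst q) * \<omega> (snd q) * g (En V q))))"
 by (rule weak_sol_product[OF ws m _ bd _ sh xs \<omega> g]) (use M0 in auto)
 finally show ?thesis by simp
 qed
 then have "(LI p. LI s. u (s, p) * (- kp' (t - s) * ps p) + u (s, p) * (kp (t - s) * D p)) = 0"
 using lborel_integral_snd3(1)[OF i] by simp
 moreover have "(LI s. u (s, p) * (- kp' (t - s) * ps p) + u (s, p) * (kp (t - s) * D p)) = conv kp u (t, p) * D p + (- conv kp' u (t, p)) * ps p" for p
 proof -
 obtain R' where R': "!!x. %%x%% >= R' ==> kp x = 0 & kp' x = 0" using C1c_support[OF kp] by blast
 have c1: "intgr (%s. kp' (t - s) * u (s, p))" by (rule conv_integrable[OF C1cD(2)[OF kp] _ m bd]) (use R' in auto)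
 have c2: "intgr (%s. kp (t - s) * u (s, p))" by (rule conv_integrable[OF C1cD(3)[OF kp] _ m bd]) (use R' in auto)
 have "(LI s. u (s, p) * (- kp' (t - s) * ps p) + u (s, p) * (kp (t - s) * D p)) =
 (LI s. (kp (t - s) * u (s, p)) * D p - (kp' (t - s) * u (s, p)) * ps p)"
 by (intro lint_cong refl) (simp add: algebra_simps)
 also have "... = (LI s. (kp (t - s) * u (s, p)) * D p) - (LI s. (kp' (t - s) * u (s, p)) * ps p)"
 by (rule Bochner_Integration.integral_diff) (intro integrable_mult_left c1 c2)+
 also have "... = conv kp u (t, p) * D p + (- conv kp' u (t, p)) * ps p"
 by (simp add: conv_def)
 finally show ?thesis .
 qed
 ultimately show ?thesis by (simp add: ps_def D_def)
qed

text \<open>Differentiating a convolution means differentiating its kernel; the statement as a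
  primitive from -\<infinity> gives access to \<open>primitive_mult\<close>.\<close>

lemma conv_is_primitive:
 assumes kp: "C1c kp kp'" and v: "intgr v"
 shows "intgr (%t. LI s. kp' (t - s) * v s)"
 "(LI s. kp (t - s) * v s) = (LI z. indicator {..<t} z * (LI s. kp' (z - s) * v s))"
proof -
 note [measurable] = C1cD(4,5)[OF kp]
 have [measurable]: "v \<in> bm" using v by auto
 have int: "integrable (lborel \<Otimes>\<^sub>M lborel) (%(s, z). kp' (z - s) * v s)"
 proof (rule lborel_pair.Fubini_integrable)
 show "(%(s, z). kp' (z - s) * v s) \<in> borel_measurable (lborel \<Otimes>\<^sub>M lborel)"
 unfolding lborel_prod split_def by measurable
 have tr: "intgr (%z. kp' (z - s))" for s
 using lborel_integrable_real_affine[OF C1c_integrable(2)[OF kp], of 1 "-s"] by simp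
 then show "AE s in lborel. intgr (%z. case (s, z) of (s, z) => kp' (z - s) * v s)" by simp
 have "(LI z. norm (kp' (z - s) * v s)) = (LI z. %%kp' z%%) * %%v s%%" for s
 using lborel_integral_real_affine[of 1 "%s. %%kp' s%%" "-s"] by (simp add: abs_mult)
 then show "intgr (%s. LI z. norm (case (s, z) of (s, z) => kp' (z - s) * v s))"
 using v by simp
 qed
 show "intgr (%t. LI s. kp' (t - s) * v s)"
 using lborel_pair.integrable_snd[OF int] .
 have int2: "integrable (lborel \<Otimes>\<^sub>M lborel) (%(s, z). indicator {..<t} z * (kp' (z - s) * v s))"
 proof -
 have "integrable (lborel \<Otimes>\<^sub>M lborel) (%q. indicator {..<t} (snd q) * (case q of (s, z) => kp' (z - s) * v s))"
 by (rule integrable_bdd_mult[OF int, of _ 1]) (auto simp: lborel_prod indicator_def)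
 then show ?thesis by (simp add: split_def)
 qed
 have "(LI z. indicator {..<t} z * (LI s. kp' (z - s) * v s)) = (LI z. LI s. indicator {..<t} z * (kp' (z - s) * v s))"
 by simp
 also have "... = (LI s. LI z. indicator {..<t} z * (kp' (z - s) * v s))"
 by (rule lborel_pair.Fubini_integral[OF int2])
 also have "... = (LI s. kp (t - s) * v s)"
 proof (intro lint_cong refl)
 fix s
 have "(LI z. indicator {..<t} z * kp' (z - s)) = (LI x. indicator {..<t} (t - x) * kp' (t - x - s))"
 using lborel_integral_real_affine[of "-1" "%z. indicator {..<t} z * kp' (z - s)" t] by simp
 also have "... = - (LI x. indicator {0<..} x * - kp' ((t - s) - x))"
 by (subst Bochner_Integration.integral_minus[symmetric]) (intro lint_cong refl, auto simp: indicator_def algebra_simps)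
 also have "... = kp (t - s)" by (subst C1c_tail_integral[OF C1c_reflect_shift[OF kp]]) simp
 finally have e: "(LI z. indicator {..<t} z * kp' (z - s)) = kp (t - s)" .
 have "(LI z. indicator {..<t} z * (kp' (z - s) * v s)) = (LI z. (indicator {..<t} z * kp' (z - s)) * v s)"
 by (simp add: mult.assoc)
 also have "... = kp (t - s) * v s" unfolding e[symmetric] by (rule integral_mult_left_zero)
 finally show "(LI z. indicator {..<t} z * (kp' (z - s) * v s)) = kp (t - s) * v s" .
 qed
 finally show "(LI s. kp (t - s) * v s) = (LI z. indicator {..<t} z * (LI s. kp' (z - s) * v s))" ..
qed

text \<open>The chain rule in time for the square of the mollified function, tested against
  \<open>a\<close>.\<close>

lemma conv_IBP:
 assumes kp: "C1c kp kp'" and a: "C1c a a'" and m[measurable]: "u \<in> bm" and bd: "!!z. %%u z%% <= M"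
 shows "(LI t. a' t * (conv kp u (t, p))^2 + a t * (2 * conv kp u (t, p) * conv kp' u (t, p))) = 0"
proof -
 note [measurable] = C1cD(4,5)[OF kp] C1cD(4,5)[OF a]
 obtain R where R: "R > 0" "!!x. %%x%% >= R ==> kp x = 0 & kp' x = 0" using C1c_support[OF kp] by blast
 obtain L where L: "L > 0" "!!x. %%x%% >= L ==> a x = 0 & a' x = 0" using C1c_support[OF a] by blast
 obtain K where K: "K >= 0" "!!x. %%a x%% <= K" "!!x. %%a' x%% <= K" using C1c_bounded[OF a] by metis
 \<comment> \<open>For times in the support of \<open>a\<close> the convolution sees only |s| <= R +
   L; truncating \<open>u\<close> there makes it integrable without changing the identity.\<close>
 define v where "v s = ivl (R + L) s * u (s, p)" for s
 have [measurable]: "v \<in> bm" unfolding v_def[abs_def] by measurable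
 have v: "intgr v"
 by (rule lint_bound[OF integrable_mult_right[OF integrable_ivl[of "R + L"], of M]])
 (use bd order_trans[OF abs_ge_zero bd] in \<open>auto simp: v_def indicator_def intro: order_trans[OF bd abs_ge_self]\<close>)
 define d U where "d t = (LI s. kp' (t - s) * v s)" and "U t = (LI s. kp (t - s) * v s)" for t
 have di: "intgr d" unfolding d_def[abs_def] by (rule conv_is_primitive(1)[OF kp v])
 have Ud: "U t = (LI z. indicator {..<t} z * d z)" for t
 unfolding U_def d_def by (rule conv_is_primitive(2)[OF kp v])
 note pm = primitive_mult[OF di di, folded Ud]
 have "(LI t. a' t * (U t * U t)) = - (LI t. a t * (d t * U t + U t * d t))"
 unfolding pm(1) by (rule primitive_IBP[OF pm(2) a])
 moreover have i2: "intgr (%t. a t * (d t * U t + U t * d t))"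
 by (rule integrable_bdd_mult[OF pm(2), of _ K]) (use K in auto)
 moreover have i1: "intgr (%t. a' t * (U t * U t))"
 proof -
 have Ub: "%%U t%% <= (LI z. %%d z%%)" for t
 proof -
 have "%%U t%% <= (LI z. %%indicator {..<t} z * d z%%)" unfolding Ud by (rule integral_abs_bound)
 also have "... <= (LI z. %%d z%%)" by (rule integral_mono') (use di in \<open>auto simp: indicator_def\<close>)
 finally show ?thesis .
 qed
 have [measurable]: "U \<in> bm"
 proof -
 have "(%(t, s). kp (t - s) * v s) \<in> borel_measurable ((lborel :: real measure) \<Otimes>\<^sub>M lborel)"
 unfolding lborel_prod split_def by measurable
 from lborel.borel_measurable_lebesgue_integral[OF this] show ?thesis by (simp add: U_def[abs_def])
 qed
 have "%%U t * U t%% <= (LI z. %%d z%%) * (LI z. %%d z%%)" for t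
 unfolding abs_mult by (intro mult_mono Ub) auto
 then have "intgr (%t. (U t * U t) * a' t)"
 by (intro integrable_bdd_mult[OF C1c_integrable(2)[OF a]]) simp_all
 then show ?thesis by (simp add: mult.commute)
 qed
 ultimately have "(LI t. a' t * (U t * U t) + a t * (d t * U t + U t * d t)) = 0"
 by simp
 moreover have "a' t * (U t * U t) + a t * (d t * U t + U t * d t) = a' t * (conv kp u (t, p))^2 + a t * (2 * conv kp u (t, p) * conv kp' u (t, p))" for t
 proof (cases "%%t%% >= L")
 case True
 then show ?thesis using L(2) by simp
 next
 case False
 have e: "h (t - s) * v s = h (t - s) * u (s, p)" if "!!x. %%x%% >= R ==> h x = 0" for h s
 proof (cases "%%t - s%% >= R")
 case True
 then show ?thesis using that by simp
 next
 case f: False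
 then have "ivl (R + L) s = 1" using False by (auto simp: indicator_def)
 then show ?thesis by (simp add: v_def)
 qed
 have "U t = conv kp u (t, p)" "d t = conv kp' u (t, p)"
 unfolding U_def d_def conv_def fst_conv snd_conv using R(2)
 by (auto intro!: lint_cong e)
 then show ?thesis by (simp add: power2_eq_square)
 qed
 ultimately show ?thesis by simp
qed

lemma cone_support:
 assumes Th: "tx_test Th Tht Thx" and g: "C1c g g'"
 obtains L where "L > 0" "!!z. (Th (tx z) ~= 0 | Tht (tx z) ~= 0 | Thx (tx z) ~= 0) ==> g (En V (snd z)) ~= 0 ==> in_box L z"
proof -
 obtain L where L: "L > 0" "!!p. %%fst p%% >= L | %%snd p%% >= L ==> Th p = 0 & Tht p = 0 & Thx p = 0"
 using tx_test_support[OF Th] by blast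
 obtain N where N: "N > 0" "!!x. %%x%% >= N ==> g x = 0 & g' x = 0" using C1c_support[OF g] by blast
 obtain Y where Y: "Y > 0" "!!p. %%fst p%% <= L ==> %%En V p%% <= N ==> %%snd p%% <= Y" using speed_bound by blast
 show thesis
 proof (rule that[of "L + Y"])
 show "L + Y > 0" using L Y by simp
 fix z :: "R3"
 assume 1: "Th (tx z) ~= 0 | Tht (tx z) ~= 0 | Thx (tx z) ~= 0" and 2: "g (En V (snd z)) ~= 0"
 have "%%fst z%% < L" "%%px z%% < L" using 1 L(2)[of "(tx z)"] by (auto simp: not_le[symmetric])
 moreover have "%%En V (snd z)%% < N" using 2 N(2) not_le by blast
 ultimately show "in_box (L + Y) z" using Y(1) Y(2)[of "snd z"] L(1) by (simp add: in_box_def)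
 qed
qed

text \<open>At fixed t the stationary theorem applies with source - conv kp' u (\<open>F1\<close>),
  at fixed (x, y) the chain rule in time (\<open>F2\<close>); the terms with conv kp' u cancel in
  the sum.\<close>

lemma conv_renormalization:
 assumes ws: "weak_sol k (%_. 0) u" and m[measurable]: "u \<in> bm" and bd: "!!z. %%u z%% <= M"
 and kp: "C1c kp kp'" and Th: "tx_test Th Tht Thx" and g: "C1c g g'"
 shows "(LI z. (conv kp u z)^2 * ((Tht (tx z) + py z * Thx (tx z)) * g (En V (snd z)))) = 0"
proof -
 note [measurable] = C1cD(4,5)[OF kp] C1cD(4)[OF g] tx_test_measurable[OF Th]
 obtain L where L: "L > 0" "!!z. (Th (tx z) ~= 0 | Tht (tx z) ~= 0 | Thx (tx z) ~= 0) ==> g (En V (snd z)) ~= 0 ==> in_box L z"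
 using cone_support[OF Th g] by blast
 obtain K where K: "K >= 0" "!!p. %%Th p%% <= K" "!!p. %%Tht p%% <= K" "!!p. %%Thx p%% <= K" using tx_test_bounded[OF Th] by metis
 obtain G where G: "G >= 0" "!!x. %%g x%% <= G" using C1c_bounded[OF g] by metis
 have bdd: "%%u * v%% <= U * W" if "%%u%% <= U" "%%v%% <= W" for u v U W :: real
 using that by (auto simp: abs_mult intro!: mult_mono)
 define B where "B = max ((LI s. %%kp s%%) * M) ((LI s. %%kp' s%%) * M)"
 have B: "%%conv kp u z%% <= B" "%%conv kp' u z%% <= B" for z
 using conv_bounded[OF C1c_integrable(1)[OF kp] m bd, of z] conv_bounded[OF C1c_integrable(2)[OF kp] m bd, of z] by (auto simp: B_def)
 have B0: "B >= 0" using order_trans[OF abs_ge_zero B(1)] .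
 let ?x = "%z::R3. (tx z)"
 define F1 where "F1 z = (conv kp u z)^2 * (py z * Thx (?x z) * g (En V (snd z))) + (2 * conv kp u z * - conv kp' u z) * (Th (?x z) * g (En V (snd z)))" for z
 define F2 where "F2 z = g (En V (snd z)) * (Tht (?x z) * (conv kp u z)^2 + Th (?x z) * (2 * conv kp u z * conv kp' u z))" for z
 have [measurable]: "F1 \<in> bm" "F2 \<in> bm" unfolding F1_def[abs_def] F2_def[abs_def] by measurable
 have i1: "intgr F1"
 proof (rule integrable_box3)
 show s: "in_box L z" if "F1 z ~= 0" for z by (rule L(2)) (use that in \<open>auto simp: F1_def\<close>)
 show "%%F1 z%% <= B * B * (L * K * G) + (2 * B * B) * (K * G)" for z
 proof (cases "F1 z = 0")
 case True
 then show ?thesis using B0 K G L by simp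
 next
 case False
 then have y: "%%py z%% <= L" using s[of z] by (simp add: in_box_def)
 have t: "%%2::real%% <= 2" by simp
 have nB: "%%- conv kp' u z%% <= B" using B(2) by simp
 show ?thesis unfolding F1_def power2_eq_square
 by (intro order_trans[OF abs_triangle_ineq add_mono] bdd B K G y t nB)
 qed
 qed measurable
 have i2: "intgr F2"
 proof (rule integrable_box3)
 show s: "in_box L z" if "F2 z ~= 0" for z by (rule L(2)) (use that in \<open>auto simp: F2_def\<close>)
 show "%%F2 z%% <= G * (K * (B * B) + K * (2 * B * B))" for z
 proof -
 have t: "%%2::real%% <= 2" by simp
 show ?thesis unfolding F2_def power2_eq_square
 by (intro bdd order_trans[OF abs_triangle_ineq add_mono] B K G t)
 qed
 qed measurable
 have "(LI p. F1 (t, p)) = 0" for t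
 unfolding F1_def fst_conv snd_conv
 by (rule stationary_renormalization[where M=B and xs="%x. Th (t, x)" and xs'="%x. Thx (t, x)" and f="%p. conv kp u (t, p)" and h="%p. - conv kp' u (t, p)"])
 (use B conv_stationary[OF ws m bd kp] tx_test_slices(1)[OF Th] g in auto)
 then have z1: "(LI z. F1 z) = 0" using lborel_integral_snd3(2)[OF i1] by simp
 have "(LI t. F2 (t, p)) = 0" for p
 unfolding F2_def fst_conv snd_conv integral_mult_right_zero
 using conv_IBP[OF kp tx_test_slices(2)[OF Th] m bd, of "fst p" p] by simp
 then have z2: "(LI z. F2 z) = 0" using lborel_integral_snd3(1)[OF i2] by simp
 have "(LI z. (conv kp u z)^2 * ((Tht (?x z) + py z * Thx (?x z)) * g (En V (snd z)))) = (LI z. F1 z + F2 z)"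
 by (intro lint_cong refl) (simp add: F1_def F2_def algebra_simps)
 also have "... = 0" using Bochner_Integration.integral_add[OF i1 i2] z1 z2 by simp
 finally show ?thesis .
qed

end

section \<open>Removing the time mollification\<close>

lemma C1c_mollifier_exists:
 obtains kp kp' where "C1c kp kp'" "!!x. kp x >= 0" "(LI x. kp x) = 1"
proof -
 obtain kp kp' where kp: "C1c kp kp'" "!!x. %%x%% <= 1 ==> kp x = 1" "!!x. 0 <= kp x & kp x <= 1"
 using C1c_plateau_exists[of 1] by (metis zero_less_one)
 define c where "c = (LI x. kp x)"
 have "(LI x. ivl 1 x) <= c"
 unfolding c_def
 proof (rule integral_mono[OF integrable_ivl C1c_integrable(1)[OF kp(1)]])
 show "ivl 1 x <= kp x" for x
 using kp(2)[of x] kp(3)[of x] by (cases "%%x%% <= 1") (auto simp: indicator_def abs_le_iff)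
 qed
 then have c: "c > 0" by simp
 obtain R where R: "!!x. %%x%% >= R ==> kp x = 0 & kp' x = 0" using C1c_support[OF kp(1)] by blast
 show thesis
 proof (rule that[of "%x. kp x / c" "%x. kp' x / c"])
 show "C1c (%x. kp x / c) (%x. kp' x / c)"
 unfolding C1c_def
 proof (intro conjI allI exI[of _ R] impI)
 show "((%x. kp x / c) has_real_derivative kp' x / c) (at x)" for x by (rule DERIV_cdivide[OF C1cD(1)[OF kp(1)]])
 show "continuous_on UNIV (%x. kp' x / c)" using C1cD(2)[OF kp(1)] c by (intro continuous_intros) auto
 qed (use R in auto)
 show "kp x / c >= 0" for x using kp(3) c by simp
 show "(LI x. kp x / c) = 1" using c by (simp add: c_def[symmetric])
 qed
qed

lemma C1c_scale:
 assumes kp: "C1c kp kp'" and N: "N > 0"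
 shows "C1c (%s. N * kp (N * s)) (%s. N * (kp' (N * s) * N))"
proof -
 obtain R where R: "R > 0" "!!x. %%x%% >= R ==> kp x = 0 & kp' x = 0" using C1c_support[OF kp] by blast
 show ?thesis
 unfolding C1c_def
 proof (intro conjI allI exI[of _ "R / N"] impI)
 fix s
 have "((%s. N * s) has_real_derivative N) (at s)" by (auto intro!: derivative_eq_intros)
 from DERIV_cmult[OF DERIV_chain2[where f=kp and g="%s. N * s", OF C1cD(1)[OF kp] this], of N]
 show "((%s. N * kp (N * s)) has_real_derivative N * (kp' (N * s) * N)) (at s)" .
 next
 show "continuous_on UNIV (%s. N * (kp' (N * s) * N))"
 by (intro continuous_intros cont_comp[OF C1cD(2)[OF kp]]) auto
 next
 fix s assume "%%s%% >= R / N"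
 then have "%%N * s%% >= R" using N by (simp add: abs_mult divide_le_eq mult.commute)
 from R(2)[OF this] show "N * kp (N * s) = 0" "N * (kp' (N * s) * N) = 0" by auto
 qed
qed

lemma conv_scale:
 assumes N: "N > 0"
 shows "conv (%s. N * kp (N * s)) u (t, p) = (LI r. kp r * u (t - r / N, p))"
proof -
 have "conv (%s. N * kp (N * s)) u (t, p) = (LI s. N * kp (N * (t - s)) * u (s, p))"
 by (simp add: conv_def)
 also have "... = %%- 1 / N%% *\<^sub>R (LI r. N * kp (N * (t - (t + (- 1 / N) * r))) * u (t + (- 1 / N) * r, p))"
 by (rule lborel_integral_real_affine) (use N in auto)
 also have "... = (LI r. kp r * u (t - r / N, p))"
 using N by (simp add: mult.assoc)
 finally show ?thesis .
qed

abbreviation indB :: "real => R3 => real" where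
 "indB L z \<equiv> indicator {z. in_box L z} z"

lemma in_box_measurable [measurable]: "Measurable.pred borel (in_box L)"
 unfolding in_box_def[abs_def] by measurable

lemma indB_measurable [measurable]: "{z. in_box L z} \<in> sets borel"
 using in_box_measurable[of L] by (simp add: pred_def)

lemma emeasure_in_box: "emeasure lborel {z. in_box L z} < \<infinity>"
proof -
 have "{z. in_box L z} = {-L..L} \<times> {-L..L} \<times> {-L..L}"
 by (auto simp: in_box_def abs_le_iff minus_le_iff mem_Times_iff)
 then have "compact {z. in_box L z}" by (simp add: compact_Times)
 then show ?thesis by (rule emeasure_compact_finite)
qed

lemma integrable_indB: "intgr (indB L)"
 using emeasure_in_box by (simp add: integrable_indicator_iff)

lemma integrable_indB_mult:
 assumes "f \<in> bm" "!!z. %%f z%% <= C"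
 shows "intgr (%z. indB L z * f z)"
 using integrable_bdd_mult[OF integrable_indB, of f C L] assms by (simp add: mult.commute)

text \<open>A bounded continuous function is L^1-close to \<open>u\<close> on a box enlarged by 1,
  which contains the translated box as soon as |h n| < 1; for the continuous function dominated
  convergence suffices.\<close>

lemma translation_L1_continuous:
 fixes u :: "R3 => real"
 assumes m[measurable]: "u \<in> bm" and bd: "!!z. %%u z%% <= M" and h: "h ----> 0"
 shows "(%n. LI z. indB L z * %%u (fst z - h n, snd z) - u z%%) ----> 0"
proof (rule LIMSEQ_I)
 fix e :: real assume e: "e > 0"
 obtain g where g: "continuous_on UNIV g" "!!z. %%g z%% <= M" "(LI z. indB (%%L%% + 1) z * %%u z - g z%%) < e / 3"
 by (rule bounded_approx_continuous[OF m indB_measurable bd emeasure_in_box, of "e / 3" "%%L%% + 1"]) (use e in auto)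
 have [measurable]: "g \<in> bm" using g(1) by (simp add: bm_cont)
 have lg: "(%n. LI z. indB L z * %%g (fst z - h n, snd z) - g z%%) ----> (LINT z|(lborel :: (R3) measure). 0)"
 proof (rule dct)
 show "intgr (%z. indB L z * (2 * M))" by (intro integrable_mult_left integrable_indB)
 show "AE z in lborel. (%n. indB L z * %%g (fst z - h n, snd z) - g z%%) ----> 0"
 proof (rule AE_I2)
 fix z :: "R3"
 have "(%n. (fst z - h n, snd z)) ----> (fst z - 0, snd z)" by (intro tendsto_intros h)
 then have "(%n. g (fst z - h n, snd z)) ----> g z"
 using continuous_on_tendsto_compose[OF g(1), of _ z] by simp
 then have "(%n. indB L z * %%g (fst z - h n, snd z) - g z%%) ----> indB L z * %%g z - g z%%" by (intro tendsto_intros)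
 then show "(%n. indB L z * %%g (fst z - h n, snd z) - g z%%) ----> 0" by simp
 qed
 show "AE z in lborel. norm (indB L z * %%g (fst z - h n, snd z) - g z%%) <= indB L z * (2 * M)" for n
 proof (rule AE_I2)
 fix z
 have "%%g (fst z - h n, snd z) - g z%% <= 2 * M" using g(2)[of z] g(2)[of "(fst z - h n, snd z)"] by linarith
 then show "norm (indB L z * %%g (fst z - h n, snd z) - g z%%) <= indB L z * (2 * M)" by (auto simp: indicator_def)
 qed
 qed measurable
 have ev1: "\<forall>\<^sub>F n in sequentially. (LI z. indB L z * %%g (fst z - h n, snd z) - g z%%) < e / 3"
 by (rule order_tendstoD(2)[OF lg]) (use e in simp)
 have ev2: "\<forall>\<^sub>F n in sequentially. %%h n%% < 1"
 using tendstoD[OF h, of 1] by (simp add: dist_real_def)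
 have "\<forall>\<^sub>F n in sequentially. norm ((LI z. indB L z * %%u (fst z - h n, snd z) - u z%%) - 0) < e"
 using ev1 ev2
 proof eventually_elim
 case (elim n)
 let ?s = "%z::R3. (fst z - h n, snd z)"
 have trb: "%%u z - g z%% <= 2 * M" for z using bd[of z] g(2)[of z] by linarith
 have dist: "distr lborel borel ?s = (lborel :: (R3) measure)"
 proof -
 have "?s = (%z. (- h n, 0) + z)" by (auto simp: fun_eq_iff prod_eq_iff)
 then show ?thesis using lborel_distr_plus[of "(- h n, 0) :: R3"] by simp
 qed
 have "(LI z. indB L z * %%u (?s z) - g (?s z)%%) <= (LI z. indB (%%L%% + 1) (?s z) * %%u (?s z) - g (?s z)%%)"
 proof (rule integral_mono)
 show "intgr (%z. indB L z * %%u (?s z) - g (?s z)%%)"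
 by (rule integrable_indB_mult[of _ "2 * M"]) (use trb in auto)
 have "integrable (distr lborel borel ?s) (%z. indB (%%L%% + 1) z * %%u z - g z%%)"
 unfolding dist by (rule integrable_indB_mult[of _ "2 * M"]) (use trb in auto)
 then show "intgr (%z. indB (%%L%% + 1) (?s z) * %%u (?s z) - g (?s z)%%)"
 by (subst (asm) integrable_distr_eq) auto
 show "indB L z * %%u (?s z) - g (?s z)%% <= indB (%%L%% + 1) (?s z) * %%u (?s z) - g (?s z)%%" for z
 using elim(2) by (intro mult_right_mono) (auto simp: indicator_def in_box_def)
 qed
 also have "... = (LINT z|distr lborel borel ?s. indB (%%L%% + 1) z * %%u z - g z%%)"
 by (rule integral_distr[symmetric]) auto
 also have "... < e / 3" unfolding dist by (rule g(3))
 finally have 1: "(LI z. indB L z * %%u (?s z) - g (?s z)%%) < e / 3" .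
 have "(LI z. indB L z * %%u z - g z%%) <= (LI z. indB (%%L%% + 1) z * %%u z - g z%%)"
 proof (rule integral_mono)
 show "intgr (%z. indB L z * %%u z - g z%%)" "intgr (%z. indB (%%L%% + 1) z * %%u z - g z%%)"
 by (rule integrable_indB_mult[of _ "2 * M"]; use trb in auto)+
 show "indB L z * %%u z - g z%% <= indB (%%L%% + 1) z * %%u z - g z%%" for z
 by (intro mult_right_mono) (auto simp: indicator_def in_box_def)
 qed
 then have 2: "(LI z. indB L z * %%u z - g z%%) < e / 3" using g(3) by linarith
 have i1: "intgr (%z. indB L z * %%u (?s z) - g (?s z)%%)" "intgr (%z. indB L z * %%u z - g z%%)"
 by (rule integrable_indB_mult[of _ "2 * M"]; use trb in auto)+
 have gb: "%%g (?s z) - g z%% <= 2 * M" "%%u (?s z) - u z%% <= 2 * M" for z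
 using g(2)[of z] g(2)[of "?s z"] bd[of z] bd[of "?s z"] by linarith+
 have i2: "intgr (%z. indB L z * %%g (?s z) - g z%%)" "intgr (%z. indB L z * %%u (?s z) - u z%%)"
 by (rule integrable_indB_mult[of _ "2 * M"]; use gb in auto)+
 have "(LI z. indB L z * %%u (?s z) - u z%%) <= (LI z. (indB L z * %%u (?s z) - g (?s z)%% + indB L z * %%g (?s z) - g z%%) + indB L z * %%u z - g z%%)"
 proof (rule integral_mono)
 show "intgr (%z. (indB L z * %%u (?s z) - g (?s z)%% + indB L z * %%g (?s z) - g z%%) + indB L z * %%u z - g z%%)"
 by (intro lint_add i1 i2)
 show "indB L z * %%u (?s z) - u z%% <= (indB L z * %%u (?s z) - g (?s z)%% + indB L z * %%g (?s z) - g z%%) + indB L z * %%u z - g z%%" for z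
 by (auto simp: indicator_def)
 qed (rule i2)
 also have "... = (LI z. indB L z * %%u (?s z) - g (?s z)%%) + (LI z. indB L z * %%g (?s z) - g z%%) + (LI z. indB L z * %%u z - g z%%)"
 by (simp add: Bochner_Integration.integral_add i1 i2 lint_add)
 also have "... < e" using 1 2 elim(1) by linarith
 finally show ?case by (simp add: integral_nonneg)
 qed
 then show "\<exists>no. \<forall>n\<ge>no. norm ((LI z. indB L z * %%u (fst z - h n, snd z) - u z%%) - 0) < e"
 by (simp add: eventually_sequentially)
qed

text \<open>The error of mollification is at most the average, with weight kp r, of the errors of
  translation by r/(n + 1); these tend to 0 for each r and are bounded uniformly.\<close>

lemma mollification_L1:
 fixes u :: "R3 => real"
 assumes m[measurable]: "u \<in> bm" and bd: "!!z. %%u z%% <= M"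
 and kp: "C1c kp kp'" "!!x. kp x >= 0" "(LI x. kp x) = 1"
 defines "kpn \<equiv> %n s. real (Suc n) * kp (real (Suc n) * s)"
 shows "(%n. LI z. indB L z * %%conv (kpn n) u z - u z%%) ----> 0"
 and "!!n z. %%conv (kpn n) u z%% <= M"
proof -
 note [measurable] = C1cD(4,5)[OF kp(1)]
 note kpi = C1c_integrable(1)[OF kp(1)]
 have M0: "M >= 0" using order_trans[OF abs_ge_zero bd] .
 have cs: "conv (kpn n) u z = (LI r. kp r * u (fst z - r / real (Suc n), snd z))" for n z
 using conv_scale[of "real (Suc n)" kp u "fst z" "snd z"] by (simp add: kpn_def)
 have kpu: "intgr (%r. kp r * u (fst z - r / real (Suc n), snd z))" for n z
 using integrable_bdd_mult[OF kpi, of "%r. u (fst z - r / real (Suc n), snd z)" M] bd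
 by (simp add: mult.commute)
 show "%%conv (kpn n) u z%% <= M" for n z
 proof -
 have "%%conv (kpn n) u z%% <= (LI r. %%kp r * u (fst z - r / real (Suc n), snd z)%%)" unfolding cs by (rule integral_abs_bound)
 also have "... <= (LI r. kp r * M)"
 proof (rule integral_mono)
 show "%%kp r * u (fst z - r / real (Suc n), snd z)%% <= kp r * M" for r
 unfolding abs_mult using kp(2)[of r] bd by (simp add: mult_left_mono)
 qed (use kpu[of z n] kpi in auto)
 finally show ?thesis using kp(3) by simp
 qed
 define \<tau> where "\<tau> n r = (LI z. indB L z * %%u (fst z - r / real (Suc n), snd z) - u z%%)" for n r
 have I: "integrable (lborel \<Otimes>\<^sub>M lborel) (%q. %%u (px q - fst q / real (Suc n), py q) - u (snd q)%% * (kp (fst q) * indB L (snd q)))" for n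
 unfolding lborel_prod
 proof (rule integrable_bdd_mult[OF integrable_lborel_prod_mult[OF kpi integrable_indB], of _ "2 * M"])
 fix q :: "real \<times> R3"
 show "%%%%u (px q - fst q / real (Suc n), py q) - u (snd q)%%%% <= 2 * M"
 using bd[of "(px q - fst q / real (Suc n), py q)"] bd[of "snd q"] by linarith
 qed measurable
 have I': "integrable (lborel \<Otimes>\<^sub>M lborel) (%(r, z). %%u (fst z - r / real (Suc n), snd z) - u z%% * (kp r * indB L z))" for n
 using I[of n] by (simp add: split_def)
 have \<tau>i: "(LI r. kp r * \<tau> n r) = (LI z. LI r. %%u (fst z - r / real (Suc n), snd z) - u z%% * (kp r * indB L z))" for n
 proof -
 have "(LI r. kp r * \<tau> n r) = (LI r. LI z. %%u (fst z - r / real (Suc n), snd z) - u z%% * (kp r * indB L z))"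
 unfolding \<tau>_def by (simp flip: integral_mult_right_zero add: mult_ac)
 also have "... = (LI z. LI r. %%u (fst z - r / real (Suc n), snd z) - u z%% * (kp r * indB L z))"
 by (rule lborel_pair.Fubini_integral[OF I', symmetric])
 finally show ?thesis .
 qed
 have le: "(LI z. indB L z * %%conv (kpn n) u z - u z%%) <= (LI r. kp r * \<tau> n r)" for n
 unfolding \<tau>i
 proof (rule integral_mono)
 have "conv (kpn n) u \<in> bm" unfolding kpn_def by measurable
 moreover have "%%%%conv (kpn n) u z - u z%%%% <= 2 * M" for z
 using \<open>!!n z. %%conv (kpn n) u z%% <= M\<close>[of n z] bd[of z] by linarith
 ultimately show "intgr (%z. indB L z * %%conv (kpn n) u z - u z%%)"
 by (intro integrable_indB_mult[of _ "2 * M"]) simp_all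
 show "intgr (%z. LI r. %%u (fst z - r / real (Suc n), snd z) - u z%% * (kp r * indB L z))"
 by (rule lborel_pair.integrable_snd[OF I'])
 fix z
 have d: "intgr (%r. kp r * u z)" using kpi by simp
 have "conv (kpn n) u z - u z = (LI r. kp r * u (fst z - r / real (Suc n), snd z) - kp r * u z)"
 using Bochner_Integration.integral_diff[OF kpu[of z n] d] kp(3) by (simp add: cs)
 also have "%%...%% <= (LI r. %%kp r * u (fst z - r / real (Suc n), snd z) - kp r * u z%%)" by (rule integral_abs_bound)
 also have "... = (LI r. %%u (fst z - r / real (Suc n), snd z) - u z%% * kp r)"
 using kp(2) by (intro lint_cong refl) (simp flip: right_diff_distrib add: abs_mult)
 finally have "indB L z * %%conv (kpn n) u z - u z%% <= indB L z * (LI r. %%u (fst z - r / real (Suc n), snd z) - u z%% * kp r)"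
 by (intro mult_left_mono) auto
 also have "... = (LI r. %%u (fst z - r / real (Suc n), snd z) - u z%% * (kp r * indB L z))"
 by (simp flip: integral_mult_right_zero add: mult_ac)
 finally show "indB L z * %%conv (kpn n) u z - u z%% <= (LI r. %%u (fst z - r / real (Suc n), snd z) - u z%% * (kp r * indB L z))" .
 qed
 have "(%n. LI r. kp r * \<tau> n r) ----> (LINT r|(lborel :: real measure). 0)"
 proof (rule dct)
 let ?B = "2 * M * (LI z. indB L z)"
 show "intgr (%r. kp r * ?B)" using kpi by simp
 have \<tau>b: "0 <= \<tau> n r & \<tau> n r <= ?B" for n r
 proof
 show "0 <= \<tau> n r" unfolding \<tau>_def by (rule lint_nonneg) simp
 have b: "%%u (fst z - r / real (Suc n), snd z) - u z%% <= 2 * M" for z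
 using bd[of "(fst z - r / real (Suc n), snd z)"] bd[of z] by linarith
 have "\<tau> n r <= (LI z. indB L z * (2 * M))"
 unfolding \<tau>_def
 by (intro integral_mono integrable_indB_mult[of _ "2 * M"] integrable_mult_left integrable_indB mult_left_mono b) (use b in auto)
 then show "\<tau> n r <= ?B" by (simp add: mult.commute)
 qed
 show "AE r in lborel. norm (kp r * \<tau> n r) <= kp r * ?B" for n
 using kp(2) \<tau>b by (intro AE_I2) (simp add: abs_mult mult_left_mono)
 show "AE r in lborel. (%n. kp r * \<tau> n r) ----> 0"
 proof (rule AE_I2)
 fix r :: real
 have "(%n. r * (1 / real (Suc n))) ----> r * 0" by (intro tendsto_mult tendsto_const LIMSEQ_Suc[OF lim_1_over_n])
 then have "(%n. r / real (Suc n)) ----> 0" by simp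
 from tendsto_mult[OF tendsto_const[of "kp r"] translation_L1_continuous[OF m bd this]]
 show "(%n. kp r * \<tau> n r) ----> 0" by (simp add: \<tau>_def)
 qed
 have "\<tau> n \<in> bm" for n
 proof -
 have "(%(r, z). indB L z * %%u (fst z - r / real (Suc n), snd z) - u z%%) \<in> borel_measurable ((lborel :: real measure) \<Otimes>\<^sub>M lborel)"
 unfolding lborel_prod split_def by measurable
 from lborel.borel_measurable_lebesgue_integral[OF this] show ?thesis by (simp add: \<tau>_def[abs_def])
 qed
 then show "(%r. kp r * \<tau> n r) \<in> borel_measurable lborel" for n by simp
 qed simp
 then have l: "(%n. LI r. kp r * \<tau> n r) ----> 0" by simp
 show "(%n. LI z. indB L z * %%conv (kpn n) u z - u z%%) ----> 0"
 by (rule Lim_null_comparison[OF _ l]) (use le in \<open>simp add: integral_nonneg\<close>)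
qed

text \<open>The square makes the positive part C^1 while keeping it positive exactly for s > 0: the
  profile of the light-cone tests.\<close>

lemma pos_part_square_deriv: "((%s. (max 0 s)^2) has_real_derivative 2 * max 0 s) (at (s :: real))"
proof (cases s "0 :: real" rule: linorder_cases)
 case less
 have "((%s. 0) has_real_derivative 2 * max 0 s) (at s)" using less by simp
 then show ?thesis by (rule has_field_derivative_transform_within_open[where S="{..<0}"]) (use less in auto)
next
 case greater
 have "((%s. s^2) has_real_derivative 2 * max 0 s) (at s)" using greater by (auto intro!: derivative_eq_intros)
 then show ?thesis by (rule has_field_derivative_transform_within_open[where S="{0<..}"]) (use greater in auto)
next
 case equal
 have "((%h. (max 0 h)^2 / h) \<longlongrightarrow> 0) (at (0::real))"
 proof (rule Lim_null_comparison)
 show "\<forall>\<^sub>F h in at (0::real). norm ((max 0 h)^2 / h) <= %%h%%"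
 by (rule always_eventually) (auto simp: max_def power2_eq_square)
 show "((%h::real. %%h%%) \<longlongrightarrow> 0) (at 0)" by (rule tendsto_rabs_zero) (rule tendsto_ident_at)
 qed
 then show ?thesis using equal by (simp add: DERIV_def)
qed

lemma antiderivative_unbounded:
 fixes F f :: "real => real"
 assumes F: "!!x. (F has_real_derivative f x) (at x)" and c: "continuous_on UNIV f" and nn: "!!x. f x >= 0"
 and inf: "(\<integral>\<^sup>+x. ennreal (f x) * indicator {0..} x \<partial>lborel) = \<infinity>"
 shows "\<exists>X\<ge>0. F X - F 0 > L"
proof (rule ccontr)
 assume "~ ?thesis"
 then have b: "F x - F 0 <= L" if "x >= 0" for x using that by (meson not_le)
 have [measurable]: "f \<in> bm" using c by (simp add: bm_cont)
 have "(%n. \<integral>\<^sup>+x. ennreal (f x) * indicator {0..real n} x \<partial>lborel) ----> (\<integral>\<^sup>+x. ennreal (f x) * indicator {0..} x \<partial>lborel)"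
 proof (rule nn_integral_LIMSEQ)
 show "incseq (%n x. ennreal (f x) * indicator {0..real n} x)"
 by (auto simp: incseq_def le_fun_def indicator_def intro: order_trans)
 show "(%n. ennreal (f x) * indicator {0..real n} x) ----> ennreal (f x) * indicator {0..} x" for x
 proof (rule tendsto_eventually)
 obtain m where m: "x <= real m" using real_arch_simple by blast
 show "eventually (%n. ennreal (f x) * indicator {0..real n} x = ennreal (f x) * indicator {0..} x) sequentially"
 using eventually_ge_at_top[of m] by eventually_elim (use m in \<open>auto simp: indicator_def\<close>)
 qed
 qed measurable
 moreover have "(\<integral>\<^sup>+x. ennreal (f x) * indicator {0..real n} x \<partial>lborel) <= ennreal L" for n
 proof -
 have "(\<integral>\<^sup>+x. ennreal (f x) * indicator {0..real n} x \<partial>lborel) = ennreal (F (real n) - F 0)"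
 by (rule nn_integral_FTC_Icc) (use F nn in auto)
 then show ?thesis using b[of "real n"] by (simp add: ennreal_leI)
 qed
 ultimately have "(\<integral>\<^sup>+x. ennreal (f x) * indicator {0..} x \<partial>lborel) <= ennreal L"
 by (meson LIMSEQ_le_const2)
 then show False unfolding inf infinity_ennreal_def using ennreal_less_top not_le by blast
qed

context potential begin

lemma cone_test_bounded:
 assumes Th: "tx_test Th Tht Thx" and g: "C1c g g'"
 obtains L C where "L > 0" "C >= 0"
 "!!z. %%(Tht (tx z) + py z * Thx (tx z)) * g (En V (snd z))%% <= C"
 "!!z. (Tht (tx z) + py z * Thx (tx z)) * g (En V (snd z)) ~= 0 ==> in_box L z"
proof -
 obtain L where L: "L > 0" "!!z. (Th (tx z) ~= 0 | Tht (tx z) ~= 0 | Thx (tx z) ~= 0) ==> g (En V (snd z)) ~= 0 ==> in_box L z"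
 using cone_support[OF Th g] by blast
 obtain K where K: "K >= 0" "!!p. %%Th p%% <= K" "!!p. %%Tht p%% <= K" "!!p. %%Thx p%% <= K" using tx_test_bounded[OF Th] by metis
 obtain G where G: "G >= 0" "!!x. %%g x%% <= G" using C1c_bounded[OF g] by metis
 define \<Psi> where "\<Psi> z = (Tht (tx z) + py z * Thx (tx z)) * g (En V (snd z))" for z
 have \<Psi>s: "in_box L z" if "\<Psi> z ~= 0" for z by (rule L(2)) (use that in \<open>auto simp: \<Psi>_def\<close>)
 define C where "C = (K + L * K) * G"
 have C0: "C >= 0" using K L G by (simp add: C_def)
 have \<Psi>b: "%%\<Psi> z%% <= C" for z
 proof (cases "\<Psi> z = 0")
 case False
 then have "%%py z%% <= L" using \<Psi>s[of z] by (simp add: in_box_def)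
 then have "%%py z * Thx (tx z)%% <= L * K" unfolding abs_mult by (intro mult_mono K) (use L in auto)
 then have "%%Tht (tx z) + py z * Thx (tx z)%% <= K + L * K" using K(3)[of "(tx z)"] by linarith
 then show ?thesis unfolding \<Psi>_def abs_mult C_def by (intro mult_mono G) (use K L in auto)
 qed (simp add: C0)
 show thesis by (rule that[OF L(1) C0 \<Psi>b[unfolded \<Psi>_def] \<Psi>s[unfolded \<Psi>_def]])
qed

lemma cone_test_integrable:
 assumes Th: "tx_test Th Tht Thx" and g: "C1c g g'" and [measurable]: "h \<in> bm" and h: "!!z. %%h z%% <= M"
 shows "intgr (%z. h z * ((Tht (tx z) + py z * Thx (tx z)) * g (En V (snd z))))"
proof -
 note [measurable] = C1cD(4)[OF g] tx_test_measurable[OF Th]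
 have M0: "M >= 0" using order_trans[OF abs_ge_zero h] .
 obtain L C where C: "C >= 0" "!!z. %%(Tht (tx z) + py z * Thx (tx z)) * g (En V (snd z))%% <= C"
 "!!z. (Tht (tx z) + py z * Thx (tx z)) * g (En V (snd z)) ~= 0 ==> in_box L z"
 using cone_test_bounded[OF Th g] by metis
 show ?thesis
 proof (rule integrable_box3)
 show "%%h z * ((Tht (tx z) + py z * Thx (tx z)) * g (En V (snd z)))%% <= M * C" for z
 unfolding abs_mult[of "h z"] by (intro mult_mono h C(2)) (use M0 in auto)
 qed (use C(3) in \<open>simp, force\<close>)
qed

text \<open>The identity is exact for each mollified function, and its square differs from u^2 by at
  most 2 M times the mollification error on the support of the test function.\<close>

theorem time_renormalization:
 assumes ws: "weak_sol k (%_. 0) u" and m[measurable]: "u \<in> bm" and bd: "!!z. %%u z%% <= M"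
 and Th: "tx_test Th Tht Thx" and g: "C1c g g'"
 shows "(LI z. (u z)^2 * ((Tht (tx z) + py z * Thx (tx z)) * g (En V (snd z)))) = 0"
proof -
 have M0: "M >= 0" using order_trans[OF abs_ge_zero bd] .
 obtain kp kp' where kp: "C1c kp kp'" "!!x. kp x >= 0" "(LI x. kp x) = 1"
 using C1c_mollifier_exists by blast
 note [measurable] = C1cD(4,5)[OF kp(1)] C1cD(4)[OF g] tx_test_measurable[OF Th]
 define \<Psi> where "\<Psi> z = (Tht (tx z) + py z * Thx (tx z)) * g (En V (snd z))" for z
 have [measurable]: "\<Psi> \<in> bm" unfolding \<Psi>_def[abs_def] by measurable
 obtain L C where C0: "C >= 0" and \<Psi>b: "!!z. %%\<Psi> z%% <= C" and \<Psi>s: "!!z. \<Psi> z ~= 0 ==> in_box L z"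
 using cone_test_bounded[OF Th g, folded \<Psi>_def] by metis
 define kpn where "kpn n s = real (Suc n) * kp (real (Suc n) * s)" for n s
 have kpnc: "C1c (kpn n) (%s. real (Suc n) * (kp' (real (Suc n) * s) * real (Suc n)))" for n
 unfolding kpn_def[abs_def] by (rule C1c_scale[OF kp(1)]) simp
 note [measurable] = C1cD(4)[OF kpnc]
 have cb: "%%conv (kpn n) u z%% <= M" for n z
 using mollification_L1(2)[OF m bd kp] by (simp add: kpn_def[abs_def])
 have lim: "(%n. LI z. indB L z * %%conv (kpn n) u z - u z%%) ----> 0"
 using mollification_L1(1)[OF m bd kp] by (simp add: kpn_def[abs_def])
 have int: "intgr (%z. (f z)^2 * \<Psi> z)" if [measurable]: "f \<in> bm" and f: "!!z. %%f z%% <= M" for f :: "R3 => real"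
 proof (rule integrable_box3)
 show "%%(f z)^2 * \<Psi> z%% <= (M * M) * C" for z
 unfolding power2_eq_square abs_mult by (intro mult_mono f \<Psi>b) (use M0 in auto)
 qed (use \<Psi>s in auto)
 have zero: "(LI z. (conv (kpn n) u z)^2 * \<Psi> z) = 0" for n
 unfolding \<Psi>_def by (rule conv_renormalization[OF ws m bd kpnc Th g])
 have db: "%%conv (kpn n) u z - u z%% <= 2 * M" for n z using cb[of n z] bd[of z] by linarith
 have est: "norm ((LI z. (u z)^2 * \<Psi> z)) <= (2 * M * C) * (LI z. indB L z * %%conv (kpn n) u z - u z%%)" for n
 proof -
 have "(LI z. (u z)^2 * \<Psi> z) = (LI z. (u z)^2 * \<Psi> z - (conv (kpn n) u z)^2 * \<Psi> z)"
 using Bochner_Integration.integral_diff[OF int[of u] int[of "conv (kpn n) u"]] zero[of n] bd cb by simp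
 also have "norm ... <= (LI z. norm ((u z)^2 * \<Psi> z - (conv (kpn n) u z)^2 * \<Psi> z))"
 by (rule integral_norm_bound)
 also have "... <= (LI z. (2 * M * C) * (indB L z * %%conv (kpn n) u z - u z%%))"
 proof (rule integral_mono)
 show "intgr (%z. norm ((u z)^2 * \<Psi> z - (conv (kpn n) u z)^2 * \<Psi> z))"
 by (intro integrable_norm lint_diff int) (use bd cb in auto)
 show "intgr (%z. (2 * M * C) * (indB L z * %%conv (kpn n) u z - u z%%))"
 by (intro integrable_mult_right integrable_indB_mult[of _ "2 * M"]) (use db in auto)
 fix z
 show "norm ((u z)^2 * \<Psi> z - (conv (kpn n) u z)^2 * \<Psi> z) <= (2 * M * C) * (indB L z * %%conv (kpn n) u z - u z%%)"
 proof (cases "\<Psi> z = 0")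
 case False
 have e: "(u z)^2 * \<Psi> z - (conv (kpn n) u z)^2 * \<Psi> z = (u z + conv (kpn n) u z) * \<Psi> z * (u z - conv (kpn n) u z)"
 by (simp add: power2_eq_square algebra_simps)
 have "%%u z + conv (kpn n) u z%% <= 2 * M" using cb[of n z] bd[of z] by linarith
 then have "%%(u z + conv (kpn n) u z) * \<Psi> z * (u z - conv (kpn n) u z)%% <= (2 * M * C) * %%u z - conv (kpn n) u z%%"
 unfolding abs_mult using \<Psi>b[of z] M0 by (intro mult_mono) auto
 then show ?thesis unfolding e using \<Psi>s[OF False] by (simp add: abs_minus_commute)
 qed (use M0 C0 in simp)
 qed
 finally show ?thesis by simp
 qed
 have "(%n. (2 * M * C) * (LI z. indB L z * %%conv (kpn n) u z - u z%%)) ----> (2 * M * C) * 0"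
 by (intro tendsto_mult tendsto_const lim)
 then have "norm (LI z. (u z)^2 * \<Psi> z) <= (2 * M * C) * 0"
 by (rule LIMSEQ_le_const) (use est in auto)
 then show ?thesis by (simp add: \<Psi>_def)
qed

end

section \<open>Travel time, light cones and confinement\<close>

locale complete_potential = potential +
 assumes escape: "(\<integral>\<^sup>+x. ennreal (1 / sqrt (max 1 (- V x))) * indicator {0..} x \<partial>lborel) = \<infinity>"
 "(\<integral>\<^sup>+x. ennreal (1 / sqrt (max 1 (- V x))) * indicator {..0} x \<partial>lborel) = \<infinity>"
begin

text \<open>At bounded energy |y| is at most a constant times sqrt(max 1 (-V)), so y times
  \<open>mspeed x\<close>, the rate of change of the travel time along the flow, is bounded even
  where V tends to -\<infinity>.\<close>

definition mspeed :: "real => real" where "mspeed x = 1 / sqrt (max 1 (- V x))"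

lemma mspeed_pos: "mspeed x > 0"
 by (simp add: mspeed_def)

lemma mspeed_continuous: "continuous_on UNIV mspeed"
 unfolding mspeed_def by (intro continuous_intros Vc) (auto simp: max_def)

text \<open>Divergence of the escape integrals makes the primitive T unbounded at both ends; the
  left end is reduced to the right one by reflecting x.\<close>

lemma travel_time_exists:
 obtains T where "!!x. (T has_real_derivative mspeed x) (at x)" "!!L. \<exists>X. \<forall>x. %%T x%% <= L --> %%x%% <= X"
proof -
 obtain T where T: "!!x. (T has_real_derivative mspeed x) (at x)"
 using continuous_antiderivative[OF mspeed_continuous] by blast
 have nn: "mspeed x >= 0" for x using mspeed_pos[of x] by simp
 have mono: "T x <= T y" if "x <= y" for x y
 by (rule DERIV_nonneg_imp_nondecreasing[OF that]) (use T nn in blast)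
 have 1: "\<exists>X\<ge>0. T X - T 0 > L" for L
 by (rule antiderivative_unbounded[OF T mspeed_continuous nn]) (use escape(1) in \<open>simp add: mspeed_def\<close>)
 have 2: "\<exists>X\<ge>0. T 0 - T (- X) > L" for L
 proof -
 have d: "((%x. - T (- x)) has_real_derivative mspeed (- x)) (at x)" for x
 proof -
 have "((%x. - x) has_real_derivative - 1) (at x)" by (auto intro!: derivative_eq_intros)
 from DERIV_minus[OF DERIV_chain2[where f=T and g="%x. - x", OF T this]] show ?thesis by simp
 qed
 have [measurable]: "mspeed \<in> bm" using mspeed_continuous by (simp add: bm_cont)
 have "(\<integral>\<^sup>+x. ennreal (mspeed (- x)) * indicator {0..} x \<partial>lborel) = (\<integral>\<^sup>+x. ennreal (mspeed (- x)) * indicator {..0} (- x) \<partial>lborel)"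
 by (intro nn_integral_cong) (auto simp: indicator_def)
 also have "... = (\<integral>\<^sup>+x. ennreal (mspeed x) * indicator {..0} x \<partial>distr lborel borel (%x. - x))"
 by (rule nn_integral_distr[symmetric]) auto
 also have "... = \<infinity>" unfolding distr_uminus_lborel using escape(2) by (simp add: mspeed_def)
 finally have inf: "(\<integral>\<^sup>+x. ennreal (mspeed (- x)) * indicator {0..} x \<partial>lborel) = \<infinity>" .
 have c: "continuous_on UNIV (%x. mspeed (- x))"
 by (rule cont_comp[OF mspeed_continuous]) (auto intro: continuous_intros)
 have "\<exists>X\<ge>0. - T (- X) - - T (- 0) > L"
 by (rule antiderivative_unbounded[OF d c nn inf])
 then show ?thesis by simp
 qed
 have "\<exists>X. \<forall>x. %%T x%% <= L --> %%x%% <= X" for L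
 proof -
 obtain X1 where X1: "X1 >= 0" "T X1 - T 0 > L - T 0" using 1 by blast
 obtain X2 where X2: "X2 >= 0" "T 0 - T (- X2) > L + T 0" using 2 by blast
 have "%%x%% <= X1 + X2" if x: "%%T x%% <= L" for x
 proof (rule ccontr)
 assume "~ %%x%% <= X1 + X2"
 then have "X1 <= x | x <= - X2" using X1 X2 by auto
 then have "T X1 <= T x | T x <= T (- X2)" using mono by blast
 then show False using X1 X2 x by auto
 qed
 then show ?thesis by blast
 qed
 with T that show thesis by blast
qed

text \<open>For \<open>C\<close> exceeding all speeds \<open>\<bar>y\<bar> mspeed x\<close> on the support of \<open>g(H)\<close>, the function \<open>Th\<close> below is
 nonincreasing along the flow, and its support is bounded since the travel time \<open>T\<close> is unbounded.\<close>

lemma light_cone_test: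
 fixes L :: real
 assumes T: "!!x. (T has_real_derivative mspeed x) (at x)" "!!L. \<exists>X. \<forall>x. %%T x%% <= L --> %%x%% <= X"
 and zt: "!!x. (zt has_real_derivative zt' x) (at x)" "continuous_on UNIV zt'" "!!t. t <= -1 ==> zt t = 0 & zt' t = 0" "!!t. t > 0 ==> zt' t = 0"
 and C: "C > 0"
 defines "Lm \<equiv> %s. (max 0 (L - s))^2" and "Lm' \<equiv> %s. - 2 * max 0 (L - s)"
 shows "tx_test (%p. zt (fst p) * (Lm (C * fst p + T (snd p)) * Lm (C * fst p - T (snd p))))
 (%p. zt' (fst p) * (Lm (C * fst p + T (snd p)) * Lm (C * fst p - T (snd p)))
 + zt (fst p) * (Lm' (C * fst p + T (snd p)) * C * Lm (C * fst p - T (snd p)) + Lm (C * fst p + T (snd p)) * (Lm' (C * fst p - T (snd p)) * C)))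
 (%p. zt (fst p) * (Lm' (C * fst p + T (snd p)) * mspeed (snd p) * Lm (C * fst p - T (snd p)) + Lm (C * fst p + T (snd p)) * (Lm' (C * fst p - T (snd p)) * (- mspeed (snd p)))))"
proof -
 have Lm: "(Lm has_real_derivative Lm' s) (at s)" for s
 proof -
 have "((%s. L - s) has_real_derivative - 1) (at s)" by (auto intro!: derivative_eq_intros)
 from DERIV_chain2[where f="%s. (max 0 s)^2" and g="%s. L - s", OF pos_part_square_deriv this]
 show ?thesis by (simp add: Lm_def Lm'_def)
 qed
 have Lm'c: "continuous_on UNIV Lm'" unfolding Lm'_def by (intro continuous_intros)
 have Lmc: "continuous_on UNIV Lm" unfolding Lm_def by (intro continuous_intros)
 have Tc: "continuous_on UNIV T" using T(1) by (intro continuous_at_imp_continuous_on) (auto intro: DERIV_isCont)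
 have ztc: "continuous_on UNIV zt" using zt(1) by (intro continuous_at_imp_continuous_on) (auto intro: DERIV_isCont)
 note cc = cont_comp[OF Lm'c] cont_comp[OF Lmc] cont_comp[OF Tc] cont_comp[OF ztc]
 cont_comp[OF zt(2)] cont_comp[OF mspeed_continuous]
 have mT: "((%x. - T x) has_real_derivative - mspeed x) (at x)" for x by (rule DERIV_minus[OF T(1)])
 have mTc: "continuous_on UNIV (%x. - mspeed x)" using mspeed_continuous by (intro continuous_intros)
 have lin: "((%s. C * s) has_real_derivative C) (at s)" for s by (auto intro!: derivative_eq_intros)
 have cC: "continuous_on UNIV (%s::real. C)" by simp
 show ?thesis
 unfolding tx_test_def
 proof (intro conjI allI impI)
 fix t x
 have p: "((%s. C * s + T x) has_real_derivative C) (at t)" "((%s. C * s - T x) has_real_derivative C) (at t)"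
 by (auto intro!: derivative_eq_intros)
 have q: "((%s. C * t + T s) has_real_derivative mspeed x) (at x)" "((%s. C * t - T s) has_real_derivative - mspeed x) (at x)"
 using DERIV_add[OF DERIV_const[of "C * t"] T(1)[of x]] DERIV_diff[OF DERIV_const[of "C * t"] T(1)[of x]] by simp_all
 note pd = DERIV_chain2[where f=Lm and g="%s. C * s + T x", OF Lm p(1)] DERIV_chain2[where f=Lm and g="%s. C * s - T x", OF Lm p(2)]
 note qd = DERIV_chain2[where f=Lm and g="%s. C * t + T s", OF Lm q(1)] DERIV_chain2[where f=Lm and g="%s. C * t - T s", OF Lm q(2)]
 show "((%s. zt (fst (s, x)) * (Lm (C * fst (s, x) + T (snd (s, x))) * Lm (C * fst (s, x) - T (snd (s, x))))) has_real_derivative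
 zt' (fst (t, x)) * (Lm (C * fst (t, x) + T (snd (t, x))) * Lm (C * fst (t, x) - T (snd (t, x))))
 + zt (fst (t, x)) * (Lm' (C * fst (t, x) + T (snd (t, x))) * C * Lm (C * fst (t, x) - T (snd (t, x))) + Lm (C * fst (t, x) + T (snd (t, x))) * (Lm' (C * fst (t, x) - T (snd (t, x))) * C))) (at t)"
 using DERIV_mult[OF zt(1)[of t] DERIV_mult[OF pd]] by (simp add: algebra_simps)
 show "((%s. zt (fst (t, s)) * (Lm (C * fst (t, s) + T (snd (t, s))) * Lm (C * fst (t, s) - T (snd (t, s))))) has_real_derivative
 zt (fst (t, x)) * (Lm' (C * fst (t, x) + T (snd (t, x))) * mspeed (snd (t, x)) * Lm (C * fst (t, x) - T (snd (t, x))) + Lm (C * fst (t, x) + T (snd (t, x))) * (Lm' (C * fst (t, x) - T (snd (t, x))) * (- mspeed (snd (t, x)))))) (at x)"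
 using DERIV_cmult[OF DERIV_mult[OF qd], of "zt t"] by (simp add: algebra_simps)
 next
 show "continuous_on UNIV (%p. zt (fst p) * (Lm (C * fst p + T (snd p)) * Lm (C * fst p - T (snd p))))"
 by (intro continuous_intros cc) auto
 show "continuous_on UNIV (%p. zt' (fst p) * (Lm (C * fst p + T (snd p)) * Lm (C * fst p - T (snd p)))
 + zt (fst p) * (Lm' (C * fst p + T (snd p)) * C * Lm (C * fst p - T (snd p)) + Lm (C * fst p + T (snd p)) * (Lm' (C * fst p - T (snd p)) * C)))"
 by (intro continuous_intros cc) auto
 show "continuous_on UNIV (%p. zt (fst p) * (Lm' (C * fst p + T (snd p)) * mspeed (snd p) * Lm (C * fst p - T (snd p)) + Lm (C * fst p + T (snd p)) * (Lm' (C * fst p - T (snd p)) * (- mspeed (snd p)))))"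
 by (intro continuous_intros cc) auto
 next
 obtain X where X: "!!x. %%T x%% <= %%L%% + C ==> %%x%% <= X" using T(2) by blast
 \<comment> \<open>On the support \<open>zt\<close> forces t > -1; together with C t + T x < L and C
   t - T x < L this gives |T x| <= |L| + C, hence |x| <= X, and also t < |L|/C.\<close>
 define S where "S = 1 + %%L%% / C + (%%X%% + 1)"
 have key: "(zt (fst p) = 0 & zt' (fst p) = 0) | (Lm (C * fst p + T (snd p)) = 0 & Lm' (C * fst p + T (snd p)) = 0) | (Lm (C * fst p - T (snd p)) = 0 & Lm' (C * fst p - T (snd p)) = 0)"
 if p: "%%fst p%% >= S | %%snd p%% >= S" for p
 proof (rule ccontr)
 assume n: "~ ?thesis"
 then have t: "fst p > -1" using zt(3)[of "fst p"] by force
 have 1: "C * fst p + T (snd p) < L" using n by (auto simp: Lm_def Lm'_def max_def split: if_splits)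
 have 2: "C * fst p - T (snd p) < L" using n by (auto simp: Lm_def Lm'_def max_def split: if_splits)
 have "C * (-1) < C * fst p" using t C by (rule mult_strict_left_mono)
 then have "%%T (snd p)%% <= %%L%% + C" using 1 2 by linarith
 then have x: "%%snd p%% <= X" by (rule X)
 have "C * fst p < L" using 1 2 by linarith
 then have "fst p < %%L%% / C" using C by (simp add: less_divide_eq mult.commute)
 moreover have "0 <= %%L%% / C" using C by simp
 ultimately show False using p x t unfolding S_def by linarith
 qed
 show "\<exists>L'. \<forall>p. L' <= %%fst p%% | L' <= %%snd p%% --> zt (fst p) * (Lm (C * fst p + T (snd p)) * Lm (C * fst p - T (snd p))) = 0 &
 zt' (fst p) * (Lm (C * fst p + T (snd p)) * Lm (C * fst p - T (snd p)))
 + zt (fst p) * (Lm' (C * fst p + T (snd p)) * C * Lm (C * fst p - T (snd p)) + Lm (C * fst p + T (snd p)) * (Lm' (C * fst p - T (snd p)) * C)) = 0 &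
 zt (fst p) * (Lm' (C * fst p + T (snd p)) * mspeed (snd p) * Lm (C * fst p - T (snd p)) + Lm (C * fst p + T (snd p)) * (Lm' (C * fst p - T (snd p)) * (- mspeed (snd p)))) = 0"
 proof (intro exI[of _ S] allI impI)
 fix p :: "R2" assume p: "S <= %%fst p%% | S <= %%snd p%%"
 show "zt (fst p) * (Lm (C * fst p + T (snd p)) * Lm (C * fst p - T (snd p))) = 0 &
 zt' (fst p) * (Lm (C * fst p + T (snd p)) * Lm (C * fst p - T (snd p)))
 + zt (fst p) * (Lm' (C * fst p + T (snd p)) * C * Lm (C * fst p - T (snd p)) + Lm (C * fst p + T (snd p)) * (Lm' (C * fst p - T (snd p)) * C)) = 0 &
 zt (fst p) * (Lm' (C * fst p + T (snd p)) * mspeed (snd p) * Lm (C * fst p - T (snd p)) + Lm (C * fst p + T (snd p)) * (Lm' (C * fst p - T (snd p)) * (- mspeed (snd p)))) = 0"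
 using key[OF p] by (elim disjE conjE) simp_all
 qed
 next
 fix R :: real assume "R > 0"
 note ap = approximable_add[OF approximable_coord_comp(1)[of "%s. C * s", OF lin cC] approximable_coord_comp(2)[OF T(1) mspeed_continuous], of R]
 approximable_add[OF approximable_coord_comp(1)[of "%s. C * s", OF lin cC] approximable_coord_comp(2)[OF mT mTc], of R]
 note ap' = approximable_mult[OF approximable_coord_comp(1)[OF zt(1,2)] approximable_mult[OF approximable_comp[OF Lm Lm'c ap(1)] approximable_comp[OF Lm Lm'c ap(2)]]]
 show "approximable R (%z. zt (fst (tx z)) * (Lm (C * fst (tx z) + T (snd (tx z))) * Lm (C * fst (tx z) - T (snd (tx z)))))
 (%z. zt' (fst (tx z)) * (Lm (C * fst (tx z) + T (snd (tx z))) * Lm (C * fst (tx z) - T (snd (tx z))))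
 + zt (fst (tx z)) * (Lm' (C * fst (tx z) + T (snd (tx z))) * C * Lm (C * fst (tx z) - T (snd (tx z))) + Lm (C * fst (tx z) + T (snd (tx z))) * (Lm' (C * fst (tx z) - T (snd (tx z))) * C)))
 (%z. zt (fst (tx z)) * (Lm' (C * fst (tx z) + T (snd (tx z))) * mspeed (snd (tx z)) * Lm (C * fst (tx z) - T (snd (tx z))) + Lm (C * fst (tx z) + T (snd (tx z))) * (Lm' (C * fst (tx z) - T (snd (tx z))) * (- mspeed (snd (tx z))))))
 (%z. 0)"
 using ap' by simp
 qed
qed

text \<open>For t > 0 the derivative of the light-cone test along the flow is nonpositive, and
  strictly negative inside the cone, whereas \<open>H\<close> makes its integral against the
  nonnegative \<open>w\<close> nonnegative. So \<open>w\<close> vanishes in the cone. The lemma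
  serves both the square of a difference of solutions and the defect of weak limits.\<close>

theorem confinement:
 assumes [measurable]: "w \<in> bm" and w: "!!z. 0 <= w z" "!!z. w z <= M"
 and H: "!!Th Tht Thx g g'. tx_test Th Tht Thx ==> C1c g g' ==> (!!p. 0 <= Th p) ==> (!!E. 0 <= g E) ==>
 0 <= (LI z. indicator {0<..} (fst z) * (w z * ((Tht (tx z) + py z * Thx (tx z)) * g (En V (snd z)))))"
 shows "AE z in lborel. fst z > 0 --> w z = 0"
proof -
 have M0: "M >= 0" using w[of undefined] by linarith
 obtain T where T: "!!x. (T has_real_derivative mspeed x) (at x)" "!!L. \<exists>X. \<forall>x. %%T x%% <= L --> %%x%% <= X"
 using travel_time_exists by blast
 obtain vt vt' :: "real => real" where vt: "!!x. (vt has_real_derivative vt' x) (at x)" "continuous_on UNIV vt'"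
 "!!x. x <= 1 ==> vt x = 0" "!!x. x >= 2 ==> vt x = 1" "!!x. 0 <= vt x & vt x <= 1"
 "!!x. x \<notin> {1..2} ==> vt' x = 0" using step_C1_exists by metis
 have "vt' 1 = 0"
 proof (rule DERIV_local_min[OF vt(1)[of 1], of 1])
 show "\<forall>y. %%1 - y%% < 1 --> vt 1 <= vt y" using vt(3)[of 1] vt(5) by simp
 qed simp
 then have vt1: "vt' x = 0" if "x <= 1" for x using vt(6)[of x] that by (cases "x = 1") auto
 define zt zt' where "zt t = vt (t + 2)" and "zt' t = vt' (t + 2)" for t
 have zt: "(zt has_real_derivative zt' t) (at t)" for t
 proof -
 have "((%t. t + 2) has_real_derivative 1) (at t)" by (auto intro!: derivative_eq_intros)
 from DERIV_chain2[where f=vt and g="%t. t + 2", OF vt(1) this] show ?thesis by (simp add: zt_def[abs_def] zt'_def)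
 qed
 have zt'c: "continuous_on UNIV zt'" unfolding zt'_def by (rule cont_comp[OF vt(2)]) (auto intro: continuous_intros)
 have zt0: "zt t = 0 & zt' t = 0" if "t <= -1" for t using vt(3)[of "t + 2"] vt1[of "t + 2"] that by (simp add: zt_def zt'_def)
 have zt1: "zt t = 1" "zt' t = 0" if "t > 0" for t using vt(4)[of "t + 2"] vt(6)[of "t + 2"] that by (auto simp: zt_def zt'_def)
 have ztnn: "zt t >= 0" for t using vt(5) by (simp add: zt_def)
 have main: "AE z in lborel. fst z > 0 & C * fst z + T (px z) < L & C * fst z - T (px z) < L & %%En V (snd z)%% <= K --> w z = 0"
 if K: "K > 0" and C_def: "C = sqrt (2 * (2 * K + 1)) + 1" for K L C
 proof -
 have C: "C > 0" using K by (simp add: C_def add_nonneg_pos)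
 obtain g g' where g: "C1c g g'" "!!x. %%x%% <= K ==> g x = 1" "!!x. 0 <= g x & g x <= 1" "!!x. %%x%% >= 2 * K ==> g x = 0 & g' x = 0"
 using C1c_plateau_exists[OF K] by metis
 define Lm where "Lm s = (max 0 (L - s))^2" for s
 define Lm' where "Lm' s = - 2 * max 0 (L - s)" for s
 note tx = light_cone_test[OF T zt zt'c zt0 zt1(2) C, of L, folded Lm_def Lm'_def]
 let ?P = "%z. C * fst z + T (px z)" and ?Q = "%z. C * fst z - T (px z)"
 define F where "F z = indicator {0<..} (fst z) * (w z * ((Lm' (?P z) * Lm (?Q z) * (C + py z * mspeed (px z))
 + Lm (?P z) * Lm' (?Q z) * (C - py z * mspeed (px z))) * g (En V (snd z))))" for z
 \<comment> \<open>Origin of \<open>C\<close>: where g(H) is nonzero, y^2/2 = H - V <= (2 K + 1) max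
   1 (-V). The additional 1 in \<open>C\<close> makes the inequality strict, hence \<open>F\<close>
   negative inside the cone wherever \<open>w\<close> is positive and g = 1.\<close>
 have sp: "%%py z * mspeed (px z)%% < C" if "g (En V (snd z)) ~= 0" for z
 proof -
 have E: "%%En V (snd z)%% < 2 * K" using that g(4) not_le by blast
 let ?m = "max 1 (- V (px z))"
 have "(py z)^2 / 2 <= 2 * K - V (px z)" using E by (auto simp: En_def)
 also have "... <= 2 * K * ?m + ?m"
 proof -
 have "2 * K * 1 <= 2 * K * ?m" using K by (intro mult_left_mono) auto
 then show ?thesis by linarith
 qed
 finally have "(py z)^2 <= 2 * (2 * K + 1) * ?m" by (simp add: algebra_simps)
 then have "%%py z%% <= sqrt (2 * (2 * K + 1) * ?m)" by (simp add: real_le_rsqrt)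
 then have "%%py z%% <= sqrt (2 * (2 * K + 1)) * sqrt ?m" by (simp only: real_sqrt_mult)
 then have "%%py z%% / sqrt ?m <= sqrt (2 * (2 * K + 1))" by (simp add: divide_le_eq)
 then show ?thesis by (simp add: mspeed_def abs_mult C_def)
 qed
 have Fle: "F z <= 0" for z
 proof (cases "g (En V (snd z)) = 0")
 case False
 have "Lm' (?P z) * Lm (?Q z) * (C + py z * mspeed (px z)) <= 0"
 using sp[OF False] by (intro mult_nonpos_nonneg) (auto simp: Lm_def Lm'_def)
 moreover have "Lm (?P z) * Lm' (?Q z) * (C - py z * mspeed (px z)) <= 0"
 using sp[OF False] by (intro mult_nonpos_nonneg mult_nonneg_nonpos) (auto simp: Lm_def Lm'_def)
 ultimately show ?thesis unfolding F_def using w(1)[of z] g(3)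
 by (intro mult_nonneg_nonpos mult_nonpos_nonneg) auto
 qed (simp add: F_def)
 let ?G = "%z. indicator {0<..} (fst z) * (w z * ((zt' (fst z) * (Lm (?P z) * Lm (?Q z)) + zt (fst z) * (Lm' (?P z) * C * Lm (?Q z) + Lm (?P z) * (Lm' (?Q z) * C))
 + py z * (zt (fst z) * (Lm' (?P z) * mspeed (px z) * Lm (?Q z) + Lm (?P z) * (Lm' (?Q z) * - mspeed (px z))))) * g (En V (snd z))))"
 have "?G z = F z" for z
 unfolding F_def using zt1[of "fst z"] by (cases "fst z > 0") (simp_all add: algebra_simps)
 then have GF: "?G = F" by (rule ext)
 have pos: "0 <= zt (fst p) * (Lm (C * fst p + T (snd p)) * Lm (C * fst p - T (snd p)))" for p
 using ztnn by (simp add: Lm_def)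
 have "0 <= (LI z. ?G z)"
 using H[OF tx g(1) pos] g(3) by simp
 then have "0 <= (LI z. F z)" unfolding GF .
 moreover have Fi: "intgr F"
 proof -
 have h: "(%z. indicator {0<..} (fst z) * w z) \<in> bm" by measurable
 have hb: "%%indicator {0<..} (fst z) * w z%% <= M" for z using w[of z] M0 by (auto simp: indicator_def)
 have "intgr ?G" using cone_test_integrable[OF tx g(1) h hb] by (simp add: mult.assoc)
 then show ?thesis unfolding GF .
 qed
 moreover have "0 <= (LI z. - F z)" by (rule lint_nonneg) (use Fle in simp)
 ultimately have "(LI z. - F z) = 0" by simp
 then have "AE z in lborel. - F z = 0"
 by (subst (asm) integral_nonneg_eq_0_iff_AE) (use Fi Fle in auto)
 then show ?thesis
 proof eventually_elim
 case (elim z)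
 show ?case
 proof
 assume z: "fst z > 0 & ?P z < L & ?Q z < L & %%En V (snd z)%% <= K"
 then have g1: "g (En V (snd z)) = 1" using g(2) by blast
 have s: "%%py z * mspeed (px z)%% < C" by (rule sp) (simp add: g1)
 have "Lm' (?P z) * Lm (?Q z) * (C + py z * mspeed (px z)) < 0"
 using s z by (intro mult_neg_pos) (auto simp: Lm_def Lm'_def)
 moreover have "Lm (?P z) * Lm' (?Q z) * (C - py z * mspeed (px z)) < 0"
 using s z by (intro mult_neg_pos mult_pos_neg) (auto simp: Lm_def Lm'_def)
 ultimately have "Lm' (?P z) * Lm (?Q z) * (C + py z * mspeed (px z)) + Lm (?P z) * Lm' (?Q z) * (C - py z * mspeed (px z)) ~= 0"
 by linarith
 then show "w z = 0" using elim z g1 by (auto simp: F_def)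
 qed
 qed
 qed
 \<comment> \<open>Countably many energy bounds n + 1 and cone heights j reach every point with t >
   0, so the exceptional sets can be united.\<close>
 have "AE z in lborel. \<forall>n::nat. \<forall>j::nat. fst z > 0 & (sqrt (2 * (2 * real (Suc n) + 1)) + 1) * fst z + T (px z) < real j &
 (sqrt (2 * (2 * real (Suc n) + 1)) + 1) * fst z - T (px z) < real j & %%En V (snd z)%% <= real (Suc n) --> w z = 0"
 unfolding AE_all_countable
 proof (intro allI)
 fix n j :: nat
 show "AE z in lborel. fst z > 0 & (sqrt (2 * (2 * real (Suc n) + 1)) + 1) * fst z + T (px z) < real j &
 (sqrt (2 * (2 * real (Suc n) + 1)) + 1) * fst z - T (px z) < real j & %%En V (snd z)%% <= real (Suc n) --> w z = 0"
 by (rule main[OF _ refl]) simp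
 qed
 then show ?thesis
 proof eventually_elim
 case (elim z)
 show ?case
 proof
 assume t: "fst z > 0"
 obtain n where n: "%%En V (snd z)%% <= real n" using real_arch_simple by blast
 then have n': "%%En V (snd z)%% <= real (Suc n)" by simp
 let ?C = "sqrt (2 * (2 * real (Suc n) + 1)) + 1"
 obtain j where j: "%%?C * fst z%% + %%T (px z)%% < real j" using reals_Archimedean2 by blast
 have "?C * fst z + T (px z) < real j" "?C * fst z - T (px z) < real j" using j by linarith+
 then show "w z = 0" using elim t n' by blast
 qed
 qed
qed

text \<open>\<open>time_renormalization\<close> gives the hypothesis of \<open>confinement\<close>
  for v^2 with equality: \<open>v\<close> vanishes for t < 0, so restricting the integral to t > 0
  loses only the null set t = 0.\<close>

theorem uniqueness_zero:
 assumes ws: "weak_sol k (%_. 0) v" and m[measurable]: "v \<in> bm" and bd: "!!z. %%v z%% <= M"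
 and neg: "!!z. fst z < 0 ==> v z = 0"
 shows "AE z in lborel. fst z > 0 --> v z = 0"
proof -
 have M0: "M >= 0" using order_trans[OF abs_ge_zero bd] .
 have "AE z in lborel. fst z > 0 --> (v z)^2 = 0"
 proof (rule confinement[where M="M * M"])
 show "(v z)^2 <= M * M" for z
 proof -
 have "%%v z%% * %%v z%% <= M * M" by (intro mult_mono bd) (use M0 in auto)
 then show ?thesis by (simp add: power2_eq_square)
 qed
 fix Th Tht Thx :: "R2 => real" and g g' assume Th: "tx_test Th Tht Thx" and g: "C1c g g'"
 note [measurable] = C1cD(4)[OF g] tx_test_measurable[OF Th]
 have "(LI z. indicator {0<..} (fst z) * ((v z)^2 * ((Tht (tx z) + py z * Thx (tx z)) * g (En V (snd z)))))
 = (LI z. (v z)^2 * ((Tht (tx z) + py z * Thx (tx z)) * g (En V (snd z))))"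
 proof (rule integral_cong_AE)
 show "AE z in lborel. indicator {0<..} (fst z) * ((v z)^2 * ((Tht (tx z) + py z * Thx (tx z)) * g (En V (snd z))))
 = (v z)^2 * ((Tht (tx z) + py z * Thx (tx z)) * g (En V (snd z)))"
 using AE_lborel_fst[OF AE_lborel_singleton[of "0 :: real"]]
 by eventually_elim (use neg in \<open>auto simp: indicator_def not_less\<close>)
 qed measurable
 also have "... = 0" by (rule time_renormalization[OF ws m bd Th g])
 finally show "0 <= (LI z. indicator {0<..} (fst z) * ((v z)^2 * ((Tht (tx z) + py z * Thx (tx z)) * g (En V (snd z)))))"
 by simp
 qed auto
 then show ?thesis by eventually_elim simp
qed

end

section \<open>Weak-* limits along filters\<close>

lemma compact_real_boxes: "compact (Pi\<^sub>E UNIV (%i::'i. {- B i..B i :: real}))"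
proof -
 have "compactin (product_topology (%i::'i. euclidean :: real topology) UNIV) (Pi\<^sub>E UNIV (%i. {- B i..B i}))"
 unfolding compactin_PiE by simp
 then show ?thesis unfolding euclidean_product_topology by simp
qed

text \<open>The preimage of the neighbourhood filter of a cluster point, met with \<open>G\<close>,
  plays the part of a convergent subnet.\<close>

lemma cluster_filter:
 assumes K: "compact K" and X: "!!n. X n \<in> K" and G: "G ~= bot"
 obtains F l where "F <= G" "F ~= bot" "l \<in> K" "(X \<longlongrightarrow> l) F"
proof -
 have "filtermap X G ~= bot" using G by (simp add: filtermap_bot_iff)
 moreover have "eventually (%x. x \<in> K) (filtermap X G)" using X by (simp add: eventually_filtermap)
 ultimately obtain l where l: "l \<in> K" "inf (nhds l) (filtermap X G) ~= bot"
 using K unfolding compact_filter by blast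
 let ?F = "inf (filtercomap X (nhds l)) G"
 have "?F ~= bot"
 proof
 assume "?F = bot"
 then have "eventually (%_. False) ?F" by simp
 then obtain P Q where P: "eventually P (filtercomap X (nhds l))" "eventually Q G" "!!n. P n ==> Q n ==> False"
 unfolding eventually_inf by blast
 obtain P' where P': "eventually P' (nhds l)" "!!n. P' (X n) ==> P n" using P(1) unfolding eventually_filtercomap by blast
 have "eventually (%n. ~ P' (X n)) G" using P(2) by eventually_elim (use P(3) P'(2) in blast)
 then have "eventually (%x. ~ P' x) (filtermap X G)" by (simp add: eventually_filtermap)
 then have "eventually (%_. False) (inf (nhds l) (filtermap X G))"
 unfolding eventually_inf using P'(1) by blast
 then show False using l(2) trivial_limit_def by blast
 qed
 moreover have "(X \<longlongrightarrow> l) ?F"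
 by (rule filterlim_mono[OF filterlim_filtercomap order_refl inf_le1])
 ultimately show thesis by (intro that[of ?F l]) (simp_all add: l)
qed

lemma AE_density_le:
 assumes "finite_measure \<mu>" and [measurable]: "f \<in> borel_measurable \<mu>" and M: "M >= 0"
 and le: "!!A. A \<in> sets \<mu> ==> emeasure (density \<mu> f) A <= ennreal M * emeasure \<mu> A"
 shows "AE z in \<mu>. f z <= ennreal M"
proof -
 interpret finite_measure \<mu> by fact
 define A where "A = {z \<in> space \<mu>. ennreal M < f z}"
 have [measurable]: "A \<in> sets \<mu>" unfolding A_def by measurable
 have "(\<integral>\<^sup>+z. (f z - ennreal M) * indicator A z \<partial>\<mu>) + ennreal M * emeasure \<mu> A
 = (\<integral>\<^sup>+z. (f z - ennreal M) * indicator A z + ennreal M * indicator A z \<partial>\<mu>)"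
 by (subst nn_integral_add) (auto simp: nn_integral_cmult_indicator)
 also have "... = (\<integral>\<^sup>+z. f z * indicator A z \<partial>\<mu>)"
 by (intro nn_integral_cong) (auto simp: A_def indicator_def intro!: diff_add_cancel_ennreal less_imp_le)
 also have "... = emeasure (density \<mu> f) A" by (simp add: emeasure_density)
 also have "... <= 0 + ennreal M * emeasure \<mu> A" using le by simp
 finally have "ennreal M * emeasure \<mu> A + (\<integral>\<^sup>+z. (f z - ennreal M) * indicator A z \<partial>\<mu>) <= ennreal M * emeasure \<mu> A + 0"
 by (simp add: add.commute)
 then have "(\<integral>\<^sup>+z. (f z - ennreal M) * indicator A z \<partial>\<mu>) <= 0"
 unfolding ennreal_add_left_cancel_le using emeasure_finite[of A] by (auto simp: ennreal_mult_eq_top_iff)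
 then have "AE z in \<mu>. (f z - ennreal M) * indicator A z = 0" by (subst (asm) le_zero_eq, subst (asm) nn_integral_0_iff_AE) auto
 then show ?thesis
 by (rule AE_mp) (auto intro!: AE_I2 simp: A_def indicator_def not_le diff_eq_0_iff_ennreal split: if_splits)
qed

text \<open>Sequential weak-* compactness would need a diagonal argument; limits along a finer filter are
 enough, and these come from Tychonoff's theorem together with the Radon--Nikodym theorem.\<close>

lemma weak_star_finite:
 fixes \<mu> :: "'a measure" and u :: "'i => 'a => real"
 assumes fm: "finite_measure \<mu>" and [measurable]: "!!n. u n \<in> borel_measurable \<mu>"
 and u: "!!n z. 0 <= u n z" "!!n z. u n z <= M" and G: "G ~= bot"
 obtains F v where "F <= G" "F ~= bot" "v \<in> borel_measurable \<mu>" "!!z. 0 <= v z" "!!z. v z <= M"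
 "!!ps. integrable \<mu> ps ==> ((%n. LINT z|\<mu>. u n z * ps z) \<longlongrightarrow> (LINT z|\<mu>. v z * ps z)) F"
proof -
 interpret finite_measure \<mu> by (rule fm)
 have M0: "M >= 0" using u order_trans by blast
 have mi: "integrable \<mu> (%z. f z * ps z)" if "integrable \<mu> ps" "f \<in> borel_measurable \<mu>" "!!z. 0 <= f z" "!!z. f z <= M" for f ps :: "'a => real"
 proof (rule lint_bound[OF integrable_mult_right[OF that(1), of M]])
 show "AE z in \<mu>. norm (f z * ps z) <= norm (M * ps z)"
 using that(3,4) M0 by (auto simp: abs_mult intro!: mult_right_mono)
 qed (use that in measurable)
 note ui = mi[OF _ _ u]
 \<comment> \<open>Coordinates are indexed by all functions \<open>ps\<close>; the value 0 at
   non-integrable ones places every \<open>X n\<close> in a single compact product of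
   intervals.\<close>
 define X where "X n ps = (if integrable \<mu> ps then LINT z|\<mu>. u n z * ps z else 0)" for n ps
 define B where "B ps = M * (LINT z|\<mu>. %%ps z%%)" for ps :: "'a => real"
 have B0: "B ps >= 0" for ps using M0 by (simp add: B_def integral_nonneg)
 have Xb: "%%X n ps%% <= B ps" for n ps
 proof (cases "integrable \<mu> ps")
 case True
 have "%%LINT z|\<mu>. u n z * ps z%% <= (LINT z|\<mu>. %%u n z * ps z%%)" by (rule integral_abs_bound)
 also have "... <= (LINT z|\<mu>. M * %%ps z%%)"
 by (intro integral_mono integrable_abs ui True integrable_mult_right) (use u in \<open>auto simp: abs_mult intro!: mult_right_mono\<close>)
 finally show ?thesis using True by (simp add: X_def B_def)
 qed (simp add: X_def B0)
 have XK: "X n \<in> Pi\<^sub>E UNIV (%ps. {- B ps..B ps})" for n using Xb[of n] by (simp add: PiE_iff abs_le_iff minus_le_iff)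
 obtain F l where F: "F <= G" "F ~= bot" and lK: "l \<in> Pi\<^sub>E UNIV (%ps. {- B ps..B ps})" and Xl: "(X \<longlongrightarrow> l) F"
 by (rule cluster_filter[where X=X and G=G, OF compact_real_boxes XK G]) blast
 have lB: "%%l ps%% <= B ps" for ps using lK by (simp add: PiE_iff abs_le_iff minus_le_iff)
 have lim: "((%n. X n ps) \<longlongrightarrow> l ps) F" for ps
 using continuous_on_tendsto_compose[OF continuous_on_product_coordinates Xl] by simp
 have limi: "((%n. LINT z|\<mu>. u n z * ps z) \<longlongrightarrow> l ps) F" if "integrable \<mu> ps" for ps
 using lim[of ps] that by (simp add: X_def)
 have ladd: "l (%z. f z + g z) = l f + l g" if "integrable \<mu> f" "integrable \<mu> g" for f g
 proof (rule tendsto_unique[OF F(2)])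
 show "((%n. LINT z|\<mu>. u n z * (f z + g z)) \<longlongrightarrow> l (%z. f z + g z)) F" by (rule limi) (use that in simp)
 show "((%n. LINT z|\<mu>. u n z * (f z + g z)) \<longlongrightarrow> l f + l g) F"
 using tendsto_add[OF limi limi] that by (simp add: distrib_left ui)
 qed
 have lscale: "l (%z. c * f z) = c * l f" if "integrable \<mu> f" for c f
 proof (rule tendsto_unique[OF F(2)])
 show "((%n. LINT z|\<mu>. u n z * (c * f z)) \<longlongrightarrow> l (%z. c * f z)) F" by (rule limi) (use that in simp)
 show "((%n. LINT z|\<mu>. u n z * (c * f z)) \<longlongrightarrow> c * l f) F"
 using tendsto_mult[OF tendsto_const[of c] limi[OF that]] by (simp add: mult.left_commute)
 qed
 have lpos: "l f >= 0" if "integrable \<mu> f" "!!z. f z >= 0" for f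
 by (rule tendsto_lowerbound[OF limi[OF that(1)] _ F(2)])
 (use u that in \<open>auto intro!: always_eventually lint_nonneg\<close>)
 have indi: "integrable \<mu> (indicator A :: 'a => real)" if "A \<in> sets \<mu>" for A
 using that by (simp add: integrable_indicator_iff less_top[symmetric])
 have lind: "l (indicator A) >= 0" "l (indicator A) <= M * measure \<mu> A" if A: "A \<in> sets \<mu>" for A
 using lpos[OF indi[OF A]] lB[of "indicator A"] A by (auto simp: B_def)
 define \<nu> where "\<nu> A = ennreal (l (indicator A))" for A
 have \<nu>le: "\<nu> A <= ennreal (M * measure \<mu> A)" if "A \<in> sets \<mu>" for A
 unfolding \<nu>_def by (rule ennreal_leI) (rule lind[OF that])
 have \<nu>0: "positive (sets \<mu>) \<nu>" using lind[of "{}"] by (auto simp: positive_def \<nu>_def intro: antisym)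
 \<comment> \<open>Domination of \<open>\<nu>\<close> by M times the finite measure
   \<open>\<mu>\<close> gives continuity at the empty set, which turns finite into countable
   additivity.\<close>
 have ca: "countably_additive (sets \<mu>) \<nu>"
 proof (rule sets.empty_continuous_imp_countably_additive[OF \<nu>0])
 show "additive (sets \<mu>) \<nu>"
 unfolding additive_def
 proof (intro ballI impI)
 fix A C assume A: "A \<in> sets \<mu>" "C \<in> sets \<mu>" "A \<inter> C = {}"
 have "l (indicator (A \<union> C)) = l (%z. indicator A z + indicator C z)"
 using A(3) by (intro arg_cong[where f=l]) (auto simp: indicator_def fun_eq_iff)
 also have "... = l (indicator A) + l (indicator C)" by (rule ladd[OF indi indi]) (use A in auto)
 finally show "\<nu> (A \<union> C) = \<nu> A + \<nu> C" using lind A by (simp add: \<nu>_def)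
 qed
 show "\<forall>A\<in>sets \<mu>. \<nu> A ~= \<infinity>" by (simp add: \<nu>_def)
 fix A :: "nat => 'a set" assume A: "range A \<subseteq> sets \<mu>" "decseq A" "(\<Inter>i. A i) = {}"
 have "(%i. ennreal (M * measure \<mu> (A i))) ----> ennreal (M * measure \<mu> (\<Inter>i. A i))"
 by (intro tendsto_ennrealI tendsto_mult tendsto_const finite_Lim_measure_decseq A)
 then have "(%i. ennreal (M * measure \<mu> (A i))) ----> 0" by (simp add: A(3))
 then show "(%i. \<nu> (A i)) ----> 0"
 by (rule tendsto_sandwich[OF _ _ tendsto_const, rotated 2]) (use \<nu>le A(1) in \<open>auto intro!: always_eventually\<close>)
 qed
 define N where "N = measure_of (space \<mu>) (sets \<mu>) \<nu>"
 have eN: "emeasure N A = \<nu> A" if "A \<in> sets \<mu>" for A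
 unfolding N_def by (rule emeasure_measure_of_sigma[OF sets.sigma_algebra_axioms \<nu>0 ca that])
 have sN: "sets N = sets \<mu>" by (simp add: N_def)
 have "absolutely_continuous \<mu> N"
 unfolding absolutely_continuous_def
 proof
 fix A assume A: "A \<in> null_sets \<mu>"
 then have "\<nu> A <= 0" using \<nu>le[of A] by (auto simp: null_sets_def measure_def)
 then show "A \<in> null_sets N" using A eN[of A] by (auto simp: null_sets_def sN)
 qed
 then obtain f where f[measurable]: "f \<in> borel_measurable \<mu>" and dN: "density \<mu> f = N"
 using Radon_Nikodym[OF _ sN] by blast
 have fM: "AE z in \<mu>. f z <= ennreal M"
 by (rule AE_density_le[OF fm f M0]) (simp add: dN eN order_trans[OF \<nu>le] emeasure_eq_measure ennreal_mult M0)
 \<comment> \<open>Clipping at M turns the a.e. bound on the density into one valid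
   everywhere.\<close>
 define v where "v z = min M (enn2real (f z))" for z
 have vm[measurable]: "v \<in> borel_measurable \<mu>" unfolding v_def[abs_def] by measurable
 have v: "0 <= v z" "v z <= M" for z using M0 by (auto simp: v_def)
 have fv: "AE z in \<mu>. f z = ennreal (v z)"
 using fM
 proof eventually_elim
 case (elim z)
 then have "f z < top" by (simp add: le_less_trans)
 moreover have "enn2real (f z) <= M" using elim M0 by (simp add: enn2real_leI)
 ultimately show ?case by (simp add: v_def min_def)
 qed
 \<comment> \<open>Both sides are linear in \<open>ps\<close>, agree on indicators and are
   continuous in L^1, the left one because of \<open>lB\<close>.\<close>
 have l_eq: "l ps = (LINT z|\<mu>. v z * ps z)" if "integrable \<mu> ps" for ps
 using that
 proof (induction rule: integrable_induct)
 case (base A c)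
 have iv: "integrable \<mu> (%z. v z * indicator A z)" by (rule mi[OF indi[OF base(1)] _ v]) simp
 have "ennreal (l (indicator A)) = (\<integral>\<^sup>+z. f z * indicator A z \<partial>\<mu>)"
 using eN[OF base(1)] base(1) unfolding \<nu>_def dN[symmetric] by (simp add: emeasure_density)
 also have "... = (\<integral>\<^sup>+z. ennreal (v z * indicator A z) \<partial>\<mu>)"
 by (rule nn_integral_cong_AE) (use fv in eventually_elim, auto simp: indicator_def)
 also have "... = ennreal (LINT z|\<mu>. v z * indicator A z)"
 by (rule nn_integral_eq_integral[OF iv]) (use v in auto)
 finally have "l (indicator A) = (LINT z|\<mu>. v z * indicator A z)"
 using lind(1)[OF base(1)] v by (subst (asm) ennreal_inj) (auto intro!: lint_nonneg)
 then have "l (%z. c * indicator A z) = c * (LINT z|\<mu>. v z * indicator A z)" using lscale[OF indi[OF base(1)], of c] by simp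
 also have "... = (LINT z|\<mu>. v z * (indicator A z *\<^sub>R c))" by (simp flip: integral_mult_right_zero add: mult_ac)
 finally show ?case by (simp add: mult.commute)
 next
 case (add f g)
 then show ?case by (simp add: ladd distrib_left mi v)
 next
 case (lim f s)
 have a: "(%i. LINT z|\<mu>. v z * s i z) ----> (LINT z|\<mu>. v z * f z)"
 proof (rule dct[where w="%z. M * (2 * %%f z%%)"])
 show "AE z in \<mu>. norm (v z * s i z) <= M * (2 * %%f z%%)" for i
 proof (rule AE_I2)
 fix z assume "z \<in> space \<mu>"
 then have "%%s i z%% <= 2 * %%f z%%" using lim.hyps(3) by simp
 then show "norm (v z * s i z) <= M * (2 * %%f z%%)"
 using v M0 by (auto simp: abs_mult intro!: mult_mono)
 qed
 qed (use lim in \<open>auto intro!: AE_I2 tendsto_intros\<close>)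
 have b: "(%i. LINT z|\<mu>. %%s i z + (- 1) * f z%%) ----> (LINT z|\<mu>. 0)"
 proof (rule dct[where w="%z. 3 * %%f z%%"])
 show "AE z in \<mu>. (%i. %%s i z + (- 1) * f z%%) ----> 0"
 proof (rule AE_I2)
 fix z assume "z \<in> space \<mu>"
 from tendsto_rabs[OF tendsto_diff[OF lim.hyps(2)[OF this] tendsto_const[of "f z"]]]
 show "(%i. %%s i z + (- 1) * f z%%) ----> 0" by simp
 qed
 show "AE z in \<mu>. norm %%s i z + (- 1) * f z%% <= 3 * %%f z%%" for i
 using lim.hyps(3)[of _ i] by (intro AE_I2) fastforce
 qed (use lim in auto)
 have "(%i. l (s i) - l f) ----> 0"
 proof (rule Lim_null_comparison)
 show "(%i. M * (LINT z|\<mu>. %%s i z + (- 1) * f z%%)) ----> 0" using tendsto_mult[OF tendsto_const[of M] b] by simp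
 have "l (s i) - l f = l (%z. s i z + (- 1) * f z)" for i
 using ladd[OF lim.hyps(1) integrable_mult_right[OF lim.hyps(4)], of i "- 1"] lscale[OF lim.hyps(4), of "- 1"] by simp
 then show "\<forall>\<^sub>F i in sequentially. norm (l (s i) - l f) <= M * (LINT z|\<mu>. %%s i z + (- 1) * f z%%)"
 using lB by (simp add: B_def)
 qed
 then have "(%i. l (s i)) ----> l f" by (simp add: LIM_zero_iff)
 then show ?case using LIMSEQ_unique[OF _ a] lim.IH by simp
 qed
 show thesis by (rule that[OF F(1,2) vm v]) (use limi l_eq in auto)
qed

lemma positive_integrable_exists:
 obtains \<rho> :: "'a::euclidean_space => real" where "intgr \<rho>" "!!z. \<rho> z > 0"
proof -
 obtain h :: "'a => ennreal" where h: "h \<in> borel_measurable lborel" "integral\<^sup>N lborel h ~= \<infinity>" "!!z. 0 < h z & h z < \<infinity>"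
 using sigma_finite_measure.Ex_finite_integrable_function[OF sigma_finite_lborel] by force
 have e: "ennreal (enn2real (h z)) = h z" for z using h(3)[of z] by simp
 show thesis
 proof (rule that[of "%z. enn2real (h z)"])
 show "intgr (%z. enn2real (h z))"
 by (rule integrableI_bounded) (use h in \<open>auto simp: e less_top\<close>)
 show "enn2real (h z) > 0" for z using h(3)[of z] by (simp add: enn2real_positive_iff)
 qed
qed

text \<open>A positive integrable weight \<open>\<rho>\<close> makes the measure finite, with ps /
  \<rho> as the test function there; adding M makes the functions nonnegative.\<close>

lemma weak_star_limit:
 fixes u :: "'i => 'a::euclidean_space => real"
 assumes [measurable]: "!!n. u n \<in> bm" and u: "!!n z. %%u n z%% <= M" and G: "G ~= bot"
 obtains F v where "F <= G" "F ~= bot" "v \<in> bm" "!!z. %%v z%% <= M"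
 "!!ps. intgr ps ==> ((%n. LI z. u n z * ps z) \<longlongrightarrow> (LI z. v z * ps z)) F"
proof -
 obtain \<rho> :: "'a => real" where \<rho>: "intgr \<rho>" "!!z. \<rho> z > 0" using positive_integrable_exists by blast
 have [measurable]: "\<rho> \<in> bm" using \<rho>(1) by auto
 have r0: "\<rho> z >= 0" for z using \<rho>(2)[of z] by simp
 let ?\<mu> = "density lborel (%z. ennreal (\<rho> z))"
 have fm: "finite_measure ?\<mu>"
 by (rule finite_measureI) (use r0 in \<open>simp add: emeasure_density nn_integral_eq_integral[OF \<rho>(1)]\<close>)
 have ub: "0 <= u n z + M" "u n z + M <= 2 * M" for n z using u[of n z] by auto
 obtain F w where F: "F <= G" "F ~= bot" and w[measurable]: "w \<in> borel_measurable ?\<mu>" and wb: "!!z. 0 <= w z" "!!z. w z <= 2 * M"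
 and lim: "!!ps. integrable ?\<mu> ps ==> ((%n. LINT z|?\<mu>. (u n z + M) * ps z) \<longlongrightarrow> (LINT z|?\<mu>. w z * ps z)) F"
 using weak_star_finite[OF fm, where u="%n z. u n z + M" and M="2 * M" and G=G] G ub by auto
 have [measurable]: "w \<in> bm" using w by simp
 show thesis
 proof (rule that[OF F, of "%z. w z - M"])
 show "%%w z - M%% <= M" for z using wb[of z] by auto
 fix ps :: "'a => real" assume ps: "intgr ps"
 have [measurable]: "ps \<in> bm" using ps by auto
 have e: "(LINT z|?\<mu>. f z * (ps z / \<rho> z)) = (LI z. f z * ps z)" if [measurable]: "f \<in> bm" for f
 using \<rho>(2) by (subst integral_density) (auto simp: r0 less_imp_neq[THEN not_sym] intro!: lint_cong)
 have "integrable ?\<mu> (%z. ps z / \<rho> z)"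
 using \<rho>(2) ps by (subst integrable_density) (auto simp: r0 less_imp_neq[THEN not_sym])
 have l: "((%n. (LI z. (u n z + M) * ps z) - (LI z. M * ps z)) \<longlongrightarrow> (LI z. w z * ps z) - (LI z. M * ps z)) F"
 using \<open>integrable ?\<mu> (%z. ps z / \<rho> z)\<close>[THEN lim] by (intro tendsto_diff tendsto_const) (simp add: e del: times_divide_eq_right)
 have s: "(LI z. f z * ps z) - (LI z. M * ps z) = (LI z. (f z - M) * ps z)"
 if [measurable]: "f \<in> bm" and f: "!!z. 0 <= f z" "!!z. f z <= 2 * M" for f :: "'a => real"
 proof -
 have "%%f z%% <= 2 * M" for z using f[of z] by simp
 then have "intgr (%z. f z * ps z)" by (intro integrable_bdd_mult[OF ps]) auto
 then show ?thesis using ps by (simp add: left_diff_distrib)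
 qed
 have "(LI z. (u n z + M) * ps z) - (LI z. M * ps z) = (LI z. u n z * ps z)" for n
 using s[of "%z. u n z + M"] ub by simp
 then show "((%n. LI z. u n z * ps z) \<longlongrightarrow> (LI z. (w z - M) * ps z)) F"
 using l s[of w] wb by simp
 qed simp
qed

section \<open>The splitting scheme\<close>

lemma distr_translation_lborel: "distr lborel borel (%x::'a::euclidean_space. x + c) = lborel"
proof -
 have "(%x. x + c) = (+) c" by (simp add: fun_eq_iff add.commute)
 then show ?thesis using lborel_distr_plus[of c] by simp
qed

text \<open>\<open>step k h\<close> is the inverse of a kick by \<open>-h k\<close>, truncated where \<open>h |k| > 1\<close>, followed by a drift by \<open>h y\<close>: both shears
 preserve area, and the truncation keeps supports bounded uniformly in \<open>h\<close>.\<close>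

definition kick :: "(real => real) => real => real => real" where
 "kick k h x = (if %%h * k x%% <= 1 then h * k x else 0)"

definition step_back :: "(real => real) => real => R2 => R2" where
 "step_back k h q = (fst q + h * (snd q - kick k h (fst q)), snd q - kick k h (fst q))"

definition step :: "(real => real) => real => R2 => R2" where
 "step k h q = (fst q - h * snd q, snd q + kick k h (fst q - h * snd q))"

text \<open>Negative indices iterate the inverse map, so that the scheme lives on the whole time
  axis and its weak limit can be mollified in time across t = 0.\<close>

definition iter :: "(real => real) => real => int => R2 => R2" where
 "iter k h m = (if m >= 0 then step k h ^^ nat m else step_back k h ^^ nat (- m))"

text \<open>The datum is transported, never averaged; hence the scheme commutes with every function
  applied to the datum, such as squares, \<open>arctan\<close> and renormalizations.\<close>

definition scheme :: "(real => real) => real => (R2 => real) => R3 => real" where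
 "scheme k h a z = a (iter k h \<lfloor>fst z / h\<rfloor> (snd z))"

lemma kick_bound: "%%kick k h x%% <= 1" "%%kick k h x%% <= %%h * k x%%"
 by (auto simp: kick_def)

lemma step_inverse: "step k h (step_back k h q) = q" "step_back k h (step k h q) = q"
 by (simp_all add: step_def step_back_def)

lemma iter_Suc: "iter k h (m + 1) q = iter k h m (step k h q)"
proof (cases "m >= 0")
 case True
 then have "nat (m + 1) = Suc (nat m)" by simp
 then show ?thesis using True by (simp add: iter_def funpow_Suc_right del: funpow.simps)
next
 case False
 then have e: "nat (- m) = Suc (nat (- (m + 1)))" by simp
 have "iter k h m (step k h q) = (step_back k h ^^ nat (- (m + 1))) q"
 using False unfolding iter_def e by (simp add: funpow_Suc_right step_inverse del: funpow.simps)
 also have "... = iter k h (m + 1) q" using False by (cases "m = - 1") (auto simp: iter_def)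
 finally show ?thesis ..
qed

lemma scheme_shift:
 assumes "h > 0"
 shows "scheme k h a (t + h, q) = scheme k h a (t, step k h q)"
proof -
 have "\<lfloor>(t + h) / h\<rfloor> = \<lfloor>t / h\<rfloor> + 1" using assms by (simp add: add_divide_distrib)
 then show ?thesis by (simp add: scheme_def iter_Suc)
qed

lemma scheme_initial: "0 <= t ==> t < h ==> scheme k h a (t, q) = a q"
 by (simp add: scheme_def iter_def floor_eq_iff[THEN iffD2])

context
 fixes k :: "real => real" assumes km[measurable]: "k \<in> bm"
begin

lemma kick_measurable [measurable]: "kick k h \<in> bm"
 unfolding kick_def[abs_def] by measurable

lemma step_measurable [measurable]: "step k h \<in> borel \<rightarrow>\<^sub>M borel" "step_back k h \<in> borel \<rightarrow>\<^sub>M borel"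
 unfolding step_def[abs_def] step_back_def[abs_def] by measurable

text \<open>Kick and drift are shears along the two axes; the coordinate swaps bring the drift into
  the form required by \<open>distr_fiberwise\<close>.\<close>

lemma step_back_preserving: "distr lborel borel (step_back k h) = lborel"
proof -
 let ?sw = "%p::R2. (snd p, fst p)"
 have K: "distr lborel borel (%p. (fst p, snd p - kick k h (fst p))) = (lborel :: (R2) measure)"
 using distr_fiberwise[of "%x y. y - kick k h x"] distr_translation_lborel[of "- kick k h _ :: real"] by simp
 have D: "distr lborel borel (%p. (fst p, snd p + h * fst p)) = (lborel :: (R2) measure)"
 using distr_fiberwise[of "%y x. x + h * y"] distr_translation_lborel[of "h * _ :: real"] by simp
 have e: "step_back k h = ?sw \<circ> (%p. (fst p, snd p + h * fst p)) \<circ> ?sw \<circ> (%p. (fst p, snd p - kick k h (fst p)))"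
 by (simp add: step_back_def fun_eq_iff)
 have "distr lborel borel (step_back k h) = distr (distr (distr (distr lborel borel (%p. (fst p, snd p - kick k h (fst p)))) borel ?sw) borel (%p. (fst p, snd p + h * fst p))) borel ?sw"
 unfolding e by (simp add: distr_distr comp_assoc)
 also have "... = lborel" unfolding K distr_swap_lborel D ..
 finally show ?thesis .
qed

lemma step_preserving: "distr lborel borel (step k h) = lborel"
proof -
 have "distr lborel borel (step k h) = distr (distr lborel borel (step_back k h)) borel (step k h)"
 by (simp add: step_back_preserving)
 also have "... = distr lborel borel (%q. q)" by (simp add: distr_distr comp_def step_inverse)
 finally show ?thesis by (simp add: distr_id2)
qed

lemma iter_preserving: "iter k h m \<in> borel \<rightarrow>\<^sub>M borel" "distr lborel borel (iter k h m) = lborel"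
proof -
 have "(f ^^ n) \<in> borel \<rightarrow>\<^sub>M borel & distr lborel borel (f ^^ n) = lborel"
 if [measurable]: "f \<in> borel \<rightarrow>\<^sub>M borel" and f: "distr lborel borel f = lborel" for f :: "R2 => R2" and n
 proof (induction n)
 case (Suc n)
 then have [measurable]: "(f ^^ n) \<in> borel \<rightarrow>\<^sub>M borel" by simp
 have "distr lborel borel (f \<circ> f ^^ n) = distr (distr lborel borel (f ^^ n)) borel f" by (simp add: distr_distr)
 moreover have "f \<circ> f ^^ n \<in> borel \<rightarrow>\<^sub>M borel" by (rule measurable_comp) measurable
 ultimately show ?case unfolding funpow.simps using Suc f by metis
 qed (simp add: distr_id2 id_def)
 then show "iter k h m \<in> borel \<rightarrow>\<^sub>M borel" "distr lborel borel (iter k h m) = lborel"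
 unfolding iter_def using step_preserving step_back_preserving by simp_all
qed

lemma scheme_measurable [measurable]:
 assumes [measurable]: "a \<in> bm"
 shows "scheme k h a \<in> bm"
proof -
 note [measurable] = iter_preserving(1)
 show ?thesis unfolding scheme_def[abs_def]
 by (rule measurable_compose_countable[of "%m z. a (iter k h m (snd z))"]) measurable
qed

abbreviation (input) shift :: "real => R3 => R3" where
 "shift h z \<equiv> (fst z + h, step_back k h (snd z))"

lemma shift_preserving: "distr lborel borel (shift h) = lborel"
proof -
 let ?sw = "%p::(R2)\<times>real. (snd p, fst p)" and ?sw' = "%p::real\<times>(R2). (snd p, fst p)"
 have K: "distr lborel borel (%p. (fst p, step_back k h (snd p))) = (lborel :: (R3) measure)"
 using distr_fiberwise[of "%x. step_back k h"] step_back_preserving by simp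
 have D: "distr lborel borel (%p. (fst p, snd p + h)) = (lborel :: ((R2)\<times>real) measure)"
 using distr_fiberwise[of "%y x. x + h"] distr_translation_lborel[of "h :: real"] by simp
 have e: "shift h = ?sw \<circ> (%p. (fst p, snd p + h)) \<circ> ?sw' \<circ> (%p. (fst p, step_back k h (snd p)))"
 by (simp add: fun_eq_iff)
 have "distr lborel borel (shift h) = distr (distr (distr (distr lborel borel (%p. (fst p, step_back k h (snd p)))) borel ?sw') borel (%p. (fst p, snd p + h))) borel ?sw"
 unfolding e by (simp add: distr_distr comp_assoc)
 also have "... = lborel" unfolding K distr_swap_lborel D ..
 finally show ?thesis .
qed

text \<open>Discrete integration by parts: \<open>shift h\<close> preserves space-time volume and
  the scheme is constant along it, so the difference moves from \<open>ph\<close> to the domain of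
  integration. For S = {0..} the two domains differ by the slab 0 <= t < h, on which the scheme
  still equals the datum.\<close>

lemma scheme_identity:
 assumes h: "h > 0" and a[measurable]: "a \<in> bm" and ab: "!!q. %%a q%% <= M"
 and ph: "intgr ph" and S: "S = UNIV | S = {0..}"
 shows "(LI z. (indicator S (fst z) * scheme k h a z) * ((ph (shift h z) - ph z) / h))
 = - (1 / h) * (if S = UNIV then 0 else LI z. (indicator {0..<h} (fst z) * a (snd z)) * ph z)"
proof -
 have [measurable]: "S \<in> sets borel" using S by auto
 have [measurable]: "ph \<in> bm" using ph by auto
 have phs: "intgr (%z. ph (shift h z))"
 proof -
 have "integrable (distr lborel borel (shift h)) ph" unfolding shift_preserving by (rule ph)
 then show ?thesis by (subst (asm) integrable_distr_eq) auto
 qed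
 have i: "intgr (%z. (indicator A (fst z) * scheme k h a z) * ps z)"
 if "intgr ps" and [measurable]: "A \<in> sets borel" for A :: "real set" and ps
 proof (rule integrable_bdd_mult[OF that(1)])
 show "(%z. indicator A (fst z) * scheme k h a z) \<in> borel_measurable lborel" by measurable
 show "%%indicator A (fst z) * scheme k h a z%% <= M" for z
 using ab order_trans[OF abs_ge_zero ab] by (cases "fst z \<in> A") (simp_all add: scheme_def)
 qed
 have us: "scheme k h a (shift h z) = scheme k h a z" for z
 using scheme_shift[OF h, of k a "fst z" "step_back k h (snd z)"] by (simp add: step_inverse)
 have "(LI z. (indicator S (fst z) * scheme k h a z) * ph (shift h z))
 = (LI z. (indicator S (fst (shift h z) - h) * scheme k h a (shift h z)) * ph (shift h z))"
 unfolding us by simp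
 also have "... = (LINT z|distr lborel borel (shift h). (indicator S (fst z - h) * scheme k h a z) * ph z)"
 by (rule integral_distr[symmetric]) auto
 also have "... = (LI z. (indicator ((%t. t - h) -` S) (fst z) * scheme k h a z) * ph z)"
 unfolding shift_preserving by (simp add: indicator_def)
 finally have e: "(LI z. (indicator S (fst z) * scheme k h a z) * ph (shift h z))
 = (LI z. (indicator ((%t. t - h) -` S) (fst z) * scheme k h a z) * ph z)" .
 have [measurable]: "(%t. t - h) -` S \<in> sets borel" by (rule measurable_sets_borel[of _ borel]) auto
 have "(LI z. (indicator S (fst z) * scheme k h a z) * ((ph (shift h z) - ph z) / h))
 = (LI z. (1 / h) * ((indicator S (fst z) * scheme k h a z) * ph (shift h z) - (indicator S (fst z) * scheme k h a z) * ph z))"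
 by (intro lint_cong refl) (simp add: algebra_simps diff_divide_distrib)
 also have "... = (1 / h) * ((LI z. (indicator S (fst z) * scheme k h a z) * ph (shift h z)) - (LI z. (indicator S (fst z) * scheme k h a z) * ph z))"
 unfolding integral_mult_right_zero by (subst Bochner_Integration.integral_diff[OF i[OF phs] i[OF ph]]) simp_all
 also have "... = (1 / h) * (LI z. (indicator ((%t. t - h) -` S) (fst z) * scheme k h a z) * ph z - (indicator S (fst z) * scheme k h a z) * ph z)"
 unfolding e by (subst Bochner_Integration.integral_diff[OF i[OF ph] i[OF ph]]) simp_all
 also have "(LI z. (indicator ((%t. t - h) -` S) (fst z) * scheme k h a z) * ph z - (indicator S (fst z) * scheme k h a z) * ph z)
 = (LI z. (if S = UNIV then 0 else - ((indicator {0..<h} (fst z) * a (snd z)) * ph z)))"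
 proof (intro lint_cong refl)
 fix z :: "R3"
 show "(indicator ((%t. t - h) -` S) (fst z) * scheme k h a z) * ph z - (indicator S (fst z) * scheme k h a z) * ph z
 = (if S = UNIV then 0 else - ((indicator {0..<h} (fst z) * a (snd z)) * ph z))"
 using S scheme_initial[of "fst z" h k a "snd z"] h by (auto simp: indicator_def)
 qed
 finally show ?thesis by (cases "S = UNIV") simp_all
qed

end

section \<open>Consistency and convergence of the scheme\<close>

lemma has_partials_lipschitz:
 assumes P: "has_partials P Pt Px Py" and C: "!!z. %%Pt z%% <= C" "!!z. %%Px z%% <= C" "!!z. %%Py z%% <= C"
 shows "%%P z - P z'%% <= 3 * C * (%%fst z - fst z'%% + %%px z - fst (snd z')%% + %%py z - snd (snd z')%%)"
proof -
 have C0: "C >= 0" using order_trans[OF abs_ge_zero C(1)] .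
 have "norm (P z - P z') <= (3 * C) * norm (z - z')"
 proof (rule differentiable_bound[OF convex_UNIV])
 show "(P has_derivative (%v. fst v * Pt x + px v * Px x + py v * Py x)) (at x within UNIV)" for x
 using has_partialsD[OF P] by simp
 show "onorm (%v. fst v * Pt x + px v * Px x + py v * Py x) <= 3 * C" for x
 proof (rule onorm_le)
 fix v :: "R3"
 have n: "%%fst v%% <= norm v" "%%px v%% <= norm v" "%%py v%% <= norm v"
 using norm_fst_le[of "fst v" "snd v"] norm_snd_le[of "snd v" "fst v"] norm_fst_le[of "px v" "py v"] norm_snd_le[of "py v" "px v"]
 by auto
 have "%%fst v * Pt x%% <= norm v * C" "%%px v * Px x%% <= norm v * C" "%%py v * Py x%% <= norm v * C"
 unfolding abs_mult by (intro mult_mono n C; simp)+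
 then show "norm (fst v * Pt x + px v * Px x + py v * Py x) <= 3 * C * norm v" by (simp add: algebra_simps)
 qed
 qed auto
 also have "... <= 3 * C * (%%fst z - fst z'%% + %%px z - fst (snd z')%% + %%py z - snd (snd z')%%)"
 proof (rule mult_left_mono)
 have "norm (z - z') <= norm (fst (z - z')) + norm (snd (z - z'))" using norm_Pair_le[of "fst (z - z')" "snd (z - z')"] unfolding prod.collapse .
 moreover have "norm (snd (z - z')) <= norm (fst (snd (z - z'))) + norm (snd (snd (z - z')))" using norm_Pair_le[of "fst (snd (z - z'))" "snd (snd (z - z'))"] unfolding prod.collapse .
 ultimately show "norm (z - z') <= %%fst z - fst z'%% + %%px z - fst (snd z')%% + %%py z - snd (snd z')%%" by simp
 qed (use C0 in simp)
 finally show ?thesis by simp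
qed

lemma test_function_bounds:
 assumes t: "test_function ph" and P: "has_partials ph pht phx phy"
 obtains R C where "R >= 1" "C >= 0" "!!z. ~ in_box R z ==> ph z = 0 & pht z = 0 & phx z = 0 & phy z = 0"
 "!!z. %%ph z%% <= C" "!!z. %%pht z%% <= C" "!!z. %%phx z%% <= C" "!!z. %%phy z%% <= C"
 "continuous_on UNIV ph" "continuous_on UNIV pht" "continuous_on UNIV phx" "continuous_on UNIV phy"
proof -
 have sm: "smooth ph" using t by (simp add: test_function_def smooth_def)
 obtain At Ax Ay where A: "has_partials ph At Ax Ay" "smooth At" "smooth Ax" "smooth Ay" using smooth_has_partials[OF sm] by metis
 note u = has_partials_unique[OF P A(1)]
 have c: "continuous_on UNIV ph" "continuous_on UNIV pht" "continuous_on UNIV phx" "continuous_on UNIV phy"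
 using sm A(2-) by (simp_all add: u smooth_continuous)
 have K: "compact (closure {z. ph z ~= 0})" using t by (simp add: test_function_def)
 obtain B where B: "!!z. z \<in> closure {z. ph z ~= 0} ==> norm z <= B" using compact_imp_bounded[OF K] unfolding bounded_iff by blast
 define R where "R = max 1 B"
 have out: "ph z = 0 & pht z = 0 & phx z = 0 & phy z = 0" if z: "z \<notin> closure {z. ph z ~= 0}" for z
 proof -
 have d0: "(ph has_derivative (%v. 0)) (at z)"
 proof (rule has_derivative_transform_within_open[OF has_derivative_const[of 0]])
 show "open (- closure {z. ph z ~= 0})" by auto
 show "0 = ph x" if "x \<in> - closure {z. ph z ~= 0}" for x
 using subsetD[OF closure_subset, of x "{z. ph z ~= 0}"] that by force
 qed (use z in auto)
 have e: "fst v * pht z + px v * phx z + py v * phy z = 0" for v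
 using fun_cong[OF has_derivative_unique[OF has_partialsD[OF P] d0], of v] .
 show ?thesis using e[of "(1,0,0)"] e[of "(0,1,0)"] e[of "(0,0,1)"] subsetD[OF closure_subset, of z "{z. ph z ~= 0}"] z by force
 qed
 have vb: "~ in_box R z ==> z \<notin> closure {z. ph z ~= 0}" for z
 proof
 assume "z \<in> closure {z. ph z ~= 0}" and n: "~ in_box R z"
 then have "norm z <= R" using B[of z] by (simp add: R_def)
 then have "in_box R z"
 using norm_fst_le[of "fst z" "snd z"] norm_snd_le[of "snd z" "fst z"] norm_fst_le[of "px z" "py z"] norm_snd_le[of "py z" "px z"]
 by (auto simp: in_box_def)
 then show False using n by simp
 qed
 have bd: "\<exists>C. \<forall>z. %%f z%% <= C" if cf: "continuous_on UNIV f" and z: "!!z. z \<notin> closure {z. ph z ~= 0} ==> f z = 0" for f :: "R3 => real"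
 proof -
 have "bounded (f ` closure {z. ph z ~= 0})" by (intro compact_imp_bounded compact_continuous_image continuous_on_subset[OF cf] K) auto
 then obtain C where C: "!!z. z \<in> closure {z. ph z ~= 0} ==> %%f z%% <= C" unfolding bounded_iff by fastforce
 have "%%f z%% <= max C 0" for z using C[of z] z[of z] by (cases "z \<in> closure {z. ph z ~= 0}") auto
 then show ?thesis by blast
 qed
 have "\<exists>C. \<forall>z. %%ph z%% <= C" "\<exists>C. \<forall>z. %%pht z%% <= C" "\<exists>C. \<forall>z. %%phx z%% <= C" "\<exists>C. \<forall>z. %%phy z%% <= C"
 by (intro bd c; use out in blast)+
 then obtain C1 C2 C3 C4 where C: "\<forall>z. %%ph z%% <= C1" "\<forall>z. %%pht z%% <= C2" "\<forall>z. %%phx z%% <= C3" "\<forall>z. %%phy z%% <= C4"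
 by blast
 let ?C = "max 0 (max (max C1 C2) (max C3 C4))"
 have o: "ph z = 0 & pht z = 0 & phx z = 0 & phy z = 0" if "~ in_box R z" for z by (rule out[OF vb[OF that]])
 have b: "%%ph z%% <= ?C" "%%pht z%% <= ?C" "%%phx z%% <= ?C" "%%phy z%% <= ?C" for z
 using C[THEN spec, of z] by (simp_all add: le_max_iff_disj)
 show thesis by (rule that[OF _ _ o b c]) (simp_all add: R_def)
qed

context potential begin

lemma km': "k \<in> bm" using k by (simp add: locint_def)

text \<open>At fixed x the truncation in \<open>kick\<close> is inactive once h |k x| < 1; the
  shifted point is then a differentiable curve in h through z with velocity (1, y, -k x).\<close>

lemma difference_quotient_limit:
 assumes P: "has_partials ph pht phx phy" and h: "h ----> 0" "!!n. h n > 0"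
 shows "(%n. (ph (fst z + h n, step_back k (h n) (snd z)) - ph z) / h n) ----> pht z + py z * phx z - k (px z) * phy z"
proof -
 obtain t x y where z: "z = (t, x, y)" by (cases z)
 let ?c = "%s. (t + s, x + s * (y - s * k x), y - s * k x)"
 have c: "(?c has_derivative (%s. (s, s * y, - s * k x))) (at 0)"
 by (auto intro!: derivative_eq_intros)
 have p: "(ph has_derivative (%v. fst v * pht z + px v * phx z + py v * phy z)) (at (?c 0))"
 using has_partialsD[OF P, of z] by (simp add: z)
 have "((%s. ph (?c s)) has_real_derivative pht z + y * phx z - k x * phy z) (at 0)"
 unfolding has_field_derivative_def
 by (rule has_derivative_eq_rhs[OF has_derivative_compose[OF c p]]) (simp add: fun_eq_iff algebra_simps)
 then have "((%s. (ph (?c s) - ph z) / s) \<longlongrightarrow> pht z + y * phx z - k x * phy z) (at 0)"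
 by (simp add: DERIV_def z)
 moreover have "filterlim h (at 0) sequentially"
 unfolding filterlim_at using h by (auto intro!: always_eventually simp: less_imp_neq[THEN not_sym])
 ultimately have l: "(%n. (ph (?c (h n)) - ph z) / h n) ----> pht z + y * phx z - k x * phy z"
 by (rule filterlim_compose)
 have "(%n. %%h n * k x%%) ----> %%0 * k x%%" by (intro tendsto_intros h)
 then have "\<forall>\<^sub>F n in sequentially. %%h n * k x%% < 1" by (intro order_tendstoD(2)) auto
 then have "\<forall>\<^sub>F n in sequentially. (ph (?c (h n)) - ph z) / h n = (ph (fst z + h n, step_back k (h n) (snd z)) - ph z) / h n"
 by eventually_elim (simp add: step_back_def kick_def z)
 then have "(%n. (ph (fst z + h n, step_back k (h n) (snd z)) - ph z) / h n) ----> pht z + y * phx z - k x * phy z"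
 by (rule Lim_transform_eventually[OF l])
 then show ?thesis by (simp add: z)
qed

text \<open>A truncated kick moves y by at most 1, so the shifted test function is supported in a
  box of half-width 2 R + 1 for every h <= 1, however large k is. On that box |kick| <= h |k x|
  keeps the bound linear in |k|, hence integrable.\<close>

lemma difference_quotient_bound:
 assumes P: "has_partials ph pht phx phy" and C: "!!z. %%pht z%% <= C" "!!z. %%phx z%% <= C" "!!z. %%phy z%% <= C"
 and R: "R >= 1" "!!z. ~ in_box R z ==> ph z = 0" and h: "0 < h" "h <= 1"
 and Q: "Q = 2 * R + 1"
 shows "%%(ph (fst z + h, step_back k h (snd z)) - ph z) / h%%
 <= ivl Q (fst z) * (ivl Q (px z) * (3 * C * (2 * R + 3 + %%k (px z)%%)) * ivl Q (py z))"
proof -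
 obtain t x y where z: "z = (t, x, y)" by (cases z)
 have C0: "C >= 0" using order_trans[OF abs_ge_zero C(1)] .
 define y' where "y' = y - kick k h x"
 have sb: "step_back k h (x, y) = (x + h * y', y')" by (simp add: step_back_def y'_def)
 have hy: "%%h * y'%% <= %%y'%%" using h by (simp add: abs_mult mult_left_le_one_le)
 have kb: "%%kick k h x%% <= 1" "%%kick k h x%% <= h * %%k x%%" using kick_bound[of k h x] h by (auto simp: abs_mult)
 show ?thesis
 proof (cases "in_box Q z")
 case False
 have "~ in_box R z" using False R(1) Q by (auto simp: in_box_def)
 moreover have "~ in_box R (t + h, x + h * y', y')"
 proof
 assume "in_box R (t + h, x + h * y', y')"
 then have b: "%%t + h%% <= R" "%%x + h * y'%% <= R" "%%y'%% <= R" by (auto simp: in_box_def)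
 have "%%t%% <= 2 * R + 1" "%%x%% <= 2 * R + 1" "%%y%% <= 2 * R + 1" using b hy kb(1) h R(1) unfolding y'_def by linarith+
 then show False using False Q by (simp add: in_box_def z)
 qed
 ultimately have "ph (fst z + h, step_back k h (snd z)) = 0" "ph z = 0" using R(2) by (auto simp: z sb)
 then show ?thesis using C0 R(1) by simp
 next
 case True
 then have i: "ivl Q t = 1" "ivl Q x = 1" "ivl Q y = 1" and y: "%%y%% <= 2 * R + 1"
 unfolding Q[symmetric] by (auto simp: in_box_def z indicator_def abs_le_iff)
 have "%%ph (t + h, x + h * y', y') - ph (t, x, y)%% <= 3 * C * (%%h%% + %%h * y'%% + %%y' - y%%)"
 using has_partials_lipschitz[OF P C, of "(t + h, x + h * y', y')" "(t, x, y)"] by simp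
 also have "... <= 3 * C * (h * (2 * R + 3 + %%k x%%))"
 proof (rule mult_left_mono)
 \<comment> \<open>In the box |y| <= 2 R + 1, and the kick adds at most 1. With the displacement h
   in time this produces 2 R + 3.\<close>
 have "h * %%y'%% <= h * (2 * R + 2)" using y kb(1) h(1) by (intro mult_left_mono) (auto simp: y'_def)
 moreover have "%%h * y'%% = h * %%y'%%" "%%y' - y%% <= h * %%k x%%" "%%h%% = h"
 using kb(2) h by (simp_all add: abs_mult y'_def)
 moreover have "h * (2 * R + 3 + %%k x%%) = h + h * (2 * R + 2) + h * %%k x%%" by (simp add: algebra_simps)
 ultimately show "%%h%% + %%h * y'%% + %%y' - y%% <= h * (2 * R + 3 + %%k x%%)" by linarith
 qed (use C0 in simp)
 finally have "%%ph (t + h, x + h * y', y') - ph (t, x, y)%% <= (3 * C * (2 * R + 3 + %%k x%%)) * h" by (simp add: algebra_simps)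
 then have "%%ph (t + h, x + h * y', y') - ph (t, x, y)%% / h <= 3 * C * (2 * R + 3 + %%k x%%)" using h(1) by (simp add: divide_le_eq)
 then show ?thesis using h(1) by (simp add: z sb i)
 qed
qed

text \<open>With \<open>S = UNIV\<close> this gives a solution on the whole of space-time, with \<open>S = {0..}\<close> the Cauchy problem.\<close>

lemma scheme_limit:
 assumes a[measurable]: "a \<in> bm" and ab: "!!q. %%a q%% <= M"
 and h: "h ----> 0" "!!n. 0 < h n" "!!n. h n <= 1"
 and F: "F <= sequentially" "F ~= bot" and S: "S = UNIV | S = {0..}"
 and lim: "!!ps. intgr ps ==> ((%n. LI z. (indicator S (fst z) * scheme k (h n) a z) * ps z) \<longlongrightarrow> (LI z. (indicator S (fst z) * v z) * ps z)) F"
 shows "weak_sol k (%q. if S = UNIV then 0 else a q) (%z. indicator S (fst z) * v z)"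
 unfolding weak_sol_def
proof (intro allI impI)
 fix ph pht phx phy assume t: "test_function ph" and P: "has_partials ph pht phx phy"
 note [measurable] = km' step_measurable[OF km'] scheme_measurable[OF km']
 have M0: "M >= 0" using order_trans[OF abs_ge_zero ab] .
 have [measurable]: "S \<in> sets borel" using S by auto
 obtain R C where R: "R >= 1" "!!z. ~ in_box R z ==> ph z = 0 & pht z = 0 & phx z = 0 & phy z = 0" and C0: "C >= 0"
 and C: "!!z. %%ph z%% <= C" "!!z. %%pht z%% <= C" "!!z. %%phx z%% <= C" "!!z. %%phy z%% <= C"
 and c: "continuous_on UNIV ph" "continuous_on UNIV pht" "continuous_on UNIV phx" "continuous_on UNIV phy"
 using test_function_bounds[OF t P] by metis
 have Rz: "~ in_box R z ==> ph z = 0" for z using R(2) by blast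
 have [measurable]: "ph \<in> bm" "pht \<in> bm" "phx \<in> bm" "phy \<in> bm"
 using c by (simp_all add: bm_cont)
 have phi: "intgr ph" by (rule integrable_box3[OF _ C(1), where R=R]) (use Rz in auto)
 define D where "D z = pht z + py z * phx z - k (px z) * phy z" for z
 define Dn where "Dn n z = (ph (fst z + h n, step_back k (h n) (snd z)) - ph z) / h n" for n z
 define Q where "Q = 2 * R + 1"
 define W where "W z = ivl Q (fst z) * (ivl Q (px z) * (3 * C * (2 * R + 3 + %%k (px z)%%)) * ivl Q (py z))" for z :: "R3"
 have [measurable]: "D \<in> bm" "Dn n \<in> bm" for n unfolding D_def[abs_def] Dn_def[abs_def] by measurable
 have Wi: "intgr W"
 unfolding W_def[abs_def]
 proof (rule integrable_kernel_box)
 have "intgr (%x. ivl Q x * k x)" using k by (simp add: locint_def)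
 from integrable_mult_right[OF lint_add[OF integrable_mult_right[OF integrable_ivl[of Q], of "2 * R + 3"] integrable_abs[OF this]], of "3 * C"]
 show "intgr (%x. ivl Q x * (3 * C * (2 * R + 3 + %%k x%%)))" by (simp add: abs_mult algebra_simps)
 qed
 have DnW: "%%Dn n z%% <= W z" for n z
 unfolding Dn_def W_def by (rule difference_quotient_bound[OF P C(2-4) R(1) Rz h(2,3) Q_def])
 have Dlim: "(%n. Dn n z) ----> D z" for z
 unfolding Dn_def D_def by (rule difference_quotient_limit[OF P h(1,2)])
 have DW: "%%D z%% <= W z" for z
 by (rule LIMSEQ_le_const2[OF tendsto_rabs[OF Dlim]]) (use DnW in auto)
 have Di: "intgr D" by (rule lint_bound[OF Wi]) (use DW in \<open>auto intro!: AE_I2 intro: order_trans[OF _ abs_ge_self]\<close>)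
 have Dni: "intgr (Dn n)" for n by (rule lint_bound[OF Wi]) (use DnW in \<open>auto intro!: AE_I2 intro: order_trans[OF _ abs_ge_self]\<close>)
 let ?u = "%n z. indicator S (fst z) * scheme k (h n) a z"
 have um: "?u n \<in> borel_measurable lborel" for n by measurable
 have ub: "%%?u n z%% <= M" for n z using ab M0 by (cases "fst z \<in> S") (simp_all add: scheme_def)
 note ui = integrable_bdd_mult[OF _ um ub]
 have "(%n. LI z. %%Dn n z - D z%%) ----> (LINT z|(lborel :: (R3) measure). 0)"
 proof (rule dct[where w="%z. 2 * W z"])
 show "AE z in lborel. (%n. %%Dn n z - D z%%) ----> 0"
 using tendsto_rabs[OF tendsto_diff[OF Dlim tendsto_const]] by (intro AE_I2) (metis abs_zero cancel_comm_monoid_add_class.diff_cancel)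
 show "AE z in lborel. norm %%Dn n z - D z%% <= 2 * W z" for n
 proof (rule AE_I2)
 fix z show "norm %%Dn n z - D z%% <= 2 * W z" using DnW[of n z] DW[of z] by simp
 qed
 qed (use Wi in auto)
 then have l1: "(%n. M * (LI z. %%Dn n z - D z%%)) ----> 0" using tendsto_mult[OF tendsto_const[of M]] by fastforce
 have est: "%%(LI z. ?u n z * Dn n z) - (LI z. ?u n z * D z)%% <= M * (LI z. %%Dn n z - D z%%)" for n
 proof -
 have "(LI z. ?u n z * Dn n z) - (LI z. ?u n z * D z) = (LI z. ?u n z * (Dn n z - D z))"
 unfolding right_diff_distrib by (rule Bochner_Integration.integral_diff[OF ui[OF Dni] ui[OF Di], symmetric])
 also have "%%...%% <= (LI z. %%?u n z * (Dn n z - D z)%%)" by (rule integral_abs_bound)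
 also have "... <= (LI z. M * %%Dn n z - D z%%)"
 proof (rule integral_mono)
 have d: "intgr (%z. Dn n z - D z)" using Dni Di by simp
 show "intgr (%z. %%?u n z * (Dn n z - D z)%%)" by (rule integrable_abs[OF ui[OF d]])
 show "intgr (%z. M * %%Dn n z - D z%%)" by (intro integrable_mult_right integrable_abs d)
 show "%%?u n z * (Dn n z - D z)%% <= M * %%Dn n z - D z%%" for z
 unfolding abs_mult[of "?u n z"] by (intro mult_right_mono ub) simp
 qed
 finally show ?thesis by simp
 qed
 \<comment> \<open>\<open>Dn\<close> converges in L^1 along all n, the scheme only weakly and along
   \<open>F\<close>; the uniform bound \<open>M\<close> on the scheme allows the two limits to be
   combined.\<close>
 have "(%n. (LI z. ?u n z * Dn n z) - (LI z. ?u n z * D z)) ----> 0"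
 by (rule Lim_null_comparison[OF _ l1]) (use est in simp)
 from tendsto_add[OF tendsto_mono[OF F(1) this] lim[OF Di]]
 have L: "((%n. LI z. ?u n z * Dn n z) \<longlongrightarrow> (LI z. (indicator S (fst z) * v z) * D z)) F" by simp
 have id: "(LI z. ?u n z * Dn n z) = - (1 / h n) * (if S = UNIV then 0 else LI z. (indicator {0..<h n} (fst z) * a (snd z)) * ph z)" for n
 unfolding Dn_def by (rule scheme_identity[OF km' h(2) a ab phi S])
 \<comment> \<open>The initial term is the mean of \<open>G\<close> over [0, h n); a Lipschitz bound
   in time makes it converge to \<open>G 0\<close>.\<close>
 define G where "G s = (LI q. a q * ph (s, q))" for s
 have "%%G s - G 0%% <= (M * (3 * C) * (LI q. ivl R (fst q) * ivl R (snd q))) * %%s%%" for s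
 proof -
 let ?b = "%q::R2. ivl R (fst q) * ivl R (snd q)"
 have bi: "intgr ?b" by (rule integrable_lborel_prod_mult[OF integrable_ivl integrable_ivl])
 have aphi: "intgr (%q. a q * ph (s, q))" for s
 proof (rule lint_bound[OF integrable_mult_right[OF bi, of "M * C"]])
 show "AE q in lborel. norm (a q * ph (s, q)) <= norm (M * C * ?b q)"
 proof (rule AE_I2)
 fix q
 show "norm (a q * ph (s, q)) <= norm (M * C * ?b q)"
 proof (cases "in_box R (s, q)")
 case True
 then have "?b q = 1" by (auto simp: in_box_def indicator_def abs_le_iff)
 moreover have "%%a q%% * %%ph (s, q)%% <= M * C" by (intro mult_mono ab C) (use M0 in auto)
 ultimately show ?thesis using M0 C0 by (simp add: abs_mult)
 qed (simp add: Rz)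
 qed
 qed measurable
 have "G s - G 0 = (LI q. a q * ph (s, q) - a q * ph (0, q))" unfolding G_def by (rule Bochner_Integration.integral_diff[OF aphi aphi, symmetric])
 also have "%%...%% <= (LI q. %%a q * ph (s, q) - a q * ph (0, q)%%)" by (rule integral_abs_bound)
 also have "... <= (LI q. (M * (3 * C * %%s%%)) * ?b q)"
 proof (rule integral_mono)
 show "intgr (%q. %%a q * ph (s, q) - a q * ph (0, q)%%)" by (intro integrable_abs lint_diff aphi)
 show "intgr (%q. (M * (3 * C * %%s%%)) * ?b q)" by (intro integrable_mult_right bi)
 fix q
 show "%%a q * ph (s, q) - a q * ph (0, q)%% <= (M * (3 * C * %%s%%)) * ?b q"
 proof (cases "in_box R (s, q) | in_box R (0, q)")
 case True
 then have b: "?b q = 1" by (auto simp: in_box_def indicator_def abs_le_iff)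
 have "%%ph (s, q) - ph (0, q)%% <= 3 * C * %%s%%" using has_partials_lipschitz[OF P C(2-4), of "(s, q)" "(0, q)"] by simp
 then have "%%a q%% * %%ph (s, q) - ph (0, q)%% <= M * (3 * C * %%s%%)" by (intro mult_mono ab) (use M0 in auto)
 then show ?thesis by (simp add: b abs_mult flip: right_diff_distrib)
 next
 case False
 then have "ph (s, q) = 0" "ph (0, q) = 0" using Rz by blast+
 then show ?thesis using M0 C0 by simp
 qed
 qed
 finally show ?thesis by (simp add: mult_ac)
 qed
 then obtain B where GB: "!!s. %%G s - G 0%% <= B * %%s%%" by blast
 have B0: "B >= 0" using order_trans[OF abs_ge_zero GB[of 1]] by simp
 have "(%(s, q). a q * ph (s, q)) \<in> borel_measurable ((lborel :: real measure) \<Otimes>\<^sub>M lborel)" unfolding lborel_prod split_def by measurable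
 then have [measurable]: "G \<in> bm" unfolding G_def[abs_def] using lborel.borel_measurable_lebesgue_integral by fastforce
 have RHS: "(%n. (1 / h n) * (LI z. (indicator {0..<h n} (fst z) * a (snd z)) * ph z)) ----> G 0"
 proof -
 have "%%(1 / h n) * (LI z. (indicator {0..<h n} (fst z) * a (snd z)) * ph z) - G 0%% <= B * h n" for n
 proof -
 have hi: "intgr (indicator {0..<h n} :: real => real)" "(LI s. indicator {0..<h n} s) = h n"
 using h(2)[of n] by (simp_all add: integrable_indicator_iff)
 have "intgr (%z. (indicator {0..<h n} (fst z) * a (snd z)) * ph z)"
 by (rule integrable_bdd_mult[OF phi, of _ M]) (use ab M0 in \<open>auto simp: indicator_def\<close>)
 then have "(LI z. (indicator {0..<h n} (fst z) * a (snd z)) * ph z) = (LI s. indicator {0..<h n} s * G s)"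
 by (subst lborel_integral_snd3(2)) (simp_all add: G_def mult.assoc)
 also have "... - h n * G 0 = (LI s. indicator {0..<h n} s * (G s - G 0))"
 proof -
 have "%%G s%% <= B * h n + %%G 0%%" if "0 <= s" "s <= h n" for s
 proof -
 have "B * %%s%% <= B * h n" using that B0 by (intro mult_left_mono) auto
 then show ?thesis using GB[of s] by linarith
 qed
 then have "intgr (%s. indicator {0..<h n} s * G s)"
 by (intro lint_bound[OF integrable_mult_left[OF hi(1), of "B * h n + %%G 0%%"]] AE_I2)
 (auto simp: indicator_def intro: order_trans[OF _ abs_ge_self])
 then show ?thesis using hi by (simp add: right_diff_distrib)
 qed
 also have "%%...%% <= (LI s. %%indicator {0..<h n} s * (G s - G 0)%%)" by (rule integral_abs_bound)
 also have "... <= (LI s. indicator {0..<h n} s * (B * h n))"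
 proof (rule integral_mono')
 fix s
 have "%%G s - G 0%% <= B * h n" if "0 <= s" "s < h n" using GB[of s] mult_left_mono[of s "h n" B] that B0 by simp
 then show "%%indicator {0..<h n} s * (G s - G 0)%% <= indicator {0..<h n} s * (B * h n)" by (auto simp: indicator_def)
 show "0 <= indicator {0..<h n} s * (B * h n)" using B0 h(2)[of n] by simp
 qed (use hi in simp)
 also have "... = h n * (B * h n)" using hi(2) by simp
 finally have e: "%%(LI z. (indicator {0..<h n} (fst z) * a (snd z)) * ph z) - h n * G 0%% <= h n * (B * h n)" .
 have "(1 / h n) * X - G 0 = (1 / h n) * (X - h n * G 0)" for X using h(2)[of n] by (simp add: field_simps)
 then show ?thesis using mult_left_mono[OF e, of "1 / h n"] h(2)[of n] by (simp add: abs_mult)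
 qed
 then have "(%n. (1 / h n) * (LI z. (indicator {0..<h n} (fst z) * a (snd z)) * ph z) - G 0) ----> 0"
 by (intro Lim_null_comparison[OF _ tendsto_mult_right_zero[OF h(1), of B]]) simp
 then show ?thesis by (rule LIM_zero_cancel)
 qed
 have "(%n. LI z. ?u n z * Dn n z) ----> - (if S = UNIV then 0 else G 0)"
 unfolding id using tendsto_minus[OF RHS] by (cases "S = UNIV") simp_all
 from tendsto_unique[OF F(2) L tendsto_mono[OF F(1) this]]
 show "(LI z. (indicator S (fst z) * v z) * (pht z + py z * phx z - k (px z) * phy z)) = - (LI q. (if S = UNIV then 0 else a q) * ph (0, q))"
 by (simp add: D_def G_def)
qed

end

section \<open>Initial traces and the sign of the defect\<close>

text \<open>The sign 0 <= et' matters: the derivatives of the cutoffs, which concentrate at t = 0,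
  act as nonnegative weights in the defect estimate.\<close>

definition time_cutoff :: "(real => real) => (real => real) => bool" where
 "time_cutoff et et' \<longleftrightarrow> (\<forall>t. (et has_real_derivative et' t) (at t)) & continuous_on UNIV et' & (\<forall>t\<le>0. et t = 0 & et' t = 0) &
 (\<forall>t. 0 <= et t & et t <= 1 & 0 <= et' t) & (\<exists>K. \<forall>t. %%et' t%% <= K)"

lemma time_cutoffs_exist:
 obtains et et' where "!!n::nat. time_cutoff (et n) (et' n)" "!!t. t > 0 ==> \<forall>\<^sub>F n in sequentially. et n t = 1"
proof -
 obtain vt vt' :: "real => real" and K where vt: "!!x. (vt has_real_derivative vt' x) (at x)" "continuous_on UNIV vt'"
 "!!x. x <= 1 ==> vt x = 0" "!!x. x >= 2 ==> vt x = 1" "!!x. 0 <= vt x & vt x <= 1"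
 "!!x. x \<notin> {1..2} ==> vt' x = 0" "!!x. %%vt' x%% <= K" "!!x. 0 <= vt' x" by (rule step_C1_exists) blast
 show thesis
 proof (rule that)
 fix n :: nat
 let ?N = "real (Suc n)"
 show "time_cutoff (%t. vt (?N * t)) (%t. vt' (?N * t) * ?N)"
 unfolding time_cutoff_def
 proof (intro conjI allI impI exI[of _ "K * ?N"])
 fix t
 have "((%t. ?N * t) has_real_derivative ?N) (at t)" by (auto intro!: derivative_eq_intros)
 from DERIV_chain2[where f=vt and g="%t. ?N * t", OF vt(1) this]
 show "((%t. vt (?N * t)) has_real_derivative vt' (?N * t) * ?N) (at t)" .
 show "%%vt' (?N * t) * ?N%% <= K * ?N" unfolding abs_mult using vt(7)[of "?N * t"] by (intro mult_mono) auto
 next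
 fix t :: real assume "t <= 0"
 then have "?N * t <= 0" by (simp add: mult_nonneg_nonpos)
 then show "vt (?N * t) = 0" "vt' (?N * t) * ?N = 0" using vt(3)[of "?N * t"] vt(6)[of "?N * t"] by auto
 next
 show "continuous_on UNIV (%t. vt' (?N * t) * ?N)" by (intro continuous_intros cont_comp[OF vt(2)]) auto
 qed (use vt(5,8) in simp_all)
 next
 fix t :: real assume t: "t > 0"
 obtain m :: nat where m: "2 / t <= real m" using real_arch_simple by blast
 show "\<forall>\<^sub>F n in sequentially. vt (real (Suc n) * t) = 1"
 using eventually_ge_at_top[of m]
 proof eventually_elim
 case (elim n)
 then have "2 / t <= real (Suc n)" using m by simp
 then show ?case using t by (intro vt(4)) (simp add: divide_le_eq)
 qed
 qed
qed

lemma time_cutoffD: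
 assumes "time_cutoff et et'"
 shows "(et has_real_derivative et' t) (at t)" "continuous_on UNIV et'" "t <= 0 ==> et t = 0" "t <= 0 ==> et' t = 0"
 "0 <= et t" "et t <= 1" "0 <= et' t" "et \<in> bm" "et' \<in> bm" "continuous_on UNIV et"
proof -
 show c: "continuous_on UNIV et" using assms by (intro continuous_at_imp_continuous_on) (auto simp: time_cutoff_def intro: DERIV_isCont)
 then show "et \<in> bm" by (rule bm_cont)
 show "et' \<in> bm" using assms by (intro bm_cont) (simp add: time_cutoff_def)
qed (use assms in \<open>simp_all add: time_cutoff_def\<close>)

lemma time_cutoff_limit:
 assumes c: "!!n. time_cutoff (et n) (et' n)" and e: "!!t. t > 0 ==> \<forall>\<^sub>F n in sequentially. et n t = 1"
 and F: "intgr F"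
 shows "(%n. LI z. et n (fst z) * F z) ----> (LI z. indicator {0<..} (fst z) * F (z :: R3))"
proof (rule dct[where w="%z. %%F z%%"])
 note [measurable] = time_cutoffD(8)[OF c]
 have [measurable]: "F \<in> bm" using F by auto
 show "(%z. et n (fst z) * F z) \<in> borel_measurable lborel" "(%z. indicator {0<..} (fst z) * F z) \<in> borel_measurable lborel" for n by measurable
 show "AE z in lborel. (%n. et n (fst z) * F z) ----> indicator {0<..} (fst z) * F z"
 proof (rule AE_I2)
 fix z :: "R3"
 show "(%n. et n (fst z) * F z) ----> indicator {0<..} (fst z) * F z"
 proof (cases "fst z > 0")
 case True
 have "\<forall>\<^sub>F n in sequentially. et n (fst z) * F z = indicator {0<..} (fst z) * F z"
 using e[OF True] by eventually_elim (simp add: True)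
 then show ?thesis by (rule tendsto_eventually)
 qed (simp add: time_cutoffD(3)[OF c])
 qed
 show "AE z in lborel. norm (et n (fst z) * F z) <= %%F z%%" for n
 using time_cutoffD(5,6)[OF c] by (intro AE_I2) (simp add: abs_mult mult_left_le_one_le)
qed (use F in simp)

lemma integral_positive_times:
 fixes F :: "R3 => real"
 assumes [measurable]: "F \<in> bm"
 shows "(LI z. indicator {0..} (fst z) * F z) = (LI z. indicator {0<..} (fst z) * F z)"
proof (rule integral_cong_AE)
 show "AE z in lborel. indicator {0..} (fst z) * F z = indicator {0<..} (fst z) * F z"
 using AE_lborel_fst[OF AE_lborel_singleton[of "0 :: real"]] by eventually_elim (auto simp: indicator_def)
qed measurable

lemma integrable_box_mult:
 fixes B f :: "R3 => real"
 assumes [measurable]: "B \<in> bm" and B: "!!z. %%B z%% <= C" "!!z. B z ~= 0 ==> in_box L z" and f: "continuous_on UNIV f"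
 shows "\<exists>K. \<forall>z. %%B z * f z%% <= K" and "intgr (%z. B z * f z)"
proof -
 have [measurable]: "f \<in> bm" using f by (simp add: bm_cont)
 have "{z. in_box L z} = {-L..L} \<times> {-L..L} \<times> {-L..L}" by (auto simp: in_box_def abs_le_iff minus_le_iff mem_Times_iff)
 then have "bounded (f ` {z. in_box L z})"
 by (intro compact_imp_bounded compact_continuous_image continuous_on_subset[OF f]) (simp_all add: compact_Times)
 then obtain K where K: "!!z. in_box L z ==> %%f z%% <= K" unfolding bounded_iff by fastforce
 have b: "%%B z * f z%% <= C * %%K%%" for z
 proof (cases "B z = 0")
 case True
 then show ?thesis using order_trans[OF abs_ge_zero B(1)[of z]] by simp
 next
 case False
 then show ?thesis unfolding abs_mult using K[OF B(2)[OF False]] order_trans[OF abs_ge_zero B(1)[of z]] by (intro mult_mono B) auto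
 qed
 then show "\<exists>K. \<forall>z. %%B z * f z%% <= K" by blast
 show "intgr (%z. B z * f z)" by (rule integrable_box3[OF _ b, where R=L]) (use B(2) in auto)
qed

lemma smooth_polynomial_snd: "real_polynomial_function p ==> smooth (%z::R3. p (snd z))"
 by (induction rule: real_polynomial_function.induct)
 (auto intro: smooth_linear smooth_const smooth_add smooth_mult bounded_linear_compose[OF _ bounded_linear_snd])

context potential begin

lemma cone_support_deriv:
 assumes Th: "tx_test Th Tht Thx" and g: "C1c g g'"
 obtains L where "L > 0" "!!z. ~ in_box L z ==> (Th (tx z) = 0 & Tht (tx z) = 0 & Thx (tx z) = 0) | (g (En V (snd z)) = 0 & g' (En V (snd z)) = 0)"
proof -
 obtain L where L: "L > 0" "!!p. %%fst p%% >= L | %%snd p%% >= L ==> Th p = 0 & Tht p = 0 & Thx p = 0"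
 using tx_test_support[OF Th] by blast
 obtain N where N: "N > 0" "!!x. %%x%% >= N ==> g x = 0 & g' x = 0" using C1c_support[OF g] by blast
 obtain Y where Y: "Y > 0" "!!p. %%fst p%% <= L ==> %%En V p%% <= N ==> %%snd p%% <= Y" using speed_bound by blast
 show thesis
 proof (rule that[of "L + Y"])
 show "L + Y > 0" using L Y by simp
 fix z :: "R3"
 assume n: "~ in_box (L + Y) z"
 show "(Th (tx z) = 0 & Tht (tx z) = 0 & Thx (tx z) = 0) | (g (En V (snd z)) = 0 & g' (En V (snd z)) = 0)"
 proof (rule ccontr)
 assume c: "~ ?thesis"
 have "%%fst z%% < L" "%%px z%% < L" using c L(2)[of "tx z"] by (auto simp: not_le[symmetric])
 moreover have "%%En V (snd z)%% < N" using c N(2) not_le by blast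
 ultimately have "in_box (L + Y) z" using Y(1) Y(2)[of "snd z"] L(1) by (simp add: in_box_def)
 then show False using n by simp
 qed
 qed
qed

text \<open>Testing with \<open>et n\<close> times Q removes the datum but adds a term with
  \<open>et' n\<close>. As \<open>et n\<close> tends to the indicator of t > 0, the remaining terms
  tend to those of the test with Q itself, whose boundary term is the datum.\<close>

lemma initial_trace:
 assumes ws: "weak_sol k c0 (%z. indicator {0..} (fst z) * c z)"
 and m[measurable]: "c \<in> bm" "c0 \<in> bm" and bd: "!!z. %%c z%% <= M" "!!q. %%c0 q%% <= M"
 and ap: "!!R. R > 0 ==> approximable R Q Qt Qx Qy"
 and van: "!!z. ~ in_box L z ==> Q z = 0 & Qt z = 0 & Qx z = 0 & Qy z = 0" and L: "L > 0"
 and Di: "intgr (%z. Qt z + py z * Qx z - k (px z) * Qy z)" and Qi: "intgr Q"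
 and et: "!!n. time_cutoff (et n) (et' n)" "!!t. t > 0 ==> \<forall>\<^sub>F n in sequentially. et n t = 1"
 shows "(%n. LI z. c z * (et' n (fst z) * Q z)) ----> (LI q. c0 q * Q (0, q))"
proof -
 define D where "D z = Qt z + py z * Qx z - k (px z) * Qy z" for z
 note Di' = Di[folded D_def]
 have M0: "M >= 0" using order_trans[OF abs_ge_zero bd(1)] .
 note [measurable] = time_cutoffD(8,9)[OF et(1)]
 have [measurable]: "D \<in> bm" "Q \<in> bm" using Di' Qi by auto
 have cm: "(%z. indicator {0..} (fst z) * c z) \<in> bm" by measurable
 have cb: "%%indicator {0..} (fst z) * c z%% <= M" for z using bd(1)[of z] M0 by (simp add: indicator_def)
 have cDm: "(%z. c z * D z) \<in> bm" by measurable
 have cD: "intgr (%z. c z * D z)" by (rule integrable_bdd_mult[OF Di' _ bd(1)]) simp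
 have eq: "(LI z. c z * (et' n (fst z) * Q z)) = - (LI z. et n (fst z) * (c z * D z))" for n
 proof -
 obtain K where K: "!!t. %%et' n t%% <= K" using et(1)[of n] unfolding time_cutoff_def by blast
 note ap' = approximable_mult[OF approximable_coord_comp(1)[OF time_cutoffD(1,2)[OF et(1)[of n]]] ap]
 have "(LI z. (indicator {0..} (fst z) * c z) * ((et' n (fst z) * Q z + et n (fst z) * Qt z) + py z * (0 * Q z + et n (fst z) * Qx z) - k (px z) * (0 * Q z + et n (fst z) * Qy z)))
 = - (LI q. c0 q * (et n (fst (0::real, q)) * Q (0, q)))"
 by (rule weak_sol_test[OF ws cm m(2) cb bd(2) ap' _ L]) (use van in simp_all)
 moreover have "(indicator {0..} (fst z) * c z) * ((et' n (fst z) * Q z + et n (fst z) * Qt z) + py z * (0 * Q z + et n (fst z) * Qx z) - k (px z) * (0 * Q z + et n (fst z) * Qy z))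
 = c z * (et' n (fst z) * Q z) + et n (fst z) * (c z * D z)" for z
 using time_cutoffD(3,4)[OF et(1)[of n], of "fst z"] by (cases "fst z >= 0") (simp_all add: D_def algebra_simps)
 moreover have "intgr (%z. c z * (et' n (fst z) * Q z))"
 by (rule integrable_bdd_mult[OF integrable_bdd_mult[OF Qi _ K] _ bd(1)]) measurable
 moreover have "intgr (%z. et n (fst z) * (c z * D z))"
 by (rule integrable_bdd_mult[OF cD, of _ 1]) (use time_cutoffD(5,6)[OF et(1)] in simp_all)
 ultimately show ?thesis using time_cutoffD(3)[OF et(1), of 0] by simp
 qed
 have "- (LI z. indicator {0<..} (fst z) * (c z * D z)) = (LI q. c0 q * Q (0, q))"
 using weak_sol_test[OF ws cm m(2) cb bd(2) ap van L] integral_positive_times[OF cDm] by (simp add: D_def mult.assoc)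
 then show ?thesis unfolding eq using tendsto_minus[OF time_cutoff_limit[OF et cD]] by simp
qed

text \<open>Localizes \<open>time_renormalization\<close> to t > 0 while staying within the
  admissible tests.\<close>

lemma tx_test_time_mult:
 assumes Th: "tx_test Th Tht Thx" and et: "time_cutoff et et'"
 shows "tx_test (%p. et (fst p) * Th p) (%p. et' (fst p) * Th p + et (fst p) * Tht p) (%p. et (fst p) * Thx p)"
 unfolding tx_test_def
proof (intro conjI allI impI)
 note c = cont_comp[OF time_cutoffD(10)[OF et]] cont_comp[OF time_cutoffD(2)[OF et]]
 have Thc: "continuous_on UNIV Th" "continuous_on UNIV Tht" "continuous_on UNIV Thx" using Th by (auto simp: tx_test_def)
 show "continuous_on UNIV (%p. et (fst p) * Th p)" "continuous_on UNIV (%p. et' (fst p) * Th p + et (fst p) * Tht p)" "continuous_on UNIV (%p. et (fst p) * Thx p)"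
 by (intro continuous_intros c Thc; auto)+
 fix t x
 have d: "((%s. Th (s, x)) has_real_derivative Tht (t, x)) (at t)" "((%s. Th (t, s)) has_real_derivative Thx (t, x)) (at x)"
 using Th unfolding tx_test_def by blast+
 show "((%s. et (fst (s, x)) * Th (s, x)) has_real_derivative et' (fst (t, x)) * Th (t, x) + et (fst (t, x)) * Tht (t, x)) (at t)"
 using DERIV_mult[OF time_cutoffD(1)[OF et] d(1)] by (simp add: add.commute mult.commute)
 show "((%s. et (fst (t, s)) * Th (t, s)) has_real_derivative et (fst (t, x)) * Thx (t, x)) (at x)"
 using DERIV_cmult[OF d(2)] by simp
next
 obtain L where "!!p. %%fst p%% >= L | %%snd p%% >= L ==> Th p = 0 & Tht p = 0 & Thx p = 0" using tx_test_support[OF Th] by blast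
 then show "\<exists>L. \<forall>p. L <= %%fst p%% | L <= %%snd p%% --> et (fst p) * Th p = 0 & et' (fst p) * Th p + et (fst p) * Tht p = 0 & et (fst p) * Thx p = 0"
 by (intro exI[of _ L]) simp
next
 fix R :: real assume R: "R > 0"
 have "approximable R (%z. Th (tx z)) (%z. Tht (tx z)) (%z. Thx (tx z)) (%z. 0)" using Th R unfolding tx_test_def by blast
 from approximable_mult[OF approximable_coord_comp(1)[OF time_cutoffD(1,2)[OF et]] this]
 show "approximable R (%z. et (fst (tx z)) * Th (tx z)) (%z. et' (fst (tx z)) * Th (tx z) + et (fst (tx z)) * Tht (tx z)) (%z. et (fst (tx z)) * Thx (tx z)) (%z. 0)"
 by simp
qed

text \<open>Expanding \<open>(u - p)\<^sup>2 \<ge> 0\<close> for polynomials \<open>p\<close>, only linear quantities need a trace at \<open>t = 0\<close>; letting \<open>p\<close>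
 approach the initial datum shows that the defect \<open>q - u^2\<close> cannot enter through \<open>t = 0\<close>.\<close>

theorem defect_estimate:
 assumes am[measurable]: "a \<in> bm" and ab: "!!q. %%a q%% <= M" and M1: "M >= 1"
 and um[measurable]: "u \<in> bm" and ub: "!!z. %%u z%% <= M"
 and qm[measurable]: "q \<in> bm" and qb: "!!z. %%q z%% <= M^2"
 and ws0: "weak_sol k (%_. 0) u" and ws: "weak_sol k a (%z. indicator {0..} (fst z) * u z)"
 and wsq: "weak_sol k (%p. (a p)^2) (%z. indicator {0..} (fst z) * q z)" and wsc: "weak_sol k (%_. 1) (%z. indicator {0..} (fst z) * 1)"
 and Th: "tx_test Th Tht Thx" and g: "C1c g g'" and nn: "!!p. 0 <= Th p" "!!E. 0 <= g E"
 shows "0 <= (LI z. indicator {0<..} (fst z) * ((q z - (u z)^2) * ((Tht (tx z) + py z * Thx (tx z)) * g (En V (snd z)))))"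
proof -
 note [measurable] = C1cD(4,5)[OF g] tx_test_measurable[OF Th] km'
 obtain L where L: "L > 0" "!!z. ~ in_box L z ==> (Th (tx z) = 0 & Tht (tx z) = 0 & Thx (tx z) = 0) | (g (En V (snd z)) = 0 & g' (En V (snd z)) = 0)"
 using cone_support_deriv[OF Th g] by blast
 obtain K where K: "K >= 0" "!!p. %%Th p%% <= K" "!!p. %%Tht p%% <= K" "!!p. %%Thx p%% <= K" using tx_test_bounded[OF Th] by metis
 obtain G where G: "G >= 0" "!!x. %%g x%% <= G" using C1c_bounded[OF g] by metis
 define \<Psi> where "\<Psi> z = (Tht (tx z) + py z * Thx (tx z)) * g (En V (snd z))" for z
 define B where "B z = Th (tx z) * g (En V (snd z))" for z
 have \<Psi>m[measurable]: "\<Psi> \<in> bm" and Bm[measurable]: "B \<in> bm" unfolding \<Psi>_def[abs_def] B_def[abs_def] by measurable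
 have Bb: "%%B z%% <= K * G" for z unfolding B_def abs_mult by (intro mult_mono K G) auto
 have Bs: "in_box L z" if "B z ~= 0" for z using that L(2)[of z] unfolding B_def by fastforce
 have Bn: "B z >= 0" for z using nn by (simp add: B_def)
 obtain C where C: "C >= 0" "!!z. %%\<Psi> z%% <= C" using cone_test_bounded[OF Th g, folded \<Psi>_def] by metis
 have \<Psi>s: "in_box L z" if "\<Psi> z ~= 0" for z using that L(2)[of z] unfolding \<Psi>_def by fastforce
 have \<Psi>i: "intgr (%z. f z * \<Psi> z)" if "f \<in> bm" "!!z. %%f z%% <= S" for f S
 unfolding \<Psi>_def by (rule cone_test_integrable[OF Th g that])
 have Bap: "approximable R B (%z. Tht (tx z) * g (En V (snd z)) + Th (tx z) * 0)
 (%z. Thx (tx z) * g (En V (snd z)) + Th (tx z) * (g' (En V (snd z)) * k (px z))) (%z. 0 * g (En V (snd z)) + Th (tx z) * (g' (En V (snd z)) * py z))"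
 if "R > 0" for R unfolding B_def[abs_def]
 by (rule approximable_mult[OF _ approximable_En[OF that g]]) (use Th that in \<open>simp add: tx_test_def\<close>)
 have Bvan: "B z = 0 & Tht (tx z) * g (En V (snd z)) + Th (tx z) * 0 = 0 & Thx (tx z) * g (En V (snd z)) + Th (tx z) * (g' (En V (snd z)) * k (px z)) = 0 & 0 * g (En V (snd z)) + Th (tx z) * (g' (En V (snd z)) * py z) = 0"
 if "~ in_box L z" for z using L(2)[OF that] unfolding B_def by (elim disjE conjE) simp_all
 obtain et et' where et: "!!n::nat. time_cutoff (et n) (et' n)" "!!t. t > 0 ==> \<forall>\<^sub>F n in sequentially. et n t = 1"
 using time_cutoffs_exist by blast
 note [measurable] = time_cutoffD(8,9)[OF et(1)]
 \<comment> \<open>Weak traces tested by smooth functions P of position and velocity; needed for u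
   with datum \<open>a\<close> and for the constant solution 1, which carries P^2.\<close>
 have tr: "(%n. LI z. c z * (et' n (fst z) * (B z * P (snd z)))) ----> (LI p. c0 p * (B (0, p) * P p))"
 if wc: "weak_sol k c0 (%z. indicator {0..} (fst z) * c z)" and mc: "c \<in> bm" "c0 \<in> bm" "!!z. %%c z%% <= M" "!!q. %%c0 q%% <= M"
 and sm: "smooth (%z::R3. P (snd z))" for c c0 and P :: "R2 => real"
 proof -
 obtain Pt Px Py where P: "has_partials (%z. P (snd z)) Pt Px Py" "smooth Pt" "smooth Px" "smooth Py" using smooth_has_partials[OF sm] by metis
 note cP = smooth_continuous[OF sm, of UNIV] smooth_continuous[OF P(2), of UNIV] smooth_continuous[OF P(3), of UNIV] smooth_continuous[OF P(4), of UNIV]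
 note [measurable] = cP[THEN bm_cont]
 have e: "((Tht (tx z) * g (En V (snd z)) + Th (tx z) * 0) * P (snd z) + B z * Pt z)
 + py z * ((Thx (tx z) * g (En V (snd z)) + Th (tx z) * (g' (En V (snd z)) * k (px z))) * P (snd z) + B z * Px z)
 - k (px z) * ((0 * g (En V (snd z)) + Th (tx z) * (g' (En V (snd z)) * py z)) * P (snd z) + B z * Py z)
 = \<Psi> z * P (snd z) + B z * (Pt z + py z * Px z) - k (px z) * (B z * Py z)" for z
 by (simp add: \<Psi>_def algebra_simps)
 have i3: "intgr (%z. k (px z) * (B z * Py z))"
 proof -
 obtain K' where K': "!!z. %%B z * Py z%% <= K'" using integrable_box_mult(1)[OF Bm Bb Bs cP(4)] by blast
 have "intgr (%x. ivl L x * k x)" using k by (simp add: locint_def)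
 from integrable_bdd_mult[OF integrable_kernel_box[OF this] _ K']
 have "intgr (%z. (B z * Py z) * (ivl L (fst z) * (ivl L (px z) * k (px z) * ivl L (py z))))" by simp
 moreover have "(B z * Py z) * (ivl L (fst z) * (ivl L (px z) * k (px z) * ivl L (py z))) = k (px z) * (B z * Py z)" for z
 proof (cases "B z = 0")
 case False
 then have "ivl L (fst z) = 1" "ivl L (px z) = 1" "ivl L (py z) = 1" using Bs[of z] by (auto simp: in_box_def indicator_def abs_le_iff)
 then show ?thesis by simp
 qed simp
 ultimately show ?thesis by simp
 qed
 have "continuous_on UNIV (%z. Pt z + py z * Px z)" by (intro continuous_intros cP)
 then have Di: "intgr (%z. \<Psi> z * P (snd z) + B z * (Pt z + py z * Px z) - k (px z) * (B z * Py z))"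
 by (intro lint_diff lint_add i3 integrable_box_mult(2)[OF Bm Bb Bs] integrable_box_mult(2)[OF \<Psi>m C(2) \<Psi>s] cP) measurable
 have "(%n. LI z. c z * (et' n (fst z) * (B z * P (snd z)))) ----> (LI p. c0 p * (B (0, p) * P (snd (0 :: real, p))))"
 by (rule initial_trace[OF wc mc(1,2) mc(3) mc(4) approximable_mult[OF Bap approximable_smooth[OF sm P(1)]] _ L(1) Di[folded e] integrable_box_mult(2)[OF Bm Bb Bs cP(1)] et])
 (assumption, drule Bvan, elim conjE, simp only: mult_zero_left mult_zero_right add_0_left simp_thms)
 then show ?thesis by simp
 qed
 let ?Q = "LI z. indicator {0<..} (fst z) * (q z * \<Psi> z)" and ?U = "LI z. indicator {0<..} (fst z) * ((u z)^2 * \<Psi> z)"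
 have u2m: "(%z. (u z)^2) \<in> bm" by measurable
 have u2: "%%(u z)^2%% <= M^2" for z using ub[of z] power_mono[of "%%u z%%" M 2] by simp
 \<comment> \<open>The equation of \<open>q\<close> is linear with datum a^2, so its contribution is
   known exactly.\<close>
 have qeq: "?Q = - (LI p. (a p)^2 * B (0, p))"
 proof -
 have qb': "%%indicator {0..} (fst z) * q z%% <= M^2" for z using qb[of z] by (simp add: indicator_def)
 have ab': "%%(a p)^2%% <= M^2" for p using ab[of p] power_mono[of "%%a p%%" M 2] by simp
 have "(LI z. (indicator {0..} (fst z) * q z) * ((Tht (tx z) * g (En V (snd z)) + Th (tx z) * 0)
 + py z * (Thx (tx z) * g (En V (snd z)) + Th (tx z) * (g' (En V (snd z)) * k (px z)))
 - k (px z) * (0 * g (En V (snd z)) + Th (tx z) * (g' (En V (snd z)) * py z)))) = - (LI p. (a p)^2 * B (0, p))"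
 by (rule weak_sol_test[OF wsq _ _ qb' ab' Bap Bvan L(1)]) measurable
 also have "(%z. (indicator {0..} (fst z) * q z) * ((Tht (tx z) * g (En V (snd z)) + Th (tx z) * 0)
 + py z * (Thx (tx z) * g (En V (snd z)) + Th (tx z) * (g' (En V (snd z)) * k (px z)))
 - k (px z) * (0 * g (En V (snd z)) + Th (tx z) * (g' (En V (snd z)) * py z)))) = (%z. indicator {0..} (fst z) * (q z * \<Psi> z))"
 by (simp add: fun_eq_iff \<Psi>_def algebra_simps)
 finally show ?thesis by (simp add: integral_positive_times)
 qed
 have QU: "(LI z. indicator {0<..} (fst z) * ((q z - (u z)^2) * \<Psi> z)) = ?Q - ?U"
 proof -
 have "intgr (%z. indicator {0<..} (fst z) * (f z * \<Psi> z))" if "f \<in> bm" "!!z. %%f z%% <= M^2" for f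
 by (rule integrable_bdd_mult[OF \<Psi>i[OF that], of _ 1]) (auto simp: indicator_def)
 from this[OF qm qb] this[OF u2m u2] show ?thesis by (simp add: algebra_simps)
 qed
 \<comment> \<open>Renormalization with the cutoff writes -U as a limit of integrals of u^2 against
   et' B. There u^2 >= 2 u P - P^2, and this lower bound is linear in the solutions u and 1, so
   \<open>tr\<close> gives its limit.\<close>
 have low: "- ?U >= 2 * (LI p. a p * (B (0, p) * P p)) - (LI p. 1 * (B (0, p) * (P p * P p)))"
 if sm: "smooth (%z::R3. P (snd z))" for P
 proof (rule LIMSEQ_le)
 have one: "%%1::real%% <= M" using M1 by simp
 show "(%n. 2 * (LI z. u z * (et' n (fst z) * (B z * P (snd z)))) - (LI z. 1 * (et' n (fst z) * (B z * (P (snd z) * P (snd z)))))) ----> 2 * (LI p. a p * (B (0, p) * P p)) - (LI p. 1 * (B (0, p) * (P p * P p)))"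
 by (intro tendsto_diff tendsto_mult tendsto_const tr[OF ws um am ub ab sm] tr[OF wsc _ _ one one smooth_mult[OF sm sm]]) simp_all
 show "(%n. - (LI z. et n (fst z) * ((u z)^2 * \<Psi> z))) ----> - ?U"
 by (intro tendsto_minus time_cutoff_limit[OF et] \<Psi>i[OF u2m u2])
 note cP = smooth_continuous[OF sm, of UNIV]
 note [measurable] = cP[THEN bm_cont]
 have "2 * (LI z. u z * (et' n (fst z) * (B z * P (snd z)))) - (LI z. 1 * (et' n (fst z) * (B z * (P (snd z) * P (snd z))))) <= - (LI z. et n (fst z) * ((u z)^2 * \<Psi> z))" for n
 proof -
 obtain S where S: "!!t. %%et' n t%% <= S" using et(1)[of n] unfolding time_cutoff_def by blast
 have iB: "intgr (%z. c z * (et' n (fst z) * (B z * f z)))" if "continuous_on UNIV f" "c \<in> bm" "!!z. %%c z%% <= M^2" for c f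
 by (rule integrable_bdd_mult[OF integrable_bdd_mult[OF integrable_box_mult(2)[OF Bm Bb Bs that(1)] _ S] _ that(3)]) (use that(2) in measurable)
 have MM: "M <= M^2" using M1 by (simp add: power2_eq_square)
 have ub': "%%u z%% <= M^2" for z using ub[of z] MM by simp
 have i1: "intgr (%z. u z * (et' n (fst z) * (B z * P (snd z))))" by (rule iB[OF cP um ub'])
 have i2: "intgr (%z. 1 * (et' n (fst z) * (B z * (P (snd z) * P (snd z)))))"
 by (rule iB) (use cP M1 MM in \<open>auto intro: continuous_intros\<close>)
 have i3: "intgr (%z. (u z)^2 * (et' n (fst z) * (B z * 1)))" by (rule iB[OF _ u2m u2]) simp_all
 have "(LI z. (u z)^2 * (((et' n (fst z) * Th (tx z) + et n (fst z) * Tht (tx z)) + py z * (et n (fst z) * Thx (tx z))) * g (En V (snd z)))) = 0"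
 using time_renormalization[OF ws0 um ub tx_test_time_mult[OF Th et(1)[of n]] g] by simp
 moreover have "(u z)^2 * (((et' n (fst z) * Th (tx z) + et n (fst z) * Tht (tx z)) + py z * (et n (fst z) * Thx (tx z))) * g (En V (snd z)))
 = (u z)^2 * (et' n (fst z) * (B z * 1)) + et n (fst z) * ((u z)^2 * \<Psi> z)" for z
 by (simp add: B_def \<Psi>_def algebra_simps)
 moreover have "intgr (%z. et n (fst z) * ((u z)^2 * \<Psi> z))"
 by (rule integrable_bdd_mult[OF \<Psi>i[OF u2m u2], of _ 1]) (use time_cutoffD(5,6)[OF et(1)] in simp_all)
 ultimately have e: "- (LI z. et n (fst z) * ((u z)^2 * \<Psi> z)) = (LI z. (u z)^2 * (et' n (fst z) * (B z * 1)))" using i3 by simp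
 have "2 * (LI z. u z * (et' n (fst z) * (B z * P (snd z)))) - (LI z. 1 * (et' n (fst z) * (B z * (P (snd z) * P (snd z)))))
 = (LI z. 2 * (u z * (et' n (fst z) * (B z * P (snd z)))) - 1 * (et' n (fst z) * (B z * (P (snd z) * P (snd z)))))"
 using i1 i2 by simp
 also have "... <= (LI z. (u z)^2 * (et' n (fst z) * (B z * 1)))"
 proof (rule integral_mono[OF lint_diff[OF integrable_mult_right[OF i1] i2] i3])
 fix z
 have "0 <= (u z - P (snd z))^2 * (et' n (fst z) * B z)" using Bn time_cutoffD(7)[OF et(1)] by simp
 then show "2 * (u z * (et' n (fst z) * (B z * P (snd z)))) - 1 * (et' n (fst z) * (B z * (P (snd z) * P (snd z)))) <= (u z)^2 * (et' n (fst z) * (B z * 1))"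
 by (simp add: power2_eq_square algebra_simps)
 qed
 finally show ?thesis unfolding e .
 qed
 then show "\<exists>N. \<forall>n\<ge>N. 2 * (LI z. u z * (et' n (fst z) * (B z * P (snd z)))) - (LI z. 1 * (et' n (fst z) * (B z * (P (snd z) * P (snd z))))) <= - (LI z. et n (fst z) * ((u z)^2 * \<Psi> z))" by blast
 qed
 let ?S = "{q. %%fst q%% <= L & %%snd q%% <= L} :: (R2) set"
 have Seq: "?S = {-L..L} \<times> {-L..L}" by (auto simp: abs_le_iff minus_le_iff mem_Times_iff)
 have Sc: "compact ?S" unfolding Seq by (intro compact_Times) auto
 have Sb[measurable]: "?S \<in> sets borel" using Sc by (rule borel_compact)
 have Sf: "emeasure lborel ?S < \<infinity>" by (rule emeasure_compact_finite[OF Sc])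
 have Si: "intgr (indicator ?S :: R2 => real)" using Sf by (simp add: integrable_indicator_iff)
 define A where "A = measure lborel ?S"
 \<comment> \<open>By \<open>low\<close> and \<open>qeq\<close> the defect integral is at least
   minus the integral of (a - p)^2 B(0, .). An L^1-close continuous f and a uniformly close
   polynomial p bound it by K G (4 M + 2 A) e, using (a - p)^2 <= 2 (a - f)^2 + 2 (f - p)^2 and |a -
   f| <= 2 M.\<close>
 have key: "- ?U + ?Q >= - (K * G * (4 * M + 2 * A)) * e" if e: "e > 0" "e <= 1" for e
 proof -
 obtain f where f: "continuous_on UNIV f" "!!x. %%f x%% <= M" "(LI x. indicator ?S x * %%a x - f x%%) < e"
 by (rule bounded_approx_continuous[OF am Sb ab Sf e(1)]) blast
 obtain p where p: "real_polynomial_function p" "!!x. x \<in> ?S ==> %%f x - p x%% < e"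
 by (rule Stone_Weierstrass_real_polynomial_function[OF Sc continuous_on_subset[OF f(1) subset_UNIV] e(1)]) blast
 note sm = smooth_polynomial_snd[OF p(1)]
 have "continuous_on UNIV p" by (rule continuous_on_polymonial_function) (use p(1) in \<open>simp add: real_polynomial_function_eq\<close>)
 then have [measurable]: "f \<in> bm" "p \<in> bm"
 using f(1) by (simp_all add: bm_cont)
 have B0m[measurable]: "(%x. B (0, x)) \<in> bm" by measurable
 have fi: "intgr (%x. indicator ?S x * %%a x - f x%%)"
 proof -
 have "%%%%a x - f x%%%% <= 2 * M" for x using ab[of x] f(2)[of x] by linarith
 from integrable_bdd_mult[OF Si _ this] show ?thesis by (simp add: mult.commute)
 qed
 have bs: "indicator ?S x = (1::real)" if "B (0, x) ~= 0" for x using Bs[OF that] by (simp add: in_box_def)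
 have i: "intgr (%x. c x * (B (0, x) * h x))" if [measurable]: "c \<in> bm" "h \<in> bm"
 and b: "!!x. x \<in> ?S ==> %%c x * h x%% <= H" for c h H
 proof (rule lint_bound[OF integrable_mult_left[OF Si, of "(K * G) * H"]])
 show "AE x in lborel. norm (c x * (B (0, x) * h x)) <= norm (indicator ?S x * ((K * G) * H))"
 proof (rule AE_I2)
 fix x
 show "norm (c x * (B (0, x) * h x)) <= norm (indicator ?S x * ((K * G) * H))"
 proof (cases "B (0, x) = 0")
 case False
 have s: "x \<in> ?S" using bs[OF False] by (simp add: indicator_def split: if_splits)
 have "norm (c x * (B (0, x) * h x)) = %%B (0, x)%% * %%c x * h x%%" by (simp add: abs_mult mult_ac)
 also have "... <= (K * G) * H" by (intro mult_mono Bb b s) (use K G in auto)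
 also have "... <= norm (indicator ?S x * ((K * G) * H))" unfolding bs[OF False] by (simp only: mult_1 real_norm_def abs_ge_self)
 finally show ?thesis .
 qed simp
 qed
 qed measurable
 have pb: "%%p x%% <= M + 1" if "x \<in> ?S" for x using p(2)[OF that] f(2)[of x] e(2) by linarith
 have bdd: "%%c * d%% <= (M + 1) * (M + 1)" if "%%c%% <= M + 1" "%%d%% <= M + 1" for c d :: real
 unfolding abs_mult by (intro mult_mono that) (use M1 in auto)
 have ab': "%%a x%% <= M + 1" for x using ab[of x] by simp
 have pp: "%%1 * (p x * p x)%% <= (M + 1) * (M + 1)" if "x \<in> ?S" for x
 unfolding mult_1 by (rule bdd[OF pb[OF that] pb[OF that]])
 have j1: "intgr (%x. a x * (B (0, x) * p x))" by (rule i[OF _ _ bdd[OF ab' pb]]) simp_all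
 have j2: "intgr (%x. 1 * (B (0, x) * (p x * p x)))" by (rule i[OF _ _ pp]) simp_all
 have j3: "intgr (%x. a x * (B (0, x) * a x))" by (rule i[OF _ _ bdd[OF ab' ab']]) simp_all
 have "(LI x. a x * (B (0, x) * a x)) - 2 * (LI x. a x * (B (0, x) * p x)) + (LI x. 1 * (B (0, x) * (p x * p x)))
 = (LI x. a x * (B (0, x) * a x) - 2 * (a x * (B (0, x) * p x)) + 1 * (B (0, x) * (p x * p x)))"
 using j1 j2 j3 by simp
 also have "... <= (LI x. (K * G) * (4 * M * (indicator ?S x * %%a x - f x%%) + indicator ?S x * (2 * e)))"
 proof (rule integral_mono)
 show "intgr (%x. a x * (B (0, x) * a x) - 2 * (a x * (B (0, x) * p x)) + 1 * (B (0, x) * (p x * p x)))"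
 by (intro lint_add lint_diff integrable_mult_right j1 j2 j3)
 show "intgr (%x. (K * G) * (4 * M * (indicator ?S x * %%a x - f x%%) + indicator ?S x * (2 * e)))"
 by (intro integrable_mult_right lint_add fi integrable_mult_left Si)
 fix x
 have e1: "a x * (B (0, x) * a x) - 2 * (a x * (B (0, x) * p x)) + 1 * (B (0, x) * (p x * p x)) = B (0, x) * (a x - p x)^2"
 by (simp add: power2_eq_square algebra_simps)
 show "a x * (B (0, x) * a x) - 2 * (a x * (B (0, x) * p x)) + 1 * (B (0, x) * (p x * p x)) <= (K * G) * (4 * M * (indicator ?S x * %%a x - f x%%) + indicator ?S x * (2 * e))"
 unfolding e1
 proof (cases "B (0, x) = 0")
 case True
 then show "B (0, x) * (a x - p x)^2 <= (K * G) * (4 * M * (indicator ?S x * %%a x - f x%%) + indicator ?S x * (2 * e))"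
 using K G M1 e by (auto intro!: mult_nonneg_nonneg add_nonneg_nonneg)
 next
 case False
 have s: "x \<in> ?S" using bs[OF False] by (simp add: indicator_def split: if_splits)
 have "(a x - p x)^2 <= 2 * (a x - f x)^2 + 2 * (f x - p x)^2" using sum_squares_ge_zero[of "(a x - f x) - (f x - p x)" 0] by (simp add: power2_eq_square algebra_simps)
 moreover have "(a x - f x)^2 <= (2 * M) * %%a x - f x%%"
 proof -
 have "%%a x - f x%% <= 2 * M" using ab[of x] f(2)[of x] by linarith
 then have "%%a x - f x%% * %%a x - f x%% <= (2 * M) * %%a x - f x%%" by (intro mult_right_mono) auto
 then show ?thesis by (simp add: power2_eq_square flip: abs_mult)
 qed
 moreover have "(f x - p x)^2 <= e"
 proof -
 have "%%f x - p x%% * %%f x - p x%% <= e * 1" using p(2)[OF s] e by (intro mult_mono) auto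
 then show ?thesis by (simp add: power2_eq_square flip: abs_mult)
 qed
 ultimately have "(a x - p x)^2 <= 4 * M * %%a x - f x%% + 2 * e" by linarith
 then have "B (0, x) * (a x - p x)^2 <= (K * G) * (4 * M * %%a x - f x%% + 2 * e)"
 using Bb[of "(0, x)"] Bn[of "(0, x)"] K G by (intro mult_mono) auto
 then show "B (0, x) * (a x - p x)^2 <= (K * G) * (4 * M * (indicator ?S x * %%a x - f x%%) + indicator ?S x * (2 * e))" by (simp add: bs[OF False])
 qed
 qed
 also have "... = (K * G) * (4 * M * (LI x. indicator ?S x * %%a x - f x%%) + A * (2 * e))"
 unfolding integral_mult_right_zero using Bochner_Integration.integral_add[OF integrable_mult_right[OF fi, of "4 * M"] integrable_mult_left[OF Si, of "2 * e"]] by (simp add: A_def)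
 also have "... <= (K * G) * (4 * M * e + A * (2 * e))"
 using f(3) M1 K G by (intro mult_left_mono add_right_mono) auto
 also have "... = (K * G * (4 * M + 2 * A)) * e" by (simp add: algebra_simps)
 finally have "(LI x. a x * (B (0, x) * a x)) - 2 * (LI x. a x * (B (0, x) * p x)) + (LI x. 1 * (B (0, x) * (p x * p x))) <= (K * G * (4 * M + 2 * A)) * e" .
 moreover have "(LI p. (a p)^2 * B (0, p)) = (LI x. a x * (B (0, x) * a x))"
 by (intro lint_cong refl) (simp add: power2_eq_square)
 ultimately show ?thesis unfolding mult_minus_left using low[OF sm] qeq by linarith
 qed
 have "0 <= - ?U + ?Q"
 proof (rule LIMSEQ_le_const2)
 show "(%n. - (K * G * (4 * M + 2 * A)) * (1 / real (Suc n))) ----> 0"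
 by (rule tendsto_mult_right_zero[OF LIMSEQ_Suc[OF lim_1_over_n]])
 show "\<exists>N. \<forall>n\<ge>N. - (K * G * (4 * M + 2 * A)) * (1 / real (Suc n)) <= - ?U + ?Q"
 using key[of "1 / real (Suc n)" for n] by auto
 qed
 then show ?thesis using QU unfolding \<Psi>_def by simp
qed

end

section \<open>Strong convergence and existence\<close>

text \<open>A filter finer than \<open>sequentially\<close> need not come from a subsequence. A
  single real sequence tending to 0 along it is still small at arbitrarily late indices, which is
  enough to select an ordinary sequence.\<close>

lemma frequent_subsequence:
 fixes \<alpha> :: "nat => real"
 assumes F: "F <= sequentially" "F ~= bot" and l: "(\<alpha> \<longlongrightarrow> 0) F" and nn: "!!n. \<alpha> n >= 0"
 obtains r where "!!n. n <= r n" "(%n. \<alpha> (r n)) ----> 0"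
proof -
 have "\<exists>n\<ge>m. \<alpha> n < 1 / real (Suc m)" for m
 proof -
 have "eventually (%n. n >= m) F" using F(1) eventually_ge_at_top[of m] by (meson filter_leD)
 moreover have "eventually (%n. \<alpha> n < 1 / real (Suc m)) F" by (rule order_tendstoD(2)[OF l]) simp
 ultimately have "eventually (%n. n >= m & \<alpha> n < 1 / real (Suc m)) F" by eventually_elim simp
 then show ?thesis using eventually_happens F(2) by blast
 qed
 then obtain r where r: "!!m. r m >= m" "!!m. \<alpha> (r m) < 1 / real (Suc m)" by metis
 have "(%m. \<alpha> (r m)) ----> 0"
 by (rule Lim_null_comparison[OF _ LIMSEQ_Suc[OF lim_1_over_n]]) (use r(2) nn in \<open>simp add: less_imp_le\<close>)
 with r(1) show thesis by (rule that)
qed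

text \<open>A finite lower limit means |s n| < B infinitely often, so |u| <= arctan B < pi/2, and
  tan is continuous at u.\<close>

lemma tan_limit:
 assumes l: "(%n. arctan (s n)) ----> u" and b: "liminf (%n. ennreal %%s n%%) < \<infinity>"
 shows "s ----> tan u"
proof -
 obtain B where B: "liminf (%n. ennreal %%s n%%) < ennreal B" "B >= 0"
 using b less_top_ennreal[of "liminf (%n. ennreal %%s n%%)"] ennreal_less_iff[of _ "_ + 1"] by (metis add_increasing2 enn2real_nonneg ennreal_enn2real infinity_ennreal_def less_add_one zero_le_one)
 have "~ eventually (%n. ennreal B <= ennreal %%s n%%) sequentially"
 using Liminf_bounded[of "ennreal B" "%n. ennreal %%s n%%" sequentially] B(1) not_le by blast
 then have f: "\<exists>\<^sub>F n in sequentially. ~ ennreal B <= ennreal %%s n%%" by (simp add: not_eventually)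
 have "%%u%% <= arctan B"
 proof (rule ccontr)
 assume "~ ?thesis"
 then have "eventually (%n. arctan B < %%arctan (s n)%%) sequentially" using order_tendstoD(1)[OF tendsto_rabs[OF l]] by simp
 then have "eventually (%n. ennreal B <= ennreal %%s n%%) sequentially"
 proof eventually_elim
 case (elim n)
 have "%%arctan (s n)%% = arctan %%s n%%" by (cases "s n >= 0") (auto simp: arctan_minus)
 then show ?case using elim by (simp add: arctan_less_iff ennreal_leI)
 qed
 then show False using f by (simp add: not_eventually[symmetric])
 qed
 then have "- (pi / 2) < u" "u < pi / 2" using arctan_ubound[of B] by auto
 then have "cos u ~= 0" using cos_gt_zero_pi by force
 from isCont_tendsto_compose[OF isCont_tan[OF this] l] show ?thesis by (simp add: tan_arctan)
qed

context complete_potential begin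

text \<open>The bounded part of the datum is integrated over the box, the integrable part over all
  of phase space at each time, where \<open>iter\<close> preserves measure. The bound is therefore
  uniform in h.\<close>

lemma scheme_box_bound:
 assumes [measurable]: "a \<in> bm" and a: "!!q. %%a q%% <= C + f q" "!!q. f q >= 0" and f: "intgr f"
 shows "(\<integral>\<^sup>+z. ennreal (indB R z * %%scheme k h a z%%) \<partial>lborel)
 <= ennreal %%C%% * emeasure lborel {z. in_box R z} + emeasure lborel {-R..R} * (\<integral>\<^sup>+q. ennreal (f q) \<partial>lborel)"
proof -
 note [measurable] = scheme_measurable[OF km'] iter_preserving(1)[OF km']
 have fm[measurable]: "f \<in> bm" using f by auto
 have sm[measurable]: "(%z. f (iter k h \<lfloor>fst z / h\<rfloor> (snd z))) \<in> bm"
 using scheme_measurable[OF km' fm] by (simp add: scheme_def[abs_def])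
 have "(\<integral>\<^sup>+z. ennreal (indB R z * %%scheme k h a z%%) \<partial>lborel)
 <= (\<integral>\<^sup>+z. ennreal %%C%% * indicator {z. in_box R z} z + indicator {-R..R} (fst z) * ennreal (f (iter k h \<lfloor>fst z / h\<rfloor> (snd z))) \<partial>lborel)"
 proof (rule nn_integral_mono)
 fix z :: "R3"
 show "ennreal (indB R z * %%scheme k h a z%%) <= ennreal %%C%% * indicator {z. in_box R z} z + indicator {-R..R} (fst z) * ennreal (f (iter k h \<lfloor>fst z / h\<rfloor> (snd z)))"
 proof (cases "in_box R z")
 case True
 then have i: "indicator {-R..R} (fst z) = (1::ennreal)" by (auto simp: in_box_def indicator_def abs_le_iff)
 have "%%scheme k h a z%% <= %%C%% + f (iter k h \<lfloor>fst z / h\<rfloor> (snd z))"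
 unfolding scheme_def using a(1)[of "iter k h \<lfloor>fst z / h\<rfloor> (snd z)"] by linarith
 then show ?thesis using True i a(2) by (simp flip: ennreal_plus add: ennreal_leI)
 qed simp
 qed
 also have "... = ennreal %%C%% * emeasure lborel {z. in_box R z} + (\<integral>\<^sup>+z. indicator {-R..R} (fst z) * ennreal (f (iter k h \<lfloor>fst z / h\<rfloor> (snd z))) \<partial>lborel)"
 by (subst nn_integral_add) (auto simp: nn_integral_cmult_indicator)
 also have "(\<integral>\<^sup>+z. indicator {-R..R} (fst z) * ennreal (f (iter k h \<lfloor>fst z / h\<rfloor> (snd z))) \<partial>lborel)
 = (\<integral>\<^sup>+t. \<integral>\<^sup>+q. indicator {-R..R} t * ennreal (f (iter k h \<lfloor>t / h\<rfloor> q)) \<partial>lborel \<partial>lborel)"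
 proof -
 have "(%z. indicator {-R..R} (fst z) * ennreal (f (iter k h \<lfloor>fst z / h\<rfloor> (snd z)))) \<in> borel_measurable ((lborel :: real measure) \<Otimes>\<^sub>M (lborel :: (R2) measure))"
 unfolding lborel_prod by measurable
 from lborel.nn_integral_fst[OF this] show ?thesis unfolding lborel_prod by (simp only: fst_conv snd_conv)
 qed
 also have "... = (\<integral>\<^sup>+t. indicator {-R..R} t * (\<integral>\<^sup>+q. ennreal (f q) \<partial>lborel) \<partial>lborel)"
 proof (rule nn_integral_cong)
 fix t :: real
 have "(\<integral>\<^sup>+q. ennreal (f (iter k h \<lfloor>t / h\<rfloor> q)) \<partial>lborel) = (\<integral>\<^sup>+q. ennreal (f q) \<partial>distr lborel borel (iter k h \<lfloor>t / h\<rfloor>))"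
 by (rule nn_integral_distr[symmetric]) auto
 then show "(\<integral>\<^sup>+q. indicator {-R..R} t * ennreal (f (iter k h \<lfloor>t / h\<rfloor> q)) \<partial>lborel) = indicator {-R..R} t * (\<integral>\<^sup>+q. ennreal (f q) \<partial>lborel)"
 by (simp add: iter_preserving(2)[OF km'] nn_integral_cmult)
 qed
 also have "... = emeasure lborel {-R..R} * (\<integral>\<^sup>+q. ennreal (f q) \<partial>lborel)" by (simp add: nn_integral_multc)
 finally show ?thesis .
qed

text \<open>The scheme for \<open>arctan\<close> of the datum is bounded and has weak limits.
  Absence of a defect makes the convergence strong, hence a.e. along a subsequence, and tan recovers
  the scheme for \<open>a0\<close> itself. Then every bounded continuous \<beta> passes to the limit
  by dominated convergence and \<open>scheme_limit\<close>.\<close>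

theorem existence:
 assumes am[measurable]: "a0 \<in> bm" and a0: "!!q. %%a0 q%% <= C + f q" "!!q. f q >= 0" and f: "intgr f"
 obtains U where "U \<in> bm"
 "!!R. intgr (%z. indB R z * (indicator {0..} (fst z) * U z))"
 "!!\<beta> B. continuous_on UNIV \<beta> ==> (!!s. %%\<beta> s%% <= B) ==> weak_sol k (%q. \<beta> (a0 q)) (%z. indicator {0..} (fst z) * \<beta> (U z))"
proof -
 note [measurable] = scheme_measurable[OF km']
 define h where "h n = 1 / real (Suc n)" for n
 have h: "h ----> 0" "!!n. 0 < h n" "!!n. h n <= 1" unfolding h_def[abs_def] using LIMSEQ_Suc[OF lim_1_over_n] by simp_all
 define a where "a q = arctan (a0 q)" for q
 have am'[measurable]: "a \<in> bm"
 proof -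
 have "arctan \<in> bm"
 by (intro bm_cont continuous_at_imp_continuous_on ballI isCont_arctan)
 from measurable_compose[OF am this] show ?thesis by (simp add: a_def[abs_def])
 qed
 have ab: "%%a q%% <= 2" for q using arctan_bounded[of "a0 q"] pi_less_4 by (simp add: a_def abs_le_iff)
 define w where "w n = scheme k (h n) a" for n
 have [measurable]: "w n \<in> bm" for n unfolding w_def by measurable
 have wb: "%%w n z%% <= 2" for n z using ab by (simp add: w_def scheme_def)
 have b4: "%%x^2%% <= 4" if "%%x%% <= 2" for x :: real using power_mono[OF that, of 2] by simp
 obtain F1 u where F1: "F1 <= sequentially" "F1 ~= bot" and um[measurable]: "u \<in> bm" and ub: "!!z. %%u z%% <= 2"
 and ul: "!!ps. intgr ps ==> ((%n. LI z. w n z * ps z) \<longlongrightarrow> (LI z. u z * ps z)) F1"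
 by (rule weak_star_limit[of w 2 sequentially]) (use wb in auto)
 obtain F q where F: "F <= F1" "F ~= bot" and qm[measurable]: "q \<in> bm" and qb: "!!z. %%q z%% <= 4"
 and ql: "!!ps. intgr ps ==> ((%n. LI z. (w n z)^2 * ps z) \<longlongrightarrow> (LI z. q z * ps z)) F"
 by (rule weak_star_limit[of "%n z. (w n z)^2" 4 F1]) (use b4[OF wb] F1(2) in auto)
 have FS: "F <= sequentially" using F(1) F1(1) by (rule order_trans)
 note ul' = tendsto_mono[OF F(1) ul]
 have Si: "intgr (%z. indicator S (fst z) * ps z)" if "intgr ps" "S \<in> sets borel" for S and ps :: "R3 => real"
 by (rule integrable_bdd_mult[OF that(1), of _ 1]) (use that(2) in \<open>auto simp: indicator_def\<close>)
 have limS: "((%n. LI z. (indicator S (fst z) * c n z) * ps z) \<longlongrightarrow> (LI z. (indicator S (fst z) * v z) * ps z)) F"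
 if "!!ps. intgr ps ==> ((%n. LI z. c n z * ps z) \<longlongrightarrow> (LI z. v z * ps z)) F" "intgr ps" "S = UNIV | S = {0..}"
 for S :: "real set" and ps and c :: "nat => R3 => real" and v
 proof -
 have "S \<in> sets borel" using that(3) by auto
 from that(1)[OF Si[OF that(2) this]] show ?thesis by (simp add: mult_ac)
 qed
 have S0: "{0..} ~= (UNIV :: real set)" by (metis UNIV_I atLeast_iff neg_0_le_iff_le not_one_le_zero)
 have a2m: "(%p. (a p)^2) \<in> bm" and a1m: "(%p::R2. 1::real) \<in> bm" by measurable
 note sl = scheme_limit[OF _ _ h FS F(2)]
 have ws0: "weak_sol k (%_. 0) u"
 using sl[where a=a and S=UNIV and v=u, OF am' ab] limS[OF ul', where S=UNIV] by (simp add: w_def)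
 have ws: "weak_sol k a (%z. indicator {0..} (fst z) * u z)"
 using sl[where a=a and S="{0..}" and v=u, OF am' ab] limS[OF ul', where S="{0..}"] S0 by (simp add: w_def)
 have wsq: "weak_sol k (%p. (a p)^2) (%z. indicator {0..} (fst z) * q z)"
 using sl[where a="%p. (a p)^2" and S="{0..}" and v=q, OF a2m b4[OF ab]] limS[OF ql, where S="{0..}"] S0 by (simp add: w_def scheme_def)
 have wsc: "weak_sol k (%_. 1) (%z. indicator {0..} (fst z) * 1)"
 using sl[where a="%_. 1" and M=1 and S="{0..}" and v="%_. 1", OF a1m] S0 by (simp add: scheme_def)
 have u2: "%%(u z)^2%% <= 4" for z by (rule b4[OF ub])
 \<comment> \<open>Expanding the square, the weak limit of (w n - u)^2 is q - 2 u^2 + u^2: the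
   defect measures the failure of strong convergence.\<close>
 have d: "((%n. LI z. (w n z - u z)^2 * ps z) \<longlongrightarrow> (LI z. (q z - (u z)^2) * ps z)) F" if ps: "intgr ps" for ps
 proof -
 have m: "intgr (%z. v z * ps z)" if "v \<in> bm" "!!z. %%v z%% <= 4" for v
 by (rule integrable_bdd_mult[OF ps _ that(2)]) (use that(1) in simp)
 have i1: "intgr (%z. u z * ps z)" by (rule m[OF um]) (rule order_trans[OF ub], simp)
 have i2: "intgr (%z. (u z)^2 * ps z)" by (rule m[OF _ u2]) measurable
 have i3: "intgr (%z. (w n z)^2 * ps z)" for n by (rule m[OF _ b4[OF wb]]) measurable
 have i4: "intgr (%z. w n z * (u z * ps z))" for n by (rule integrable_bdd_mult[OF i1 _ wb]) simp
 have i5: "intgr (%z. q z * ps z)" by (rule m[OF qm qb])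
 have "(LI z. (w n z - u z)^2 * ps z) = (LI z. (w n z)^2 * ps z - 2 * (w n z * (u z * ps z)) + (u z)^2 * ps z)" for n
 by (intro lint_cong refl) (simp add: power2_eq_square algebra_simps)
 then have e1: "(LI z. (w n z - u z)^2 * ps z) = (LI z. (w n z)^2 * ps z) - 2 * (LI z. w n z * (u z * ps z)) + (LI z. (u z)^2 * ps z)" for n
 using i2 i3[of n] i4[of n] by simp
 have "(LI z. u z * (u z * ps z)) = (LI z. (u z)^2 * ps z)" by (simp add: power2_eq_square mult.assoc)
 then have e2: "(LI z. (q z - (u z)^2) * ps z) = (LI z. q z * ps z) - 2 * (LI z. u z * (u z * ps z)) + (LI z. (u z)^2 * ps z)"
 using i2 i5 by (simp add: left_diff_distrib)
 show ?thesis unfolding e1 e2 by (intro tendsto_intros ql[OF ps] ul'[OF i1])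
 qed
 obtain \<rho> :: "R3 => real" where \<rho>: "intgr \<rho>" "!!z. \<rho> z > 0" using positive_integrable_exists by blast
 have [measurable]: "\<rho> \<in> bm" using \<rho>(1) by auto
 have qu: "%%q z - (u z)^2%% <= 8" for z using qb[of z] u2[of z] by linarith
 \<comment> \<open>The limit of nonnegative integrals is nonnegative; testing on the set where q <
   u^2, weighted by \<open>\<rho>\<close>, shows that this set is null.\<close>
 have pos: "AE z in lborel. (u z)^2 <= q z"
 proof -
 let ?ps = "%z. indicator {z. q z < (u z)^2} z * \<rho> z"
 have i: "intgr ?ps" by (rule integrable_bdd_mult[OF \<rho>(1), of _ 1]) (auto simp: indicator_def)
 have j: "intgr (%z. (q z - (u z)^2) * ?ps z)" by (rule integrable_bdd_mult[OF i _ qu]) simp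
 have "0 <= (LI z. (q z - (u z)^2) * ?ps z)"
 proof (rule tendsto_lowerbound[OF d[OF i] _ F(2)], intro always_eventually allI lint_nonneg)
 show "0 <= (w n z - u z)^2 * ?ps z" for n z using \<rho>(2)[of z] by (simp add: indicator_def)
 qed
 moreover have le: "(q z - (u z)^2) * ?ps z <= 0" for z
 using \<rho>(2)[of z] by (cases "q z < (u z)^2") (auto intro!: mult_nonpos_nonneg)
 then have "0 <= (LI z. - ((q z - (u z)^2) * ?ps z))" by (intro lint_nonneg) simp
 ultimately have "(LI z. - ((q z - (u z)^2) * ?ps z)) = 0" by simp
 then have "AE z in lborel. - ((q z - (u z)^2) * ?ps z) = 0"
 by (subst (asm) integral_nonneg_eq_0_iff_AE) (use j le in auto)
 then show ?thesis
 proof eventually_elim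
 case (elim z)
 then show ?case using \<rho>(2)[of z] by (cases "q z < (u z)^2") auto
 qed
 qed
 \<comment> \<open>The positive part is taken because \<open>confinement\<close> requires
   nonnegativity everywhere, while q >= u^2 holds only a.e.\<close>
 have "AE z in lborel. fst z > 0 --> max 0 (q z - (u z)^2) = 0"
 proof (rule confinement[where M=8])
 show "max 0 (q z - (u z)^2) <= 8" for z using qu[of z] by simp
 fix Th Tht Thx :: "R2 => real" and g g'
 assume A: "tx_test Th Tht Thx" "C1c g g'" "!!p. 0 <= Th p" "!!E. 0 <= g E"
 note [measurable] = C1cD(4)[OF A(2)] tx_test_measurable[OF A(1)]
 have "0 <= (LI z. indicator {0<..} (fst z) * ((q z - (u z)^2) * ((Tht (tx z) + py z * Thx (tx z)) * g (En V (snd z)))))"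
 by (rule defect_estimate[OF _ ab _ um ub qm _ ws0 ws wsq wsc A]) (use qb in auto)
 also have "... = (LI z. indicator {0<..} (fst z) * (max 0 (q z - (u z)^2) * ((Tht (tx z) + py z * Thx (tx z)) * g (En V (snd z)))))"
 proof (rule integral_cong_AE)
 show "AE z in lborel. indicator {0<..} (fst z) * ((q z - (u z)^2) * ((Tht (tx z) + py z * Thx (tx z)) * g (En V (snd z))))
 = indicator {0<..} (fst z) * (max 0 (q z - (u z)^2) * ((Tht (tx z) + py z * Thx (tx z)) * g (En V (snd z))))"
 using pos by eventually_elim (simp add: max_def)
 qed measurable
 finally show "0 <= (LI z. indicator {0<..} (fst z) * (max 0 (q z - (u z)^2) * ((Tht (tx z) + py z * Thx (tx z)) * g (En V (snd z)))))" .
 qed auto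
 then have zero: "AE z in lborel. (q z - (u z)^2) * (indicator {0<..} (fst z) * \<rho> z) = 0"
 using pos by eventually_elim (auto simp: indicator_def max_def split: if_splits)
 let ?ps = "%z. indicator {0<..} (fst z) * \<rho> z"
 have psi: "intgr ?ps" by (rule Si[OF \<rho>(1)]) simp
 have ps0: "?ps z >= 0" for z using \<rho>(2)[of z] by (simp add: indicator_def)
 have z0: "(LI z. (q z - (u z)^2) * ?ps z) = 0" using integral_cong_AE[OF _ _ zero] by simp
 have p0: "0 <= (w n z - u z)^2 * ?ps z" for n z by (rule mult_nonneg_nonneg[OF zero_le_power2 ps0])
 have nnf: "0 <= (LI z. (w n z - u z)^2 * ?ps z)" for n by (rule lint_nonneg) (rule p0)
 obtain r where r: "!!n. n <= r n" "(%n. LI z. (w (r n) z - u z)^2 * ?ps z) ----> 0"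
 using frequent_subsequence[OF FS F(2) d[OF psi, unfolded z0] nnf] by blast
 have di: "intgr (%z. (w (r n) z - u z)^2 * ?ps z)" for n
 proof (rule integrable_bdd_mult[OF psi])
 show "%%(w (r n) z - u z)^2%% <= 4 ^ 2" for z
 proof -
 have "%%w (r n) z - u z%% <= 4" using wb[of "r n" z] ub[of z] by linarith
 from power_mono[OF this, of 2] show ?thesis by simp
 qed
 qed measurable
 have "(%n. LI z. norm ((w (r n) z - u z)^2 * ?ps z)) ----> 0" using r(2) unfolding real_norm_def abs_of_nonneg[OF p0] .
 from tendsto_L1_AE_subseq[OF di this]
 obtain s where s: "strict_mono s" "AE z in lborel. (%n. (w (r (s n)) z - u z)^2 * ?ps z) ----> 0" by blast
 \<comment> \<open>\<open>N\<close> need not be monotone; tending to infinity makes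
   \<open>filtermap N sequentially\<close> an admissible filter for
   \<open>scheme_limit\<close>.\<close>
 define N where "N n = r (s n)" for n
 have "n <= N n" for n using r(1)[of "s n"] strict_mono_imp_increasing[OF s(1), of n] by (simp add: N_def)
 then have N: "filterlim N sequentially sequentially" by (intro filterlim_at_top_mono[OF filterlim_ident]) simp
 define W where "W n = scheme k (h (N n)) a0" for n
 have [measurable]: "W n \<in> bm" for n unfolding W_def by measurable
 have wW: "w (N n) z = arctan (W n z)" for n z by (simp add: w_def W_def scheme_def a_def)
 have cv: "AE z in lborel. fst z > 0 --> (%n. arctan (W n z)) ----> u z"
 using s(2)
 proof eventually_elim
 case (elim z)
 show ?case
 proof
 assume t: "fst z > 0"
 have "(%n. ((w (N n) z - u z)^2 * ?ps z) * (1 / \<rho> z)) ----> 0 * (1 / \<rho> z)"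
 unfolding N_def by (intro tendsto_mult elim tendsto_const)
 then have "(%n. (w (N n) z - u z)^2) ----> 0" using t \<rho>(2)[of z] by simp
 from tendsto_real_sqrt[OF this] have "(%n. %%w (N n) z - u z%%) ----> 0" by simp
 then have "(%n. w (N n) z - u z) ----> 0" by (simp add: tendsto_rabs_zero_iff)
 then show "(%n. arctan (W n z)) ----> u z" unfolding wW by (rule LIM_zero_cancel)
 qed
 qed
 define g where "g R n z = ennreal (indB R z * %%W n z%%)" for R n z
 have [measurable]: "g R n \<in> bm" for R n unfolding g_def[abs_def] by measurable
 \<comment> \<open>Fatou's lemma and the uniform bound on boxes: the lower limit of |W n| is finite
   a.e., as \<open>tan_limit\<close> requires, and the same estimate later makes the limit locally
   integrable.\<close>
 have fin: "(\<integral>\<^sup>+z. liminf (%n. g R n z) \<partial>lborel) < \<infinity>" for R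
 proof -
 let ?K = "ennreal %%C%% * emeasure lborel {z. in_box R z} + emeasure lborel {-R..R} * (\<integral>\<^sup>+q. ennreal (f q) \<partial>lborel)"
 have "(\<integral>\<^sup>+z. liminf (%n. g R n z) \<partial>lborel) <= liminf (%n. \<integral>\<^sup>+z. g R n z \<partial>lborel)"
 by (rule nn_integral_liminf) simp
 also have "... <= limsup (%n. \<integral>\<^sup>+z. g R n z \<partial>lborel)" by (rule Liminf_le_Limsup) simp
 also have "... <= ?K"
 by (rule Limsup_bounded) (use scheme_box_bound[OF am a0 f] in \<open>simp add: g_def W_def\<close>)
 also have "?K < \<infinity>"
 using emeasure_in_box[of R] emeasure_compact_finite[OF compact_Icc, of "- R" R] f a0(2) by (simp add: ennreal_mult_less_top ennreal_add_less_top nn_integral_eq_integral)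
 finally show ?thesis .
 qed
 have fin': "AE z in lborel. liminf (%n. g R n z) < \<infinity>" for R
 using nn_integral_PInf_AE[of "%z. liminf (%n. g R n z)" lborel] fin[of R] by (simp add: less_top)
 have "AE z in lborel. \<forall>j::nat. liminf (%n. g (real j) n z) < \<infinity>" unfolding AE_all_countable using fin' by blast
 then have WU: "AE z in lborel. fst z > 0 --> (%n. W n z) ----> tan (u z)"
 using cv
 proof eventually_elim
 case (elim z)
 show ?case
 proof
 assume t: "fst z > 0"
 obtain j :: nat where "%%fst z%% + %%px z%% + %%py z%% <= real j" using real_arch_simple by blast
 then have "in_box (real j) z" unfolding in_box_def by linarith
 then have "liminf (%n. ennreal %%W n z%%) < \<infinity>" using elim(1)[THEN spec, of j] by (simp add: g_def)
 then show "(%n. W n z) ----> tan (u z)" using elim(2) t by (intro tan_limit) simp_all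
 qed
 qed
 have tanm: "(%x::real. tan x) \<in> bm"
 unfolding tan_def by (intro borel_measurable_divide bm_cont continuous_intros)
 show thesis
 proof (rule that[of "%z. tan (u z)"])
 show Um: "(%z. tan (u z)) \<in> bm" by (rule measurable_compose[OF um tanm])
 note [measurable] = Um
 show "intgr (%z. indB R z * (indicator {0..} (fst z) * tan (u z)))" for R
 proof (rule integrableI_bounded)
 have "(\<integral>\<^sup>+z. ennreal (norm (indB R z * (indicator {0..} (fst z) * tan (u z)))) \<partial>lborel) <= (\<integral>\<^sup>+z. liminf (%n. g R n z) \<partial>lborel)"
 proof (rule nn_integral_mono_AE)
 show "AE z in lborel. ennreal (norm (indB R z * (indicator {0..} (fst z) * tan (u z)))) <= liminf (%n. g R n z)"
 using WU AE_lborel_fst[OF AE_lborel_singleton[of "0::real"]]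
 proof eventually_elim
 case (elim z)
 show ?case
 proof (cases "fst z > 0")
 case True
 have "(%n. g R n z) ----> ennreal (indB R z * %%tan (u z)%%)"
 unfolding g_def by (intro tendsto_ennrealI tendsto_mult tendsto_const tendsto_rabs) (use elim True in blast)
 then have "liminf (%n. g R n z) = ennreal (indB R z * %%tan (u z)%%)" by (intro lim_imp_Liminf) simp_all
 then show ?thesis using True by (simp add: abs_mult)
 qed (use elim in simp)
 qed
 qed
 then show "(\<integral>\<^sup>+z. ennreal (norm (indB R z * (indicator {0..} (fst z) * tan (u z)))) \<partial>lborel) < \<infinity>"
 using fin[of R] by (rule le_less_trans)
 qed measurable
 fix \<beta> :: "real => real" and B assume \<beta>: "continuous_on UNIV \<beta>" "!!s. %%\<beta> s%% <= B"
 have [measurable]: "\<beta> \<in> bm" using \<beta>(1) by (simp add: bm_cont)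
 have "weak_sol k (%q. if {0..} = (UNIV :: real set) then 0 else \<beta> (a0 q)) (%z. indicator {0..} (fst z) * \<beta> (tan (u z)))"
 proof (rule scheme_limit[where F="filtermap N sequentially", OF _ \<beta>(2) h])
 show "filtermap N sequentially <= sequentially" using N by (simp add: filterlim_def)
 show "filtermap N sequentially ~= bot" by (simp add: filtermap_bot_iff)
 fix ps :: "R3 => real" assume ps: "intgr ps"
 have [measurable]: "ps \<in> bm" using ps by auto
 have "(%n. LI z. (indicator {0..} (fst z) * \<beta> (W n z)) * ps z) ----> (LI z. (indicator {0..} (fst z) * \<beta> (tan (u z))) * ps z)"
 proof (rule dct[where w="%z. B * %%ps z%%"])
 show "AE z in lborel. (%n. (indicator {0..} (fst z) * \<beta> (W n z)) * ps z) ----> (indicator {0..} (fst z) * \<beta> (tan (u z))) * ps z"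
 using WU AE_lborel_fst[OF AE_lborel_singleton[of "0::real"]]
 proof eventually_elim
 case (elim z)
 show ?case
 proof (cases "fst z > 0")
 case True
 then have "(%n. \<beta> (W n z)) ----> \<beta> (tan (u z))"
 using elim(1) continuous_on_tendsto_compose[OF \<beta>(1), of "%n. W n z" "tan (u z)" sequentially] by simp
 then show ?thesis by (intro tendsto_intros)
 qed (use elim in simp)
 qed
 have B0: "B >= 0" using order_trans[OF abs_ge_zero \<beta>(2)] .
 show "AE z in lborel. norm ((indicator {0..} (fst z) * \<beta> (W n z)) * ps z) <= B * %%ps z%%" for n
 using \<beta>(2) B0 by (intro AE_I2) (auto simp: abs_mult indicator_def intro!: mult_right_mono)
 qed (use ps in \<open>simp_all, measurable?\<close>)
 moreover have "scheme k (h (N n)) (%q. \<beta> (a0 q)) z = \<beta> (W n z)" for n z by (simp add: W_def scheme_def)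
 ultimately show "((%n. LI z. (indicator {0..} (fst z) * scheme k (h n) (%q. \<beta> (a0 q)) z) * ps z) \<longlongrightarrow> (LI z. (indicator {0..} (fst z) * \<beta> (tan (u z))) * ps z)) (filtermap N sequentially)"
 by (simp add: filterlim_filtermap)
 qed auto
 then show "weak_sol k (%q. \<beta> (a0 q)) (%z. indicator {0..} (fst z) * \<beta> (tan (u z)))" using S0 by simp
 qed
qed

end

section \<open>Lebesgue measurable data and Borel representatives\<close>

lemma space_time_sets: "space_time \<in> sets borel" "space_time \<inter> space lebesgue \<in> sets lebesgue"
proof -
 show "space_time \<in> sets borel" unfolding space_time_def by (intro borel_closed closed_Times) auto
 then show "space_time \<inter> space lebesgue \<in> sets lebesgue" by (simp add: sets_completionI_sets)
qed

lemma indicator_space_time: "indicator space_time z = indicator {0..} (fst z)"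
 by (cases z) (simp add: space_time_def indicator_def)

lemma borel_version:
 fixes g :: "'a::euclidean_space => real"
 assumes g: "g \<in> borel_measurable lebesgue" and b: "AE x in lebesgue. %%g x%% <= B" "B >= 0"
 obtains g' where "g' \<in> bm" "!!x. %%g' x%% <= B" "AE x in lborel. g x = g' x"
proof -
 obtain c where c: "c \<in> borel_measurable lborel" "AE x in lborel. g x = c x" using completion_ex_borel_measurable_real[OF g] by blast
 then have [measurable]: "c \<in> bm" by simp
 show thesis
 proof (rule that[of "%x. if %%c x%% <= B then c x else 0"])
 show "AE x in lborel. g x = (if %%c x%% <= B then c x else 0)"
 using c(2) b(1)[unfolded AE_completion_iff] by eventually_elim auto
 qed (use b(2) in auto)
qed

text \<open>The weak formulation of \<open>is_solution\<close> in terms of Borel representatives \<open>k\<close>, \<open>a\<close>, \<open>W\<close> of \<open>V'\<close>, \<open>u0\<close>, \<open>w\<close>.\<close>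

lemma weak_sol_iff:
 assumes b: "!!x y. b (x, y) = (y, - V' x)"
 and V': "AE x in lborel. V' x = k x" and km[measurable]: "k \<in> bm"
 and a[measurable]: "a \<in> bm" and u0: "AE q in lborel. u0 q = a q"
 and W[measurable]: "W \<in> bm" and w: "AE z in lborel. z \<in> space_time --> w z = W z"
 shows "(\<forall>ph. test_function ph -->
 integral\<^sup>L (lebesgue_on space_time)
 (%(t, x, y). w (t, x, y) *
 (deriv (%s. ph (s, x, y)) t
 + (fst (b (x, y)) * deriv (%s. ph (t, s, y)) x
 + snd (b (x, y)) * deriv (%s. ph (t, x, s)) y)))
 = - integral\<^sup>L lebesgue (%(x, y). u0 (x, y) * ph (0, x, y)))
 \<longleftrightarrow> weak_sol k a (%z. indicator {0..} (fst z) * W z)"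
proof -
 have cong: "integral\<^sup>L lebesgue f = integral\<^sup>L lborel g" if g: "g \<in> bm" and ae: "AE z in lborel. f z = g z" for f g :: "'c::euclidean_space => real"
 proof -
 have gl: "g \<in> borel_measurable lebesgue" by (rule measurable_completion) (use g in simp)
 have ae': "AE z in lebesgue. g z = f z" using ae unfolding AE_completion_iff by eventually_elim simp
 have "integral\<^sup>L lebesgue f = integral\<^sup>L lebesgue g"
 by (rule integral_cong_AE[OF borel_measurable_AE[OF gl ae'] gl]) (use ae' in eventually_elim, simp)
 also have "... = integral\<^sup>L lborel g" by (rule integral_completion) (use g in simp)
 finally show ?thesis .
 qed
 have eq: "integral\<^sup>L (lebesgue_on space_time)
 (%(t, x, y). w (t, x, y) *
 (deriv (%s. ph (s, x, y)) t
 + (fst (b (x, y)) * deriv (%s. ph (t, s, y)) x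
 + snd (b (x, y)) * deriv (%s. ph (t, x, s)) y)))
 = (LI z. (indicator {0..} (fst z) * W z) * (pht z + py z * phx z - k (px z) * phy z)) &
 integral\<^sup>L lebesgue (%(x, y). u0 (x, y) * ph (0, x, y)) = (LI q. a q * ph (0, q))"
 if t: "test_function ph" and P: "has_partials ph pht phx phy" for ph pht phx phy
 proof
 have c: "continuous_on UNIV ph" "continuous_on UNIV pht" "continuous_on UNIV phx" "continuous_on UNIV phy"
 using test_function_bounds[OF t P] by metis+
 note [measurable] = c[THEN bm_cont]
 show "integral\<^sup>L lebesgue (%(x, y). u0 (x, y) * ph (0, x, y)) = (LI q. a q * ph (0, q))"
 proof (rule cong)
 show "AE q in lborel. (case q of (x, y) => u0 (x, y) * ph (0, x, y)) = a q * ph (0, q)"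
 using u0 by eventually_elim (simp add: split_def)
 qed measurable
 have "integral\<^sup>L (lebesgue_on space_time)
 (%(t, x, y). w (t, x, y) *
 (deriv (%s. ph (s, x, y)) t
 + (fst (b (x, y)) * deriv (%s. ph (t, s, y)) x
 + snd (b (x, y)) * deriv (%s. ph (t, x, s)) y)))
 = integral\<^sup>L lebesgue (%z. indicator space_time z *\<^sub>R (%(t, x, y). w (t, x, y) * (pht (t, x, y) + (y * phx (t, x, y) + - V' x * phy (t, x, y)))) z)"
 using has_partials_deriv[OF P] by (simp add: integral_restrict_space[OF space_time_sets(2)] b)
 also have "... = (LI z. (indicator {0..} (fst z) * W z) * (pht z + py z * phx z - k (px z) * phy z))"
 proof (rule cong)
 show "AE z in lborel. indicator space_time z *\<^sub>R (%(t, x, y). w (t, x, y) * (pht (t, x, y) + (y * phx (t, x, y) + - V' x * phy (t, x, y)))) z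
 = (indicator {0..} (fst z) * W z) * (pht z + py z * phx z - k (px z) * phy z)"
 using w AE_lborel_snd[OF AE_lborel_fst[OF V']]
 by eventually_elim (auto simp: indicator_space_time split_def space_time_def mem_Times_iff indicator_def)
 qed measurable
 finally show "integral\<^sup>L (lebesgue_on space_time)
 (%(t, x, y). w (t, x, y) *
 (deriv (%s. ph (s, x, y)) t
 + (fst (b (x, y)) * deriv (%s. ph (t, s, y)) x
 + snd (b (x, y)) * deriv (%s. ph (t, x, s)) y)))
 = (LI z. (indicator {0..} (fst z) * W z) * (pht z + py z * phx z - k (px z) * phy z))" .
 qed
 show ?thesis
 proof
 assume l: "\<forall>ph. test_function ph -->
 integral\<^sup>L (lebesgue_on space_time)
 (%(t, x, y). w (t, x, y) *
 (deriv (%s. ph (s, x, y)) t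
 + (fst (b (x, y)) * deriv (%s. ph (t, s, y)) x
 + snd (b (x, y)) * deriv (%s. ph (t, x, s)) y)))
 = - integral\<^sup>L lebesgue (%(x, y). u0 (x, y) * ph (0, x, y))"
 show "weak_sol k a (%z. indicator {0..} (fst z) * W z)"
 unfolding weak_sol_def
 proof (intro allI impI)
 fix ph pht phx phy assume t: "test_function ph" and P: "has_partials ph pht phx phy"
 show "(LI z. (indicator {0..} (fst z) * W z) * (pht z + py z * phx z - k (px z) * phy z)) = - (LI q. a q * ph (0, q))"
 using l[THEN spec, THEN mp, OF t] unfolding eq[OF t P, THEN conjunct1] eq[OF t P, THEN conjunct2] .
 qed
 next
 assume r: "weak_sol k a (%z. indicator {0..} (fst z) * W z)"
 show "\<forall>ph. test_function ph -->
 integral\<^sup>L (lebesgue_on space_time)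
 (%(t, x, y). w (t, x, y) *
 (deriv (%s. ph (s, x, y)) t
 + (fst (b (x, y)) * deriv (%s. ph (t, s, y)) x
 + snd (b (x, y)) * deriv (%s. ph (t, x, s)) y)))
 = - integral\<^sup>L lebesgue (%(x, y). u0 (x, y) * ph (0, x, y))"
 proof (intro allI impI)
 fix ph :: "R3 => real" assume t: "test_function ph"
 then have "smooth ph" by (simp add: test_function_def smooth_def)
 then obtain pht phx phy where P: "has_partials ph pht phx phy" using smooth_has_partials by metis
 show "integral\<^sup>L (lebesgue_on space_time)
 (%(t, x, y). w (t, x, y) *
 (deriv (%s. ph (s, x, y)) t
 + (fst (b (x, y)) * deriv (%s. ph (t, s, y)) x
 + snd (b (x, y)) * deriv (%s. ph (t, x, s)) y)))
 = - integral\<^sup>L lebesgue (%(x, y). u0 (x, y) * ph (0, x, y))"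
 unfolding eq[OF t P, THEN conjunct1] eq[OF t P, THEN conjunct2] using r t P unfolding weak_sol_def by blast
 qed
 qed
qed

text \<open>Equal initial terms cancel, which leaves a solution of the homogeneous equation across t
  = 0, the form taken by \<open>uniqueness_zero\<close>.\<close>

lemma weak_sol_diff:
 assumes k: "locint k" and "weak_sol k a v" "weak_sol k a w"
 and v: "v \<in> bm" "!!z. %%v z%% <= M" and w: "w \<in> bm" "!!z. %%w z%% <= M"
 shows "weak_sol k (%_. 0) (%z. v z - w z)"
 unfolding weak_sol_def
proof (intro allI impI)
 fix ph pht phx phy assume t: "test_function ph" and P: "has_partials ph pht phx phy"
 have [measurable]: "k \<in> bm" using k by (simp add: locint_def)
 obtain R C where R: "!!z. ~ in_box R z ==> ph z = 0 & pht z = 0 & phx z = 0 & phy z = 0"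
 and C: "!!z. %%pht z%% <= C" "!!z. %%phx z%% <= C" "!!z. %%phy z%% <= C"
 and c: "continuous_on UNIV pht" "continuous_on UNIV phx" "continuous_on UNIV phy"
 using test_function_bounds[OF t P] by metis
 note [measurable] = c[THEN bm_cont]
 have i1: "intgr (%z. pht z * 1)" by (rule integrable_box_mult(2)[OF _ C(1)]) (use R in \<open>measurable, blast, simp\<close>)
 have i2: "intgr (%z. phx z * py z)" by (rule integrable_box_mult(2)[OF _ C(2)]) (use R in \<open>measurable, blast, intro continuous_intros\<close>)
 have "intgr (%x. ivl R x * k x)" using k by (simp add: locint_def)
 from integrable_bdd_mult[OF integrable_kernel_box[OF this] _ C(3)]
 have "intgr (%z. phy z * (ivl R (fst z) * (ivl R (px z) * k (px z) * ivl R (py z))))" by simp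
 moreover have "phy z * (ivl R (fst z) * (ivl R (px z) * k (px z) * ivl R (py z))) = k (px z) * phy z" for z
 proof (cases "in_box R z")
 case True
 then have "ivl R (fst z) = 1" "ivl R (px z) = 1" "ivl R (py z) = 1" by (auto simp: in_box_def indicator_def abs_le_iff)
 then show ?thesis by simp
 qed (simp add: R)
 ultimately have "intgr (%z. pht z * 1 + phx z * py z - k (px z) * phy z)"
 using i1 i2 by simp
 then have D: "intgr (%z. pht z + py z * phx z - k (px z) * phy z)" by (simp add: mult.commute)
 have "intgr (%z. v z * (pht z + py z * phx z - k (px z) * phy z))"
 by (rule integrable_bdd_mult[OF D _ v(2)]) (use v(1) in simp)
 moreover have "intgr (%z. w z * (pht z + py z * phx z - k (px z) * phy z))"
 by (rule integrable_bdd_mult[OF D _ w(2)]) (use w(1) in simp)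
 ultimately have "(LI z. (v z - w z) * (pht z + py z * phx z - k (px z) * phy z))
 = (LI z. v z * (pht z + py z * phx z - k (px z) * phy z)) - (LI z. w z * (pht z + py z * phx z - k (px z) * phy z))"
 unfolding left_diff_distrib[of "v _"] by (rule Bochner_Integration.integral_diff)
 also have "... = 0" using assms(2,3) t P unfolding weak_sol_def by fastforce
 finally show "(LI z. (v z - w z) * (pht z + py z * phx z - k (px z) * phy z)) = - (LI q. 0 * ph (0, q))" by simp
qed

text \<open>The injective renormalization: \<open>arctan\<close> of a solution determines it, so
  uniqueness among locally integrable functions reduces to bounded weak solutions.\<close>

lemma C1_bounded_arctan: "C1_bounded arctan"
 unfolding C1_bounded_def
proof (intro conjI)
 have d: "(arctan has_real_derivative inverse (1 + x^2)) (at x)" for x by (rule DERIV_arctan)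
 have d': "deriv arctan = (%x. inverse (1 + x^2))" using d by (intro ext DERIV_imp_deriv)
 have "(arctan has_vector_derivative inverse (1 + x^2)) (at x)" for x
 using d by (simp add: has_real_derivative_iff_has_vector_derivative)
 moreover have nz: "1 + x^2 ~= 0" for x :: real using zero_le_power2[of x] by linarith
 have "continuous_on UNIV (%x::real. inverse (1 + x^2))" by (intro continuous_intros) (use nz in auto)
 ultimately show "arctan C1_differentiable_on UNIV" unfolding C1_differentiable_on_def by (intro exI[of _ "%x. inverse (1 + x^2)"]) simp
 have "%%arctan x%% <= pi / 2" for x using arctan_bounded[of x] by linarith
 then show "bounded (range arctan)" unfolding bounded_iff by (intro exI[of _ "pi / 2"]) auto
 have "%%inverse (1 + x^2)%% <= 1" for x :: real by (simp add: inverse_le_1_iff abs_of_nonneg)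
 then show "bounded (range (deriv arctan))" unfolding d' bounded_iff by (intro exI[of _ 1]) auto
qed

lemma C1_bounded_continuous:
 assumes "C1_bounded \<beta>"
 obtains B where "continuous_on UNIV \<beta>" "!!s. %%\<beta> s%% <= B" "B >= 0"
proof -
 have c: "continuous_on UNIV \<beta>" using assms unfolding C1_bounded_def by (simp add: C1_differentiable_imp_continuous_on)
 obtain B where B: "!!s. %%\<beta> s%% <= B" using assms unfolding C1_bounded_def bounded_iff by auto
 show thesis by (rule that[OF c B]) (rule order_trans[OF abs_ge_zero B])
qed

text \<open>L^p is contained in L^\<infinity> + L^1, since |a| <= 1 + |a|^p for finite p >= 1. This
  decomposition treats all exponents at once.\<close>

lemma Lp_fun_majorant:
 fixes u0 :: "R2 => real"
 assumes "Lp_fun p lebesgue u0" "1 <= p"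
 obtains a f C where "a \<in> bm" "AE q in lborel. u0 q = a q" "intgr f"
 "!!q. %%a q%% <= C + f q" "!!q. f q >= 0"
proof (cases "p = \<infinity>")
 case True
 then obtain C where u: "u0 \<in> borel_measurable lebesgue" "AE x in lebesgue. %%u0 x%% <= C" using assms by (auto simp: Lp_fun_def)
 have "AE x in lebesgue. %%u0 x%% <= %%C%%" using u(2) by eventually_elim simp
 then obtain a where "a \<in> bm" "!!x. %%a x%% <= %%C%%" "AE x in lborel. u0 x = a x"
 using borel_version[OF u(1)] by (metis abs_ge_zero)
 then show thesis by (intro that[of a "%_. 0" "%%C%%"]) auto
next
 case False
 define r where "r = enn2real p"
 have "1 <= r" using assms(2) False unfolding r_def by (metis enn2real_1 enn2real_mono infinity_ennreal_def top.not_eq_extremum)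
 have u: "u0 \<in> borel_measurable lebesgue" "integrable lebesgue (%x. %%u0 x%% powr r)" using assms False by (auto simp: Lp_fun_def r_def)
 obtain a where a: "a \<in> borel_measurable lborel" "AE x in lborel. u0 x = a x" using completion_ex_borel_measurable_real[OF u(1)] by blast
 have [measurable]: "a \<in> bm" using a(1) by simp
 have "integrable lebesgue (%x. %%a x%% powr r)"
 proof (rule integrable_cong_AE_imp[OF u(2)])
 show "(%x. %%a x%% powr r) \<in> borel_measurable lebesgue" by (rule measurable_completion) measurable
 show "AE x in lebesgue. %%u0 x%% powr r = %%a x%% powr r" unfolding AE_completion_iff using a(2) by eventually_elim simp
 qed
 then have f: "intgr (%x. %%a x%% powr r)" by (subst (asm) integrable_completion) measurable
 have "%%a q%% <= 1 + %%a q%% powr r" for q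
 proof (cases "%%a q%% <= 1")
 case False
 then have "%%a q%% powr 1 <= %%a q%% powr r" using \<open>1 <= r\<close> by (intro powr_mono) auto
 then show ?thesis using False by simp
 qed (use powr_ge_zero[of "%%a q%%" r] in linarith)
 then show thesis using a f by (intro that[of a "%x. %%a x%% powr r" 1]) auto
qed

text \<open>V' is Lebesgue measurable as the limit of its truncations to [-n, n], so it has a Borel
  representative \<open>k\<close>; absolute continuity then yields the integral representation of
  V.\<close>

lemma complete_potential_exists:
 fixes V V' :: "real => real"
 assumes ac: "locally_abs_continuous V" and d: "AE x in lebesgue. (V has_real_derivative V' x) (at x)" and l: "L1_loc UNIV V'"
 and e: "(\<integral>\<^sup>+x\<in>{0..}. ennreal (1 / sqrt (max 1 (- V x))) \<partial>lebesgue) = \<infinity>" "(\<integral>\<^sup>+x\<in>{..0}. ennreal (1 / sqrt (max 1 (- V x))) \<partial>lebesgue) = \<infinity>"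
 obtains k where "complete_potential V k" "AE x in lborel. V' x = k x"
proof -
 have li: "integrable lebesgue (%x. indicator {- R..R} x * V' x)" for R
 using l compact_Icc[of "- R" R] unfolding L1_loc_def set_integrable_def by simp
 have "V' \<in> borel_measurable lebesgue"
 proof (rule borel_measurable_LIMSEQ_real)
 show "(%n. indicator {- real n..real n} x * V' x) ----> V' x" for x
 proof (rule tendsto_eventually)
 obtain m :: nat where m: "%%x%% <= real m" using real_arch_simple by blast
 show "\<forall>\<^sub>F n in sequentially. indicator {- real n..real n} x * V' x = V' x"
 using eventually_ge_at_top[of m] by eventually_elim (use m in \<open>auto simp: indicator_def\<close>)
 qed
 show "(%x. indicator {- real n..real n} x * V' x) \<in> borel_measurable lebesgue" for n using li by (rule borel_measurable_integrable)
 qed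
 then obtain k where k: "k \<in> borel_measurable lborel" "AE x in lborel. V' x = k x" using completion_ex_borel_measurable_real by blast
 have [measurable]: "k \<in> bm" using k(1) by simp
 have ki: "intgr (%x. ivl R x * k x)" for R
 proof -
 have "integrable lebesgue (%x. ivl R x * k x)"
 proof (rule integrable_cong_AE_imp[OF li[of R]])
 show "(%x. ivl R x * k x) \<in> borel_measurable lebesgue" by (rule measurable_completion) measurable
 show "AE x in lebesgue. ivl R x * V' x = ivl R x * k x" unfolding AE_completion_iff using k(2) by eventually_elim simp
 qed
 then show ?thesis by (subst (asm) integrable_completion) measurable
 qed
 have der: "AE x in lborel. (V has_real_derivative k x) (at x)"
 using d[unfolded AE_completion_iff] k(2) by eventually_elim simp
 have Vc: "continuous_on UNIV V" by (rule locally_abs_continuous_imp_continuous[OF ac])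
 have "complete_potential V k"
 proof
 show "locint k" using ki by (simp add: locint_def)
 show "continuous_on UNIV V" by (rule Vc)
 show "V b - V a = (LI x. indicator {a..b} x * k x)" if "a <= b" for a b
 proof -
 define R where "R = %%a%% + %%b%%"
 have "intgr (%x. indicator {a..b} x * (ivl R x * k x))"
 by (rule integrable_bdd_mult[OF ki, of _ 1]) (auto simp: indicator_def)
 moreover have "(%x. indicator {a..b} x * (ivl R x * k x)) = (%x. if x \<in> {a..b} then k x else 0)"
 by (auto simp: fun_eq_iff indicator_def R_def)
 moreover have e: "(%x. indicator {a..b} x * k x) = (%x. if x \<in> {a..b} then k x else 0)" by (auto simp: fun_eq_iff indicator_def)
 ultimately have "((%x. if x \<in> {a..b} then k x else 0) has_integral (LI x. indicator {a..b} x * k x)) UNIV"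
 using has_integral_integral_lborel by metis
 then have "(k has_integral (LI x. indicator {a..b} x * k x)) {a..b}" by (simp only: has_integral_restrict_UNIV)
 moreover have "(k has_integral (V b - V a)) {a..b}" by (rule locally_abs_continuous_FTC[OF ac der that])
 ultimately show ?thesis using has_integral_unique by blast
 qed
 show "AE x in lborel. (V has_real_derivative k x) (at x)" by (rule der)
 show "(\<integral>\<^sup>+x. ennreal (1 / sqrt (max 1 (- V x))) * indicator {0..} x \<partial>lborel) = \<infinity>"
 "(\<integral>\<^sup>+x. ennreal (1 / sqrt (max 1 (- V x))) * indicator {..0} x \<partial>lborel) = \<infinity>"
 using e by (simp_all only: nn_integral_completion)
 qed
 then show thesis using k(2) by (rule that)
qed

theorem theorem2:
  fixes V V' :: "real \<Rightarrow> real"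
    and b :: "real \<times> real \<Rightarrow> real \<times> real"
    and p :: ennreal
    and u0 :: "real \<times> real \<Rightarrow> real"
  assumes "locally_abs_continuous V"
    and "AE x in lebesgue. (V has_real_derivative V' x) (at x)"
    and "L1_loc UNIV V'"
    and "(\<integral>\<^sup>+x\<in>{0..}. ennreal (1 / sqrt (max 1 (- V x))) \<partial>lebesgue) = \<infinity>"
    and "(\<integral>\<^sup>+x\<in>{..0}. ennreal (1 / sqrt (max 1 (- V x))) \<partial>lebesgue) = \<infinity>"
    and "\<And>x y. b (x, y) = (y, - V' x)"
    and "1 \<le> p"
    and "Lp_fun p lebesgue u0"
  shows "\<exists>u. renormalized_solution b u0 u \<and>
           (\<forall>w. renormalized_solution b u0 w \<longrightarrow> (AE z in lebesgue_on space_time. w z = u z))"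
proof -
 obtain k where cp: "complete_potential V k" and Vk: "AE x in lborel. V' x = k x"
 by (rule complete_potential_exists[OF assms(1-5)]) (rule that)
 interpret complete_potential V k by (rule cp)
 obtain a f C where am: "a \<in> bm" and ua: "AE q in lborel. u0 q = a q" and f: "intgr f"
 and af: "!!q. %%a q%% <= C + f q" "!!q. f q >= 0" 
 by (rule Lp_fun_majorant[OF assms(8,7)]) (rule that)
 obtain U where Um: "U \<in> bm" and Ui: "!!R. intgr (%z. indB R z * (indicator {0..} (fst z) * U z))"
 and Us: "!!\<beta> B. continuous_on UNIV \<beta> ==> (!!s. %%\<beta> s%% <= B) ==> weak_sol k (%q. \<beta> (a q)) (%z. indicator {0..} (fst z) * \<beta> (U z))"
 proof (rule existence[OF am af f])
 fix U assume 1: "U \<in> bm" and 2: "!!R. intgr (%z. indB R z * (indicator {0..} (fst z) * U z))"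
 and 3: "!!\<beta> B. continuous_on UNIV \<beta> ==> (!!s. %%\<beta> s%% <= B) ==> weak_sol k (%q. \<beta> (a q)) (%z. indicator {0..} (fst z) * \<beta> (U z))"
 show ?thesis by (rule that[OF 1 2 3])
 qed
 have lm: "g \<in> borel_measurable lebesgue" if "g \<in> bm" for g :: "'c::euclidean_space => real"
 by (rule measurable_completion) (use that in simp)
 have "renormalized_solution b u0 U"
 unfolding renormalized_solution_def
 proof (intro conjI allI impI)
 show "L1_loc space_time U"
 unfolding L1_loc_def
 proof (intro allI impI)
 fix K :: "(R3) set" assume K: "compact K & K \<subseteq> space_time"
 then obtain R where R: "!!z. z \<in> K ==> norm z <= R" using compact_imp_bounded bounded_iff by metis
 have "integrable lebesgue (%z. indB R z * (indicator {0..} (fst z) * U z))"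
 using Ui[of R] by (subst integrable_completion) auto
 moreover have "K \<in> sets lebesgue" using K by (simp add: borel_compact sets_completionI_sets)
 ultimately have "integrable lebesgue (%z. indicator K z *\<^sub>R (indB R z * (indicator {0..} (fst z) * U z)))"
 by (intro integrable_mult_indicator)
 moreover have "indicator K z *\<^sub>R (indB R z * (indicator {0..} (fst z) * U z)) = indicator K z *\<^sub>R U z" for z
 proof (cases "z \<in> K")
 case True
 have "in_box R z"
 using norm_fst_le[of "fst z" "snd z"] norm_snd_le[of "snd z" "fst z"] norm_fst_le[of "px z" "py z"] norm_snd_le[of "py z" "px z"] R[OF True]
 by (simp add: in_box_def)
 moreover have "fst z >= 0" using K True by (auto simp: space_time_def)
 ultimately show ?thesis by simp
 qed simp
 ultimately show "U absolutely_integrable_on K" unfolding set_integrable_def by (simp only:)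
 qed
 fix \<beta> assume "C1_bounded \<beta>"
 then obtain B where B: "continuous_on UNIV \<beta>" "!!s. %%\<beta> s%% <= B" using C1_bounded_continuous by blast
 have \<beta>m: "\<beta> \<in> bm" using B(1) by (rule bm_cont)
 have m: "(%q. \<beta> (a q)) \<in> bm" "(%z. \<beta> (U z)) \<in> bm"
 by (rule measurable_compose[OF am \<beta>m], rule measurable_compose[OF Um \<beta>m])
 have ae: "AE q in lborel. \<beta> (u0 q) = \<beta> (a q)" using ua by eventually_elim simp
 then have ae': "AE q in lebesgue. \<beta> (a q) = \<beta> (u0 q)" unfolding AE_completion_iff by eventually_elim simp
 show "is_solution b (%q. \<beta> (u0 q)) (%z. \<beta> (U z))"
 unfolding is_solution_def
 proof (intro conjI)
 show "Lp_fun \<infinity> lebesgue (%q. \<beta> (u0 q))" using borel_measurable_AE[OF lm[OF m(1)] ae'] B(2) by (auto simp: Lp_fun_def)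
 show "Lp_fun \<infinity> (lebesgue_on space_time) (%z. \<beta> (U z))"
 using measurable_restrict_space1[OF lm[OF m(2)]] B(2) by (auto simp: Lp_fun_def)
 qed (subst weak_sol_iff[OF assms(6) Vk km' m(1) ae m(2)], simp, rule Us[OF B])
 qed
 \<comment> \<open>\<open>arctan\<close> of both solutions, set to 0 for t < 0, are bounded weak
   solutions with the same datum; their difference solves the homogeneous equation on all of
   space-time, and injectivity of \<open>arctan\<close> gives w = U.\<close>
 moreover have "AE z in lebesgue_on space_time. w z = U z" if w: "renormalized_solution b u0 w" for w
 proof -
 have ab: "%%arctan s%% <= 2" for s using arctan_bounded[of s] pi_less_4 by (simp add: abs_le_iff)
 have ac: "continuous_on UNIV (arctan :: real => real)" by (intro continuous_at_imp_continuous_on ballI isCont_arctan)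
 have atm: "(arctan :: real => real) \<in> bm" using ac by (rule bm_cont)
 have sol: "is_solution b (%q. arctan (u0 q)) (%z. arctan (w z))" using w C1_bounded_arctan unfolding renormalized_solution_def by blast
 then have "(%z. arctan (w z)) \<in> borel_measurable (lebesgue_on space_time)" by (simp add: is_solution_def Lp_fun_def)
 then have wm: "(%z. indicator space_time z *\<^sub>R arctan (w z)) \<in> borel_measurable lebesgue"
 by (subst (asm) borel_measurable_restrict_space_iff[OF space_time_sets(2)])
 have "AE z in lebesgue. %%indicator space_time z *\<^sub>R arctan (w z)%% <= 2" using ab by (intro AE_I2) (simp add: indicator_def)
 from borel_version[OF wm this] obtain W where W: "W \<in> bm" "!!z. %%W z%% <= 2" "AE z in lborel. indicator space_time z *\<^sub>R arctan (w z) = W z" by auto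
 have wW: "AE z in lborel. z \<in> space_time --> arctan (w z) = W z" using W(3) by eventually_elim auto
 have m: "(%q. arctan (a q)) \<in> bm" "(%z. arctan (U z)) \<in> bm"
 by (rule measurable_compose[OF am atm], rule measurable_compose[OF Um atm])
 have ae: "AE q in lborel. arctan (u0 q) = arctan (a q)" using ua by eventually_elim simp
 have s1: "weak_sol k (%q. arctan (a q)) (%z. indicator {0..} (fst z) * W z)"
 using sol unfolding is_solution_def weak_sol_iff[OF assms(6) Vk km' m(1) ae W(1) wW] by blast
 have s2: "weak_sol k (%q. arctan (a q)) (%z. indicator {0..} (fst z) * arctan (U z))" by (rule Us[OF ac ab])
 let ?v = "%z. indicator {0..} (fst z) * W z" and ?w = "%z. indicator {0..} (fst z) * arctan (U z)"
 have vm: "?v \<in> bm" "?w \<in> bm" using W(1) m(2) by measurable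
 have vb: "%%?v z%% <= 2" "%%?w z%% <= 2" for z using W(2) ab by (simp_all add: indicator_def)
 have "AE z in lborel. fst z > 0 --> ?v z - ?w z = 0"
 proof (rule uniqueness_zero[OF weak_sol_diff[OF k s1 s2 vm(1) vb(1) vm(2) vb(2)]])
 show "%%?v z - ?w z%% <= 4" for z using vb[of z] by linarith
 qed (use vm in \<open>simp_all add: borel_measurable_diff\<close>)
 then have "AE z in lborel. z \<in> space_time --> w z = U z"
 using wW AE_lborel_fst[OF AE_lborel_singleton[of "0::real"]]
 proof eventually_elim
 case (elim z)
 show ?case
 proof
 assume z: "z \<in> space_time"
 then have "fst z > 0" using elim(3) by (auto simp: space_time_def)
 then have "arctan (w z) = arctan (U z)" using elim z by simp
 then show "w z = U z" by (simp only: arctan_eq_iff)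
 qed
 qed
 then show ?thesis
 by (subst AE_restrict_space_iff[OF space_time_sets(2)]) (simp add: AE_completion_iff)
 qed
 ultimately show ?thesis by blast
qed

end
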